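(* Let $A$ be an associative unital ring, $\mathcal{C}$ an $A$-coring, $P\in\mathbf{M}^{\mathcal{C}}$ a Galois comodule, $S=\mathrm{End}^{\mathcal{C}}(P)$ and $T=\mathrm{End}_A(P)$. (1) If ${}_SP$ is finitely generated, then ${}_A\mathcal{C}$ is finitely generated. (2) If ${}_SP$ is Mittag-Leffler, then ${}_A\mathcal{C}$ is Mittag-Leffler. (3) If ${}_SP$ is finitely presented, then ${}_A\mathcal{C}$ is finitely presented. (4) If ${}_SP$ is projective, then ${}_A\mathcal{C}$ is projective. (5) If ${}_TP$ is finitely generated and ${}_SP$ is locally projective, then ${}_A\mathcal{C}$ is locally projective. (6) If ${}_SP$ is flat, then ${}_A\mathcal{C}$ is flat and $P$ is a generator in $\mathbf{M}^{\mathcal{C}}$. (7) If ${}_SP$ is faithfully flat, then ${}_A\mathcal{C}$ is flat and $P$ is a projective generator in $\mathbf{M}^{\mathcal{C}}$.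
   Context: An $A$-coring is an $(A,A)$-bimodule $\mathcal{C}$ with a coassociative coproduct $\Delta:\mathcal{C}\to\mathcal{C}\otimes_A\mathcal{C}$ and a counit $\varepsilon:\mathcal{C}\to A$, both $(A,A)$-bilinear. $\mathbf{M}_A$ is the category of right $A$-modules and $\mathbf{M}^{\mathcal{C}}$ the category of right $\mathcal{C}$-comodules, i.e. right $A$-modules $M$ with an $A$-linear coassociative and counital coaction $\varrho^M:M\to M\otimes_A\mathcal{C}$; $\mathrm{Hom}^{\mathcal{C}}$, $\mathrm{End}^{\mathcal{C}}$ denote colinear maps. $P$ is a left $S$- and left $T$-module by evaluation; $\mathrm{Hom}_A(P,K)$ is a right $S$-module by composition. $P$ is a Galois comodule if for every $K\in\mathbf{M}_A$ the (functorial) comodule map $\mathrm{Hom}_A(P,K)\otimes_S P\to K\otimes_A\mathcal{C}$, $g\otimes p\mapsto (g\otimes I_{\mathcal{C}})\varrho^P(p)$, is an isomorphism; no finiteness or projectivity of $P_A$ is assumed. Left subscripts such as ${}_SP$ indicate the module structure considered. A left $R$-module $M$ is called Mittag-Leffler if the canonical map $R^{\Lambda}\otimes_R M\to M^{\Lambda}$ is injective for every index set $\Lambda$ (so ${}_A\mathcal{C}$ is Mittag-Leffler if $A^{\Lambda}\otimes_A\mathcal{C}\to\mathcal{C}^{\Lambda}$ is injective). A left $R$-module $M$ is locally projective if for every finitely generated submodule $i:F\hookrightarrow M$, every epimorphism $f:L\to N$ and every $g:M\to N$ there is $h:M\to L$ with $f\circ h\circ i=g\circ i$. A generator in $\mathbf{M}^{\mathcal{C}}$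 is a comodule $P$ with $\mathrm{Hom}^{\mathcal{C}}(P,-)$ faithful; $P$ is projective in $\mathbf{M}^{\mathcal{C}}$ if $\mathrm{Hom}^{\mathcal{C}}(P,-)$ sends epimorphisms to surjections (epimorphisms in $\mathbf{M}^{\mathcal{C}}$ are the surjective colinear maps).
   Formalization: In (2) the hypothesis that P is Mittag-Leffler over S is taken in the Raynaud–Gruson sense (all families of right modules, not only powers of S), since with powers only (2) is false; the conclusion for C is given in both senses. *)

theory Defs
  imports "HOL-Algebra.Module" "HOL-Algebra.Free_Abelian_Groups"
begin

text \<open>
  The library's module locale assumes a commutative base ring. Left modules over an arbitrary ring
  use the library's record and its axioms; right modules get a record of their own. In module
  records the inherited fields \<open>mult\<close> and \<open>one\<close> carry no meaning.
\<close>

locale left_module = R?: ring R + M?: abelian_group M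
  for R :: "('r, 'x) ring_scheme" (structure) and M :: "('r, 'm, 'y) module_scheme" (structure) +
  assumes lsmult_closed:
      "\<lbrakk>a \<in> carrier R; x \<in> carrier M\<rbrakk> \<Longrightarrow> a \<odot>\<^bsub>M\<^esub> x \<in> carrier M"
    and lsmult_l_distr:
      "\<lbrakk>a \<in> carrier R; b \<in> carrier R; x \<in> carrier M\<rbrakk>
        \<Longrightarrow> (a \<oplus> b) \<odot>\<^bsub>M\<^esub> x = a \<odot>\<^bsub>M\<^esub> x \<oplus>\<^bsub>M\<^esub> b \<odot>\<^bsub>M\<^esub> x"
    and lsmult_r_distr:
      "\<lbrakk>a \<in> carrier R; x \<in> carrier M; y \<in> carrier M\<rbrakk>
        \<Longrightarrow> a \<odot>\<^bsub>M\<^esub> (x \<oplus>\<^bsub>M\<^esub> y) = a \<odot>\<^bsub>M\<^esub> x \<oplus>\<^bsub>M\<^esub> a \<odot>\<^bsub>M\<^esub> y"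
    and lsmult_assoc:
      "\<lbrakk>a \<in> carrier R; b \<in> carrier R; x \<in> carrier M\<rbrakk>
        \<Longrightarrow> (a \<otimes> b) \<odot>\<^bsub>M\<^esub> x = a \<odot>\<^bsub>M\<^esub> (b \<odot>\<^bsub>M\<^esub> x)"
    and lsmult_one: "x \<in> carrier M \<Longrightarrow> \<one> \<odot>\<^bsub>M\<^esub> x = x"

record ('r, 'm) rmodule = "'m ring" +
  rsmult :: "'m \<Rightarrow> 'r \<Rightarrow> 'm"  (infixl \<open>\<triangleleft>\<index>\<close> 70)

locale right_module = R?: ring R + M?: abelian_group M
  for R :: "('r, 'x) ring_scheme" (structure) and M :: "('r, 'm, 'y) rmodule_scheme" (structure) +
  assumes rsmult_closed:
      "\<lbrakk>a \<in> carrier R; x \<in> carrier M\<rbrakk> \<Longrightarrow> x \<triangleleft>\<^bsub>M\<^esub> a \<in> carrier M"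
    and rsmult_r_distr:
      "\<lbrakk>a \<in> carrier R; b \<in> carrier R; x \<in> carrier M\<rbrakk>
        \<Longrightarrow> x \<triangleleft>\<^bsub>M\<^esub> (a \<oplus> b) = x \<triangleleft>\<^bsub>M\<^esub> a \<oplus>\<^bsub>M\<^esub> x \<triangleleft>\<^bsub>M\<^esub> b"
    and rsmult_l_distr:
      "\<lbrakk>a \<in> carrier R; x \<in> carrier M; y \<in> carrier M\<rbrakk>
        \<Longrightarrow> (x \<oplus>\<^bsub>M\<^esub> y) \<triangleleft>\<^bsub>M\<^esub> a = x \<triangleleft>\<^bsub>M\<^esub> a \<oplus>\<^bsub>M\<^esub> y \<triangleleft>\<^bsub>M\<^esub> a"
    and rsmult_assoc:
      "\<lbrakk>a \<in> carrier R; b \<in> carrier R; x \<in> carrier M\<rbrakk>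
        \<Longrightarrow> x \<triangleleft>\<^bsub>M\<^esub> (a \<otimes> b) = (x \<triangleleft>\<^bsub>M\<^esub> a) \<triangleleft>\<^bsub>M\<^esub> b"
    and rsmult_one: "x \<in> carrier M \<Longrightarrow> x \<triangleleft>\<^bsub>M\<^esub> \<one> = x"

definition left_linear ::
  "('r, 'x) ring_scheme \<Rightarrow> ('r, 'm, 'y) module_scheme \<Rightarrow> ('r, 'n, 'z) module_scheme
    \<Rightarrow> ('m \<Rightarrow> 'n) \<Rightarrow> bool" where
  "left_linear R M N f \<longleftrightarrow> f \<in> hom (add_monoid M) (add_monoid N) \<and>
     (\<forall>r\<in>carrier R. \<forall>m\<in>carrier M. f (r \<odot>\<^bsub>M\<^esub> m) = r \<odot>\<^bsub>N\<^esub> f m)"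

definition right_linear ::
  "('r, 'x) ring_scheme \<Rightarrow> ('r, 'm, 'y) rmodule_scheme \<Rightarrow> ('r, 'n, 'z) rmodule_scheme
    \<Rightarrow> ('m \<Rightarrow> 'n) \<Rightarrow> bool" where
  "right_linear R M N f \<longleftrightarrow> f \<in> hom (add_monoid M) (add_monoid N) \<and>
     (\<forall>r\<in>carrier R. \<forall>m\<in>carrier M. f (m \<triangleleft>\<^bsub>M\<^esub> r) = f m \<triangleleft>\<^bsub>N\<^esub> r)"


section \<open>Tensor products\<close>

text \<open>
  The tensor product of a right module \<open>M\<close> and a left module \<open>N\<close> is the free abelian group on
  \<open>carrier M \<times> carrier N\<close> modulo the subgroup of bilinearity and balancing relations.
\<close>

type_synonym ('m, 'n) tens = "('m \<times> 'n \<Rightarrow>\<^sub>0 int) set"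

definition tensor_relations ::
  "('r, 'x) ring_scheme \<Rightarrow> ('r, 'm, 'y) rmodule_scheme \<Rightarrow> ('r, 'n, 'z) module_scheme
    \<Rightarrow> ('m \<times> 'n \<Rightarrow>\<^sub>0 int) set" where
  "tensor_relations R M N =
     generate (free_Abelian_group (carrier M \<times> carrier N))
      ({frag_of (m \<oplus>\<^bsub>M\<^esub> m', n) - frag_of (m, n) - frag_of (m', n) | m m' n.
          m \<in> carrier M \<and> m' \<in> carrier M \<and> n \<in> carrier N} \<union>
       {frag_of (m, n \<oplus>\<^bsub>N\<^esub> n') - frag_of (m, n) - frag_of (m, n') | m n n'.
          m \<in> carrier M \<and> n \<in> carrier N \<and> n' \<in> carrier N} \<union>
       {frag_of (m \<triangleleft>\<^bsub>M\<^esub> r, n) - frag_of (m, r \<odot>\<^bsub>N\<^esub> n) | m r n.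
          m \<in> carrier M \<and> r \<in> carrier R \<and> n \<in> carrier N})"

definition tensor ::
  "('r, 'x) ring_scheme \<Rightarrow> ('r, 'm, 'y) rmodule_scheme \<Rightarrow> ('r, 'n, 'z) module_scheme
    \<Rightarrow> ('m, 'n) tens ring" where
  "tensor R M N =
     (let Q = free_Abelian_group (carrier M \<times> carrier N) Mod tensor_relations R M N
      in \<lparr>carrier = carrier Q, monoid.mult = undefined, monoid.one = undefined,
          ring.zero = monoid.one Q, ring.add = monoid.mult Q\<rparr>)"

definition tens ::
  "('r, 'x) ring_scheme \<Rightarrow> ('r, 'm, 'y) rmodule_scheme \<Rightarrow> ('r, 'n, 'z) module_scheme
    \<Rightarrow> 'm \<Rightarrow> 'n \<Rightarrow> ('m, 'n) tens" where
  "tens R M N m n =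
     tensor_relations R M N #>\<^bsub>free_Abelian_group (carrier M \<times> carrier N)\<^esub> frag_of (m, n)"

text \<open>
  \<open>tensor_lift G \<beta>\<close> is the additive map to \<open>G\<close> induced by \<open>m \<otimes> n \<mapsto> \<beta> m n\<close>. For balanced biadditive
  \<open>\<beta>\<close>, the only ones it is applied to, it does not depend on the chosen representative.
\<close>

definition tensor_lift ::
  "('t, 'x) ring_scheme \<Rightarrow> ('m \<Rightarrow> 'n \<Rightarrow> 't) \<Rightarrow> ('m, 'n) tens \<Rightarrow> 't" where
  "tensor_lift G \<beta> X =
     (let x = (SOME x. x \<in> X)
      in \<Oplus>\<^bsub>G\<^esub>z\<in>Poly_Mapping.keys x. [Poly_Mapping.lookup x z] \<cdot>\<^bsub>G\<^esub> \<beta> (fst z) (snd z))"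

text \<open>\<open>tensor_map R M' N' f g\<close> is \<open>f \<otimes> g\<close> with values in the tensor product of \<open>M'\<close> and \<open>N'\<close>.\<close>

definition tensor_map ::
  "('r, 'x) ring_scheme \<Rightarrow> ('r, 'm2, 'y) rmodule_scheme \<Rightarrow> ('r, 'n2, 'z) module_scheme
    \<Rightarrow> ('m \<Rightarrow> 'm2) \<Rightarrow> ('n \<Rightarrow> 'n2) \<Rightarrow> ('m, 'n) tens \<Rightarrow> ('m2, 'n2) tens" where
  "tensor_map R M' N' f g = tensor_lift (tensor R M' N') (\<lambda>m n. tens R M' N' (f m) (g n))"


section \<open>Corings and comodules\<close>

record ('a, 'c) coring = "('a, 'c) module" +
  ract :: "'c \<Rightarrow> 'a \<Rightarrow> 'c"
  comult :: "'c \<Rightarrow> ('c, 'c) tens"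
  counit :: "'c \<Rightarrow> 'a"

definition right_part :: "('a, 'c, 'x) coring_scheme \<Rightarrow> ('a, 'c) rmodule" where
  "right_part C = \<lparr>carrier = carrier C, monoid.mult = monoid.mult C, monoid.one = monoid.one C,
                   ring.zero = ring.zero C, ring.add = ring.add C, rsmult = ract C\<rparr>"

definition tensor_right ::
  "('a, 'x) ring_scheme \<Rightarrow> ('a, 'm, 'y) rmodule_scheme \<Rightarrow> ('a, 'c, 'z) coring_scheme
    \<Rightarrow> ('a, ('m, 'c) tens) rmodule" where
  "tensor_right A M C =
     ring.extend (tensor A M C)
       (rmodule.fields (\<lambda>t a. tensor_map A M C (\<lambda>m. m) (\<lambda>c. ract C c a) t))"

definition tensor_left ::
  "('a, 'x) ring_scheme \<Rightarrow> ('a, 'c, 'z) coring_scheme \<Rightarrow> ('a, 'n, 'y) module_scheme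
    \<Rightarrow> ('a, ('c, 'n) tens) module" where
  "tensor_left A C N =
     ring.extend (tensor A (right_part C) N)
       (module.fields (\<lambda>a t. tensor_map A (right_part C) N (\<lambda>c. a \<odot>\<^bsub>C\<^esub> c) (\<lambda>n. n) t))"

text \<open>The associativity isomorphism \<open>(M \<otimes> C) \<otimes> C \<rightarrow> M \<otimes> (C \<otimes> C)\<close>.\<close>

definition tensor_assoc ::
  "('a, 'x) ring_scheme \<Rightarrow> ('a, 'm, 'y) rmodule_scheme \<Rightarrow> ('a, 'c, 'z) coring_scheme
    \<Rightarrow> (('m, 'c) tens, 'c) tens \<Rightarrow> ('m, ('c, 'c) tens) tens" where
  "tensor_assoc A M C =
     (let CC = tensor_left A C C; MCC = tensor A M CC
      in tensor_lift MCC (\<lambda>t d. tensor_lift MCC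
           (\<lambda>m c. tens A M CC m (tens A (right_part C) C c d)) t))"

locale coring = left_module A C + right: right_module A "right_part C"
  for A :: "('a, 'x) ring_scheme" and C :: "('a, 'c, 'y) coring_scheme" +
  assumes bimodule:
      "\<lbrakk>a \<in> carrier A; c \<in> carrier C; b \<in> carrier A\<rbrakk>
        \<Longrightarrow> ract C (a \<odot>\<^bsub>C\<^esub> c) b = a \<odot>\<^bsub>C\<^esub> ract C c b"
    and comult_left_linear: "left_linear A C (tensor_left A C C) (comult C)"
    and comult_right_linear:
      "right_linear A (right_part C) (tensor_right A (right_part C) C) (comult C)"
    and counit_add: "counit C \<in> hom (add_monoid C) (add_monoid A)"
    and counit_left: "\<lbrakk>a \<in> carrier A; c \<in> carrier C\<rbrakk>
        \<Longrightarrow> counit C (a \<odot>\<^bsub>C\<^esub> c) = a \<otimes>\<^bsub>A\<^esub> counit C c"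
    and counit_right: "\<lbrakk>a \<in> carrier A; c \<in> carrier C\<rbrakk>
        \<Longrightarrow> counit C (ract C c a) = counit C c \<otimes>\<^bsub>A\<^esub> a"
    and coassoc: "c \<in> carrier C \<Longrightarrow>
        tensor_assoc A (right_part C) C
          (tensor_map A (tensor_right A (right_part C) C) C (comult C) (\<lambda>d. d) (comult C c))
        = tensor_map A (right_part C) (tensor_left A C C) (\<lambda>d. d) (comult C) (comult C c)"
    and counit_comult_left:
      "c \<in> carrier C \<Longrightarrow> tensor_lift C (\<lambda>d e. counit C d \<odot>\<^bsub>C\<^esub> e) (comult C c) = c"
    and counit_comult_right:
      "c \<in> carrier C \<Longrightarrow> tensor_lift C (\<lambda>d e. ract C d (counit C e)) (comult C c) = c"

record ('a, 'c, 'm) comodule = "('a, 'm) rmodule" +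
  coact :: "'m \<Rightarrow> ('m, 'c) tens"

locale comodule = coring A C + comod: right_module A M
  for A :: "('a, 'x) ring_scheme" and C :: "('a, 'c, 'y) coring_scheme"
    and M :: "('a, 'c, 'm, 'z) comodule_scheme" +
  assumes coact_linear: "right_linear A M (tensor_right A M C) (coact M)"
    and coact_coassoc: "m \<in> carrier M \<Longrightarrow>
        tensor_assoc A M C
          (tensor_map A (tensor_right A M C) C (coact M) (\<lambda>c. c) (coact M m))
        = tensor_map A M (tensor_left A C C) (\<lambda>n. n) (comult C) (coact M m)"
    and coact_counit:
      "m \<in> carrier M \<Longrightarrow> tensor_lift M (\<lambda>n c. n \<triangleleft>\<^bsub>M\<^esub> counit C c) (coact M m) = m"


section \<open>Linear and colinear maps\<close>

definition Hom_A ::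
  "('a, 'x) ring_scheme \<Rightarrow> ('a, 'm, 'y) rmodule_scheme \<Rightarrow> ('a, 'n, 'z) rmodule_scheme
    \<Rightarrow> ('m \<Rightarrow> 'n) set" where
  "Hom_A A M N = {f \<in> extensional (carrier M). right_linear A M N f}"

definition Hom_C ::
  "('a, 'x) ring_scheme \<Rightarrow> ('a, 'c, 'w) coring_scheme
    \<Rightarrow> ('a, 'c, 'm, 'y) comodule_scheme \<Rightarrow> ('a, 'c, 'n, 'z) comodule_scheme
    \<Rightarrow> ('m \<Rightarrow> 'n) set" where
  "Hom_C A C M N = {f \<in> Hom_A A M N.
     \<forall>m\<in>carrier M. coact N (f m) = tensor_map A N C f (\<lambda>c. c) (coact M m)}"

definition endo_ring :: "('m, 'x) ring_scheme \<Rightarrow> ('m \<Rightarrow> 'm) set \<Rightarrow> ('m \<Rightarrow> 'm) ring" where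
  "endo_ring M H =
     \<lparr>carrier = H, monoid.mult = compose (carrier M), monoid.one = (\<lambda>m\<in>carrier M. m),
      ring.zero = (\<lambda>m\<in>carrier M. \<zero>\<^bsub>M\<^esub>), ring.add = (\<lambda>f g. \<lambda>m\<in>carrier M. f m \<oplus>\<^bsub>M\<^esub> g m)\<rparr>"

definition End_A ::
  "('a, 'x) ring_scheme \<Rightarrow> ('a, 'm, 'y) rmodule_scheme \<Rightarrow> ('m \<Rightarrow> 'm) ring" where
  "End_A A M = endo_ring M (Hom_A A M M)"

definition End_C ::
  "('a, 'x) ring_scheme \<Rightarrow> ('a, 'c, 'w) coring_scheme
    \<Rightarrow> ('a, 'c, 'm, 'y) comodule_scheme \<Rightarrow> ('m \<Rightarrow> 'm) ring" where
  "End_C A C M = endo_ring M (Hom_C A C M M)"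

text \<open>\<open>P\<close> as a left module, by evaluation, over any ring of endomorphisms of \<open>P\<close>.\<close>

definition eval_module :: "('m, 'x) ring_scheme \<Rightarrow> ('m \<Rightarrow> 'm, 'm) module" where
  "eval_module P = \<lparr>carrier = carrier P, monoid.mult = monoid.mult P, monoid.one = monoid.one P,
                    ring.zero = ring.zero P, ring.add = ring.add P, smult = (\<lambda>s p. s p)\<rparr>"

text \<open>\<open>Hom\<^sub>A(P,K)\<close> as a right module, by composition, over any ring of endomorphisms of \<open>P\<close>.\<close>

definition Hom_module ::
  "('a, 'x) ring_scheme \<Rightarrow> ('a, 'p, 'y) rmodule_scheme \<Rightarrow> ('a, 'k, 'z) rmodule_scheme
    \<Rightarrow> ('p \<Rightarrow> 'p, 'p \<Rightarrow> 'k) rmodule" where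
  "Hom_module A P K =
     \<lparr>carrier = Hom_A A P K, monoid.mult = undefined, monoid.one = undefined,
      ring.zero = (\<lambda>p\<in>carrier P. \<zero>\<^bsub>K\<^esub>), ring.add = (\<lambda>f g. \<lambda>p\<in>carrier P. f p \<oplus>\<^bsub>K\<^esub> g p),
      rsmult = compose (carrier P)\<rparr>"


section \<open>Universes and Galois comodules\<close>

text \<open>
  Statements about all modules, all comodules or all index sets range over those whose carrier is a
  subset of a type \<open>'u\<close>, which serves as the universe and is passed as an argument \<open>TYPE('u)\<close>.
  It has to be large compared with the data \<open>A\<close>, \<open>C\<close>, \<open>P\<close>, so that it contains, up to isomorphism,
  \<open>A\<close>, \<open>C\<close>, \<open>P\<close>, \<open>S\<close>, \<open>T\<close>, free modules such as \<open>S\<^sup>(\<^sup>P\<^sup>)\<close> and products such as \<open>A\<^sup>C\<close>. For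
  instance \<open>('a + 'c + 'p + nat) set\<close> is large enough.
\<close>

definition large_universe ::
  "'u itself \<Rightarrow> ('a, 'x) ring_scheme \<Rightarrow> ('c, 'y) ring_scheme \<Rightarrow> ('p, 'z) ring_scheme \<Rightarrow> bool" where
  "large_universe (u :: 'u itself) A C P \<longleftrightarrow>
     (\<exists>\<iota> :: ('a + 'c + 'p + nat) set \<Rightarrow> 'u.
        inj_on \<iota> (Pow (carrier A <+> carrier C <+> carrier P <+> UNIV)))"

definition galois_map ::
  "('a, 'x) ring_scheme \<Rightarrow> ('a, 'c, 'w) coring_scheme \<Rightarrow> ('a, 'c, 'p, 'y) comodule_scheme
    \<Rightarrow> ('a, 'k, 'z) rmodule_scheme \<Rightarrow> ('p \<Rightarrow> 'k, 'p) tens \<Rightarrow> ('k, 'c) tens" where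
  "galois_map A C P K =
     tensor_lift (tensor A K C) (\<lambda>g p. tensor_map A K C g (\<lambda>c. c) (coact P p))"

text \<open>A comodule map is an isomorphism of comodules iff it is bijective.\<close>

definition galois_comodule ::
  "'u itself \<Rightarrow> ('a, 'x) ring_scheme \<Rightarrow> ('a, 'c, 'w) coring_scheme
    \<Rightarrow> ('a, 'c, 'p, 'y) comodule_scheme \<Rightarrow> bool" where
  "galois_comodule (u :: 'u itself) A C P \<longleftrightarrow>
     comodule A C P \<and>
     (\<forall>K :: ('a, 'u) rmodule. right_module A K \<longrightarrow>
        bij_betw (galois_map A C P K)
          (carrier (tensor (End_C A C P) (Hom_module A P K) (eval_module P)))
          (carrier (tensor A K C)))"

definition comodule_generator ::
  "'u itself \<Rightarrow> ('a, 'x) ring_scheme \<Rightarrow> ('a, 'c, 'w) coring_scheme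
    \<Rightarrow> ('a, 'c, 'p, 'y) comodule_scheme \<Rightarrow> bool" where
  "comodule_generator (u :: 'u itself) A C P \<longleftrightarrow>
     (\<forall>(M :: ('a, 'c, 'u) comodule) (N :: ('a, 'c, 'u) comodule).
        comodule A C M \<longrightarrow> comodule A C N \<longrightarrow>
        (\<forall>f\<in>Hom_C A C M N. \<forall>g\<in>Hom_C A C M N.
           (\<forall>h\<in>Hom_C A C P M. compose (carrier P) f h = compose (carrier P) g h) \<longrightarrow> f = g))"

definition comodule_projective ::
  "'u itself \<Rightarrow> ('a, 'x) ring_scheme \<Rightarrow> ('a, 'c, 'w) coring_scheme
    \<Rightarrow> ('a, 'c, 'p, 'y) comodule_scheme \<Rightarrow> bool" where
  "comodule_projective (u :: 'u itself) A C P \<longleftrightarrow>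
     (\<forall>(M :: ('a, 'c, 'u) comodule) (N :: ('a, 'c, 'u) comodule).
        comodule A C M \<longrightarrow> comodule A C N \<longrightarrow>
        (\<forall>f\<in>Hom_C A C M N. f ` carrier M = carrier N \<longrightarrow>
           (\<forall>g\<in>Hom_C A C P N. \<exists>h\<in>Hom_C A C P M. compose (carrier P) f h = g)))"


section \<open>Properties of left modules\<close>

definition fin_gen :: "('r, 'x) ring_scheme \<Rightarrow> ('r, 'm, 'y) module_scheme \<Rightarrow> bool" where
  "fin_gen R M \<longleftrightarrow>
     (\<exists>X. finite X \<and> X \<subseteq> carrier M \<and>
        (\<forall>m\<in>carrier M. \<exists>r\<in>X \<rightarrow> carrier R. m = (\<Oplus>\<^bsub>M\<^esub>x\<in>X. r x \<odot>\<^bsub>M\<^esub> x)))"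

definition free_left :: "('r, 'x) ring_scheme \<Rightarrow> nat \<Rightarrow> ('r, nat \<Rightarrow> 'r) module" where
  "free_left R n =
     \<lparr>carrier = {..<n} \<rightarrow>\<^sub>E carrier R, monoid.mult = undefined, monoid.one = undefined,
      ring.zero = (\<lambda>i\<in>{..<n}. \<zero>\<^bsub>R\<^esub>), ring.add = (\<lambda>x y. \<lambda>i\<in>{..<n}. x i \<oplus>\<^bsub>R\<^esub> y i),
      smult = (\<lambda>r x. \<lambda>i\<in>{..<n}. r \<otimes>\<^bsub>R\<^esub> x i)\<rparr>"

definition fin_presented :: "('r, 'x) ring_scheme \<Rightarrow> ('r, 'm, 'y) module_scheme \<Rightarrow> bool" where
  "fin_presented R M \<longleftrightarrow>
     (\<exists>n \<phi>. left_linear R (free_left R n) M \<phi> \<and>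
        \<phi> ` carrier (free_left R n) = carrier M \<and>
        fin_gen R ((free_left R n)
          \<lparr>carrier := {x \<in> carrier (free_left R n). \<phi> x = \<zero>\<^bsub>M\<^esub>}\<rparr>))"

definition projective_left ::
  "'u itself \<Rightarrow> ('r, 'x) ring_scheme \<Rightarrow> ('r, 'm, 'y) module_scheme \<Rightarrow> bool" where
  "projective_left (u :: 'u itself) R M \<longleftrightarrow>
     (\<forall>(L :: ('r, 'u) module) (N :: ('r, 'u) module). left_module R L \<longrightarrow> left_module R N \<longrightarrow>
        (\<forall>f g. left_linear R L N f \<longrightarrow> f ` carrier L = carrier N \<longrightarrow> left_linear R M N g \<longrightarrow>
           (\<exists>h. left_linear R M L h \<and> (\<forall>m\<in>carrier M. f (h m) = g m))))"

definition locally_projective ::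
  "'u itself \<Rightarrow> ('r, 'x) ring_scheme \<Rightarrow> ('r, 'm, 'y) module_scheme \<Rightarrow> bool" where
  "locally_projective (u :: 'u itself) R M \<longleftrightarrow>
     (\<forall>F. submodule F R M \<longrightarrow> fin_gen R (M\<lparr>carrier := F\<rparr>) \<longrightarrow>
       (\<forall>(L :: ('r, 'u) module) (N :: ('r, 'u) module). left_module R L \<longrightarrow> left_module R N \<longrightarrow>
         (\<forall>f g. left_linear R L N f \<longrightarrow> f ` carrier L = carrier N \<longrightarrow> left_linear R M N g \<longrightarrow>
           (\<exists>h. left_linear R M L h \<and> (\<forall>m\<in>F. f (h m) = g m)))))"

definition flat_left ::
  "'u itself \<Rightarrow> ('r, 'x) ring_scheme \<Rightarrow> ('r, 'm, 'y) module_scheme \<Rightarrow> bool" where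
  "flat_left (u :: 'u itself) R M \<longleftrightarrow>
     (\<forall>(X :: ('r, 'u) rmodule) (Y :: ('r, 'u) rmodule). right_module R X \<longrightarrow> right_module R Y \<longrightarrow>
        (\<forall>f. right_linear R X Y f \<longrightarrow> inj_on f (carrier X) \<longrightarrow>
           inj_on (tensor_map R Y M f (\<lambda>m. m)) (carrier (tensor R X M))))"

definition faithfully_flat_left ::
  "'u itself \<Rightarrow> ('r, 'x) ring_scheme \<Rightarrow> ('r, 'm, 'y) module_scheme \<Rightarrow> bool" where
  "faithfully_flat_left (u :: 'u itself) R M \<longleftrightarrow>
     flat_left u R M \<and>
     (\<forall>X :: ('r, 'u) rmodule. right_module R X \<longrightarrow>
        carrier (tensor R X M) = {\<zero>\<^bsub>tensor R X M\<^esub>} \<longrightarrow> carrier X = {\<zero>\<^bsub>X\<^esub>})"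

definition product_right :: "'i set \<Rightarrow> ('i \<Rightarrow> ('r, 'q, 'x) rmodule_scheme) \<Rightarrow> ('r, 'i \<Rightarrow> 'q) rmodule"
  where
  "product_right I Q =
     \<lparr>carrier = (\<Pi>\<^sub>E i\<in>I. carrier (Q i)), monoid.mult = undefined, monoid.one = undefined,
      ring.zero = (\<lambda>i\<in>I. \<zero>\<^bsub>Q i\<^esub>), ring.add = (\<lambda>x y. \<lambda>i\<in>I. x i \<oplus>\<^bsub>Q i\<^esub> y i),
      rsmult = (\<lambda>x r. \<lambda>i\<in>I. x i \<triangleleft>\<^bsub>Q i\<^esub> r)\<rparr>"

definition regular_right :: "('r, 'x) ring_scheme \<Rightarrow> ('r, 'r) rmodule" where
  "regular_right R = \<lparr>carrier = carrier R, monoid.mult = monoid.mult R, monoid.one = monoid.one R,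
                      ring.zero = ring.zero R, ring.add = ring.add R, rsmult = monoid.mult R\<rparr>"

text \<open>
  Mittag-Leffler in the sense of Raynaud and Gruson: for every family \<open>(Q\<^sub>i)\<close> of right modules the
  canonical map \<open>(\<Prod>Q\<^sub>i) \<otimes> M \<rightarrow> \<Prod>(Q\<^sub>i \<otimes> M)\<close> is injective. The special case where every \<open>Q\<^sub>i\<close> is \<open>R\<close>,
  i.e. injectivity of \<open>R\<^sup>I \<otimes> M \<rightarrow> M\<^sup>I\<close>, is a strictly weaker property and gets a separate name.
  The weaker property does not pass from \<open>\<^sub>SP\<close> to \<open>\<^sub>AC\<close>: let \<open>A\<close> be the trivial extension of the
  integers by the direct sum of the rationals and all \<open>\<int>/p\<^sup>n\<close> (\<open>p\<close> a prime), \<open>C = A \<otimes> A\<close> (over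
  the integers) the Sweedler coring and \<open>P = A\<close>. Then \<open>P\<close> is Galois, \<open>S\<close> is the ring of integers,
  over which every module has the weaker property, but \<open>A\<^sup>I \<otimes>\<^sub>A C \<rightarrow> C\<^sup>I\<close> is not injective for
  infinite \<open>I\<close>.
\<close>

definition mittag_leffler ::
  "'u itself \<Rightarrow> ('r, 'x) ring_scheme \<Rightarrow> ('r, 'm, 'y) module_scheme \<Rightarrow> bool" where
  "mittag_leffler (u :: 'u itself) R M \<longleftrightarrow>
     (\<forall>(I :: 'u set) (Q :: 'u \<Rightarrow> ('r, 'u) rmodule). (\<forall>i\<in>I. right_module R (Q i)) \<longrightarrow>
        inj_on (\<lambda>t. \<lambda>i\<in>I. tensor_map R (Q i) M (\<lambda>v. v i) (\<lambda>m. m) t)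
          (carrier (tensor R (product_right I Q) M)))"

definition power_mittag_leffler ::
  "'u itself \<Rightarrow> ('r, 'x) ring_scheme \<Rightarrow> ('r, 'm, 'y) module_scheme \<Rightarrow> bool" where
  "power_mittag_leffler (u :: 'u itself) R M \<longleftrightarrow>
     (\<forall>I :: 'u set.
        inj_on (\<lambda>t. \<lambda>i\<in>I. tensor_lift M (\<lambda>v m. v i \<odot>\<^bsub>M\<^esub> m) t)
          (carrier (tensor R (product_right I (\<lambda>_. regular_right R)) M)))"

end

theory Submission
  imports Defs
begin

text \<open>
  Write \<open>\<rho>\<close> for the coaction of \<open>P\<close>. The Galois map identifies \<open>Hom\<^sub>A(P,K) \<otimes>\<^sub>S P\<close> with \<open>K \<otimes>\<^sub>A C\<close>, naturally
  in the right \<open>A\<close>-module \<open>K\<close>, so \<open>- \<otimes>\<^sub>A C\<close> is the composite of \<open>Hom\<^sub>A(P,-)\<close> and \<open>- \<otimes>\<^sub>S P\<close>. Since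
  \<open>Hom\<^sub>A(P,-)\<close> preserves injective maps and products, flatness and the Mittag-Leffler property pass
  from \<open>\<^sub>SP\<close> to \<open>\<^sub>AC\<close> (\<open>flat_coring\<close>, \<open>product_injective_coring\<close>).

  The case \<open>K = A\<close> is an isomorphism \<open>\<theta> : Hom\<^sub>A(P,A) \<otimes>\<^sub>S P \<rightarrow> C\<close>, where \<open>\<theta>(k \<otimes> p)\<close> arises by
  evaluating \<open>k\<close> on the left factors of \<open>\<rho>(p)\<close>. Hence the right factors of \<open>\<rho>(p)\<close>, with \<open>p\<close> ranging
  over generators of \<open>\<^sub>SP\<close>, generate \<open>\<^sub>AC\<close> (\<open>fin_gen_coring\<close>). Finite presentation is detected on
  powers of the ring: if \<open>\<^sub>RM\<close> is finitely generated and \<open>R\<^sup>I \<otimes> M \<rightarrow> M\<^sup>I\<close> is injective when \<open>I\<close> is the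
  set of relations between the generators, then finitely many relations suffice (\<open>fin_presentedI\<close>);
  the injectivity comes from finite presentation of \<open>\<^sub>SP\<close> in the same way as the Mittag-Leffler
  property.

  To lift \<open>g : C \<rightarrow> N\<close> along a surjection \<open>f : L \<rightarrow> N\<close>, lift the \<open>S\<close>-linear map
  \<open>(P \<otimes> g) \<circ> \<rho> : P \<rightarrow> P \<otimes>\<^sub>A N\<close> along \<open>P \<otimes> f\<close> to \<open>h' : P \<rightarrow> P \<otimes>\<^sub>A L\<close>. Then
  \<open>k \<otimes> p \<mapsto> (k \<otimes> L)(h' p)\<close> is a lift of \<open>g\<close> under the identification \<open>\<theta>\<close> (\<open>lift_to_coring\<close>). A lift that
  is correct on a submodule of \<open>P\<close> yields one that is correct on the corresponding part of \<open>C\<close>.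

  For a comodule \<open>M\<close> the group \<open>Hom\<^sup>C(P,M)\<close> is the kernel of an \<open>S\<close>-linear map
  \<open>Hom\<^sub>A(P,M) \<rightarrow> Hom\<^sub>A(P,M \<otimes> C)\<close>. If \<open>\<^sub>SP\<close> is flat, tensoring with \<open>P\<close> keeps this kernel, and the
  Galois isomorphisms for \<open>M\<close> and \<open>M \<otimes> C\<close> show that evaluation \<open>Hom\<^sup>C(P,M) \<otimes>\<^sub>S P \<rightarrow> M\<close> is bijective
  (\<open>evaluate_surj\<close>, \<open>evaluate_inj\<close>). Surjectivity makes \<open>P\<close> a generator. If \<open>M \<rightarrow> N\<close> is surjective,
  the cokernel of \<open>Hom\<^sup>C(P,M) \<rightarrow> Hom\<^sup>C(P,N)\<close> vanishes after tensoring with \<open>P\<close>, hence is zero when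
  \<open>\<^sub>SP\<close> is faithfully flat, and \<open>P\<close> is projective.

  All hypotheses speak of modules inside the universe \<open>'u\<close>, whereas \<open>Hom\<^sub>A(P,K)\<close> and products may be
  larger. An element of a tensor product, or the vanishing of one, involves only finitely many
  elements of the left factor and therefore lives over a submodule that has a copy in the universe
  (\<open>tensor_small_submodule\<close>, \<open>tensor_zero_small_submodule\<close>). This extends flatness, faithful
  flatness, the Mittag-Leffler property and the Galois isomorphism to modules of every type.
\<close>


section \<open>Additive and linear maps\<close>

lemma (in abelian_group) diff_eq_iff:
  assumes "x \<in> carrier G" "y \<in> carrier G" "z \<in> carrier G"
  shows "x \<ominus> y = z \<longleftrightarrow> x = y \<oplus> z"
proof -
  have "y \<oplus> (x \<ominus> y) = x" "\<And>z. z \<in> carrier G \<Longrightarrow> (y \<oplus> z) \<ominus> y = z"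
    using assms by (simp_all add: a_minus_def a_ac r_neg r_neg2 r_neg1)
  then show ?thesis using assms by metis
qed

lemma (in abelian_group) diff_zero_iff:
  assumes "x \<in> carrier G" "y \<in> carrier G"
  shows "x \<ominus> y = \<zero> \<longleftrightarrow> x = y"
  using diff_eq_iff[OF assms zero_closed] assms by simp

lemma (in abelian_group) neg_zero: "\<ominus> \<zero> = \<zero>"
  by (metis l_zero minus_equality zero_closed)

lemma (in abelian_group) add_pow_int_zero: "[(0::int)] \<cdot> x = \<zero>"
  by (simp add: add_pow_def)

definition add_hom :: "('g, 'x) ring_scheme \<Rightarrow> ('h, 'y) ring_scheme \<Rightarrow> ('g \<Rightarrow> 'h) \<Rightarrow> bool" where
  "add_hom G H f \<longleftrightarrow> (\<forall>x\<in>carrier G. f x \<in> carrier H) \<and>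
     (\<forall>x\<in>carrier G. \<forall>y\<in>carrier G. f (x \<oplus>\<^bsub>G\<^esub> y) = f x \<oplus>\<^bsub>H\<^esub> f y)"

lemma hom_add_monoid_iff: "f \<in> hom (add_monoid G) (add_monoid H) \<longleftrightarrow> add_hom G H f"
  by (auto simp: hom_def add_hom_def)

lemma left_linear_iff:
  "left_linear R M N f \<longleftrightarrow> add_hom M N f \<and>
     (\<forall>r\<in>carrier R. \<forall>m\<in>carrier M. f (r \<odot>\<^bsub>M\<^esub> m) = r \<odot>\<^bsub>N\<^esub> f m)"
  by (simp add: left_linear_def hom_add_monoid_iff)

lemma right_linear_iff:
  "right_linear R M N f \<longleftrightarrow> add_hom M N f \<and>
     (\<forall>r\<in>carrier R. \<forall>m\<in>carrier M. f (m \<triangleleft>\<^bsub>M\<^esub> r) = f m \<triangleleft>\<^bsub>N\<^esub> r)"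
  by (simp add: right_linear_def hom_add_monoid_iff)

lemma add_homI:
  assumes "\<And>x. x \<in> carrier G \<Longrightarrow> f x \<in> carrier H"
    and "\<And>x y. x \<in> carrier G \<Longrightarrow> y \<in> carrier G \<Longrightarrow> f (x \<oplus>\<^bsub>G\<^esub> y) = f x \<oplus>\<^bsub>H\<^esub> f y"
  shows "add_hom G H f"
  using assms by (simp add: add_hom_def)

lemma add_hom_closed: "add_hom G H f \<Longrightarrow> x \<in> carrier G \<Longrightarrow> f x \<in> carrier H"
  and add_hom_add: "add_hom G H f \<Longrightarrow> x \<in> carrier G \<Longrightarrow> y \<in> carrier G \<Longrightarrow>
    f (x \<oplus>\<^bsub>G\<^esub> y) = f x \<oplus>\<^bsub>H\<^esub> f y"
  by (auto simp: add_hom_def)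

lemma add_hom_compose: "add_hom G H f \<Longrightarrow> add_hom H K g \<Longrightarrow> add_hom G K (\<lambda>x. g (f x))"
  by (auto simp: add_hom_def)

lemma add_hom_id: "add_hom G G (\<lambda>x. x)"
  by (auto simp: add_hom_def)

lemma add_hom_zero:
  assumes "add_hom G H f" "abelian_group G" "abelian_group H"
  shows "f \<zero>\<^bsub>G\<^esub> = \<zero>\<^bsub>H\<^esub>"
proof -
  interpret G: abelian_group G by fact
  interpret H: abelian_group H by fact
  have "f \<zero>\<^bsub>G\<^esub> \<oplus>\<^bsub>H\<^esub> f \<zero>\<^bsub>G\<^esub> = f \<zero>\<^bsub>G\<^esub>"
    using add_hom_add[OF assms(1), of "\<zero>\<^bsub>G\<^esub>" "\<zero>\<^bsub>G\<^esub>"] by simp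
  then show ?thesis
    using add_hom_closed[OF assms(1), of "\<zero>\<^bsub>G\<^esub>"] by (simp add: H.add.l_cancel_one)
qed

lemma add_hom_neg:
  assumes "add_hom G H f" "abelian_group G" "abelian_group H" "x \<in> carrier G"
  shows "f (\<ominus>\<^bsub>G\<^esub> x) = \<ominus>\<^bsub>H\<^esub> f x"
proof -
  interpret G: abelian_group G by fact
  interpret H: abelian_group H by fact
  have "f (\<ominus>\<^bsub>G\<^esub> x) \<oplus>\<^bsub>H\<^esub> f x = \<zero>\<^bsub>H\<^esub>"
    using add_hom_add[OF assms(1), of "\<ominus>\<^bsub>G\<^esub> x" x] assms(4) add_hom_zero[OF assms(1-3)]
    by (simp add: G.l_neg)
  then show ?thesis
    using add_hom_closed[OF assms(1)] assms(4) by (metis G.a_inv_closed H.minus_equality)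
qed

lemma add_hom_diff:
  assumes "add_hom G H f" "abelian_group G" "abelian_group H" "x \<in> carrier G" "y \<in> carrier G"
  shows "f (x \<ominus>\<^bsub>G\<^esub> y) = f x \<ominus>\<^bsub>H\<^esub> f y"
proof -
  interpret G: abelian_group G by fact
  show ?thesis
    using assms by (simp add: a_minus_def add_hom_add[OF assms(1)] add_hom_neg[OF assms(1-3)])
qed

lemma add_hom_inj_iff:
  assumes "add_hom G H f" "abelian_group G" "abelian_group H"
  shows "inj_on f (carrier G) \<longleftrightarrow> (\<forall>x\<in>carrier G. f x = \<zero>\<^bsub>H\<^esub> \<longrightarrow> x = \<zero>\<^bsub>G\<^esub>)"
proof -
  interpret G: abelian_group G by fact
  interpret H: abelian_group H by fact
  show ?thesis
  proof
    assume "inj_on f (carrier G)"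
    then show "\<forall>x\<in>carrier G. f x = \<zero>\<^bsub>H\<^esub> \<longrightarrow> x = \<zero>\<^bsub>G\<^esub>"
      using add_hom_zero[OF assms] by (metis G.zero_closed inj_onD)
  next
    assume *: "\<forall>x\<in>carrier G. f x = \<zero>\<^bsub>H\<^esub> \<longrightarrow> x = \<zero>\<^bsub>G\<^esub>"
    show "inj_on f (carrier G)"
    proof (rule inj_onI)
      fix x y assume xy: "x \<in> carrier G" "y \<in> carrier G" "f x = f y"
      then have "f x \<ominus>\<^bsub>H\<^esub> f y = \<zero>\<^bsub>H\<^esub>"
        using add_hom_closed[OF assms(1)] by (simp add: a_minus_def H.r_neg)
      then have "f (x \<ominus>\<^bsub>G\<^esub> y) = \<zero>\<^bsub>H\<^esub>"
        using xy by (simp add: add_hom_diff[OF assms])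
      then have "x \<ominus>\<^bsub>G\<^esub> y = \<zero>\<^bsub>G\<^esub>" using * xy by simp
      then show "x = y" using xy by (simp add: G.diff_zero_iff)
    qed
  qed
qed

lemma add_hom_finsum:
  assumes "add_hom G H f" "abelian_group G" "abelian_group H" "finite I" "g \<in> I \<rightarrow> carrier G"
  shows "f (finsum G g I) = finsum H (\<lambda>i. f (g i)) I"
proof -
  interpret G: abelian_group G by fact
  interpret H: abelian_group H by fact
  show ?thesis using assms(4,5)
  proof (induction I rule: finite_induct)
    case empty
    show ?case using add_hom_zero[OF assms(1-3)] by simp
  next
    case (insert i I)
    then have "g \<in> I \<rightarrow> carrier G" "g i \<in> carrier G" by auto
    moreover then have "(\<lambda>i. f (g i)) \<in> I \<rightarrow> carrier H" "f (g i) \<in> carrier H"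
      using add_hom_closed[OF assms(1)] by auto
    ultimately show ?case using insert by (simp add: add_hom_add[OF assms(1)])
  qed
qed

lemma right_linear_compose:
  "right_linear R X Y f \<Longrightarrow> right_linear R Y Z g \<Longrightarrow> right_linear R X Z (\<lambda>x. g (f x))"
  by (auto simp: right_linear_iff add_hom_def)

lemma left_linear_compose:
  "left_linear R X Y f \<Longrightarrow> left_linear R Y Z g \<Longrightarrow> left_linear R X Z (\<lambda>x. g (f x))"
  by (auto simp: left_linear_iff add_hom_def)

lemma right_linear_id: "right_linear R X X (\<lambda>x. x)"
  by (auto simp: right_linear_iff add_hom_def)

lemma left_linear_id: "left_linear R X X (\<lambda>x. x)"
  by (auto simp: left_linear_iff add_hom_def)

lemma right_linear_add_hom: "right_linear R X Y f \<Longrightarrow> add_hom X Y f"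
  by (simp add: right_linear_iff)

lemma left_linear_add_hom: "left_linear R X Y f \<Longrightarrow> add_hom X Y f"
  by (simp add: left_linear_iff)

lemma right_module_group: "right_module R X \<Longrightarrow> abelian_group X"
  by (simp add: right_module_def)

lemma left_module_group: "left_module R X \<Longrightarrow> abelian_group X"
  by (simp add: left_module_def)

lemma right_moduleI:
  assumes "ring R" "abelian_group X"
    and "\<And>a x. a \<in> carrier R \<Longrightarrow> x \<in> carrier X \<Longrightarrow> x \<triangleleft>\<^bsub>X\<^esub> a \<in> carrier X"
    and "\<And>a b x. a \<in> carrier R \<Longrightarrow> b \<in> carrier R \<Longrightarrow> x \<in> carrier X \<Longrightarrow>
           x \<triangleleft>\<^bsub>X\<^esub> (a \<oplus>\<^bsub>R\<^esub> b) = x \<triangleleft>\<^bsub>X\<^esub> a \<oplus>\<^bsub>X\<^esub> x \<triangleleft>\<^bsub>X\<^esub> b"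
    and "\<And>a x y. a \<in> carrier R \<Longrightarrow> x \<in> carrier X \<Longrightarrow> y \<in> carrier X \<Longrightarrow>
           (x \<oplus>\<^bsub>X\<^esub> y) \<triangleleft>\<^bsub>X\<^esub> a = x \<triangleleft>\<^bsub>X\<^esub> a \<oplus>\<^bsub>X\<^esub> y \<triangleleft>\<^bsub>X\<^esub> a"
    and "\<And>a b x. a \<in> carrier R \<Longrightarrow> b \<in> carrier R \<Longrightarrow> x \<in> carrier X \<Longrightarrow>
           x \<triangleleft>\<^bsub>X\<^esub> (a \<otimes>\<^bsub>R\<^esub> b) = (x \<triangleleft>\<^bsub>X\<^esub> a) \<triangleleft>\<^bsub>X\<^esub> b"
    and "\<And>x. x \<in> carrier X \<Longrightarrow> x \<triangleleft>\<^bsub>X\<^esub> \<one>\<^bsub>R\<^esub> = x"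
  shows "right_module R X"
  using assms by (simp add: right_module_def right_module_axioms_def)

lemma left_moduleI:
  assumes "ring R" "abelian_group X"
    and "\<And>a x. a \<in> carrier R \<Longrightarrow> x \<in> carrier X \<Longrightarrow> a \<odot>\<^bsub>X\<^esub> x \<in> carrier X"
    and "\<And>a b x. a \<in> carrier R \<Longrightarrow> b \<in> carrier R \<Longrightarrow> x \<in> carrier X \<Longrightarrow>
           (a \<oplus>\<^bsub>R\<^esub> b) \<odot>\<^bsub>X\<^esub> x = a \<odot>\<^bsub>X\<^esub> x \<oplus>\<^bsub>X\<^esub> b \<odot>\<^bsub>X\<^esub> x"
    and "\<And>a x y. a \<in> carrier R \<Longrightarrow> x \<in> carrier X \<Longrightarrow> y \<in> carrier X \<Longrightarrow>
           a \<odot>\<^bsub>X\<^esub> (x \<oplus>\<^bsub>X\<^esub> y) = a \<odot>\<^bsub>X\<^esub> x \<oplus>\<^bsub>X\<^esub> a \<odot>\<^bsub>X\<^esub> y"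
    and "\<And>a b x. a \<in> carrier R \<Longrightarrow> b \<in> carrier R \<Longrightarrow> x \<in> carrier X \<Longrightarrow>
           (a \<otimes>\<^bsub>R\<^esub> b) \<odot>\<^bsub>X\<^esub> x = a \<odot>\<^bsub>X\<^esub> (b \<odot>\<^bsub>X\<^esub> x)"
    and "\<And>x. x \<in> carrier X \<Longrightarrow> \<one>\<^bsub>R\<^esub> \<odot>\<^bsub>X\<^esub> x = x"
  shows "left_module R X"
  using assms by (simp add: left_module_def left_module_axioms_def)

lemma right_module_zero_smult:
  assumes "right_module R X" "r \<in> carrier R" shows "\<zero>\<^bsub>X\<^esub> \<triangleleft>\<^bsub>X\<^esub> r = \<zero>\<^bsub>X\<^esub>"
proof -
  interpret X: right_module R X by fact
  have "add_hom X X (\<lambda>x. x \<triangleleft>\<^bsub>X\<^esub> r)"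
    using assms(2) by (simp add: add_hom_def X.rsmult_closed X.rsmult_l_distr)
  then show ?thesis by (rule add_hom_zero) unfold_locales
qed

lemma right_module_neg_smult:
  assumes "right_module R X" "x \<in> carrier X"
  shows "x \<triangleleft>\<^bsub>X\<^esub> (\<ominus>\<^bsub>R\<^esub> \<one>\<^bsub>R\<^esub>) = \<ominus>\<^bsub>X\<^esub> x"
proof -
  interpret X: right_module R X by fact
  have "add_hom R X (\<lambda>r. x \<triangleleft>\<^bsub>X\<^esub> r)"
    using assms(2) by (simp add: add_hom_def X.rsmult_closed X.rsmult_r_distr)
  then have "x \<triangleleft>\<^bsub>X\<^esub> (\<ominus>\<^bsub>R\<^esub> \<one>\<^bsub>R\<^esub>) = \<ominus>\<^bsub>X\<^esub> (x \<triangleleft>\<^bsub>X\<^esub> \<one>\<^bsub>R\<^esub>)"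
    by (rule add_hom_neg) (unfold_locales, simp)
  then show ?thesis using assms(2) by (simp add: X.rsmult_one)
qed

lemma left_module_smult_zero:
  assumes "left_module R X" "r \<in> carrier R" shows "r \<odot>\<^bsub>X\<^esub> \<zero>\<^bsub>X\<^esub> = \<zero>\<^bsub>X\<^esub>"
proof -
  interpret X: left_module R X by fact
  have "add_hom X X (\<lambda>x. r \<odot>\<^bsub>X\<^esub> x)"
    using assms(2) by (simp add: add_hom_def X.lsmult_closed X.lsmult_r_distr)
  then show ?thesis by (rule add_hom_zero) unfold_locales
qed

lemma left_module_neg_smult:
  assumes "left_module R X" "x \<in> carrier X"
  shows "(\<ominus>\<^bsub>R\<^esub> \<one>\<^bsub>R\<^esub>) \<odot>\<^bsub>X\<^esub> x = \<ominus>\<^bsub>X\<^esub> x"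
proof -
  interpret X: left_module R X by fact
  have "add_hom R X (\<lambda>r. r \<odot>\<^bsub>X\<^esub> x)"
    using assms(2) by (simp add: add_hom_def X.lsmult_closed X.lsmult_l_distr)
  then have "(\<ominus>\<^bsub>R\<^esub> \<one>\<^bsub>R\<^esub>) \<odot>\<^bsub>X\<^esub> x = \<ominus>\<^bsub>X\<^esub> (\<one>\<^bsub>R\<^esub> \<odot>\<^bsub>X\<^esub> x)"
    by (rule add_hom_neg) (unfold_locales, simp)
  then show ?thesis using assms(2) by (simp add: X.lsmult_one)
qed

lemma left_module_zero_smult:
  assumes "left_module R X" "x \<in> carrier X"
  shows "\<zero>\<^bsub>R\<^esub> \<odot>\<^bsub>X\<^esub> x = \<zero>\<^bsub>X\<^esub>"
proof -
  interpret X: left_module R X by fact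
  have "add_hom R X (\<lambda>r. r \<odot>\<^bsub>X\<^esub> x)"
    using assms(2) by (simp add: add_hom_def X.lsmult_closed X.lsmult_l_distr)
  then show ?thesis by (rule add_hom_zero) unfold_locales
qed

lemma right_linear_cong:
  assumes "right_linear R M N f" "right_module R M" "\<And>m. m \<in> carrier M \<Longrightarrow> f m = f' m"
  shows "right_linear R M N f'"
  using assms(1) assms(3) right_module.rsmult_closed[OF assms(2)]
    abelian_groupE(1)[OF right_module_group[OF assms(2)]]
  by (simp add: right_linear_iff add_hom_def)

lemma abelian_group_cong:
  assumes "abelian_group G" "carrier H = carrier G" "ring.zero H = ring.zero G" "ring.add H = ring.add G"
  shows "abelian_group H"
  by (rule abelian_groupI) (auto simp: assms(2-4) intro: abelian_groupE[OF assms(1)])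

lemma right_linear_add:
  assumes N: "right_module A N" and f: "right_linear A M N f" and g: "right_linear A M N g"
  shows "right_linear A M N (\<lambda>m. f m \<oplus>\<^bsub>N\<^esub> g m)"
proof -
  interpret N: right_module A N by fact
  show ?thesis
    using f g by (auto simp: right_linear_iff add_hom_def N.rsmult_l_distr N.a_ac)
qed

lemma right_linear_neg:
  assumes N: "right_module A N" and f: "right_linear A M N f"
  shows "right_linear A M N (\<lambda>m. \<ominus>\<^bsub>N\<^esub> f m)"
proof -
  interpret N: right_module A N by fact
  have "add_hom N N (\<lambda>x. x \<triangleleft>\<^bsub>N\<^esub> r)" if "r \<in> carrier A" for r
    using that by (simp add: add_hom_def N.rsmult_closed N.rsmult_l_distr)
  then have neg: "(\<ominus>\<^bsub>N\<^esub> x) \<triangleleft>\<^bsub>N\<^esub> r = \<ominus>\<^bsub>N\<^esub> (x \<triangleleft>\<^bsub>N\<^esub> r)" if "r \<in> carrier A" "x \<in> carrier N" for r x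
    using add_hom_neg[of N N "\<lambda>x. x \<triangleleft>\<^bsub>N\<^esub> r" x] that N.abelian_group_axioms by simp
  show ?thesis
    using f by (auto simp: right_linear_iff add_hom_def neg N.minus_add)
qed

lemma right_linear_zero:
  assumes N: "right_module A N"
  shows "right_linear A M N (\<lambda>m. \<zero>\<^bsub>N\<^esub>)"
proof -
  interpret N: right_module A N by fact
  show ?thesis by (simp add: right_linear_iff add_hom_def right_module_zero_smult[OF N])
qed


section \<open>The tensor product\<close>

text \<open>
  The formula inside \<open>tensor_lift\<close>, as a map on the free abelian group.
\<close>

definition frag_eval :: "('g, 'x) ring_scheme \<Rightarrow> ('s \<Rightarrow> 'g) \<Rightarrow> ('s \<Rightarrow>\<^sub>0 int) \<Rightarrow> 'g" where
  "frag_eval G b x = (\<Oplus>\<^bsub>G\<^esub>z\<in>Poly_Mapping.keys x. [Poly_Mapping.lookup x z] \<cdot>\<^bsub>G\<^esub> b z)"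

lemma (in abelian_group) frag_eval_superset:
  assumes "b ` S \<subseteq> carrier G" "finite K" "Poly_Mapping.keys x \<subseteq> K" "K \<subseteq> S"
  shows "frag_eval G b x = (\<Oplus>z\<in>K. [Poly_Mapping.lookup x z] \<cdot> b z)"
  unfolding frag_eval_def
  by (rule add.finprod_mono_neutral_cong_left)
    (use assms in \<open>auto simp: in_keys_iff image_subset_iff subset_iff add_pow_int_zero\<close>)

lemma (in abelian_group) frag_eval_hom:
  assumes "b ` S \<subseteq> carrier G"
  shows "frag_eval G b \<in> hom (free_Abelian_group S) (add_monoid G)"
    and "s \<in> S \<Longrightarrow> frag_eval G b (frag_of s) = b s"
proof -
  have bS: "\<And>s. s \<in> S \<Longrightarrow> b s \<in> carrier G" using assms by auto
  show "frag_eval G b \<in> hom (free_Abelian_group S) (add_monoid G)"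
  proof (rule homI)
    fix x assume "x \<in> carrier (free_Abelian_group S)"
    then show "frag_eval G b x \<in> carrier (add_monoid G)"
      by (auto simp: frag_eval_def subset_iff intro!: finsum_closed bS)
  next
    fix x y
    assume xy: "x \<in> carrier (free_Abelian_group S)" "y \<in> carrier (free_Abelian_group S)"
    let ?K = "Poly_Mapping.keys x \<union> Poly_Mapping.keys y"
    have K: "finite ?K" "?K \<subseteq> S" using xy by auto
    have b': "\<And>s. s \<in> ?K \<Longrightarrow> b s \<in> carrier G" using K bS by auto
    have "frag_eval G b (x + y) = (\<Oplus>z\<in>?K. [Poly_Mapping.lookup (x + y) z] \<cdot> b z)"
      by (rule frag_eval_superset[OF assms]) (use K keys_add[of x y] in auto)
    also have "\<dots> = (\<Oplus>z\<in>?K. [Poly_Mapping.lookup x z] \<cdot> b z \<oplus> [Poly_Mapping.lookup y z] \<cdot> b z)"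
      by (rule finsum_cong') (auto simp: lookup_add add.int_pow_mult b')
    also have "\<dots> = (\<Oplus>z\<in>?K. [Poly_Mapping.lookup x z] \<cdot> b z) \<oplus> (\<Oplus>z\<in>?K. [Poly_Mapping.lookup y z] \<cdot> b z)"
      by (rule finsum_addf) (auto simp: b')
    also have "\<dots> = frag_eval G b x \<oplus> frag_eval G b y"
      using K by (simp add: frag_eval_superset[OF assms, of ?K])
    finally show "frag_eval G b (x \<otimes>\<^bsub>free_Abelian_group S\<^esub> y)
        = frag_eval G b x \<otimes>\<^bsub>add_monoid G\<^esub> frag_eval G b y" by simp
  qed
  show "frag_eval G b (frag_of s) = b s" if "s \<in> S"
    using bS[OF that] by (simp add: frag_eval_def add.int_pow_1)
qed

definition tensor_gens ::
  "('r, 'x) ring_scheme \<Rightarrow> ('r, 'm, 'y) rmodule_scheme \<Rightarrow> ('r, 'n, 'z) module_scheme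
    \<Rightarrow> ('m \<times> 'n \<Rightarrow>\<^sub>0 int) set" where
  "tensor_gens R M N =
      ({frag_of (m \<oplus>\<^bsub>M\<^esub> m', n) - frag_of (m, n) - frag_of (m', n) | m m' n.
          m \<in> carrier M \<and> m' \<in> carrier M \<and> n \<in> carrier N} \<union>
       {frag_of (m, n \<oplus>\<^bsub>N\<^esub> n') - frag_of (m, n) - frag_of (m, n') | m n n'.
          m \<in> carrier M \<and> n \<in> carrier N \<and> n' \<in> carrier N} \<union>
       {frag_of (m \<triangleleft>\<^bsub>M\<^esub> r, n) - frag_of (m, r \<odot>\<^bsub>N\<^esub> n) | m r n.
          m \<in> carrier M \<and> r \<in> carrier R \<and> n \<in> carrier N})"

abbreviation tensor_free ::
  "('r, 'm, 'y) rmodule_scheme \<Rightarrow> ('r, 'n, 'z) module_scheme \<Rightarrow> ('m \<times> 'n \<Rightarrow>\<^sub>0 int) monoid" where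
  "tensor_free M N \<equiv> free_Abelian_group (carrier M \<times> carrier N)"

lemma tensor_relations_gens:
  "tensor_relations R M N = generate (tensor_free M N) (tensor_gens R M N)"
  by (simp add: tensor_relations_def tensor_gens_def)

lemma keys_frag_diff2:
  assumes "a \<in> S" "b \<in> S" shows "Poly_Mapping.keys (frag_of a - frag_of b) \<subseteq> S"
  using keys_diff[of "frag_of a" "frag_of b"] assms by (auto simp: subset_iff)

lemma keys_frag_diff3:
  assumes "a \<in> S" "b \<in> S" "c \<in> S"
  shows "Poly_Mapping.keys (frag_of a - frag_of b - frag_of c) \<subseteq> S"
  using keys_diff[of "frag_of a - frag_of b" "frag_of c"] keys_diff[of "frag_of a" "frag_of b"] assms
  by (auto simp: subset_iff)

lemma tensor_gens_free:
  assumes "right_module R M" "left_module R N"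
  shows "tensor_gens R M N \<subseteq> carrier (tensor_free M N)"
proof -
  interpret M: right_module R M by fact
  interpret N: left_module R N by fact
  show ?thesis
    unfolding tensor_gens_def
    by (intro Un_least subsetI; elim CollectE exE conjE; hypsubst; unfold carrier_free_Abelian_group_iff;
        (rule keys_frag_diff3 | rule keys_frag_diff2))
      (simp_all add: M.rsmult_closed N.lsmult_closed)
qed

lemma subgroup_tensor_relations:
  assumes "right_module R M" "left_module R N"
  shows "subgroup (tensor_relations R M N) (tensor_free M N)"
  unfolding tensor_relations_gens
  by (rule group.generate_is_subgroup[OF group_free_Abelian_group tensor_gens_free[OF assms]])

lemma normal_tensor_relations:
  assumes "right_module R M" "left_module R N"
  shows "tensor_relations R M N \<lhd> tensor_free M N"
  using subgroup_tensor_relations[OF assms] comm_group.normal_iff_subgroup[OF abelian_free_Abelian_group]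
  by blast

lemma add_monoid_tensor: "add_monoid (tensor R M N) = tensor_free M N Mod tensor_relations R M N"
  by (simp add: tensor_def Let_def FactGroup_def)

lemma tensor_abelian_group:
  assumes "right_module R M" "left_module R N"
  shows "abelian_group (tensor R M N)"
proof -
  have "comm_group (add_monoid (tensor R M N))"
    unfolding add_monoid_tensor
    by (rule comm_group.abelian_FactGroup[OF abelian_free_Abelian_group subgroup_tensor_relations[OF assms]])
  then show ?thesis
    by (simp add: abelian_group_def abelian_monoid_def abelian_group_axioms_def comm_group_def)
qed

definition tensor_class ::
  "('r, 'x) ring_scheme \<Rightarrow> ('r, 'm, 'y) rmodule_scheme \<Rightarrow> ('r, 'n, 'z) module_scheme
    \<Rightarrow> ('m \<times> 'n \<Rightarrow>\<^sub>0 int) \<Rightarrow> ('m, 'n) tens" where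
  "tensor_class R M N w = tensor_relations R M N #>\<^bsub>tensor_free M N\<^esub> w"

lemma tens_eq_class: "tens R M N m n = tensor_class R M N (frag_of (m, n))"
  by (simp add: tens_def tensor_class_def)

lemma tensor_class_hom:
  assumes "right_module R M" "left_module R N"
  shows "tensor_class R M N \<in> hom (tensor_free M N) (add_monoid (tensor R M N))"
  using normal.r_coset_hom_Mod[OF normal_tensor_relations[OF assms]]
  unfolding add_monoid_tensor tensor_class_def .

lemma tensor_class_diff:
  assumes "right_module R M" "left_module R N"
    and "a \<in> carrier (tensor_free M N)" "b \<in> carrier (tensor_free M N)"
  shows "tensor_class R M N (a - b) = tensor_class R M N a \<ominus>\<^bsub>tensor R M N\<^esub> tensor_class R M N b"
proof -
  interpret T: abelian_group "tensor R M N" by (rule tensor_abelian_group[OF assms(1,2)])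
  have ab: "a - b \<in> carrier (tensor_free M N)"
    using assms(3,4) keys_diff[of a b] by auto
  have "tensor_class R M N ((a - b) \<otimes>\<^bsub>tensor_free M N\<^esub> b)
      = tensor_class R M N (a - b) \<otimes>\<^bsub>add_monoid (tensor R M N)\<^esub> tensor_class R M N b"
    by (rule hom_mult[OF tensor_class_hom[OF assms(1,2)] ab assms(4)])
  then have "tensor_class R M N a = tensor_class R M N (a - b) \<oplus>\<^bsub>tensor R M N\<^esub> tensor_class R M N b"
    by simp
  moreover have "tensor_class R M N (a - b) \<in> carrier (tensor R M N)"
    "tensor_class R M N b \<in> carrier (tensor R M N)"
    using hom_in_carrier[OF tensor_class_hom[OF assms(1,2)]] ab assms(4) by auto
  ultimately show ?thesis by (simp add: a_minus_def T.a_assoc T.r_neg)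
qed

lemma carrier_tensor: "carrier (tensor R M N) = tensor_class R M N ` carrier (tensor_free M N)"
  by (simp add: tensor_def Let_def carrier_FactGroup tensor_class_def)

lemma tensor_class_zero_iff:
  assumes "right_module R M" "left_module R N" "w \<in> carrier (tensor_free M N)"
  shows "tensor_class R M N w = \<zero>\<^bsub>tensor R M N\<^esub> \<longleftrightarrow> w \<in> tensor_relations R M N"
proof -
  have "\<zero>\<^bsub>tensor R M N\<^esub> = tensor_relations R M N"
    by (simp add: tensor_def Let_def)
  then show ?thesis
    unfolding tensor_class_def
    using group.coset_join1[OF group_free_Abelian_group _ _ subgroup_tensor_relations[OF assms(1,2)]]
      group.coset_join2[OF group_free_Abelian_group _ subgroup_tensor_relations[OF assms(1,2)]] assms(3)
    by metis
qed

lemma tensor_class_relation: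
  assumes "right_module R M" "left_module R N" "w \<in> tensor_relations R M N"
  shows "tensor_class R M N w = \<zero>\<^bsub>tensor R M N\<^esub>"
  using assms tensor_class_zero_iff subgroup.mem_carrier[OF subgroup_tensor_relations[OF assms(1,2)]]
  by blast

lemma tens_closed:
  assumes "right_module R M" "left_module R N" "m \<in> carrier M" "n \<in> carrier N"
  shows "tens R M N m n \<in> carrier (tensor R M N)"
  unfolding tens_eq_class using hom_in_carrier[OF tensor_class_hom[OF assms(1,2)]] assms(3,4) by simp

lemma tens_add_left:
  assumes rm: "right_module R M" and lm: "left_module R N"
    and m: "m \<in> carrier M" "m' \<in> carrier M" and n: "n \<in> carrier N"
  shows "tens R M N (m \<oplus>\<^bsub>M\<^esub> m') n = tens R M N m n \<oplus>\<^bsub>tensor R M N\<^esub> tens R M N m' n"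
proof -
  interpret M: right_module R M by fact
  interpret T: abelian_group "tensor R M N" by (rule tensor_abelian_group[OF rm lm])
  have KK: "Poly_Mapping.keys (frag_of (m \<oplus>\<^bsub>M\<^esub> m', n) - frag_of (m, n)) \<subseteq> carrier M \<times> carrier N"
    using m n by (intro keys_frag_diff2) auto
  have "frag_of (m \<oplus>\<^bsub>M\<^esub> m', n) - frag_of (m, n) - frag_of (m', n) \<in> tensor_relations R M N"
    unfolding tensor_relations_gens
    by (rule generate.incl) (use m n in \<open>auto simp: tensor_gens_def\<close>)
  then have "tensor_class R M N (frag_of (m \<oplus>\<^bsub>M\<^esub> m', n) - frag_of (m, n) - frag_of (m', n))
      = \<zero>\<^bsub>tensor R M N\<^esub>"
    by (rule tensor_class_relation[OF rm lm])
  then have "tens R M N (m \<oplus>\<^bsub>M\<^esub> m') n \<ominus>\<^bsub>tensor R M N\<^esub> tens R M N m n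
      \<ominus>\<^bsub>tensor R M N\<^esub> tens R M N m' n = \<zero>\<^bsub>tensor R M N\<^esub>"
    using m n KK by (simp add: tens_eq_class tensor_class_diff[OF rm lm])
  then have "tens R M N (m \<oplus>\<^bsub>M\<^esub> m') n \<ominus>\<^bsub>tensor R M N\<^esub> tens R M N m n = tens R M N m' n"
    using tens_closed[OF rm lm] m n by (simp add: T.diff_zero_iff T.minus_closed)
  then show ?thesis
    using tens_closed[OF rm lm] m n by (simp add: T.diff_eq_iff)
qed

lemma tens_add_right:
  assumes rm: "right_module R M" and lm: "left_module R N"
    and m: "m \<in> carrier M" and n: "n \<in> carrier N" "n' \<in> carrier N"
  shows "tens R M N m (n \<oplus>\<^bsub>N\<^esub> n') = tens R M N m n \<oplus>\<^bsub>tensor R M N\<^esub> tens R M N m n'"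
proof -
  interpret N: left_module R N by fact
  interpret T: abelian_group "tensor R M N" by (rule tensor_abelian_group[OF rm lm])
  have KK: "Poly_Mapping.keys (frag_of (m, n \<oplus>\<^bsub>N\<^esub> n') - frag_of (m, n)) \<subseteq> carrier M \<times> carrier N"
    using m n by (intro keys_frag_diff2) auto
  have "frag_of (m, n \<oplus>\<^bsub>N\<^esub> n') - frag_of (m, n) - frag_of (m, n') \<in> tensor_relations R M N"
    unfolding tensor_relations_gens
    by (rule generate.incl) (use m n in \<open>auto simp: tensor_gens_def\<close>)
  then have "tensor_class R M N (frag_of (m, n \<oplus>\<^bsub>N\<^esub> n') - frag_of (m, n) - frag_of (m, n'))
      = \<zero>\<^bsub>tensor R M N\<^esub>"
    by (rule tensor_class_relation[OF rm lm])
  then have "tens R M N m (n \<oplus>\<^bsub>N\<^esub> n') \<ominus>\<^bsub>tensor R M N\<^esub> tens R M N m n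
      \<ominus>\<^bsub>tensor R M N\<^esub> tens R M N m n' = \<zero>\<^bsub>tensor R M N\<^esub>"
    using m n KK by (simp add: tens_eq_class tensor_class_diff[OF rm lm])
  then have "tens R M N m (n \<oplus>\<^bsub>N\<^esub> n') \<ominus>\<^bsub>tensor R M N\<^esub> tens R M N m n = tens R M N m n'"
    using tens_closed[OF rm lm] m n by (simp add: T.diff_zero_iff T.minus_closed)
  then show ?thesis
    using tens_closed[OF rm lm] m n by (simp add: T.diff_eq_iff)
qed

lemma tens_balanced:
  assumes rm: "right_module R M" and lm: "left_module R N"
    and m: "m \<in> carrier M" "r \<in> carrier R" and n: "n \<in> carrier N"
  shows "tens R M N (m \<triangleleft>\<^bsub>M\<^esub> r) n = tens R M N m (r \<odot>\<^bsub>N\<^esub> n)"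
proof -
  interpret M: right_module R M by fact
  interpret N: left_module R N by fact
  interpret T: abelian_group "tensor R M N" by (rule tensor_abelian_group[OF rm lm])
  have "frag_of (m \<triangleleft>\<^bsub>M\<^esub> r, n) - frag_of (m, r \<odot>\<^bsub>N\<^esub> n) \<in> tensor_relations R M N"
    unfolding tensor_relations_gens
    by (rule generate.incl) (use m n in \<open>auto simp: tensor_gens_def\<close>)
  then have "tensor_class R M N (frag_of (m \<triangleleft>\<^bsub>M\<^esub> r, n) - frag_of (m, r \<odot>\<^bsub>N\<^esub> n))
      = \<zero>\<^bsub>tensor R M N\<^esub>"
    by (rule tensor_class_relation[OF rm lm])
  then have "tens R M N (m \<triangleleft>\<^bsub>M\<^esub> r) n \<ominus>\<^bsub>tensor R M N\<^esub> tens R M N m (r \<odot>\<^bsub>N\<^esub> n)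
      = \<zero>\<^bsub>tensor R M N\<^esub>"
    using m n by (simp add: tens_eq_class tensor_class_diff[OF rm lm] M.rsmult_closed N.lsmult_closed)
  then show ?thesis
    using tens_closed[OF rm lm] m n by (simp add: M.rsmult_closed N.lsmult_closed T.diff_zero_iff)
qed

definition balanced ::
  "('r, 'x) ring_scheme \<Rightarrow> ('r, 'm, 'y) rmodule_scheme \<Rightarrow> ('r, 'n, 'z) module_scheme
    \<Rightarrow> ('t, 'w) ring_scheme \<Rightarrow> ('m \<Rightarrow> 'n \<Rightarrow> 't) \<Rightarrow> bool" where
  "balanced R M N G b \<longleftrightarrow>
     (\<forall>m\<in>carrier M. \<forall>n\<in>carrier N. b m n \<in> carrier G) \<and>
     (\<forall>m\<in>carrier M. \<forall>m'\<in>carrier M. \<forall>n\<in>carrier N. b (m \<oplus>\<^bsub>M\<^esub> m') n = b m n \<oplus>\<^bsub>G\<^esub> b m' n) \<and>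
     (\<forall>m\<in>carrier M. \<forall>n\<in>carrier N. \<forall>n'\<in>carrier N. b m (n \<oplus>\<^bsub>N\<^esub> n') = b m n \<oplus>\<^bsub>G\<^esub> b m n') \<and>
     (\<forall>m\<in>carrier M. \<forall>r\<in>carrier R. \<forall>n\<in>carrier N. b (m \<triangleleft>\<^bsub>M\<^esub> r) n = b m (r \<odot>\<^bsub>N\<^esub> n))"

lemma balancedI:
  assumes "\<And>m n. m \<in> carrier M \<Longrightarrow> n \<in> carrier N \<Longrightarrow> b m n \<in> carrier G"
    and "\<And>m m' n. m \<in> carrier M \<Longrightarrow> m' \<in> carrier M \<Longrightarrow> n \<in> carrier N \<Longrightarrow>
           b (m \<oplus>\<^bsub>M\<^esub> m') n = b m n \<oplus>\<^bsub>G\<^esub> b m' n"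
    and "\<And>m n n'. m \<in> carrier M \<Longrightarrow> n \<in> carrier N \<Longrightarrow> n' \<in> carrier N \<Longrightarrow>
           b m (n \<oplus>\<^bsub>N\<^esub> n') = b m n \<oplus>\<^bsub>G\<^esub> b m n'"
    and "\<And>m r n. m \<in> carrier M \<Longrightarrow> r \<in> carrier R \<Longrightarrow> n \<in> carrier N \<Longrightarrow>
           b (m \<triangleleft>\<^bsub>M\<^esub> r) n = b m (r \<odot>\<^bsub>N\<^esub> n)"
  shows "balanced R M N G b"
  using assms by (simp add: balanced_def)

lemma tensor_lift_eq_frag_eval:
  "tensor_lift G b X = frag_eval G (\<lambda>z. b (fst z) (snd z)) (SOME x. x \<in> X)"
  by (simp add: tensor_lift_def frag_eval_def Let_def)

text \<open>
  Two representatives of a class differ by a relation, and a balanced map evaluates relations to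
  zero; so the representative chosen by \<open>tensor_lift\<close> does not matter.
\<close>

lemma tensor_lift_class:
  assumes rm: "right_module R M" and lm: "left_module R N" and G: "abelian_group G"
    and b: "balanced R M N G b" and w: "w \<in> carrier (tensor_free M N)"
  shows "tensor_lift G b (tensor_class R M N w) = frag_eval G (\<lambda>z. b (fst z) (snd z)) w"
proof -
  interpret G: abelian_group G by fact
  interpret M: right_module R M by fact
  interpret N: left_module R N by fact
  let ?b = "\<lambda>z. b (fst z) (snd z)" and ?F = "tensor_free M N"
  let ?e = "frag_eval G ?b"
  have bS: "?b ` (carrier M \<times> carrier N) \<subseteq> carrier G" using b by (auto simp: balanced_def)
  note hom = G.frag_eval_hom[OF bS]
  interpret e: group_hom ?F "add_monoid G" ?e
    unfolding group_hom_def group_hom_axioms_def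
    by (intro conjI group_free_Abelian_group G.a_group hom(1))
  have ediff: "?e (x - y) = ?e x \<ominus>\<^bsub>G\<^esub> ?e y" if "x \<in> carrier ?F" "y \<in> carrier ?F" for x y
  proof -
    have xy: "x - y \<in> carrier ?F" using that keys_diff[of x y] by auto
    have "?e ((x - y) \<otimes>\<^bsub>?F\<^esub> y) = ?e (x - y) \<otimes>\<^bsub>add_monoid G\<^esub> ?e y"
      by (rule hom_mult[OF hom(1) xy that(2)])
    moreover have "?e x \<in> carrier G" "?e y \<in> carrier G" "?e (x - y) \<in> carrier G"
      using hom_in_carrier[OF hom(1)] that xy by auto
    ultimately show ?thesis
      using G.diff_eq_iff[of "?e x" "?e y" "?e (x - y)"] by (simp add: G.a_comm)
  qed
  have gens: "?e g = \<zero>\<^bsub>G\<^esub>" if "g \<in> tensor_gens R M N" for g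
  proof -
    have cancel: "(x \<oplus>\<^bsub>G\<^esub> y) \<ominus>\<^bsub>G\<^esub> x \<ominus>\<^bsub>G\<^esub> y = \<zero>\<^bsub>G\<^esub>" if "x \<in> carrier G" "y \<in> carrier G" for x y
      using that G.diff_eq_iff[of "x \<oplus>\<^bsub>G\<^esub> y" x y] by (simp add: G.diff_zero_iff)
    from that show ?thesis
      unfolding tensor_gens_def
      by (elim UnE CollectE exE conjE; hypsubst)
        (use b in \<open>simp_all add: ediff keys_frag_diff2 hom(2) M.rsmult_closed N.lsmult_closed balanced_def cancel G.diff_zero_iff\<close>)
  qed
  have rel: "?e v = \<zero>\<^bsub>G\<^esub>" if "v \<in> tensor_relations R M N" for v
    using that unfolding tensor_relations_gens
  proof (induction v rule: generate.induct)
    case one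
    then show ?case using e.hom_one by simp
  next
    case (incl h)
    then show ?case using gens by simp
  next
    case (inv h)
    then have "h \<in> carrier ?F" using tensor_gens_free[OF rm lm] by blast
    then show ?case using gens[OF inv] e.hom_inv[of h] G.neg_zero by (simp add: a_inv_def)
  next
    case (eng h1 h2)
    then have "h1 \<in> carrier ?F" "h2 \<in> carrier ?F"
      using group.generate_in_carrier[OF group_free_Abelian_group tensor_gens_free[OF rm lm]] by blast+
    then show ?case using eng e.hom_mult[of h1 h2] by simp
  qed
  have "w \<in> tensor_class R M N w"
    unfolding tensor_class_def
    using group.rcos_self[OF group_free_Abelian_group w subgroup_tensor_relations[OF rm lm]] .
  then have "(SOME x. x \<in> tensor_class R M N w) \<in> tensor_class R M N w" by (rule someI)
  then obtain v where v: "v \<in> tensor_relations R M N" "(SOME x. x \<in> tensor_class R M N w) = v + w"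
    by (auto simp: tensor_class_def r_coset_def)
  have "v \<in> carrier ?F" using v subgroup.mem_carrier[OF subgroup_tensor_relations[OF rm lm]] by blast
  then have "?e (v + w) = ?e w"
    using e.hom_mult[of v w] w rel[OF v(1)] e.hom_closed[of w] by simp
  then show ?thesis by (simp add: tensor_lift_eq_frag_eval v(2))
qed

lemma tensor_lift_tens:
  assumes rm: "right_module R M" and lm: "left_module R N" and G: "abelian_group G"
    and b: "balanced R M N G b" and mn: "m \<in> carrier M" "n \<in> carrier N"
  shows "tensor_lift G b (tens R M N m n) = b m n"
proof -
  have bS: "(\<lambda>z. b (fst z) (snd z)) ` (carrier M \<times> carrier N) \<subseteq> carrier G"
    using b by (auto simp: balanced_def)
  show ?thesis
    using tensor_lift_class[OF rm lm G b, of "frag_of (m, n)"] mn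
      abelian_group.frag_eval_hom(2)[OF G bS, of "(m, n)"]
    by (simp add: tens_eq_class)
qed

lemma tensor_lift_add_hom:
  assumes rm: "right_module R M" and lm: "left_module R N" and G: "abelian_group G"
    and b: "balanced R M N G b"
  shows "add_hom (tensor R M N) G (tensor_lift G b)"
proof (rule add_homI)
  let ?e = "frag_eval G (\<lambda>z. b (fst z) (snd z))"
  have bS: "(\<lambda>z. b (fst z) (snd z)) ` (carrier M \<times> carrier N) \<subseteq> carrier G"
    using b by (auto simp: balanced_def)
  note e = abelian_group.frag_eval_hom(1)[OF G bS]
  fix x assume "x \<in> carrier (tensor R M N)"
  then obtain v where v: "v \<in> carrier (tensor_free M N)" "x = tensor_class R M N v"
    by (auto simp: carrier_tensor)
  then show "tensor_lift G b x \<in> carrier G"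
    using hom_in_carrier[OF e] by (simp add: tensor_lift_class[OF assms])
  fix y assume "y \<in> carrier (tensor R M N)"
  then obtain w where w: "w \<in> carrier (tensor_free M N)" "y = tensor_class R M N w"
    by (auto simp: carrier_tensor)
  have vw: "v \<otimes>\<^bsub>tensor_free M N\<^esub> w \<in> carrier (tensor_free M N)"
    using v(1) w(1) group_free_Abelian_group by (metis group.subgroup_self subgroup.m_closed)
  have "x \<oplus>\<^bsub>tensor R M N\<^esub> y = tensor_class R M N (v \<otimes>\<^bsub>tensor_free M N\<^esub> w)"
    using hom_mult[OF tensor_class_hom[OF rm lm] v(1) w(1)] v(2) w(2) by simp
  then show "tensor_lift G b (x \<oplus>\<^bsub>tensor R M N\<^esub> y) = tensor_lift G b x \<oplus>\<^bsub>G\<^esub> tensor_lift G b y"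
    using hom_mult[OF e v(1) w(1)] v w vw by (simp add: tensor_lift_class[OF assms])
qed

lemma tens_zero_left:
  assumes "right_module R M" "left_module R N" "n \<in> carrier N"
  shows "tens R M N \<zero>\<^bsub>M\<^esub> n = \<zero>\<^bsub>tensor R M N\<^esub>"
  by (rule add_hom_zero[where f = "\<lambda>m. tens R M N m n"])
    (use assms in \<open>auto intro!: add_homI simp: tens_closed tens_add_left tensor_abelian_group right_module_group\<close>)

lemma tens_zero_right:
  assumes "right_module R M" "left_module R N" "m \<in> carrier M"
  shows "tens R M N m \<zero>\<^bsub>N\<^esub> = \<zero>\<^bsub>tensor R M N\<^esub>"
  by (rule add_hom_zero[where f = "\<lambda>n. tens R M N m n"])
    (use assms in \<open>auto intro!: add_homI simp: tens_closed tens_add_right tensor_abelian_group left_module_group\<close>)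

lemma tens_neg_left:
  assumes "right_module R M" "left_module R N" "n \<in> carrier N" "m \<in> carrier M"
  shows "tens R M N (\<ominus>\<^bsub>M\<^esub> m) n = \<ominus>\<^bsub>tensor R M N\<^esub> tens R M N m n"
  by (rule add_hom_neg[where f = "\<lambda>m. tens R M N m n"])
    (use assms in \<open>auto intro!: add_homI simp: tens_closed tens_add_left tensor_abelian_group right_module_group\<close>)

text \<open>
  No cases for zero and negatives are needed, because \<open>0 = 0 \<otimes> 0\<close> and \<open>-(m \<otimes> n) = (-m) \<otimes> n\<close>.
\<close>

lemma tensor_induct [consumes 3, case_names tens add]:
  assumes rm: "right_module R M" and lm: "left_module R N" and t: "t \<in> carrier (tensor R M N)"
    and tens: "\<And>m n. m \<in> carrier M \<Longrightarrow> n \<in> carrier N \<Longrightarrow> Q (tens R M N m n)"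
    and add: "\<And>x y. x \<in> carrier (tensor R M N) \<Longrightarrow> y \<in> carrier (tensor R M N) \<Longrightarrow> Q x \<Longrightarrow> Q y \<Longrightarrow>
        Q (x \<oplus>\<^bsub>tensor R M N\<^esub> y)"
  shows "Q t"
proof -
  interpret M: right_module R M by fact
  interpret N: left_module R N by fact
  interpret T: abelian_group "tensor R M N" by (rule tensor_abelian_group[OF rm lm])
  obtain w where w: "w \<in> carrier (tensor_free M N)" "t = tensor_class R M N w"
    using t by (auto simp: carrier_tensor)
  have "Poly_Mapping.keys w \<subseteq> carrier M \<times> carrier N" using w by simp
  then have "Q (tensor_class R M N w) \<and> Q (\<ominus>\<^bsub>tensor R M N\<^esub> tensor_class R M N w)"
  proof (rule free_Abelian_group_induct)
    have "tensor_class R M N 0 = \<zero>\<^bsub>tensor R M N\<^esub>"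
      using tensor_class_diff[OF rm lm, of 0 0] hom_in_carrier[OF tensor_class_hom[OF rm lm], of 0]
      by (simp add: a_minus_def T.r_neg)
    moreover have "Q \<zero>\<^bsub>tensor R M N\<^esub>"
      using tens[of "\<zero>\<^bsub>M\<^esub>" "\<zero>\<^bsub>N\<^esub>"] by (simp add: tens_zero_left[OF rm lm])
    ultimately show "Q (tensor_class R M N 0) \<and> Q (\<ominus>\<^bsub>tensor R M N\<^esub> tensor_class R M N 0)"
      by (simp add: T.neg_zero)
  next
    fix x y assume xy0: "Poly_Mapping.keys x \<subseteq> carrier M \<times> carrier N"
        "Poly_Mapping.keys y \<subseteq> carrier M \<times> carrier N"
      and "Q (tensor_class R M N x) \<and> Q (\<ominus>\<^bsub>tensor R M N\<^esub> tensor_class R M N x)"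
        "Q (tensor_class R M N y) \<and> Q (\<ominus>\<^bsub>tensor R M N\<^esub> tensor_class R M N y)"
    note IH = this
    have xy: "tensor_class R M N x \<in> carrier (tensor R M N)"
      "tensor_class R M N y \<in> carrier (tensor R M N)"
      using hom_in_carrier[OF tensor_class_hom[OF rm lm]] xy0 by auto
    then show "Q (tensor_class R M N (x - y)) \<and> Q (\<ominus>\<^bsub>tensor R M N\<^esub> tensor_class R M N (x - y))"
      using IH add[of "tensor_class R M N x" "\<ominus>\<^bsub>tensor R M N\<^esub> tensor_class R M N y"]
        add[of "\<ominus>\<^bsub>tensor R M N\<^esub> tensor_class R M N x" "tensor_class R M N y"]
      by (simp add: tensor_class_diff[OF rm lm] a_minus_def T.minus_add T.minus_minus)
  next
    fix a assume "a \<in> carrier M \<times> carrier N"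
    then obtain m n where "a = (m, n)" "m \<in> carrier M" "n \<in> carrier N" by auto
    then show "Q (tensor_class R M N (frag_of a)) \<and> Q (\<ominus>\<^bsub>tensor R M N\<^esub> tensor_class R M N (frag_of a))"
      using tens[of m n] tens[of "\<ominus>\<^bsub>M\<^esub> m" n]
      by (simp add: tens_eq_class[symmetric] tens_neg_left[OF rm lm])
  qed
  then show ?thesis using w(2) by simp
qed

lemma tensor_ext:
  assumes rm: "right_module R M" and lm: "left_module R N"
    and f: "add_hom (tensor R M N) G f" and g: "add_hom (tensor R M N) G g"
    and eq: "\<And>m n. m \<in> carrier M \<Longrightarrow> n \<in> carrier N \<Longrightarrow> f (tens R M N m n) = g (tens R M N m n)"
    and t: "t \<in> carrier (tensor R M N)"
  shows "f t = g t"
  using rm lm t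
proof (induction rule: tensor_induct)
  case (tens m n)
  then show ?case by (rule eq)
next
  case (add x y)
  then show ?case by (simp add: add_hom_add[OF f] add_hom_add[OF g])
qed

lemma tensor_map_balanced:
  assumes "right_module R M" "left_module R N" "right_module R M'" "left_module R N'"
    and f: "right_linear R M M' f" and g: "left_linear R N N' g"
  shows "balanced R M N (tensor R M' N') (\<lambda>m n. tens R M' N' (f m) (g n))"
  using f g unfolding right_linear_iff left_linear_iff add_hom_def
  by (intro balancedI)
    (auto simp: tens_closed tens_add_left tens_add_right tens_balanced assms(3,4))

lemma tensor_map_tens:
  assumes "right_module R M" "left_module R N" "right_module R M'" "left_module R N'"
    and "right_linear R M M' f" "left_linear R N N' g" "m \<in> carrier M" "n \<in> carrier N"
  shows "tensor_map R M' N' f g (tens R M N m n) = tens R M' N' (f m) (g n)"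
  unfolding tensor_map_def
  by (rule tensor_lift_tens[OF assms(1,2) tensor_abelian_group[OF assms(3,4)]
        tensor_map_balanced[OF assms(1-6)] assms(7,8)])

lemma tensor_map_add_hom:
  assumes "right_module R M" "left_module R N" "right_module R M'" "left_module R N'"
    and "right_linear R M M' f" "left_linear R N N' g"
  shows "add_hom (tensor R M N) (tensor R M' N') (tensor_map R M' N' f g)"
  unfolding tensor_map_def
  by (rule tensor_lift_add_hom[OF assms(1,2) tensor_abelian_group[OF assms(3,4)]
        tensor_map_balanced[OF assms(1-6)]])

lemma tensor_map_compose:
  assumes "right_module R M" "left_module R N" "right_module R M'" "left_module R N'"
    and "right_module R M''" "left_module R N''"
    and "right_linear R M M' f" "left_linear R N N' g"
    and "right_linear R M' M'' f'" "left_linear R N' N'' g'"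
    and h: "\<And>m. m \<in> carrier M \<Longrightarrow> f' (f m) = h m" and k: "\<And>n. n \<in> carrier N \<Longrightarrow> g' (g n) = k n"
    and t: "t \<in> carrier (tensor R M N)"
  shows "tensor_map R M'' N'' f' g' (tensor_map R M' N' f g t) = tensor_map R M'' N'' h k t"
proof (rule tensor_ext[OF assms(1,2) _ _ _ t])
  have h': "right_linear R M M'' h"
    using right_linear_compose[OF assms(7,9)] h right_module.rsmult_closed[OF assms(1)]
      abelian_groupE(1)[OF right_module_group[OF assms(1)]]
    by (simp add: right_linear_iff add_hom_def)
  have k': "left_linear R N N'' k"
    using left_linear_compose[OF assms(8,10)] k left_module.lsmult_closed[OF assms(2)]
      abelian_groupE(1)[OF left_module_group[OF assms(2)]]
    by (simp add: left_linear_iff add_hom_def)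
  show "add_hom (tensor R M N) (tensor R M'' N'') (tensor_map R M'' N'' h k)"
    by (rule tensor_map_add_hom[OF assms(1,2,5,6) h' k'])
  show "add_hom (tensor R M N) (tensor R M'' N'')
      (\<lambda>t. tensor_map R M'' N'' f' g' (tensor_map R M' N' f g t))"
    by (rule add_hom_compose[OF tensor_map_add_hom[OF assms(1-4,7,8)]
          tensor_map_add_hom[OF assms(3-6,9,10)]])
  fix m n assume mn: "m \<in> carrier M" "n \<in> carrier N"
  then have "f m \<in> carrier M'" "g n \<in> carrier N'"
    using assms(7,8) by (auto simp: right_linear_iff left_linear_iff add_hom_def)
  then show "tensor_map R M'' N'' f' g' (tensor_map R M' N' f g (tens R M N m n))
      = tensor_map R M'' N'' h k (tens R M N m n)"
    using mn h k
    by (simp add: tensor_map_tens[OF assms(1-4,7,8)] tensor_map_tens[OF assms(3-6,9,10)]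
        tensor_map_tens[OF assms(1,2,5,6) h' k'])
qed

lemma tensor_map_ident:
  assumes "right_module R M" "left_module R N"
    and f: "\<And>m. m \<in> carrier M \<Longrightarrow> f m = m" and g: "\<And>n. n \<in> carrier N \<Longrightarrow> g n = n"
    and t: "t \<in> carrier (tensor R M N)"
  shows "tensor_map R M N f g t = t"
proof (rule tensor_ext[OF assms(1,2) _ _ _ t])
  have f': "right_linear R M M f"
    using right_linear_id[of R M] f right_module.rsmult_closed[OF assms(1)]
      abelian_groupE(1)[OF right_module_group[OF assms(1)]]
    by (simp add: right_linear_iff add_hom_def)
  have g': "left_linear R N N g"
    using left_linear_id[of R N] g left_module.lsmult_closed[OF assms(2)]
      abelian_groupE(1)[OF left_module_group[OF assms(2)]]
    by (simp add: left_linear_iff add_hom_def)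
  show "add_hom (tensor R M N) (tensor R M N) (tensor_map R M N f g)"
    by (rule tensor_map_add_hom[OF assms(1,2,1,2) f' g'])
  show "add_hom (tensor R M N) (tensor R M N) (\<lambda>t. t)" by (rule add_hom_id)
  show "tensor_map R M N f g (tens R M N m n) = tens R M N m n"
    if "m \<in> carrier M" "n \<in> carrier N" for m n
    using that f g by (simp add: tensor_map_tens[OF assms(1,2,1,2) f' g'])
qed

lemma tensor_map_add:
  assumes M: "right_module R M" and N: "left_module R N" and M': "right_module R M'"
    and f: "right_linear R M M' f" and g: "right_linear R M M' g" and h: "right_linear R M M' h"
    and eq: "\<And>m. m \<in> carrier M \<Longrightarrow> h m = f m \<oplus>\<^bsub>M'\<^esub> g m"
    and t: "t \<in> carrier (tensor R M N)"
  shows "tensor_map R M' N h (\<lambda>n. n) t =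
    tensor_map R M' N f (\<lambda>n. n) t \<oplus>\<^bsub>tensor R M' N\<^esub> tensor_map R M' N g (\<lambda>n. n) t"
proof (rule tensor_ext[OF M N _ _ _ t])
  interpret T: abelian_group "tensor R M' N" by (rule tensor_abelian_group[OF M' N])
  note F = tensor_map_add_hom[OF M N M' N f left_linear_id]
    and G = tensor_map_add_hom[OF M N M' N g left_linear_id]
  show "add_hom (tensor R M N) (tensor R M' N) (tensor_map R M' N h (\<lambda>n. n))"
    by (rule tensor_map_add_hom[OF M N M' N h left_linear_id])
  show "add_hom (tensor R M N) (tensor R M' N)
     (\<lambda>t. tensor_map R M' N f (\<lambda>n. n) t \<oplus>\<^bsub>tensor R M' N\<^esub> tensor_map R M' N g (\<lambda>n. n) t)"
    by (rule add_homI) (simp_all add: add_hom_closed[OF F] add_hom_closed[OF G] add_hom_add[OF F]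
        add_hom_add[OF G] T.a_ac)
  fix m n assume mn: "m \<in> carrier M" "n \<in> carrier N"
  then have "f m \<in> carrier M'" "g m \<in> carrier M'"
    using f g by (auto simp: right_linear_iff add_hom_def)
  then show "tensor_map R M' N h (\<lambda>n. n) (tens R M N m n) =
      tensor_map R M' N f (\<lambda>n. n) (tens R M N m n) \<oplus>\<^bsub>tensor R M' N\<^esub>
      tensor_map R M' N g (\<lambda>n. n) (tens R M N m n)"
    using mn eq by (simp add: tensor_map_tens[OF M N M' N f left_linear_id]
        tensor_map_tens[OF M N M' N g left_linear_id] tensor_map_tens[OF M N M' N h left_linear_id]
        tens_add_left[OF M' N])
qed

lemma tensor_map_zero:
  assumes M: "right_module R M" and N: "left_module R N" and M': "right_module R M'"
    and f: "right_linear R M M' f" and eq: "\<And>m. m \<in> carrier M \<Longrightarrow> f m = \<zero>\<^bsub>M'\<^esub>"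
    and t: "t \<in> carrier (tensor R M N)"
  shows "tensor_map R M' N f (\<lambda>n. n) t = \<zero>\<^bsub>tensor R M' N\<^esub>"
proof (rule tensor_ext[OF M N tensor_map_add_hom[OF M N M' N f left_linear_id] _ _ t])
  interpret T: abelian_group "tensor R M' N" by (rule tensor_abelian_group[OF M' N])
  show "add_hom (tensor R M N) (tensor R M' N) (\<lambda>t. \<zero>\<^bsub>tensor R M' N\<^esub>)"
    by (rule add_homI) simp_all
  show "tensor_map R M' N f (\<lambda>n. n) (tens R M N m n) = \<zero>\<^bsub>tensor R M' N\<^esub>"
    if "m \<in> carrier M" "n \<in> carrier N" for m n
    using that eq by (simp add: tensor_map_tens[OF M N M' N f left_linear_id] tens_zero_left[OF M' N])
qed

lemma tensor_map_surj:
  assumes X: "right_module R X" and Y: "right_module R Y" and L: "left_module R L" and M: "left_module R M"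
    and D: "right_linear R X Y D" "D ` carrier X = carrier Y"
    and \<phi>: "left_linear R L M \<phi>" "\<phi> ` carrier L = carrier M"
  shows "tensor_map R Y M D \<phi> ` carrier (tensor R X L) = carrier (tensor R Y M)"
proof
  note h = tensor_map_add_hom[OF X L Y M D(1) \<phi>(1)]
  show "tensor_map R Y M D \<phi> ` carrier (tensor R X L) \<subseteq> carrier (tensor R Y M)"
    using add_hom_closed[OF h] by blast
  show "carrier (tensor R Y M) \<subseteq> tensor_map R Y M D \<phi> ` carrier (tensor R X L)"
  proof
    fix t assume "t \<in> carrier (tensor R Y M)"
    with Y M show "t \<in> tensor_map R Y M D \<phi> ` carrier (tensor R X L)"
    proof (induction rule: tensor_induct)
      case (tens y m)
      then have "y \<in> D ` carrier X" "m \<in> \<phi> ` carrier L" using D(2) \<phi>(2) by simp_all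
      then obtain x l where "x \<in> carrier X" "D x = y" "l \<in> carrier L" "\<phi> l = m" by blast
      then show ?case
        using tensor_map_tens[OF X L Y M D(1) \<phi>(1), of x l] tens_closed[OF X L, of x l]
        by (intro image_eqI[of _ _ "tens R X L x l"]) simp_all
    next
      case (add y z)
      then obtain s t where st: "s \<in> carrier (tensor R X L)" "t \<in> carrier (tensor R X L)"
        "y = tensor_map R Y M D \<phi> s" "z = tensor_map R Y M D \<phi> t" by blast
      then show ?case
        using add_hom_add[OF h st(1,2)] abelian_groupE(1)[OF tensor_abelian_group[OF X L] st(1,2)]
        by (intro image_eqI[of _ _ "s \<oplus>\<^bsub>tensor R X L\<^esub> t"]) simp_all
    qed
  qed
qed

lemma regular_right_simps [simp]:
  "carrier (regular_right R) = carrier R" "ring.zero (regular_right R) = ring.zero R"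
  "ring.add (regular_right R) = ring.add R" "x \<triangleleft>\<^bsub>regular_right R\<^esub> r = x \<otimes>\<^bsub>R\<^esub> r"
  by (simp_all add: regular_right_def)

lemma regular_right_module: "ring R \<Longrightarrow> right_module R (regular_right R)"
proof -
  assume "ring R"
  then interpret R: ring R .
  show ?thesis
    by (rule right_moduleI[OF R.ring_axioms abelian_group_cong[OF R.abelian_group_axioms]])
      (simp_all add: R.l_distr R.r_distr R.m_assoc)
qed

lemma scalar_balanced:
  assumes L: "left_module R L" and K: "right_module R K" and k: "right_linear R K (regular_right R) k"
  shows "balanced R K L L (\<lambda>x l. k x \<odot>\<^bsub>L\<^esub> l)"
proof -
  interpret L: left_module R L by fact
  show ?thesis
    using k by (intro balancedI) (auto simp: right_linear_iff add_hom_def L.lsmult_closed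
        L.lsmult_l_distr L.lsmult_r_distr L.lsmult_assoc)
qed


section \<open>Right exactness of the tensor product\<close>

definition quotient_group :: "('g, 'x) ring_scheme \<Rightarrow> 'g set \<Rightarrow> 'g set ring" where
  "quotient_group G W =
     \<lparr>carrier = carrier (add_monoid G Mod W), monoid.mult = undefined, monoid.one = undefined,
      ring.zero = W, ring.add = set_mult (add_monoid G)\<rparr>"

lemma quotient_group:
  assumes G: "abelian_group G" and W: "subgroup W (add_monoid G)"
  shows "abelian_group (quotient_group G W)"
    and "add_hom G (quotient_group G W) (r_coset (add_monoid G) W)"
    and "carrier (quotient_group G W) = r_coset (add_monoid G) W ` carrier G"
    and "x \<in> carrier G \<Longrightarrow> r_coset (add_monoid G) W x = \<zero>\<^bsub>quotient_group G W\<^esub> \<longleftrightarrow> x \<in> W"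
proof -
  interpret G: abelian_group G by fact
  have eq: "add_monoid (quotient_group G W) = add_monoid G Mod W"
    by (simp add: quotient_group_def FactGroup_def)
  have "comm_group (add_monoid (quotient_group G W))"
    unfolding eq by (rule comm_group.abelian_FactGroup[OF G.a_comm_group W])
  then show "abelian_group (quotient_group G W)"
    by (simp add: abelian_group_def abelian_monoid_def abelian_group_axioms_def comm_group_def)
  have "W \<lhd> add_monoid G"
    using comm_group.normal_iff_subgroup[OF G.a_comm_group] W by blast
  then have "r_coset (add_monoid G) W \<in> hom (add_monoid G) (add_monoid (quotient_group G W))"
    unfolding eq by (rule normal.r_coset_hom_Mod)
  then show "add_hom G (quotient_group G W) (r_coset (add_monoid G) W)"
    by (simp only: hom_add_monoid_iff)
  show "carrier (quotient_group G W) = r_coset (add_monoid G) W ` carrier G"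
    by (simp add: quotient_group_def carrier_FactGroup)
  show "x \<in> carrier G \<Longrightarrow> r_coset (add_monoid G) W x = \<zero>\<^bsub>quotient_group G W\<^esub> \<longleftrightarrow> x \<in> W"
    using group.coset_join1[OF G.a_group _ _ W, of x] group.coset_join2[OF G.a_group _ W, of x]
    by (auto simp: quotient_group_def)
qed

inductive_set add_span :: "('g, 'x) ring_scheme \<Rightarrow> 'g set \<Rightarrow> 'g set" for G X where
    zero: "\<zero>\<^bsub>G\<^esub> \<in> add_span G X"
  | base: "x \<in> X \<Longrightarrow> x \<in> add_span G X"
  | add: "x \<in> add_span G X \<Longrightarrow> y \<in> add_span G X \<Longrightarrow> x \<oplus>\<^bsub>G\<^esub> y \<in> add_span G X"

lemma add_span_subgroup:
  assumes G: "abelian_group G" and X: "X \<subseteq> carrier G" and neg: "\<And>x. x \<in> X \<Longrightarrow> \<ominus>\<^bsub>G\<^esub> x \<in> X"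
  shows "subgroup (add_span G X) (add_monoid G)"
proof -
  interpret G: abelian_group G by fact
  have cl: "x \<in> carrier G" if "x \<in> add_span G X" for x
    using that by induction (use X in auto)
  have ng: "\<ominus>\<^bsub>G\<^esub> x \<in> add_span G X" if "x \<in> add_span G X" for x
    using that by induction (auto simp: G.neg_zero G.minus_add cl intro: add_span.intros neg)
  show ?thesis
    using cl ng by (intro subgroup.intro) (auto simp: a_inv_def[symmetric] intro: add_span.intros)
qed

text \<open>
  Let \<open>W\<close> be the span of the tensors that obviously vanish. For set-theoretic sections \<open>s\<close> of \<open>D\<close> and
  \<open>\<sigma>\<close> of \<open>\<phi>\<close>, the class of \<open>s y \<otimes> \<sigma> m\<close> modulo \<open>W\<close> does not depend on the sections. It is therefore
  balanced in \<open>(y, m)\<close> and induces a left inverse \<open>Y \<otimes> M \<rightarrow> (X \<otimes> L) / W\<close> of the map that \<open>D \<otimes> \<phi>\<close>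
  induces on the quotient.
\<close>

lemma tensor_right_exact:
  assumes X: "right_module R X" and Y: "right_module R Y" and L: "left_module R L" and M: "left_module R M"
    and D: "right_linear R X Y D" "D ` carrier X = carrier Y"
    and \<phi>: "left_linear R L M \<phi>" "\<phi> ` carrier L = carrier M"
    and t: "t \<in> carrier (tensor R X L)" and zero: "tensor_map R Y M D \<phi> t = \<zero>\<^bsub>tensor R Y M\<^esub>"
  shows "t \<in> add_span (tensor R X L)
    {tens R X L x l | x l. x \<in> carrier X \<and> l \<in> carrier L \<and> (D x = \<zero>\<^bsub>Y\<^esub> \<or> \<phi> l = \<zero>\<^bsub>M\<^esub>)}"
proof -
  interpret X: right_module R X by fact
  interpret Y: right_module R Y by fact
  interpret L: left_module R L by fact
  interpret M: left_module R M by fact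
  let ?T = "tensor R X L"
  interpret T: abelian_group ?T by (rule tensor_abelian_group[OF X L])
  let ?G = "{tens R X L x l | x l. x \<in> carrier X \<and> l \<in> carrier L \<and> (D x = \<zero>\<^bsub>Y\<^esub> \<or> \<phi> l = \<zero>\<^bsub>M\<^esub>)}"
  define W where "W = add_span ?T ?G"
  note Dh = right_linear_add_hom[OF D(1)] and \<phi>h = left_linear_add_hom[OF \<phi>(1)]
  have W: "subgroup W (add_monoid ?T)"
    unfolding W_def
  proof (rule add_span_subgroup[OF T.abelian_group_axioms])
    show "?G \<subseteq> carrier ?T" by (auto simp: tens_closed[OF X L])
    fix w assume "w \<in> ?G"
    then obtain x l where w: "w = tens R X L x l" "x \<in> carrier X" "l \<in> carrier L"
      "D x = \<zero>\<^bsub>Y\<^esub> \<or> \<phi> l = \<zero>\<^bsub>M\<^esub>" by blast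
    then have "D (\<ominus>\<^bsub>X\<^esub> x) = \<zero>\<^bsub>Y\<^esub> \<or> \<phi> l = \<zero>\<^bsub>M\<^esub>"
      using add_hom_neg[OF Dh X.M.abelian_group_axioms Y.M.abelian_group_axioms]
      by (auto simp: Y.M.neg_zero)
    then show "\<ominus>\<^bsub>?T\<^esub> w \<in> ?G"
      using w tens_neg_left[OF X L w(3,2)] by (auto intro!: exI[of _ "\<ominus>\<^bsub>X\<^esub> x"] exI[of _ l])
  qed
  define Q where "Q = quotient_group ?T W"
  define \<pi> where "\<pi> = r_coset (add_monoid ?T) W"
  note Q = quotient_group[OF T.abelian_group_axioms W, folded Q_def \<pi>_def]
  interpret Q: abelian_group Q by (rule Q(1))
  have key: "\<pi> (tens R X L x l) = \<pi> (tens R X L y k)"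
    if "x \<in> carrier X" "y \<in> carrier X" "l \<in> carrier L" "k \<in> carrier L" "D x = D y" "\<phi> l = \<phi> k" for x y l k
  proof -
    have 1: "D (x \<ominus>\<^bsub>X\<^esub> y) = \<zero>\<^bsub>Y\<^esub>" "\<phi> (l \<ominus>\<^bsub>L\<^esub> k) = \<zero>\<^bsub>M\<^esub>"
      using that add_hom_diff[OF Dh X.M.abelian_group_axioms Y.M.abelian_group_axioms]
        add_hom_diff[OF \<phi>h L.M.abelian_group_axioms M.M.abelian_group_axioms]
        add_hom_closed[OF Dh] add_hom_closed[OF \<phi>h]
      by (simp_all add: Y.M.diff_zero_iff M.M.diff_zero_iff)
    have 2: "y \<oplus>\<^bsub>X\<^esub> (x \<ominus>\<^bsub>X\<^esub> y) = x" "k \<oplus>\<^bsub>L\<^esub> (l \<ominus>\<^bsub>L\<^esub> k) = l"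
      using that X.M.diff_eq_iff[of x y "x \<ominus>\<^bsub>X\<^esub> y"] L.M.diff_eq_iff[of l k "l \<ominus>\<^bsub>L\<^esub> k"] by auto
    have a: "tens R X L (x \<ominus>\<^bsub>X\<^esub> y) l \<in> W" "tens R X L y (l \<ominus>\<^bsub>L\<^esub> k) \<in> W"
      unfolding W_def using 1 that by (auto intro!: add_span.base)
    have c: "tens R X L y k \<in> carrier ?T" "tens R X L (x \<ominus>\<^bsub>X\<^esub> y) l \<in> carrier ?T"
      "tens R X L y (l \<ominus>\<^bsub>L\<^esub> k) \<in> carrier ?T"
      using that by (auto simp: tens_closed[OF X L])
    have "tens R X L x l = tens R X L y l \<oplus>\<^bsub>?T\<^esub> tens R X L (x \<ominus>\<^bsub>X\<^esub> y) l"
      using that tens_add_left[OF X L, of y "x \<ominus>\<^bsub>X\<^esub> y" l] 2 by simp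
    also have "tens R X L y l = tens R X L y k \<oplus>\<^bsub>?T\<^esub> tens R X L y (l \<ominus>\<^bsub>L\<^esub> k)"
      using that tens_add_right[OF X L, of y k "l \<ominus>\<^bsub>L\<^esub> k"] 2 by simp
    finally have "\<pi> (tens R X L x l)
        = \<pi> (tens R X L y k) \<oplus>\<^bsub>Q\<^esub> \<pi> (tens R X L y (l \<ominus>\<^bsub>L\<^esub> k)) \<oplus>\<^bsub>Q\<^esub> \<pi> (tens R X L (x \<ominus>\<^bsub>X\<^esub> y) l)"
      using c by (simp add: add_hom_add[OF Q(2)])
    then show ?thesis
      using Q(4)[OF c(2)] Q(4)[OF c(3)] a add_hom_closed[OF Q(2) c(1)] by simp
  qed
  let ?s = "inv_into (carrier X) D" and ?\<sigma> = "inv_into (carrier L) \<phi>"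
  let ?b = "\<lambda>y m. \<pi> (tens R X L (?s y) (?\<sigma> m))"
  have s: "?s y \<in> carrier X" "D (?s y) = y" if "y \<in> carrier Y" for y
    using that D(2) by (auto intro: inv_into_into f_inv_into_f)
  have \<sigma>: "?\<sigma> m \<in> carrier L" "\<phi> (?\<sigma> m) = m" if "m \<in> carrier M" for m
    using that \<phi>(2) by (auto intro: inv_into_into f_inv_into_f)
  have b: "?b (D x) (\<phi> l) = \<pi> (tens R X L x l)" if "x \<in> carrier X" "l \<in> carrier L" for x l
    using that s[of "D x"] \<sigma>[of "\<phi> l"] add_hom_closed[OF Dh] add_hom_closed[OF \<phi>h] by (intro key) auto
  have bal: "balanced R Y M Q ?b"
  proof (rule balancedI)
    fix y m assume y: "y \<in> carrier Y" and m: "m \<in> carrier M"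
    show "?b y m \<in> carrier Q"
      using s(1)[OF y] \<sigma>(1)[OF m] by (simp add: Q(3) tens_closed[OF X L])
    { fix y' assume y': "y' \<in> carrier Y"
      have "?b (y \<oplus>\<^bsub>Y\<^esub> y') m = ?b (D (?s y \<oplus>\<^bsub>X\<^esub> ?s y')) (\<phi> (?\<sigma> m))"
        using s[OF y] s[OF y'] \<sigma>[OF m] by (simp add: add_hom_add[OF Dh])
      also have "\<dots> = ?b y m \<oplus>\<^bsub>Q\<^esub> ?b y' m"
        using s[OF y] s[OF y'] \<sigma>[OF m]
        by (subst b) (simp_all add: tens_add_left[OF X L] tens_closed[OF X L] add_hom_add[OF Q(2)])
      finally show "?b (y \<oplus>\<^bsub>Y\<^esub> y') m = ?b y m \<oplus>\<^bsub>Q\<^esub> ?b y' m" . }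
    { fix m' assume m': "m' \<in> carrier M"
      have "?b y (m \<oplus>\<^bsub>M\<^esub> m') = ?b (D (?s y)) (\<phi> (?\<sigma> m \<oplus>\<^bsub>L\<^esub> ?\<sigma> m'))"
        using s[OF y] \<sigma>[OF m'] \<sigma>[OF m] by (simp add: add_hom_add[OF \<phi>h])
      also have "\<dots> = ?b y m \<oplus>\<^bsub>Q\<^esub> ?b y m'"
        using s[OF y] \<sigma>[OF m'] \<sigma>[OF m]
        by (subst b) (simp_all add: tens_add_right[OF X L] tens_closed[OF X L] add_hom_add[OF Q(2)])
      finally show "?b y (m \<oplus>\<^bsub>M\<^esub> m') = ?b y m \<oplus>\<^bsub>Q\<^esub> ?b y m'" . }
    { fix r assume r: "r \<in> carrier R"
      have "?b (y \<triangleleft>\<^bsub>Y\<^esub> r) m = ?b (D (?s y \<triangleleft>\<^bsub>X\<^esub> r)) (\<phi> (?\<sigma> m))"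
        using s[OF y] \<sigma>[OF m] D(1) r by (simp add: right_linear_iff)
      also have "\<dots> = \<pi> (tens R X L (?s y \<triangleleft>\<^bsub>X\<^esub> r) (?\<sigma> m))"
        using s(1)[OF y] \<sigma>(1)[OF m] r by (intro b X.rsmult_closed)
      also have "\<dots> = \<pi> (tens R X L (?s y) (r \<odot>\<^bsub>L\<^esub> ?\<sigma> m))"
        using s(1)[OF y] \<sigma>(1)[OF m] r by (simp add: tens_balanced[OF X L])
      also have "\<dots> = ?b (D (?s y)) (\<phi> (r \<odot>\<^bsub>L\<^esub> ?\<sigma> m))"
        using s(1)[OF y] \<sigma>(1)[OF m] r by (intro b[symmetric] L.lsmult_closed)
      also have "\<dots> = ?b y (r \<odot>\<^bsub>M\<^esub> m)"
        using s[OF y] \<sigma>[OF m] \<phi>(1) r by (simp add: left_linear_iff)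
      finally show "?b (y \<triangleleft>\<^bsub>Y\<^esub> r) m = ?b y (r \<odot>\<^bsub>M\<^esub> m)" . }
  qed
  note D\<phi> = tensor_map_add_hom[OF X L Y M D(1) \<phi>(1)]
  note lift = tensor_lift_add_hom[OF Y M Q(1) bal]
  have "tensor_lift Q ?b (tensor_map R Y M D \<phi> t) = \<pi> t"
  proof (rule tensor_ext[OF X L add_hom_compose[OF D\<phi> lift] Q(2) _ t])
    fix x l assume "x \<in> carrier X" "l \<in> carrier L"
    then show "tensor_lift Q ?b (tensor_map R Y M D \<phi> (tens R X L x l)) = \<pi> (tens R X L x l)"
      using b add_hom_closed[OF Dh] add_hom_closed[OF \<phi>h]
      by (simp add: tensor_map_tens[OF X L Y M D(1) \<phi>(1)] tensor_lift_tens[OF Y M Q(1) bal])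
  qed
  then have "\<pi> t = \<zero>\<^bsub>Q\<^esub>"
    using zero add_hom_zero[OF lift tensor_abelian_group[OF Y M] Q(1)] by simp
  then show ?thesis using Q(4)[OF t] by (simp add: W_def)
qed


section \<open>Submodules and transport of structure\<close>

definition right_submodule ::
  "('r, 'x) ring_scheme \<Rightarrow> ('r, 'm, 'y) rmodule_scheme \<Rightarrow> 'm set \<Rightarrow> bool" where
  "right_submodule R X U \<longleftrightarrow> U \<subseteq> carrier X \<and> \<zero>\<^bsub>X\<^esub> \<in> U \<and>
     (\<forall>x\<in>U. \<forall>y\<in>U. x \<oplus>\<^bsub>X\<^esub> y \<in> U) \<and> (\<forall>x\<in>U. \<forall>r\<in>carrier R. x \<triangleleft>\<^bsub>X\<^esub> r \<in> U)"

lemma right_submodule_right_module: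
  assumes X: "right_module R X" and U: "right_submodule R X U"
  shows "right_module R (X\<lparr>carrier := U\<rparr>)"
proof -
  interpret X: right_module R X by fact
  have UX: "\<And>x. x \<in> U \<Longrightarrow> x \<in> carrier X" using U by (auto simp: right_submodule_def)
  show ?thesis
  proof (rule right_moduleI)
    show "ring R" by unfold_locales
    show "abelian_group (X\<lparr>carrier := U\<rparr>)"
    proof (rule abelian_groupI)
      fix x assume "x \<in> carrier (X\<lparr>carrier := U\<rparr>)"
      then have x: "x \<in> U" by simp
      then have "x \<triangleleft>\<^bsub>X\<^esub> (\<ominus>\<^bsub>R\<^esub> \<one>\<^bsub>R\<^esub>) \<in> U" using U by (auto simp: right_submodule_def)
      then have "\<ominus>\<^bsub>X\<^esub> x \<in> U" using right_module_neg_smult[OF X UX[OF x]] by simp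
      then show "\<exists>y\<in>carrier (X\<lparr>carrier := U\<rparr>). y \<oplus>\<^bsub>X\<lparr>carrier := U\<rparr>\<^esub> x = \<zero>\<^bsub>X\<lparr>carrier := U\<rparr>\<^esub>"
        using X.l_neg[OF UX[OF x]] by auto
    qed (use U UX in \<open>auto simp: right_submodule_def X.a_ac\<close>)
  qed (use U UX in \<open>auto simp: right_submodule_def X.rsmult_r_distr X.rsmult_l_distr
      X.rsmult_assoc X.rsmult_one\<close>)
qed

lemma right_submodule_inclusion:
  "right_submodule R X U \<Longrightarrow> right_linear R (X\<lparr>carrier := U\<rparr>) X (\<lambda>x. x)"
  by (auto simp: right_submodule_def right_linear_iff add_hom_def)

text \<open>
  The structure that makes \<open>i\<close> linear, computed on chosen preimages. For injective \<open>i\<close> this is a copy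
  of \<open>X\<close>; for the projection onto cosets of a submodule it is the quotient module.
\<close>

definition right_transport ::
  "('m \<Rightarrow> 'u) \<Rightarrow> ('r, 'm, 'y) rmodule_scheme \<Rightarrow> ('r, 'u) rmodule" where
  "right_transport i X = \<lparr>carrier = i ` carrier X, monoid.mult = undefined, monoid.one = undefined,
     ring.zero = i \<zero>\<^bsub>X\<^esub>,
     ring.add = (\<lambda>a b. i (inv_into (carrier X) i a \<oplus>\<^bsub>X\<^esub> inv_into (carrier X) i b)),
     rsmult = (\<lambda>a r. i (inv_into (carrier X) i a \<triangleleft>\<^bsub>X\<^esub> r))\<rparr>"

lemma right_transport_congruence:
  assumes X: "right_module R X"
    and add: "\<And>x x' y y'. x \<in> carrier X \<Longrightarrow> x' \<in> carrier X \<Longrightarrow> y \<in> carrier X \<Longrightarrow> y' \<in> carrier X \<Longrightarrow>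
      i x = i x' \<Longrightarrow> i y = i y' \<Longrightarrow> i (x \<oplus>\<^bsub>X\<^esub> y) = i (x' \<oplus>\<^bsub>X\<^esub> y')"
    and smult: "\<And>x x' r. x \<in> carrier X \<Longrightarrow> x' \<in> carrier X \<Longrightarrow> r \<in> carrier R \<Longrightarrow>
      i x = i x' \<Longrightarrow> i (x \<triangleleft>\<^bsub>X\<^esub> r) = i (x' \<triangleleft>\<^bsub>X\<^esub> r)"
  shows "right_module R (right_transport i X)" and "right_linear R X (right_transport i X) i"
    and "i ` carrier X = carrier (right_transport i X)"
proof -
  interpret X: right_module R X by fact
  let ?Q = "right_transport i X"
  have inv: "inv_into (carrier X) i (i x) \<in> carrier X" "i (inv_into (carrier X) i (i x)) = i x"
    if "x \<in> carrier X" for x using that by (auto intro: inv_into_into f_inv_into_f)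
  have a: "i x \<oplus>\<^bsub>?Q\<^esub> i y = i (x \<oplus>\<^bsub>X\<^esub> y)" if "x \<in> carrier X" "y \<in> carrier X" for x y
    unfolding right_transport_def using add[OF inv(1) _ inv(1) _ inv(2) inv(2)] that by simp
  have s: "i x \<triangleleft>\<^bsub>?Q\<^esub> r = i (x \<triangleleft>\<^bsub>X\<^esub> r)" if "x \<in> carrier X" "r \<in> carrier R" for x r
    unfolding right_transport_def using smult[OF inv(1) _ _ inv(2)] that by simp
  show c: "i ` carrier X = carrier ?Q" by (simp add: right_transport_def)
  have z: "\<zero>\<^bsub>?Q\<^esub> = i \<zero>\<^bsub>X\<^esub>" by (simp add: right_transport_def)
  show "right_linear R X ?Q i"
    using c a s by (auto simp: right_linear_iff add_hom_def)
  show "right_module R ?Q"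
  proof (rule right_moduleI[OF X.R.ring_axioms])
    show "abelian_group ?Q"
    proof (rule abelian_groupI; unfold c[symmetric])
      fix x assume "x \<in> i ` carrier X"
      then obtain y where "y \<in> carrier X" "x = i y" by blast
      then show "\<exists>y\<in>i ` carrier X. y \<oplus>\<^bsub>?Q\<^esub> x = \<zero>\<^bsub>?Q\<^esub>"
        using a[of "\<ominus>\<^bsub>X\<^esub> y" y] by (auto simp: z X.l_neg)
    qed (auto simp: a z X.a_ac)
  qed (unfold c[symmetric], auto simp: a s X.rsmult_closed X.rsmult_r_distr X.rsmult_l_distr
      X.rsmult_assoc X.rsmult_one)
qed

lemma right_transport:
  assumes X: "right_module R X" and i: "inj_on i (carrier X)"
  shows "right_module R (right_transport i X)"
    and "right_linear R X (right_transport i X) i"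
    and "right_linear R (right_transport i X) X (inv_into (carrier X) i)"
    and "inj_on (inv_into (carrier X) i) (carrier (right_transport i X))"
proof -
  interpret X: right_module R X by fact
  note eq = inj_onD[OF i]
  show "right_module R (right_transport i X)"
    by (rule right_transport_congruence(1)[OF X]) (blast dest: eq)+
  show "right_linear R X (right_transport i X) i"
    by (rule right_transport_congruence(2)[OF X]) (blast dest: eq)+
  show "right_linear R (right_transport i X) X (inv_into (carrier X) i)"
    and "inj_on (inv_into (carrier X) i) (carrier (right_transport i X))"
    using i by (auto simp: right_linear_iff add_hom_def right_transport_def X.rsmult_closed
        intro: inj_on_inv_into)
qed

definition left_transport ::
  "('m \<Rightarrow> 'u) \<Rightarrow> ('r, 'm, 'y) module_scheme \<Rightarrow> ('r, 'u) module" where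
  "left_transport i X = \<lparr>carrier = i ` carrier X, monoid.mult = undefined, monoid.one = undefined,
     ring.zero = i \<zero>\<^bsub>X\<^esub>,
     ring.add = (\<lambda>a b. i (inv_into (carrier X) i a \<oplus>\<^bsub>X\<^esub> inv_into (carrier X) i b)),
     smult = (\<lambda>r a. i (r \<odot>\<^bsub>X\<^esub> inv_into (carrier X) i a))\<rparr>"

lemma left_transport:
  assumes X: "left_module R X" and i: "inj_on i (carrier X)"
  shows "left_module R (left_transport i X)"
    and "left_linear R X (left_transport i X) i"
    and "left_linear R (left_transport i X) X (inv_into (carrier X) i)"
proof -
  interpret X: left_module R X by fact
  show "left_module R (left_transport i X)"
  proof (rule left_moduleI)
    show "ring R" by unfold_locales
    show "abelian_group (left_transport i X)"
    proof (rule abelian_groupI)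
      fix x assume "x \<in> carrier (left_transport i X)"
      then obtain y where y: "y \<in> carrier X" "x = i y" by (auto simp: left_transport_def)
      then have "i (\<ominus>\<^bsub>X\<^esub> y) \<oplus>\<^bsub>left_transport i X\<^esub> x = \<zero>\<^bsub>left_transport i X\<^esub>"
        using i by (simp add: left_transport_def X.l_neg)
      then show "\<exists>y\<in>carrier (left_transport i X).
          y \<oplus>\<^bsub>left_transport i X\<^esub> x = \<zero>\<^bsub>left_transport i X\<^esub>"
        using y by (auto simp: left_transport_def)
    qed (use i in \<open>auto simp: left_transport_def X.a_ac\<close>)
  qed (use i in \<open>auto simp: left_transport_def X.lsmult_r_distr X.lsmult_l_distr
      X.lsmult_assoc X.lsmult_one X.lsmult_closed\<close>)
  show "left_linear R X (left_transport i X) i"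
    and "left_linear R (left_transport i X) X (inv_into (carrier X) i)"
    using i by (auto simp: left_linear_iff add_hom_def left_transport_def X.lsmult_closed)
qed


section \<open>Small submodules of large modules\<close>

lemma lists_lepoll_infinite:
  assumes "infinite U" "V \<lesssim> U" shows "lists V \<lesssim> U"
proof -
  have "lists U \<approx> U"
    using card_of_lists_infinite[OF assms(1)] by (simp add: eqpoll_iff_card_of_ordIso)
  then show ?thesis using lists_lepoll_mono[OF assms(2)] eqpoll_imp_lepoll lepoll_trans by blast
qed

lemma times_lepoll_infinite:
  assumes "infinite U" "V \<lesssim> U" "W \<lesssim> U" shows "V \<times> W \<lesssim> U"
proof -
  have "U \<times> U \<approx> U"
    using card_of_Times_same_infinite[OF assms(1)] by (simp add: eqpoll_iff_card_of_ordIso)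
  then show ?thesis using times_lepoll_mono[OF assms(2,3)] eqpoll_imp_lepoll lepoll_trans by blast
qed

lemma Un_lepoll_infinite:
  assumes "infinite U" "V \<lesssim> U" "W \<lesssim> U" shows "V \<union> W \<lesssim> U"
  using assms(2,3) unfolding lepoll_def card_of_ordLeq
  by (rule card_of_Un_ordLeq_infinite[OF assms(1)])

text \<open>
  Lists of generators and coefficients bound the cardinality of the span.
\<close>

definition right_span ::
  "('r, 'x) ring_scheme \<Rightarrow> ('r, 'm, 'y) rmodule_scheme \<Rightarrow> 'm set \<Rightarrow> 'm set" where
  "right_span R X G =
     (\<lambda>ws. foldr (\<lambda>(g, r) s. g \<triangleleft>\<^bsub>X\<^esub> r \<oplus>\<^bsub>X\<^esub> s) ws \<zero>\<^bsub>X\<^esub>) ` lists (G \<times> carrier R)"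

lemma right_span:
  assumes X: "right_module R X" and G: "G \<subseteq> carrier X"
  shows "right_submodule R X (right_span R X G)" and "G \<subseteq> right_span R X G"
proof -
  interpret X: right_module R X by fact
  let ?s = "\<lambda>ws. foldr (\<lambda>(g, r) s. g \<triangleleft>\<^bsub>X\<^esub> r \<oplus>\<^bsub>X\<^esub> s) ws \<zero>\<^bsub>X\<^esub>"
  have GX: "\<And>g. g \<in> G \<Longrightarrow> g \<in> carrier X" using G by auto
  have cl: "?s ws \<in> carrier X" if "ws \<in> lists (G \<times> carrier R)" for ws
    using that by (induction ws) (auto simp del: in_lists_conv_set simp: X.rsmult_closed GX)
  have add: "?s (vs @ ws) = ?s vs \<oplus>\<^bsub>X\<^esub> ?s ws"
    if "vs \<in> lists (G \<times> carrier R)" "ws \<in> lists (G \<times> carrier R)" for vs ws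
    using that(1)
  proof (induction vs)
    case Nil
    then show ?case using cl[OF that(2)] by simp
  next
    case (Cons v vs)
    obtain g r where "v = (g, r)" "g \<in> G" "r \<in> carrier R" using Cons.hyps(1) by auto
    then show ?case
      using Cons.IH cl[OF Cons.hyps(2)] cl[OF that(2)] by (simp add: X.a_assoc X.rsmult_closed GX)
  qed
  have smult: "?s (map (\<lambda>(g, q). (g, q \<otimes>\<^bsub>R\<^esub> r)) ws) = ?s ws \<triangleleft>\<^bsub>X\<^esub> r"
    if "ws \<in> lists (G \<times> carrier R)" "r \<in> carrier R" for ws r
    using that(1)
  proof (induction ws)
    case Nil
    then show ?case by (simp add: right_module_zero_smult[OF X that(2)])
  next
    case (Cons v ws)
    obtain g q where "v = (g, q)" "g \<in> G" "q \<in> carrier R" using Cons.hyps(1) by auto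
    then show ?case
      using Cons.IH cl[OF Cons.hyps(2)] that(2)
      by (simp add: GX X.rsmult_closed X.rsmult_assoc X.rsmult_l_distr)
  qed
  have mapcl: "map (\<lambda>(g, q). (g, q \<otimes>\<^bsub>R\<^esub> r)) ws \<in> lists (G \<times> carrier R)"
    if "ws \<in> lists (G \<times> carrier R)" "r \<in> carrier R" for ws r
    using that(1) by (induction ws) (auto simp del: in_lists_conv_set simp: that(2))
  show "right_submodule R X (right_span R X G)"
    unfolding right_submodule_def
  proof (intro conjI ballI)
    show "right_span R X G \<subseteq> carrier X" unfolding right_span_def using cl by blast
    show "\<zero>\<^bsub>X\<^esub> \<in> right_span R X G"
      unfolding right_span_def by (rule image_eqI[of _ _ "[]"]) auto
  next
    fix x y assume "x \<in> right_span R X G" "y \<in> right_span R X G"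
    then obtain vs ws where w: "vs \<in> lists (G \<times> carrier R)" "ws \<in> lists (G \<times> carrier R)"
      "x = ?s vs" "y = ?s ws" unfolding right_span_def by blast
    show "x \<oplus>\<^bsub>X\<^esub> y \<in> right_span R X G"
      unfolding right_span_def w(3,4) add[OF w(1,2), symmetric] by (rule imageI) (use w(1,2) in auto)
  next
    fix x r assume "x \<in> right_span R X G" and r: "r \<in> carrier R"
    then obtain ws where w: "ws \<in> lists (G \<times> carrier R)" "x = ?s ws"
      unfolding right_span_def by blast
    show "x \<triangleleft>\<^bsub>X\<^esub> r \<in> right_span R X G"
      unfolding right_span_def w(2) smult[OF w(1) r, symmetric]
      by (rule imageI) (rule mapcl[OF w(1) r])
  qed
  show "G \<subseteq> right_span R X G"
  proof
    fix g assume "g \<in> G"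
    then show "g \<in> right_span R X G"
      unfolding right_span_def
      by (intro image_eqI[of _ _ "[(g, \<one>\<^bsub>R\<^esub>)]"]) (auto simp: X.rsmult_one GX)
  qed
qed

lemma right_span_lepoll:
  assumes "infinite U" "carrier R \<lesssim> U" "G \<lesssim> U"
  shows "right_span R X G \<lesssim> U"
  unfolding right_span_def
  using lists_lepoll_infinite[OF assms(1) times_lepoll_infinite[OF assms(1,3,2)]]
  by (rule lepoll_trans[OF image_lepoll])

lemma small_submodule:
  assumes X: "right_module R X" and U: "infinite (UNIV :: 'u set)"
    and R: "carrier R \<lesssim> (UNIV :: 'u set)"
    and G: "G \<subseteq> carrier X" "G \<lesssim> (UNIV :: 'u set)"
  obtains X1 :: "('r, 'u) rmodule" and e where "right_module R X1" "right_linear R X1 X e"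
    "inj_on e (carrier X1)" "G \<subseteq> e ` carrier X1"
proof -
  let ?X = "X\<lparr>carrier := right_span R X G\<rparr>"
  note sub = right_submodule_right_module[OF X right_span(1)[OF X G(1)]]
  obtain i :: "_ \<Rightarrow> 'u" where i: "inj_on i (carrier ?X)"
    using right_span_lepoll[OF U R G(2), of X] by (auto simp: lepoll_def)
  note tr = right_transport[OF sub i]
  have "right_linear R ?X X (\<lambda>x. x)"
    using right_span(1)[OF X G(1)] by (auto simp: right_linear_iff add_hom_def right_submodule_def)
  then have "right_linear R (right_transport i ?X) X (inv_into (carrier ?X) i)"
    using right_linear_compose[OF tr(3)] by blast
  moreover have "inv_into (carrier ?X) i ` carrier (right_transport i ?X) = carrier ?X"
    using i by (simp add: right_transport_def image_image)
  ultimately show ?thesis using that[OF tr(1) _ tr(4)] right_span(2)[OF X G(1)] by simp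
qed

text \<open>
  The set \<open>F\<close> consists of the left factors of a representation by pure tensors. Linear maps \<open>e\<close> take
  the place of inclusions, so that the result applies to copies of submodules in another type.
\<close>

lemma tensor_lift_to_submodule:
  assumes X: "right_module R X" and M: "left_module R M" and z: "z \<in> carrier (tensor R X M)"
  shows "\<exists>F. finite F \<and> F \<subseteq> carrier X \<and>
    (\<forall>(X1 :: ('r, 'v, 'w) rmodule_scheme) e. right_module R X1 \<longrightarrow> right_linear R X1 X e \<longrightarrow>
       F \<subseteq> e ` carrier X1 \<longrightarrow> (\<exists>z1\<in>carrier (tensor R X1 M). tensor_map R X M e (\<lambda>m. m) z1 = z))"
  using X M z
proof (induction rule: tensor_induct)
  case (tens x m)
  show ?case
  proof (intro exI[of _ "{x}"] conjI allI impI)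
    fix X1 :: "('r, 'v, 'w) rmodule_scheme" and e
    assume X1: "right_module R X1" and e: "right_linear R X1 X e" and "{x} \<subseteq> e ` carrier X1"
    then obtain x1 where "x1 \<in> carrier X1" "e x1 = x" by blast
    then show "\<exists>z1\<in>carrier (tensor R X1 M). tensor_map R X M e (\<lambda>m. m) z1 = tens R X M x m"
      using tens tensor_map_tens[OF X1 M X M e left_linear_id] tens_closed[OF X1 M]
      by (intro bexI[of _ "tens R X1 M x1 m"]) auto
  qed (use tens in auto)
next
  case (add z1 z2)
  obtain F1 where F1: "finite F1" "F1 \<subseteq> carrier X"
    "\<And>(X1 :: ('r, 'v, 'w) rmodule_scheme) e. right_module R X1 \<Longrightarrow> right_linear R X1 X e \<Longrightarrow>
       F1 \<subseteq> e ` carrier X1 \<Longrightarrow> \<exists>z\<in>carrier (tensor R X1 M). tensor_map R X M e (\<lambda>m. m) z = z1"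
    using add.IH(1) by blast
  obtain F2 where F2: "finite F2" "F2 \<subseteq> carrier X"
    "\<And>(X1 :: ('r, 'v, 'w) rmodule_scheme) e. right_module R X1 \<Longrightarrow> right_linear R X1 X e \<Longrightarrow>
       F2 \<subseteq> e ` carrier X1 \<Longrightarrow> \<exists>z\<in>carrier (tensor R X1 M). tensor_map R X M e (\<lambda>m. m) z = z2"
    using add.IH(2) by blast
  show ?case
  proof (intro exI[of _ "F1 \<union> F2"] conjI allI impI)
    fix X1 :: "('r, 'v, 'w) rmodule_scheme" and e
    assume X1: "right_module R X1" and e: "right_linear R X1 X e" and F: "F1 \<union> F2 \<subseteq> e ` carrier X1"
    obtain y1 where y1: "y1 \<in> carrier (tensor R X1 M)" "tensor_map R X M e (\<lambda>m. m) y1 = z1"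
      using F1(3)[OF X1 e] F by auto
    obtain y2 where y2: "y2 \<in> carrier (tensor R X1 M)" "tensor_map R X M e (\<lambda>m. m) y2 = z2"
      using F2(3)[OF X1 e] F by auto
    show "\<exists>z\<in>carrier (tensor R X1 M). tensor_map R X M e (\<lambda>m. m) z = z1 \<oplus>\<^bsub>tensor R X M\<^esub> z2"
    proof (rule bexI)
      show "y1 \<oplus>\<^bsub>tensor R X1 M\<^esub> y2 \<in> carrier (tensor R X1 M)"
        by (rule abelian_groupE(1)[OF tensor_abelian_group[OF X1 M] y1(1) y2(1)])
      show "tensor_map R X M e (\<lambda>m. m) (y1 \<oplus>\<^bsub>tensor R X1 M\<^esub> y2) = z1 \<oplus>\<^bsub>tensor R X M\<^esub> z2"
        using add_hom_add[OF tensor_map_add_hom[OF X1 M X M e left_linear_id] y1(1) y2(1)]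
        unfolding y1(2) y2(2) .
    qed
  qed (use F1 F2 in auto)
qed

lemma tensor_small_submodule:
  assumes X: "right_module R X" and M: "left_module R M" and U: "infinite (UNIV :: 'u set)"
    and R: "carrier R \<lesssim> (UNIV :: 'u set)" and z: "z \<in> carrier (tensor R X M)"
  obtains X1 :: "('r, 'u) rmodule" and e z1 where "right_module R X1" "right_linear R X1 X e"
    "inj_on e (carrier X1)" "z1 \<in> carrier (tensor R X1 M)" "tensor_map R X M e (\<lambda>m. m) z1 = z"
proof -
  obtain F where F: "finite F" "F \<subseteq> carrier X"
    "\<And>(X1 :: ('r, 'u) rmodule) e. right_module R X1 \<Longrightarrow> right_linear R X1 X e \<Longrightarrow>
       F \<subseteq> e ` carrier X1 \<Longrightarrow> \<exists>z1\<in>carrier (tensor R X1 M). tensor_map R X M e (\<lambda>m. m) z1 = z"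
    using tensor_lift_to_submodule[OF X M z, where 'v = 'u and 'w = unit] by blast
  obtain X1 :: "('r, 'u) rmodule" and e where X1: "right_module R X1" "right_linear R X1 X e"
    "inj_on e (carrier X1)" "F \<subseteq> e ` carrier X1"
    using small_submodule[OF X U R F(2) finite_lepoll_infinite[OF U F(1)]] by metis
  then show ?thesis using F(3)[OF X1(1,2,4)] that by blast
qed

text \<open>
  A relation is a finite combination of generating relations, each of which mentions at most two
  elements of \<open>X\<close> that have to be kept.
\<close>

lemma tensor_relations_submodule:
  assumes X: "right_module R X" and M: "left_module R M" and w: "w \<in> tensor_relations R X M"
  shows "\<exists>F. finite F \<and> F \<subseteq> carrier X \<and>
    (\<forall>U. right_submodule R X U \<longrightarrow> F \<subseteq> U \<longrightarrow> w \<in> tensor_relations R (X\<lparr>carrier := U\<rparr>) M)"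
proof -
  have gens: "\<exists>F. finite F \<and> F \<subseteq> carrier X \<and>
      (\<forall>U. F \<subseteq> U \<longrightarrow> h \<in> tensor_gens R (X\<lparr>carrier := U\<rparr>) M)" if "h \<in> tensor_gens R X M" for h
    using that[unfolded tensor_gens_def]
  proof (elim UnE CollectE exE conjE)
    fix m m' n assume h: "h = frag_of (m \<oplus>\<^bsub>X\<^esub> m', n) - frag_of (m, n) - frag_of (m', n)"
      "m \<in> carrier X" "m' \<in> carrier X" "n \<in> carrier M"
    show ?thesis
    proof (intro exI[of _ "{m, m'}"] conjI allI impI)
      fix U assume "{m, m'} \<subseteq> U"
      with h show "h \<in> tensor_gens R (X\<lparr>carrier := U\<rparr>) M"
        unfolding tensor_gens_def by (intro UnI1) auto
    qed (use h in auto)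
  next
    fix m n n' assume h: "h = frag_of (m, n \<oplus>\<^bsub>M\<^esub> n') - frag_of (m, n) - frag_of (m, n')"
      "m \<in> carrier X" "n \<in> carrier M" "n' \<in> carrier M"
    show ?thesis
    proof (intro exI[of _ "{m}"] conjI allI impI)
      fix U assume "{m} \<subseteq> U"
      with h show "h \<in> tensor_gens R (X\<lparr>carrier := U\<rparr>) M"
        unfolding tensor_gens_def by (intro UnI1[OF UnI2]) auto
    qed (use h in auto)
  next
    fix m r n assume h: "h = frag_of (m \<triangleleft>\<^bsub>X\<^esub> r, n) - frag_of (m, r \<odot>\<^bsub>M\<^esub> n)"
      "m \<in> carrier X" "r \<in> carrier R" "n \<in> carrier M"
    show ?thesis
    proof (intro exI[of _ "{m}"] conjI allI impI)
      fix U assume "{m} \<subseteq> U"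
      with h show "h \<in> tensor_gens R (X\<lparr>carrier := U\<rparr>) M"
        unfolding tensor_gens_def by (intro UnI2) auto
    qed (use h in auto)
  qed
  from w show ?thesis
    unfolding tensor_relations_gens[of R X M]
  proof (induction w rule: generate.induct)
    case one
    have "\<one>\<^bsub>tensor_free X M\<^esub> \<in> tensor_relations R (X\<lparr>carrier := U\<rparr>) M" if "right_submodule R X U" for U
      using subgroup.one_closed[OF subgroup_tensor_relations[OF right_submodule_right_module[OF X that] M]]
      by simp
    then show ?case by (intro exI[of _ "{}"]) auto
  next
    case (incl h)
    obtain F where "finite F" "F \<subseteq> carrier X"
      "\<And>U. F \<subseteq> U \<Longrightarrow> h \<in> tensor_gens R (X\<lparr>carrier := U\<rparr>) M"
      using gens[OF incl] by blast
    then show ?case unfolding tensor_relations_gens by (blast intro: generate.incl)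
  next
    case (inv h)
    obtain F where F: "finite F" "F \<subseteq> carrier X"
      "\<And>U. F \<subseteq> U \<Longrightarrow> h \<in> tensor_gens R (X\<lparr>carrier := U\<rparr>) M"
      using gens[OF inv] by blast
    have "inv\<^bsub>tensor_free X M\<^esub> h \<in> tensor_relations R (X\<lparr>carrier := U\<rparr>) M"
      if U: "right_submodule R X U" "F \<subseteq> U" for U
    proof -
      have "h \<in> carrier (tensor_free X M)" using tensor_gens_free[OF X M] inv by blast
      moreover have "h \<in> carrier (tensor_free (X\<lparr>carrier := U\<rparr>) M)"
        using tensor_gens_free[OF right_submodule_right_module[OF X U(1)] M] F(3)[OF U(2)] by blast
      ultimately have "inv\<^bsub>tensor_free X M\<^esub> h = inv\<^bsub>tensor_free (X\<lparr>carrier := U\<rparr>) M\<^esub> h" by simp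
      then show ?thesis
        using generate.inv[OF F(3)[OF U(2)]] unfolding tensor_relations_gens by simp
    qed
    then show ?case using F(1,2) by blast
  next
    case (eng h1 h2)
    obtain F1 where F1: "finite F1" "F1 \<subseteq> carrier X"
      "\<And>U. right_submodule R X U \<Longrightarrow> F1 \<subseteq> U \<Longrightarrow> h1 \<in> tensor_relations R (X\<lparr>carrier := U\<rparr>) M"
      using eng.IH(1) by blast
    obtain F2 where F2: "finite F2" "F2 \<subseteq> carrier X"
      "\<And>U. right_submodule R X U \<Longrightarrow> F2 \<subseteq> U \<Longrightarrow> h2 \<in> tensor_relations R (X\<lparr>carrier := U\<rparr>) M"
      using eng.IH(2) by blast
    have "h1 \<otimes>\<^bsub>tensor_free X M\<^esub> h2 \<in> tensor_relations R (X\<lparr>carrier := U\<rparr>) M"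
      if U: "right_submodule R X U" "F1 \<union> F2 \<subseteq> U" for U
      using subgroup.m_closed[OF subgroup_tensor_relations[OF right_submodule_right_module[OF X U(1)] M]
          F1(3)[OF U(1)] F2(3)[OF U(1)]] U(2) by simp
    then show ?case using F1(1,2) F2(1,2) by (intro exI[of _ "F1 \<union> F2"]) auto
  qed
qed

text \<open>
  One representative \<open>w\<close> serves all submodules that contain the image of \<open>f\<close>; this is what allows
  the vanishing of \<open>f \<otimes> M\<close> at \<open>z\<close> to be moved from \<open>X\<close> to a submodule.
\<close>

lemma tensor_map_class:
  assumes X0: "right_module R X0" and X: "right_module R X" and M: "left_module R M"
    and f: "right_linear R X0 X f" and z: "z \<in> carrier (tensor R X0 M)"
  shows "\<exists>w. Poly_Mapping.keys w \<subseteq> f ` carrier X0 \<times> carrier M \<and>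
    (\<forall>U. right_submodule R X U \<longrightarrow> f ` carrier X0 \<subseteq> U \<longrightarrow>
       tensor_map R (X\<lparr>carrier := U\<rparr>) M f (\<lambda>m. m) z = tensor_class R (X\<lparr>carrier := U\<rparr>) M w)"
proof -
  have fU: "right_linear R X0 (X\<lparr>carrier := U\<rparr>) f" if "f ` carrier X0 \<subseteq> U" for U
    using that f by (auto simp: right_linear_iff add_hom_def)
  show ?thesis
    using X0 M z
  proof (induction rule: tensor_induct)
    case (tens x m)
    then show ?case
      by (intro exI[of _ "frag_of (f x, m)"])
        (auto simp: tens_eq_class[symmetric]
          tensor_map_tens[OF X0 M right_submodule_right_module[OF X] M fU left_linear_id])
  next
    case (add z1 z2)
    obtain w1 where w1: "Poly_Mapping.keys w1 \<subseteq> f ` carrier X0 \<times> carrier M"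
      "\<And>U. right_submodule R X U \<Longrightarrow> f ` carrier X0 \<subseteq> U \<Longrightarrow>
        tensor_map R (X\<lparr>carrier := U\<rparr>) M f (\<lambda>m. m) z1 = tensor_class R (X\<lparr>carrier := U\<rparr>) M w1"
      using add.IH(1) by blast
    obtain w2 where w2: "Poly_Mapping.keys w2 \<subseteq> f ` carrier X0 \<times> carrier M"
      "\<And>U. right_submodule R X U \<Longrightarrow> f ` carrier X0 \<subseteq> U \<Longrightarrow>
        tensor_map R (X\<lparr>carrier := U\<rparr>) M f (\<lambda>m. m) z2 = tensor_class R (X\<lparr>carrier := U\<rparr>) M w2"
      using add.IH(2) by blast
    have "tensor_map R (X\<lparr>carrier := U\<rparr>) M f (\<lambda>m. m) (z1 \<oplus>\<^bsub>tensor R X0 M\<^esub> z2)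
        = tensor_class R (X\<lparr>carrier := U\<rparr>) M (w1 + w2)"
      if U: "right_submodule R X U" "f ` carrier X0 \<subseteq> U" for U
    proof -
      note XU = right_submodule_right_module[OF X U(1)]
      have w: "w1 \<in> carrier (tensor_free (X\<lparr>carrier := U\<rparr>) M)" "w2 \<in> carrier (tensor_free (X\<lparr>carrier := U\<rparr>) M)"
        using w1(1) w2(1) U(2) by auto
      show ?thesis
        using hom_mult[OF tensor_class_hom[OF XU M] w]
          add_hom_add[OF tensor_map_add_hom[OF X0 M XU M fU[OF U(2)] left_linear_id] add.hyps(1,2)]
        by (simp add: w1(2)[OF U] w2(2)[OF U])
    qed
    moreover have "Poly_Mapping.keys (w1 + w2) \<subseteq> f ` carrier X0 \<times> carrier M"
      using keys_add[of w1 w2] w1(1) w2(1) by blast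
    ultimately show ?case by blast
  qed
qed

text \<open>
  If \<open>z\<close> dies over \<open>X\<close>, it already dies over the submodule spanned by the image of \<open>f\<close> and the
  finitely many elements that occur in the relation, and this submodule has a copy in the universe.
\<close>

lemma tensor_zero_small_submodule:
  assumes X0: "right_module R X0" and X: "right_module R X" and M: "left_module R M"
    and U: "infinite (UNIV :: 'u set)" and R: "carrier R \<lesssim> (UNIV :: 'u set)"
    and small: "carrier X0 \<lesssim> (UNIV :: 'u set)"
    and f: "right_linear R X0 X f" and z: "z \<in> carrier (tensor R X0 M)"
    and zero: "tensor_map R X M f (\<lambda>m. m) z = \<zero>\<^bsub>tensor R X M\<^esub>"
  obtains X1 :: "('r, 'u) rmodule" and f1 e where "right_module R X1" "right_linear R X0 X1 f1"
    "right_linear R X1 X e" "inj_on e (carrier X1)" "\<And>x. x \<in> carrier X0 \<Longrightarrow> e (f1 x) = f x"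
    "tensor_map R X1 M f1 (\<lambda>m. m) z = \<zero>\<^bsub>tensor R X1 M\<^esub>"
proof -
  interpret X: right_module R X by fact
  have fX: "f ` carrier X0 \<subseteq> carrier X" using f by (auto simp: right_linear_iff add_hom_def)
  obtain w where w: "Poly_Mapping.keys w \<subseteq> f ` carrier X0 \<times> carrier M"
      "\<And>U. right_submodule R X U \<Longrightarrow> f ` carrier X0 \<subseteq> U \<Longrightarrow>
        tensor_map R (X\<lparr>carrier := U\<rparr>) M f (\<lambda>m. m) z = tensor_class R (X\<lparr>carrier := U\<rparr>) M w"
    using tensor_map_class[OF X0 X M f z] by blast
  have "right_submodule R X (carrier X)"
    by (simp add: right_submodule_def X.rsmult_closed)
  from w(2)[OF this fX] have "tensor_map R X M f (\<lambda>m. m) z = tensor_class R X M w"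
    by simp
  moreover have "w \<in> carrier (tensor_free X M)"
    using w(1) fX by (force simp: subset_iff)
  ultimately have w_rel: "w \<in> tensor_relations R X M"
    using zero tensor_class_zero_iff[OF X M] by metis
  obtain F where F: "finite F" "F \<subseteq> carrier X"
    "\<And>U. right_submodule R X U \<Longrightarrow> F \<subseteq> U \<Longrightarrow> w \<in> tensor_relations R (X\<lparr>carrier := U\<rparr>) M"
    using tensor_relations_submodule[OF X M w_rel] by blast
  let ?G = "f ` carrier X0 \<union> F"
  let ?V = "right_span R X ?G"
  let ?X = "X\<lparr>carrier := ?V\<rparr>"
  have G: "?G \<subseteq> carrier X" using fX F(2) by auto
  note V = right_span[OF X G]
  note sub = right_submodule_right_module[OF X V(1)]
  have "?G \<lesssim> (UNIV :: 'u set)"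
    by (rule Un_lepoll_infinite[OF U lepoll_trans[OF image_lepoll small] finite_lepoll_infinite[OF U F(1)]])
  then obtain i :: "_ \<Rightarrow> 'u" where i: "inj_on i (carrier ?X)"
    using right_span_lepoll[OF U R, of ?G X] by (auto simp: lepoll_def)
  note tr = right_transport[OF sub i]
  have inc: "right_linear R ?X X (\<lambda>x. x)"
    using V(1) by (auto simp: right_linear_iff add_hom_def right_submodule_def)
  have f': "right_linear R X0 ?X f"
    using f V(2) by (auto simp: right_linear_iff add_hom_def)
  have e: "right_linear R (right_transport i ?X) X (inv_into (carrier ?X) i)"
    using right_linear_compose[OF tr(3) inc] .
  have "tensor_map R ?X M f (\<lambda>m. m) z = \<zero>\<^bsub>tensor R ?X M\<^esub>"
    using w(2)[OF V(1)] V(2) tensor_class_relation[OF sub M F(3)[OF V(1)]] by simp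
  moreover have "tensor_map R (right_transport i ?X) M i (\<lambda>m. m) (tensor_map R ?X M f (\<lambda>m. m) z)
      = tensor_map R (right_transport i ?X) M (\<lambda>x. i (f x)) (\<lambda>m. m) z"
    by (rule tensor_map_compose[OF X0 M sub M tr(1) M f' left_linear_id tr(2) left_linear_id _ _ z]) auto
  ultimately have "tensor_map R (right_transport i ?X) M (\<lambda>x. i (f x)) (\<lambda>m. m) z
      = \<zero>\<^bsub>tensor R (right_transport i ?X) M\<^esub>"
    using add_hom_zero[OF tensor_map_add_hom[OF sub M tr(1) M tr(2) left_linear_id]
        tensor_abelian_group[OF sub M] tensor_abelian_group[OF tr(1) M]] by simp
  moreover have "inv_into (carrier ?X) i (i (f x)) = f x" if "x \<in> carrier X0" for x
    using that i V(2) by (intro inv_into_f_f) auto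
  ultimately show ?thesis
    using that[OF tr(1) right_linear_compose[OF f' tr(2)] e tr(4)] by blast
qed

lemma tensor_lepoll:
  assumes X: "right_module R X" and M: "left_module R M" and U: "infinite U"
    and "carrier X \<lesssim> U" "carrier M \<lesssim> U"
  shows "carrier (tensor R X M) \<lesssim> U"
proof -
  interpret T: abelian_group "tensor R X M" by (rule tensor_abelian_group[OF X M])
  let ?s = "\<lambda>ws. foldr (\<lambda>(x, m) t. tens R X M x m \<oplus>\<^bsub>tensor R X M\<^esub> t) ws \<zero>\<^bsub>tensor R X M\<^esub>"
  let ?L = "lists (carrier X \<times> carrier M)"
  have cl: "?s ws \<in> carrier (tensor R X M)" if "ws \<in> ?L" for ws
    using that by (induction ws) (auto simp: tens_closed[OF X M])
  have add: "?s (vs @ ws) = ?s vs \<oplus>\<^bsub>tensor R X M\<^esub> ?s ws" if "vs \<in> ?L" "ws \<in> ?L" for vs ws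
    using that(1)
  proof (induction vs)
    case Nil
    then show ?case using cl[OF that(2)] by simp
  next
    case (Cons v vs)
    obtain x m where "v = (x, m)" "x \<in> carrier X" "m \<in> carrier M" using Cons.hyps(1) by auto
    then show ?case
      using Cons.IH cl[OF Cons.hyps(2)] cl[OF that(2)] by (simp add: T.a_assoc tens_closed[OF X M])
  qed
  have "t \<in> ?s ` ?L" if "t \<in> carrier (tensor R X M)" for t
    using X M that
  proof (induction rule: tensor_induct)
    case (tens x m)
    then show ?case by (intro image_eqI[of _ _ "[(x, m)]"]) (auto simp: tens_closed[OF X M])
  next
    case (add t u)
    then obtain vs ws where vw: "vs \<in> ?L" "ws \<in> ?L" "t = ?s vs" "u = ?s ws" by blast
    then have "t \<oplus>\<^bsub>tensor R X M\<^esub> u = ?s (vs @ ws)" by (simp only: \<open>\<And>vs ws. vs \<in> ?L \<Longrightarrow> ws \<in> ?L \<Longrightarrow> ?s (vs @ ws) = ?s vs \<oplus>\<^bsub>tensor R X M\<^esub> ?s ws\<close>)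
    moreover have "vs @ ws \<in> ?L" using vw(1,2) by simp
    ultimately show ?case by (rule image_eqI)
  qed
  then have "carrier (tensor R X M) \<subseteq> ?s ` ?L" by blast
  then have "carrier (tensor R X M) \<lesssim> ?L" by (rule subset_image_lepoll)
  then show ?thesis
    using lists_lepoll_infinite[OF U times_lepoll_infinite[OF U assms(4,5)]] lepoll_trans by blast
qed


section \<open>Flat, faithfully flat and Mittag-Leffler modules\<close>

lemma lepoll_UNIV: "(V :: 'u set) \<lesssim> (UNIV :: 'u set)"
  by (rule subset_imp_lepoll) simp

lemma tensor_inj_iff:
  assumes X: "right_module R X" and Y: "right_module R Y" and M: "left_module R M"
    and f: "right_linear R X Y f"
  shows "inj_on (tensor_map R Y M f (\<lambda>m. m)) (carrier (tensor R X M)) \<longleftrightarrow>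
    (\<forall>t\<in>carrier (tensor R X M). tensor_map R Y M f (\<lambda>m. m) t = \<zero>\<^bsub>tensor R Y M\<^esub>
       \<longrightarrow> t = \<zero>\<^bsub>tensor R X M\<^esub>)"
  by (rule add_hom_inj_iff[OF tensor_map_add_hom[OF X M Y M f left_linear_id]
        tensor_abelian_group[OF X M] tensor_abelian_group[OF Y M]])

text \<open>
  Flatness tested inside the universe suffices: \<open>t\<close> comes from a small submodule of \<open>X\<close>, its image
  already vanishes over a small submodule of \<open>Y\<close>, and the map between them is still injective.
\<close>

lemma flat_left_any:
  fixes R :: "('r, 'x) ring_scheme"
  assumes flat: "flat_left TYPE('u) R M" and M: "left_module R M"
    and U: "infinite (UNIV :: 'u set)" and R: "carrier R \<lesssim> (UNIV :: 'u set)"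
    and X: "right_module R X" and Y: "right_module R Y"
    and f: "right_linear R X Y f" and inj: "inj_on f (carrier X)"
    and t: "t \<in> carrier (tensor R X M)" and zero: "tensor_map R Y M f (\<lambda>m. m) t = \<zero>\<^bsub>tensor R Y M\<^esub>"
  shows "t = \<zero>\<^bsub>tensor R X M\<^esub>"
proof -
  obtain X1 :: "('r, 'u) rmodule" and e t1 where X1: "right_module R X1" and e: "right_linear R X1 X e"
    "inj_on e (carrier X1)" and t1: "t1 \<in> carrier (tensor R X1 M)" "tensor_map R X M e (\<lambda>m. m) t1 = t"
    using tensor_small_submodule[OF X M U R t] by metis
  have fe: "right_linear R X1 Y (\<lambda>x. f (e x))" by (rule right_linear_compose[OF e(1) f])
  have "tensor_map R Y M f (\<lambda>m. m) (tensor_map R X M e (\<lambda>m. m) t1)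
      = tensor_map R Y M (\<lambda>x. f (e x)) (\<lambda>m. m) t1"
    by (rule tensor_map_compose[OF X1 M X M Y M e(1) left_linear_id f left_linear_id _ _ t1(1)]) auto
  then have fe0: "tensor_map R Y M (\<lambda>x. f (e x)) (\<lambda>m. m) t1 = \<zero>\<^bsub>tensor R Y M\<^esub>"
    using zero t1(2) by simp
  obtain Y1 :: "('r, 'u) rmodule" and f1 e1 where Y1: "right_module R Y1"
    and f1: "right_linear R X1 Y1 f1" and e1: "\<And>x. x \<in> carrier X1 \<Longrightarrow> e1 (f1 x) = f (e x)"
    and z: "tensor_map R Y1 M f1 (\<lambda>m. m) t1 = \<zero>\<^bsub>tensor R Y1 M\<^esub>"
    using tensor_zero_small_submodule[OF X1 Y M U R lepoll_UNIV fe t1(1) fe0] by metis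
  have eX: "e x \<in> carrier X" if "x \<in> carrier X1" for x
    using that e(1) by (auto simp: right_linear_iff add_hom_def)
  have "inj_on f1 (carrier X1)"
  proof (rule inj_onI)
    fix x y assume "x \<in> carrier X1" "y \<in> carrier X1" "f1 x = f1 y"
    then show "x = y" using e1 eX inj e(2) by (metis inj_onD)
  qed
  then have "inj_on (tensor_map R Y1 M f1 (\<lambda>m. m)) (carrier (tensor R X1 M))"
    using flat X1 Y1 f1 unfolding flat_left_def by blast
  then have "t1 = \<zero>\<^bsub>tensor R X1 M\<^esub>"
    using z t1(1) tensor_inj_iff[OF X1 Y1 M f1] by blast
  then show ?thesis
    using t1(2) add_hom_zero[OF tensor_map_add_hom[OF X1 M X M e(1) left_linear_id]
        tensor_abelian_group[OF X1 M] tensor_abelian_group[OF X M]] by simp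
qed

text \<open>
  A cyclic submodule is small, and by flatness its tensor product embeds into the trivial group.
\<close>

lemma faithfully_flat_left_any:
  fixes R :: "('r, 'x) ring_scheme"
  assumes ff: "faithfully_flat_left TYPE('u) R M" and M: "left_module R M"
    and U: "infinite (UNIV :: 'u set)" and R: "carrier R \<lesssim> (UNIV :: 'u set)"
    and X: "right_module R X" and triv: "carrier (tensor R X M) \<subseteq> {\<zero>\<^bsub>tensor R X M\<^esub>}"
    and x: "x \<in> carrier X"
  shows "x = \<zero>\<^bsub>X\<^esub>"
proof -
  have flat: "flat_left TYPE('u) R M" using ff by (simp add: faithfully_flat_left_def)
  obtain X1 :: "('r, 'u) rmodule" and e where X1: "right_module R X1"
    and e: "right_linear R X1 X e" "inj_on e (carrier X1)" "{x} \<subseteq> e ` carrier X1"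
    using small_submodule[OF X U R _ finite_lepoll_infinite[OF U], of "{x}"] x by auto
  interpret T: abelian_group "tensor R X1 M" by (rule tensor_abelian_group[OF X1 M])
  have "carrier (tensor R X1 M) = {\<zero>\<^bsub>tensor R X1 M\<^esub>}"
    using flat_left_any[OF flat M U R X1 X e(1,2)] triv
      add_hom_closed[OF tensor_map_add_hom[OF X1 M X M e(1) left_linear_id]] by blast
  then have "carrier X1 = {\<zero>\<^bsub>X1\<^esub>}"
    using ff X1 unfolding faithfully_flat_left_def by blast
  then show ?thesis
    using e(3) add_hom_zero[OF right_linear_add_hom[OF e(1)] right_module_group[OF X1]
        right_module_group[OF X]] by auto
qed

text \<open>
  Right exactness describes the kernel of \<open>X \<otimes> M \<rightarrow> D(X) \<otimes> M\<close>, and flatness embeds \<open>D(X) \<otimes> M\<close> into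
  \<open>Y \<otimes> M\<close>.
\<close>

lemma flat_kernel:
  assumes flat: "flat_left TYPE('u) R M" and M: "left_module R M"
    and U: "infinite (UNIV :: 'u set)" and R: "carrier R \<lesssim> (UNIV :: 'u set)"
    and X: "right_module R X" and Y: "right_module R Y" and D: "right_linear R X Y D"
    and z: "z \<in> carrier (tensor R X M)" and zero: "tensor_map R Y M D (\<lambda>m. m) z = \<zero>\<^bsub>tensor R Y M\<^esub>"
    and K: "K = {x \<in> carrier X. D x = \<zero>\<^bsub>Y\<^esub>}"
  shows "right_submodule R X K"
    and "\<exists>w\<in>carrier (tensor R (X\<lparr>carrier := K\<rparr>) M). tensor_map R X M (\<lambda>x. x) (\<lambda>m. m) w = z"
proof -
  interpret X: right_module R X by fact
  interpret Y: right_module R Y by fact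
  interpret M: left_module R M by fact
  note Dh = right_linear_add_hom[OF D]
  have D0: "D \<zero>\<^bsub>X\<^esub> = \<zero>\<^bsub>Y\<^esub>" by (rule add_hom_zero[OF Dh X.M.abelian_group_axioms Y.M.abelian_group_axioms])
  show subK: "right_submodule R X K"
    using D D0 by (auto simp: K right_submodule_def right_linear_iff add_hom_def X.rsmult_closed
        right_module_zero_smult[OF Y])
  let ?I = "D ` carrier X" and ?Y = "Y\<lparr>carrier := D ` carrier X\<rparr>"
  have subI: "right_submodule R Y ?I"
    unfolding right_submodule_def
  proof (intro conjI ballI)
    show "?I \<subseteq> carrier Y" using add_hom_closed[OF Dh] by blast
    show "\<zero>\<^bsub>Y\<^esub> \<in> ?I" unfolding D0[symmetric] by (rule imageI) simp
    fix a assume "a \<in> ?I"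
    then obtain x where x: "x \<in> carrier X" "a = D x" by blast
    { fix b assume "b \<in> ?I"
      then obtain y where y: "y \<in> carrier X" "b = D y" by blast
      show "a \<oplus>\<^bsub>Y\<^esub> b \<in> ?I"
        unfolding x(2) y(2) add_hom_add[OF Dh x(1) y(1), symmetric] by (rule imageI) (simp add: x y) }
    fix r assume r: "r \<in> carrier R"
    have "a \<triangleleft>\<^bsub>Y\<^esub> r = D (x \<triangleleft>\<^bsub>X\<^esub> r)" using D x r by (simp add: right_linear_iff)
    then show "a \<triangleleft>\<^bsub>Y\<^esub> r \<in> ?I" using X.rsmult_closed[OF r x(1)] by blast
  qed
  note I = right_submodule_right_module[OF Y subI] and inc = right_submodule_inclusion[OF subI]
  have DI: "right_linear R X ?Y D"
    using D by (auto simp: right_linear_iff add_hom_def)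
  let ?u = "tensor_map R ?Y M D (\<lambda>m. m) z"
  have "tensor_map R Y M (\<lambda>x. x) (\<lambda>m. m) ?u = tensor_map R Y M D (\<lambda>m. m) z"
    by (rule tensor_map_compose[OF X M I M Y M DI left_linear_id inc left_linear_id refl refl z])
  then have "?u = \<zero>\<^bsub>tensor R ?Y M\<^esub>"
    by (intro flat_left_any[OF flat M U R I Y inc _
          add_hom_closed[OF tensor_map_add_hom[OF X M I M DI left_linear_id] z]])
      (simp_all add: zero)
  then have "z \<in> add_span (tensor R X M)
    {tens R X M x l | x l. x \<in> carrier X \<and> l \<in> carrier M \<and> (D x = \<zero>\<^bsub>?Y\<^esub> \<or> l = \<zero>\<^bsub>M\<^esub>)}"
    by (intro tensor_right_exact[OF X I M M DI _ left_linear_id _ z]) simp_all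
  then have span: "z \<in> add_span (tensor R X M)
    {tens R X M x l | x l. x \<in> carrier X \<and> l \<in> carrier M \<and> (D x = \<zero>\<^bsub>Y\<^esub> \<or> l = \<zero>\<^bsub>M\<^esub>)}"
    by simp
  note XK = right_submodule_right_module[OF X subK] and incK = right_submodule_inclusion[OF subK]
  let ?i = "tensor_map R X M (\<lambda>x. x) (\<lambda>m. m)" and ?T = "tensor R (X\<lparr>carrier := K\<rparr>) M"
  interpret T: abelian_group ?T by (rule tensor_abelian_group[OF XK M])
  interpret T': abelian_group "tensor R X M" by (rule tensor_abelian_group[OF X M])
  have ih: "add_hom ?T (tensor R X M) ?i"
    by (rule tensor_map_add_hom[OF XK M X M incK left_linear_id])
  have i0: "?i \<zero>\<^bsub>?T\<^esub> = \<zero>\<^bsub>tensor R X M\<^esub>"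
    by (rule add_hom_zero[OF ih T.abelian_group_axioms T'.abelian_group_axioms])
  from span show "\<exists>w\<in>carrier ?T. ?i w = z"
  proof induction
    case zero
    show ?case using i0 by (intro bexI[of _ "\<zero>\<^bsub>?T\<^esub>"]) simp_all
  next
    case (base u)
    then obtain x l where u: "u = tens R X M x l" "x \<in> carrier X" "l \<in> carrier M"
      "D x = \<zero>\<^bsub>Y\<^esub> \<or> l = \<zero>\<^bsub>M\<^esub>" by blast
    show ?case
    proof (cases "l = \<zero>\<^bsub>M\<^esub>")
      case True
      then have "?i \<zero>\<^bsub>?T\<^esub> = u" using u(1) i0 tens_zero_right[OF X M u(2)] by simp
      then show ?thesis using T.zero_closed by blast
    next
      case False
      then have x: "x \<in> carrier (X\<lparr>carrier := K\<rparr>)" using u K by simp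
      have "?i (tens R (X\<lparr>carrier := K\<rparr>) M x l) = u"
        unfolding u(1) by (rule tensor_map_tens[OF XK M X M incK left_linear_id x u(3)])
      then show ?thesis using tens_closed[OF XK M x u(3)] by blast
    qed
  next
    case (add u v)
    then obtain w w' where "w \<in> carrier ?T" "w' \<in> carrier ?T" "?i w = u" "?i w' = v" by blast
    then show ?case
      using add_hom_add[OF ih, of w w'] by (intro bexI[of _ "w \<oplus>\<^bsub>?T\<^esub> w'"]) simp_all
  qed
qed

text \<open>
  If \<open>V \<otimes> M \<rightarrow> X \<otimes> M\<close> is onto, then \<open>(X/V) \<otimes> M\<close> vanishes, hence so does \<open>X/V\<close>.
\<close>

lemma faithfully_flat_submodule:
  assumes ff: "faithfully_flat_left TYPE('u) R M" and M: "left_module R M"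
    and U: "infinite (UNIV :: 'u set)" and R: "carrier R \<lesssim> (UNIV :: 'u set)"
    and X: "right_module R X" and V: "right_submodule R X V"
    and surj: "\<And>x m. x \<in> carrier X \<Longrightarrow> m \<in> carrier M \<Longrightarrow>
      \<exists>w\<in>carrier (tensor R (X\<lparr>carrier := V\<rparr>) M). tensor_map R X M (\<lambda>x. x) (\<lambda>m. m) w = tens R X M x m"
    and x: "x \<in> carrier X"
  shows "x \<in> V"
proof -
  interpret X: right_module R X by fact
  have VX: "V \<subseteq> carrier X" using V by (simp add: right_submodule_def)
  have "subgroup V (add_monoid X)"
  proof (rule subgroup.intro)
    fix v assume v: "v \<in> V"
    have "v \<triangleleft>\<^bsub>X\<^esub> (\<ominus>\<^bsub>R\<^esub> \<one>\<^bsub>R\<^esub>) \<in> V" using V v by (auto simp: right_submodule_def)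
    then show "inv\<^bsub>add_monoid X\<^esub> v \<in> V"
      using right_module_neg_smult[OF X, of v] v VX by (auto simp: a_inv_def)
  qed (use V in \<open>auto simp: right_submodule_def\<close>)
  note Q = quotient_group[OF X.M.abelian_group_axioms this]
  define \<pi> where "\<pi> = r_coset (add_monoid X) V"
  define G where "G = quotient_group X V"
  note Q = Q[folded \<pi>_def G_def]
  interpret G: abelian_group G by (rule Q(1))
  have eq: "\<pi> y = \<pi> y' \<longleftrightarrow> y \<ominus>\<^bsub>X\<^esub> y' \<in> V" if "y \<in> carrier X" "y' \<in> carrier X" for y y'
    using that Q(4)[of "y \<ominus>\<^bsub>X\<^esub> y'"] add_hom_diff[OF Q(2) X.M.abelian_group_axioms Q(1), of y y']
      G.diff_zero_iff add_hom_closed[OF Q(2)] by simp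
  let ?Q = "right_transport \<pi> X"
  have tr: "right_module R ?Q" "right_linear R X ?Q \<pi>" "\<pi> ` carrier X = carrier ?Q"
  proof -
    have add: "\<pi> (y \<oplus>\<^bsub>X\<^esub> z) = \<pi> (y' \<oplus>\<^bsub>X\<^esub> z')"
      if "y \<in> carrier X" "y' \<in> carrier X" "z \<in> carrier X" "z' \<in> carrier X" "\<pi> y = \<pi> y'" "\<pi> z = \<pi> z'"
      for y y' z z' using that by (simp add: add_hom_add[OF Q(2)])
    have smult: "\<pi> (y \<triangleleft>\<^bsub>X\<^esub> r) = \<pi> (y' \<triangleleft>\<^bsub>X\<^esub> r)"
      if y: "y \<in> carrier X" "y' \<in> carrier X" "r \<in> carrier R" "\<pi> y = \<pi> y'" for y y' r
    proof -
      have h: "add_hom X X (\<lambda>x. x \<triangleleft>\<^bsub>X\<^esub> r)"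
        using y(3) by (simp add: add_hom_def X.rsmult_closed X.rsmult_l_distr)
      have "(y \<ominus>\<^bsub>X\<^esub> y') \<triangleleft>\<^bsub>X\<^esub> r \<in> V"
        using y eq V by (auto simp: right_submodule_def)
      then show ?thesis
        using eq y add_hom_diff[OF h X.M.abelian_group_axioms X.M.abelian_group_axioms y(1,2)]
        by (simp add: X.rsmult_closed)
    qed
    show "right_module R ?Q" "right_linear R X ?Q \<pi>" "\<pi> ` carrier X = carrier ?Q"
      using right_transport_congruence[OF X add smult] by blast+
  qed
  note V' = right_submodule_right_module[OF X V] and inc = right_submodule_inclusion[OF V]
  interpret T: abelian_group "tensor R ?Q M" by (rule tensor_abelian_group[OF tr(1) M])
  have zQ: "\<zero>\<^bsub>?Q\<^esub> = \<pi> \<zero>\<^bsub>X\<^esub>" by (simp add: right_transport_def)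
  have \<pi>V: "\<pi> v = \<zero>\<^bsub>?Q\<^esub>" if "v \<in> V" for v
    using eq[of v "\<zero>\<^bsub>X\<^esub>"] that VX by (auto simp: zQ a_minus_def X.M.neg_zero)
  have "t = \<zero>\<^bsub>tensor R ?Q M\<^esub>" if "t \<in> carrier (tensor R ?Q M)" for t
    using tr(1) M that
  proof (induction rule: tensor_induct)
    case (tens q m)
    then have "q \<in> \<pi> ` carrier X" using tr(3) by simp
    then obtain y where y: "y \<in> carrier X" "q = \<pi> y" by blast
    obtain w where w: "w \<in> carrier (tensor R (X\<lparr>carrier := V\<rparr>) M)"
      "tensor_map R X M (\<lambda>x. x) (\<lambda>m. m) w = tens R X M y m" using surj[OF y(1) tens(2)] by blast
    have "tens R ?Q M q m = tensor_map R ?Q M \<pi> (\<lambda>m. m) (tensor_map R X M (\<lambda>x. x) (\<lambda>m. m) w)"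
      unfolding w(2) y(2) by (rule tensor_map_tens[OF X M tr(1) M tr(2) left_linear_id y(1) tens(2), symmetric])
    also have "\<dots> = tensor_map R ?Q M \<pi> (\<lambda>m. m) w"
      by (rule tensor_map_compose[OF V' M X M tr(1) M inc left_linear_id tr(2) left_linear_id refl refl w(1)])
    also have "\<dots> = \<zero>\<^bsub>tensor R ?Q M\<^esub>"
      by (rule tensor_map_zero[OF V' M tr(1) right_linear_compose[OF inc tr(2)] _ w(1)]) (simp add: \<pi>V)
    finally show ?case .
  next
    case (add t u)
    then show ?case by simp
  qed
  then have "carrier (tensor R ?Q M) \<subseteq> {\<zero>\<^bsub>tensor R ?Q M\<^esub>}" by blast
  moreover have "\<pi> x \<in> carrier ?Q" using x tr(3) by blast
  ultimately have "\<pi> x = \<pi> \<zero>\<^bsub>X\<^esub>"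
    using faithfully_flat_left_any[OF ff M U R tr(1)] unfolding zQ by blast
  then show ?thesis using eq[OF x, of "\<zero>\<^bsub>X\<^esub>"] x by (simp add: a_minus_def X.M.neg_zero)
qed

lemma product_right_module:
  assumes R: "ring R" and Q: "\<And>i. i \<in> I \<Longrightarrow> right_module R (Q i)"
  shows "right_module R (product_right I Q)"
proof (rule right_moduleI[OF R])
  have ag: "abelian_group (Q i)" if "i \<in> I" for i using right_module_group[OF Q[OF that]] .
  show "abelian_group (product_right I Q)"
  proof (rule abelian_groupI)
    fix x assume x: "x \<in> carrier (product_right I Q)"
    let ?y = "\<lambda>i\<in>I. \<ominus>\<^bsub>Q i\<^esub> x i"
    have "?y \<in> carrier (product_right I Q)"
      using x ag by (auto simp: product_right_def PiE_iff abelian_group.a_inv_closed)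
    moreover have "?y \<oplus>\<^bsub>product_right I Q\<^esub> x = \<zero>\<^bsub>product_right I Q\<^esub>"
      using x ag by (auto simp: product_right_def PiE_iff abelian_group.l_neg intro!: restrict_ext)
    ultimately show "\<exists>y\<in>carrier (product_right I Q).
        y \<oplus>\<^bsub>product_right I Q\<^esub> x = \<zero>\<^bsub>product_right I Q\<^esub>" by blast
  qed (use ag in \<open>auto simp: product_right_def abelian_groupE(1,2,3,5) PiE_iff extensional_def
      fun_eq_iff restrict_def intro!: abelian_groupE(4)\<close>)
qed (auto simp: product_right_def PiE_iff extensional_def right_module.rsmult_closed[OF Q]
    right_module.rsmult_r_distr[OF Q] right_module.rsmult_l_distr[OF Q]
    right_module.rsmult_assoc[OF Q] right_module.rsmult_one[OF Q] fun_eq_iff restrict_def)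

lemma product_right_proj:
  "i \<in> I \<Longrightarrow> right_linear R (product_right I Q) (Q i) (\<lambda>v. v i)"
  by (auto simp: product_right_def right_linear_iff add_hom_def)

lemma product_right_map:
  assumes "\<And>i. i \<in> I \<Longrightarrow> right_linear R X (Q i) (f i)"
  shows "right_linear R X (product_right I Q) (\<lambda>x. \<lambda>i\<in>I. f i x)"
  using assms by (auto simp: product_right_def right_linear_iff add_hom_def PiE_iff intro!: restrict_ext)

text \<open>
  Injectivity of \<open>(\<Prod>Q\<^sub>i) \<otimes> M \<rightarrow> \<Prod>(Q\<^sub>i \<otimes> M)\<close> for a single family, which may live in any type.
\<close>

definition product_injective ::
  "('r, 'x) ring_scheme \<Rightarrow> ('r, 'm, 'y) module_scheme \<Rightarrow> 'i set \<Rightarrow> ('i \<Rightarrow> ('r, 'q, 'z) rmodule_scheme) \<Rightarrow> bool" where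
  "product_injective R M I Q \<longleftrightarrow> (\<forall>t\<in>carrier (tensor R (product_right I Q) M).
     (\<forall>i\<in>I. tensor_map R (Q i) M (\<lambda>v. v i) (\<lambda>m. m) t = \<zero>\<^bsub>tensor R (Q i) M\<^esub>) \<longrightarrow>
     t = \<zero>\<^bsub>tensor R (product_right I Q) M\<^esub>)"

lemma product_injective_iff:
  assumes R: "ring R" and M: "left_module R M" and Q: "\<And>i. i \<in> I \<Longrightarrow> right_module R (Q i)"
  shows "inj_on (\<lambda>t. \<lambda>i\<in>I. tensor_map R (Q i) M (\<lambda>v. v i) (\<lambda>m. m) t)
      (carrier (tensor R (product_right I Q) M)) \<longleftrightarrow> product_injective R M I Q"
proof -
  let ?T = "tensor R (product_right I Q) M"
  let ?p = "\<lambda>i. tensor_map R (Q i) M (\<lambda>v. v i) (\<lambda>m. m)"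
  have P: "right_module R (product_right I Q)" by (rule product_right_module[OF R]) (rule Q)
  interpret T: abelian_group ?T by (rule tensor_abelian_group[OF P M])
  have h: "add_hom ?T (tensor R (Q i) M) (?p i)" if "i \<in> I" for i
    by (rule tensor_map_add_hom[OF P M Q[OF that] M product_right_proj[OF that] left_linear_id])
  have ag: "abelian_group (tensor R (Q i) M)" if "i \<in> I" for i
    by (rule tensor_abelian_group[OF Q[OF that] M])
  show ?thesis
  proof
    assume inj: "inj_on (\<lambda>t. \<lambda>i\<in>I. ?p i t) (carrier ?T)"
    show "product_injective R M I Q"
      unfolding product_injective_def
    proof (intro ballI impI)
      fix t assume t: "t \<in> carrier ?T" "\<forall>i\<in>I. ?p i t = \<zero>\<^bsub>tensor R (Q i) M\<^esub>"
      have "(\<lambda>i\<in>I. ?p i t) = (\<lambda>i\<in>I. ?p i \<zero>\<^bsub>?T\<^esub>)"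
        using t(2) add_hom_zero[OF h T.abelian_group_axioms ag] by (auto intro!: restrict_ext)
      then show "t = \<zero>\<^bsub>?T\<^esub>" using inj_onD[OF inj _ t(1) T.zero_closed] by blast
    qed
  next
    assume pi: "product_injective R M I Q"
    show "inj_on (\<lambda>t. \<lambda>i\<in>I. ?p i t) (carrier ?T)"
    proof (rule inj_onI)
      fix s t assume st: "s \<in> carrier ?T" "t \<in> carrier ?T" "(\<lambda>i\<in>I. ?p i s) = (\<lambda>i\<in>I. ?p i t)"
      have "?p i (s \<ominus>\<^bsub>?T\<^esub> t) = \<zero>\<^bsub>tensor R (Q i) M\<^esub>" if i: "i \<in> I" for i
      proof -
        have "?p i s = ?p i t" using fun_cong[OF st(3), of i] i by simp
        then show ?thesis
          using add_hom_diff[OF h[OF i] T.abelian_group_axioms ag[OF i] st(1,2)]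
            abelian_group.diff_zero_iff[OF ag[OF i]] add_hom_closed[OF h[OF i]] st(1,2) by simp
      qed
      then have "s \<ominus>\<^bsub>?T\<^esub> t = \<zero>\<^bsub>?T\<^esub>"
        using pi st(1,2) unfolding product_injective_def by blast
      then show "s = t" using st(1,2) by (simp add: T.diff_zero_iff)
    qed
  qed
qed

text \<open>
  The index set stays the same while every factor shrinks: \<open>t\<close> comes from a small \<open>X\<close>, and for each
  \<open>i\<close> the \<open>i\<close>-th component of \<open>t\<close> vanishes over a small submodule of \<open>Q\<^sub>i\<close> that contains the image of
  \<open>X\<close>. The product of these submodules is a family inside the universe.
\<close>

lemma mittag_leffler_any:
  fixes R :: "('r, 'x) ring_scheme" and I :: "'u set"
  assumes ml: "mittag_leffler TYPE('u) R M" and M: "left_module R M"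
    and U: "infinite (UNIV :: 'u set)" and R: "carrier R \<lesssim> (UNIV :: 'u set)"
    and Q: "\<And>i. i \<in> I \<Longrightarrow> right_module R (Q i)"
  shows "product_injective R M I Q"
  unfolding product_injective_def
proof (intro ballI impI)
  have ring: "ring R" using M by (simp add: left_module_def)
  let ?P = "product_right I Q"
  have P: "right_module R ?P" by (rule product_right_module[OF ring]) (rule Q)
  fix t assume t: "t \<in> carrier (tensor R ?P M)"
    and zero: "\<forall>i\<in>I. tensor_map R (Q i) M (\<lambda>v. v i) (\<lambda>m. m) t = \<zero>\<^bsub>tensor R (Q i) M\<^esub>"
  obtain X :: "('r, 'u) rmodule" and e z where X: "right_module R X" and e: "right_linear R X ?P e"
    and z: "z \<in> carrier (tensor R X M)" "tensor_map R ?P M e (\<lambda>m. m) z = t"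
    using tensor_small_submodule[OF P M U R t] by metis
  have "\<exists>(Q' :: ('r, 'u) rmodule) f e'. right_module R Q' \<and> right_linear R X Q' f \<and>
      right_linear R Q' (Q i) e' \<and> (\<forall>x\<in>carrier X. e' (f x) = e x i) \<and>
      tensor_map R Q' M f (\<lambda>m. m) z = \<zero>\<^bsub>tensor R Q' M\<^esub>" if i: "i \<in> I" for i
  proof -
    have ei: "right_linear R X (Q i) (\<lambda>x. e x i)"
      by (rule right_linear_compose[OF e product_right_proj[OF i]])
    have "tensor_map R (Q i) M (\<lambda>v. v i) (\<lambda>m. m) (tensor_map R ?P M e (\<lambda>m. m) z)
        = tensor_map R (Q i) M (\<lambda>x. e x i) (\<lambda>m. m) z"
      by (rule tensor_map_compose[OF X M P M Q[OF i] M e left_linear_id product_right_proj[OF i]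
            left_linear_id _ _ z(1)]) auto
    then have "tensor_map R (Q i) M (\<lambda>x. e x i) (\<lambda>m. m) z = \<zero>\<^bsub>tensor R (Q i) M\<^esub>"
      using zero i z(2) by simp
    from tensor_zero_small_submodule[OF X Q[OF i] M U R lepoll_UNIV ei z(1) this] show ?thesis
      by metis
  qed
  then obtain Q' :: "'u \<Rightarrow> ('r, 'u) rmodule" and f e' where
    Q': "\<And>i. i \<in> I \<Longrightarrow> right_module R (Q' i)"
    and f: "\<And>i. i \<in> I \<Longrightarrow> right_linear R X (Q' i) (f i)"
    and e': "\<And>i. i \<in> I \<Longrightarrow> right_linear R (Q' i) (Q i) (e' i)"
    and ef: "\<And>i x. i \<in> I \<Longrightarrow> x \<in> carrier X \<Longrightarrow> e' i (f i x) = e x i"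
    and z0: "\<And>i. i \<in> I \<Longrightarrow> tensor_map R (Q' i) M (f i) (\<lambda>m. m) z = \<zero>\<^bsub>tensor R (Q' i) M\<^esub>"
    by metis
  let ?P' = "product_right I Q'"
  have P': "right_module R ?P'" by (rule product_right_module[OF ring]) (rule Q')
  have F: "right_linear R X ?P' (\<lambda>x. \<lambda>i\<in>I. f i x)" by (rule product_right_map[OF f])
  let ?y = "tensor_map R ?P' M (\<lambda>x. \<lambda>i\<in>I. f i x) (\<lambda>m. m) z"
  have y: "?y \<in> carrier (tensor R ?P' M)"
    by (rule add_hom_closed[OF tensor_map_add_hom[OF X M P' M F left_linear_id] z(1)])
  have "tensor_map R (Q' i) M (\<lambda>v. v i) (\<lambda>m. m) ?y = \<zero>\<^bsub>tensor R (Q' i) M\<^esub>" if i: "i \<in> I" for i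
    using tensor_map_compose[OF X M P' M Q'[OF i] M F left_linear_id product_right_proj[OF i]
            left_linear_id, of "f i" "\<lambda>m. m" z] z0[OF i] z(1) i by simp
  moreover have "inj_on (\<lambda>t. \<lambda>i\<in>I. tensor_map R (Q' i) M (\<lambda>v. v i) (\<lambda>m. m) t)
      (carrier (tensor R ?P' M))"
    using ml Q' unfolding mittag_leffler_def by simp
  then have "product_injective R M I Q'"
    using product_injective_iff[OF ring M, of I Q'] Q' by simp
  ultimately have y0: "?y = \<zero>\<^bsub>tensor R ?P' M\<^esub>"
    using y unfolding product_injective_def by blast
  have E: "right_linear R ?P' ?P (\<lambda>v. \<lambda>i\<in>I. e' i (v i))"
  proof (rule product_right_map)
    fix i assume i: "i \<in> I"
    show "right_linear R ?P' (Q i) (\<lambda>v. e' i (v i))"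
      by (rule right_linear_compose[OF product_right_proj[OF i, of R Q'] e'[OF i]])
  qed
  have "tensor_map R ?P M (\<lambda>v. \<lambda>i\<in>I. e' i (v i)) (\<lambda>m. m) ?y = tensor_map R ?P M e (\<lambda>m. m) z"
  proof (rule tensor_map_compose[OF X M P' M P M F left_linear_id E left_linear_id _ _ z(1)])
    fix x assume x: "x \<in> carrier X"
    then have "e x \<in> carrier ?P" using e by (auto simp: right_linear_iff add_hom_def)
    then have "e x \<in> extensional I" by (simp add: product_right_def PiE_iff)
    then show "(\<lambda>i\<in>I. e' i ((\<lambda>i\<in>I. f i x) i)) = e x"
      using ef x by (auto simp: fun_eq_iff extensional_def)
  qed (rule refl)
  then show "t = \<zero>\<^bsub>tensor R ?P M\<^esub>"
    using z(2) y0 add_hom_zero[OF tensor_map_add_hom[OF P' M P M E left_linear_id]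
        tensor_abelian_group[OF P' M] tensor_abelian_group[OF P M]] by simp
qed


section \<open>Finitely generated left modules\<close>

inductive_set left_span ::
  "('r, 'x) ring_scheme \<Rightarrow> ('r, 'm, 'y) module_scheme \<Rightarrow> 'm set \<Rightarrow> 'm set"
  for R M X where
    zero: "\<zero>\<^bsub>M\<^esub> \<in> left_span R M X"
  | base: "x \<in> X \<Longrightarrow> x \<in> left_span R M X"
  | add: "x \<in> left_span R M X \<Longrightarrow> y \<in> left_span R M X \<Longrightarrow> x \<oplus>\<^bsub>M\<^esub> y \<in> left_span R M X"
  | smult: "r \<in> carrier R \<Longrightarrow> x \<in> left_span R M X \<Longrightarrow> r \<odot>\<^bsub>M\<^esub> x \<in> left_span R M X"

lemma left_span_mono:
  assumes "x \<in> left_span R M X" "X \<subseteq> left_span R M Y" shows "x \<in> left_span R M Y"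
  using assms(1)
  by induction (use assms(2) in \<open>auto intro: left_span.intros\<close>)

lemma left_span_carrier_update:
  fixes M :: "('r, 'm, 'y) module_scheme"
  shows "left_span R (M\<lparr>carrier := F\<rparr>) X = left_span R M X"
proof -
  have "x \<in> left_span R M X" if "x \<in> left_span R (M\<lparr>carrier := F\<rparr>) X" for x
    using that by induction (auto intro: left_span.intros)
  moreover have "x \<in> left_span R (M\<lparr>carrier := F\<rparr>) X" if "x \<in> left_span R M X" for x
    using that
  proof induction
    case zero then show ?case using left_span.zero[of "M\<lparr>carrier := F\<rparr>"] by simp
  next
    case (add x y) then show ?case using left_span.add[of x R "M\<lparr>carrier := F\<rparr>"] by simp
  next
    case (smult r x) then show ?case using left_span.smult[of r R x "M\<lparr>carrier := F\<rparr>"] by simp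
  qed (rule left_span.base)
  ultimately show ?thesis by blast
qed

lemma left_span_closed:
  assumes M: "left_module R M" and X: "X \<subseteq> carrier M" and x: "x \<in> left_span R M X"
  shows "x \<in> carrier M"
proof -
  interpret M: left_module R M by fact
  show ?thesis using x by induction (use X in \<open>auto simp: M.lsmult_closed\<close>)
qed

lemma left_span_finsum:
  assumes M: "left_module R M" and X: "finite X" "X \<subseteq> carrier M" and m: "m \<in> left_span R M X"
  shows "\<exists>r\<in>X \<rightarrow> carrier R. m = (\<Oplus>\<^bsub>M\<^esub>x\<in>X. r x \<odot>\<^bsub>M\<^esub> x)"
proof -
  interpret M: left_module R M by fact
  have XM: "\<And>x. x \<in> X \<Longrightarrow> x \<in> carrier M" using X(2) by auto
  show ?thesis using m
  proof induction
    case zero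
    have "(\<Oplus>\<^bsub>M\<^esub>x\<in>X. \<zero>\<^bsub>R\<^esub> \<odot>\<^bsub>M\<^esub> x) = (\<Oplus>\<^bsub>M\<^esub>x\<in>X. \<zero>\<^bsub>M\<^esub>)"
      by (rule M.M.finsum_cong') (auto simp: left_module_zero_smult[OF M] XM)
    then show ?case by (intro bexI[of _ "\<lambda>_. \<zero>\<^bsub>R\<^esub>"]) auto
  next
    case (base y)
    have "(\<Oplus>\<^bsub>M\<^esub>x\<in>X. (if y = x then \<one>\<^bsub>R\<^esub> else \<zero>\<^bsub>R\<^esub>) \<odot>\<^bsub>M\<^esub> x) = (\<Oplus>\<^bsub>M\<^esub>x\<in>X. if y = x then x else \<zero>\<^bsub>M\<^esub>)"
      by (rule M.M.finsum_cong') (auto simp: left_module_zero_smult[OF M] XM M.lsmult_one)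
    also have "\<dots> = y" using M.M.finsum_singleton[OF base X(1), of "\<lambda>x. x"] XM by auto
    finally show ?case by (intro bexI[of _ "\<lambda>x. if y = x then \<one>\<^bsub>R\<^esub> else \<zero>\<^bsub>R\<^esub>"]) auto
  next
    case (add x y)
    then obtain r q where r: "r \<in> X \<rightarrow> carrier R" "x = (\<Oplus>\<^bsub>M\<^esub>x\<in>X. r x \<odot>\<^bsub>M\<^esub> x)"
      and q: "q \<in> X \<rightarrow> carrier R" "y = (\<Oplus>\<^bsub>M\<^esub>x\<in>X. q x \<odot>\<^bsub>M\<^esub> x)" by blast
    have rq: "r x \<in> carrier R" "q x \<in> carrier R" if "x \<in> X" for x using that r(1) q(1) by auto
    have "(\<Oplus>\<^bsub>M\<^esub>x\<in>X. (r x \<oplus>\<^bsub>R\<^esub> q x) \<odot>\<^bsub>M\<^esub> x) = (\<Oplus>\<^bsub>M\<^esub>x\<in>X. r x \<odot>\<^bsub>M\<^esub> x \<oplus>\<^bsub>M\<^esub> q x \<odot>\<^bsub>M\<^esub> x)"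
      by (rule M.M.finsum_cong') (auto simp: M.lsmult_l_distr XM rq M.lsmult_closed)
    also have "\<dots> = x \<oplus>\<^bsub>M\<^esub> y"
      unfolding r(2) q(2) by (rule M.M.finsum_addf) (auto simp: XM rq M.lsmult_closed)
    finally show ?case by (intro bexI[of _ "\<lambda>x. r x \<oplus>\<^bsub>R\<^esub> q x"]) (auto simp: rq)
  next
    case (smult a x)
    then obtain r where r: "r \<in> X \<rightarrow> carrier R" "x = (\<Oplus>\<^bsub>M\<^esub>x\<in>X. r x \<odot>\<^bsub>M\<^esub> x)" by blast
    have rX: "r x \<in> carrier R" if "x \<in> X" for x using that r(1) by auto
    have "add_hom M M (\<lambda>x. a \<odot>\<^bsub>M\<^esub> x)"
      using smult.hyps(1) by (simp add: add_hom_def M.lsmult_closed M.lsmult_r_distr)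
    then have "a \<odot>\<^bsub>M\<^esub> x = (\<Oplus>\<^bsub>M\<^esub>x\<in>X. a \<odot>\<^bsub>M\<^esub> (r x \<odot>\<^bsub>M\<^esub> x))"
      unfolding r(2) by (rule add_hom_finsum[OF _ M.M.abelian_group_axioms M.M.abelian_group_axioms X(1)])
        (auto simp: XM rX M.lsmult_closed)
    also have "\<dots> = (\<Oplus>\<^bsub>M\<^esub>x\<in>X. (a \<otimes>\<^bsub>R\<^esub> r x) \<odot>\<^bsub>M\<^esub> x)"
      by (rule M.M.finsum_cong') (auto simp: M.lsmult_assoc XM rX M.lsmult_closed smult.hyps(1))
    finally show ?case
      by (intro bexI[of _ "\<lambda>x. a \<otimes>\<^bsub>R\<^esub> r x"]) (auto simp: rX smult.hyps(1))
  qed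
qed

text \<open>
  The inductive closure replaces explicit linear combinations by rule induction.
\<close>

lemma fin_gen_iff:
  assumes M: "left_module R M"
  shows "fin_gen R M \<longleftrightarrow> (\<exists>X. finite X \<and> X \<subseteq> carrier M \<and> carrier M \<subseteq> left_span R M X)"
proof -
  interpret M: left_module R M by fact
  have sum: "(\<Oplus>\<^bsub>M\<^esub>x\<in>Y. r x \<odot>\<^bsub>M\<^esub> x) \<in> left_span R M X"
    if "finite Y" "Y \<subseteq> X" "X \<subseteq> carrier M" "r \<in> X \<rightarrow> carrier R" for r X Y
    using that(1,2)
  proof (induction Y rule: finite_induct)
    case empty
    then show ?case by (simp add: left_span.zero)
  next
    case (insert y Y)
    have "(\<lambda>x. r x \<odot>\<^bsub>M\<^esub> x) \<in> Y \<rightarrow> carrier M" "r y \<odot>\<^bsub>M\<^esub> y \<in> carrier M" "r y \<in> carrier R"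
      using insert that(3,4) by (auto intro!: M.lsmult_closed)
    then show ?case
      using insert by (simp add: left_span.add left_span.smult left_span.base)
  qed
  show ?thesis
  proof
    assume "fin_gen R M"
    then obtain X where X: "finite X" "X \<subseteq> carrier M"
      "\<forall>m\<in>carrier M. \<exists>r\<in>X \<rightarrow> carrier R. m = (\<Oplus>\<^bsub>M\<^esub>x\<in>X. r x \<odot>\<^bsub>M\<^esub> x)"
      unfolding fin_gen_def by blast
    then have "carrier M \<subseteq> left_span R M X"
      using sum[OF X(1) order_refl X(2)] by (metis subsetI)
    then show "\<exists>X. finite X \<and> X \<subseteq> carrier M \<and> carrier M \<subseteq> left_span R M X" using X(1,2) by blast
  next
    assume "\<exists>X. finite X \<and> X \<subseteq> carrier M \<and> carrier M \<subseteq> left_span R M X"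
    then show "fin_gen R M" unfolding fin_gen_def using left_span_finsum[OF M] by (meson subsetD)
  qed
qed

lemma left_module_restrict:
  assumes M: "left_module R M" and F: "F \<subseteq> carrier M" "\<zero>\<^bsub>M\<^esub> \<in> F"
    and add: "\<And>x y. x \<in> F \<Longrightarrow> y \<in> F \<Longrightarrow> x \<oplus>\<^bsub>M\<^esub> y \<in> F"
    and smult: "\<And>r x. r \<in> carrier R \<Longrightarrow> x \<in> F \<Longrightarrow> r \<odot>\<^bsub>M\<^esub> x \<in> F"
  shows "left_module R (M\<lparr>carrier := F\<rparr>)" and "submodule F R M"
proof -
  interpret M: left_module R M by fact
  have FM: "\<And>x. x \<in> F \<Longrightarrow> x \<in> carrier M" using F(1) by auto
  have neg: "\<ominus>\<^bsub>M\<^esub> x \<in> F" if "x \<in> F" for x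
    using smult[of "\<ominus>\<^bsub>R\<^esub> \<one>\<^bsub>R\<^esub>" x] that left_module_neg_smult[OF M FM[OF that]] by simp
  show "left_module R (M\<lparr>carrier := F\<rparr>)"
  proof (rule left_moduleI[OF M.R.ring_axioms])
    show "abelian_group (M\<lparr>carrier := F\<rparr>)"
    proof (rule abelian_groupI)
      fix x assume "x \<in> carrier (M\<lparr>carrier := F\<rparr>)"
      then show "\<exists>y\<in>carrier (M\<lparr>carrier := F\<rparr>). y \<oplus>\<^bsub>M\<lparr>carrier := F\<rparr>\<^esub> x = \<zero>\<^bsub>M\<lparr>carrier := F\<rparr>\<^esub>"
        using neg[of x] M.l_neg[of x] FM by auto
    qed (use add F(2) FM in \<open>auto simp: M.a_ac\<close>)
  qed (use smult FM in \<open>auto simp: M.lsmult_l_distr M.lsmult_r_distr M.lsmult_assoc M.lsmult_one\<close>)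
  show "submodule F R M"
    unfolding submodule_def submodule_axioms_def
    using F add smult neg M.M.a_group
    by (auto simp: a_inv_def intro!: subgroup.intro)
qed

lemma left_span_submodule:
  assumes M: "left_module R M" and X: "X \<subseteq> carrier M"
  shows "left_module R (M\<lparr>carrier := left_span R M X\<rparr>)" and "submodule (left_span R M X) R M"
  by (rule left_module_restrict[OF M]; auto intro: left_span.intros left_span_closed[OF M X])+

lemma submodule_left_module:
  assumes M: "left_module R M" and F: "submodule F R M"
  shows "left_module R (M\<lparr>carrier := F\<rparr>)"
proof -
  interpret F: submodule F R M by fact
  show ?thesis
    by (rule left_module_restrict(1)[OF M])
      (use F.subset F.one_closed F.m_closed F.smult_closed in auto)
qed

lemma left_kernel:
  assumes L: "left_module R L" and M: "left_module R M" and \<phi>: "left_linear R L M \<phi>"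
  shows "left_module R (L\<lparr>carrier := {x \<in> carrier L. \<phi> x = \<zero>\<^bsub>M\<^esub>}\<rparr>)"
proof -
  interpret L: left_module R L by fact
  interpret M: left_module R M by fact
  show ?thesis
    using \<phi> add_hom_zero[OF left_linear_add_hom[OF \<phi>] L.M.abelian_group_axioms M.M.abelian_group_axioms]
    by (intro left_module_restrict(1)[OF L])
      (auto simp: left_linear_iff add_hom_def L.lsmult_closed left_module_smult_zero[OF M])
qed


section \<open>Finitely presented left modules\<close>

lemma free_left_module:
  assumes "ring R" shows "left_module R (free_left R n)"
proof -
  interpret R: ring R by fact
  show ?thesis
  proof (rule left_moduleI[OF assms])
    show "abelian_group (free_left R n)"
    proof (rule abelian_groupI)
      fix x assume "x \<in> carrier (free_left R n)"
      then show "\<exists>y\<in>carrier (free_left R n). y \<oplus>\<^bsub>free_left R n\<^esub> x = \<zero>\<^bsub>free_left R n\<^esub>"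
        by (intro bexI[of _ "\<lambda>i\<in>{..<n}. \<ominus>\<^bsub>R\<^esub> x i"])
          (auto simp: free_left_def PiE_iff extensional_def R.l_neg fun_eq_iff restrict_def)
    qed (auto simp: free_left_def PiE_iff extensional_def fun_eq_iff restrict_def R.a_ac)
  qed (auto simp: free_left_def PiE_iff extensional_def fun_eq_iff restrict_def R.l_distr R.r_distr R.m_assoc)
qed

definition unit_vector :: "('r, 'x) ring_scheme \<Rightarrow> nat \<Rightarrow> nat \<Rightarrow> nat \<Rightarrow> 'r" where
  "unit_vector R n k = (\<lambda>i\<in>{..<n}. if i = k then \<one>\<^bsub>R\<^esub> else \<zero>\<^bsub>R\<^esub>)"

lemma unit_vector_closed:
  assumes "ring R" shows "unit_vector R n k \<in> carrier (free_left R n)"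
proof -
  interpret R: ring R by fact
  show ?thesis by (auto simp: unit_vector_def free_left_def)
qed

lemma free_left_coordinate: "i < n \<Longrightarrow> add_hom (free_left R n) R (\<lambda>x. x i)"
  by (auto simp: add_hom_def free_left_def)

lemma free_left_expand:
  assumes R: "ring R" and x: "x \<in> carrier (free_left R n)"
  shows "(\<Oplus>\<^bsub>free_left R n\<^esub>k\<in>{..<n}. x k \<odot>\<^bsub>free_left R n\<^esub> unit_vector R n k) = x"
proof -
  interpret R: ring R by fact
  interpret F: left_module R "free_left R n" by (rule free_left_module[OF R])
  have xk: "x k \<in> carrier R" if "k < n" for k using x that by (auto simp: free_left_def)
  have cl: "(\<lambda>k. x k \<odot>\<^bsub>free_left R n\<^esub> unit_vector R n k) \<in> {..<n} \<rightarrow> carrier (free_left R n)"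
    using xk F.lsmult_closed unit_vector_closed[OF R] by auto
  let ?s = "\<Oplus>\<^bsub>free_left R n\<^esub>k\<in>{..<n}. x k \<odot>\<^bsub>free_left R n\<^esub> unit_vector R n k"
  have "?s i = x i" if i: "i < n" for i
  proof -
    have "?s i = (\<Oplus>\<^bsub>R\<^esub>k\<in>{..<n}. (x k \<odot>\<^bsub>free_left R n\<^esub> unit_vector R n k) i)"
      by (rule add_hom_finsum[OF free_left_coordinate[OF i] F.M.abelian_group_axioms
            R.abelian_group_axioms _ cl]) simp
    also have "\<dots> = (\<Oplus>\<^bsub>R\<^esub>k\<in>{..<n}. if i = k then x k else \<zero>\<^bsub>R\<^esub>)"
      by (rule R.finsum_cong') (use i xk in \<open>auto simp: free_left_def unit_vector_def\<close>)
    also have "\<dots> = x i"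
      using R.finsum_singleton[of i "{..<n}" x] i xk by auto
    finally show ?thesis .
  qed
  moreover have "?s \<in> carrier (free_left R n)" by (rule F.M.finsum_closed[OF cl])
  ultimately show ?thesis
    using x by (intro extensionalityI[of _ "{..<n}"]) (auto simp: free_left_def PiE_iff)
qed

text \<open>
  The coordinates of the isomorphism \<open>X \<otimes> R\<^sup>n \<cong> X\<^sup>n\<close>.
\<close>

definition coordinate :: "('r, 'm, 'y) rmodule_scheme \<Rightarrow> nat \<Rightarrow> ('m, nat \<Rightarrow> 'r) tens \<Rightarrow> 'm" where
  "coordinate X k = tensor_lift X (\<lambda>x r. x \<triangleleft>\<^bsub>X\<^esub> r k)"

lemma coordinate_balanced:
  assumes X: "right_module R X" and k: "k < n"
  shows "balanced R X (free_left R n) X (\<lambda>x r. x \<triangleleft>\<^bsub>X\<^esub> r k)"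
proof -
  interpret X: right_module R X by fact
  have "r k \<in> carrier R" if "r \<in> carrier (free_left R n)" for r
    using that k by (auto simp: free_left_def)
  moreover have "(r \<oplus>\<^bsub>free_left R n\<^esub> q) k = r k \<oplus>\<^bsub>R\<^esub> q k" "(a \<odot>\<^bsub>free_left R n\<^esub> r) k = a \<otimes>\<^bsub>R\<^esub> r k"
    for a r q using k by (simp_all add: free_left_def)
  ultimately show ?thesis
    by (intro balancedI)
      (simp_all add: X.rsmult_closed X.rsmult_l_distr X.rsmult_r_distr X.rsmult_assoc)
qed

lemma coordinate_add_hom:
  assumes X: "right_module R X" and k: "k < n"
  shows "add_hom (tensor R X (free_left R n)) X (coordinate X k)"
proof -
  interpret X: right_module R X by fact
  show ?thesis
    unfolding coordinate_def
    by (rule tensor_lift_add_hom[OF X free_left_module[OF X.R.ring_axioms] X.M.abelian_group_axioms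
          coordinate_balanced[OF X k]])
qed

lemma coordinate_tens:
  assumes X: "right_module R X" and k: "k < n" and "x \<in> carrier X" "r \<in> carrier (free_left R n)"
  shows "coordinate X k (tens R X (free_left R n) x r) = x \<triangleleft>\<^bsub>X\<^esub> r k"
proof -
  interpret X: right_module R X by fact
  show ?thesis
    unfolding coordinate_def
    by (rule tensor_lift_tens[OF X free_left_module[OF X.R.ring_axioms] X.M.abelian_group_axioms
          coordinate_balanced[OF X k] assms(3,4)])
qed

lemma tens_finsum_right:
  assumes X: "right_module R X" and L: "left_module R L" and x: "x \<in> carrier X"
    and I: "finite I" "g \<in> I \<rightarrow> carrier L"
  shows "tens R X L x (finsum L g I) = finsum (tensor R X L) (\<lambda>i. tens R X L x (g i)) I"
  by (rule add_hom_finsum[OF _ left_module_group[OF L] tensor_abelian_group[OF X L] I])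
    (use x in \<open>auto intro!: add_homI simp: tens_closed[OF X L] tens_add_right[OF X L]\<close>)

lemma tensor_free_expand:
  assumes X: "right_module R X" and t: "t \<in> carrier (tensor R X (free_left R n))"
  shows "(\<Oplus>\<^bsub>tensor R X (free_left R n)\<^esub>k\<in>{..<n}.
     tens R X (free_left R n) (coordinate X k t) (unit_vector R n k)) = t"
proof -
  interpret X: right_module R X by fact
  let ?F = "free_left R n"
  let ?e = "unit_vector R n"
  have R: "ring R" by unfold_locales
  have F: "left_module R ?F" by (rule free_left_module[OF R])
  interpret T: abelian_group "tensor R X ?F" by (rule tensor_abelian_group[OF X F])
  note e = unit_vector_closed[OF R, of n]
  have cl: "coordinate X k u \<in> carrier X" if "k < n" "u \<in> carrier (tensor R X ?F)" for k u
    using add_hom_closed[OF coordinate_add_hom[OF X that(1)] that(2)] .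
  let ?f = "\<lambda>t. \<Oplus>\<^bsub>tensor R X ?F\<^esub>k\<in>{..<n}. tens R X ?F (coordinate X k t) (?e k)"
  have "add_hom (tensor R X ?F) (tensor R X ?F) ?f"
  proof (rule add_homI)
    fix u v assume u: "u \<in> carrier (tensor R X ?F)"
    show "?f u \<in> carrier (tensor R X ?F)"
      using cl[OF _ u] e by (intro T.finsum_closed) (auto simp: tens_closed[OF X F])
    assume v: "v \<in> carrier (tensor R X ?F)"
    have "?f (u \<oplus>\<^bsub>tensor R X ?F\<^esub> v) = (\<Oplus>\<^bsub>tensor R X ?F\<^esub>k\<in>{..<n}.
        tens R X ?F (coordinate X k u) (?e k) \<oplus>\<^bsub>tensor R X ?F\<^esub> tens R X ?F (coordinate X k v) (?e k))"
      by (rule T.finsum_cong')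
        (use u v cl e in \<open>auto simp: add_hom_add[OF coordinate_add_hom[OF X]] tens_add_left[OF X F] tens_closed[OF X F]\<close>)
    also have "\<dots> = ?f u \<oplus>\<^bsub>tensor R X ?F\<^esub> ?f v"
      by (rule T.finsum_addf) (use u v cl e in \<open>auto simp: tens_closed[OF X F]\<close>)
    finally show "?f (u \<oplus>\<^bsub>tensor R X ?F\<^esub> v) = ?f u \<oplus>\<^bsub>tensor R X ?F\<^esub> ?f v" .
  qed
  then show ?thesis
  proof (rule tensor_ext[OF X F _ add_hom_id _ t])
    fix x r assume x: "x \<in> carrier X" and r: "r \<in> carrier ?F"
    have rk: "r k \<in> carrier R" if "k < n" for k using r that by (auto simp: free_left_def)
    have "?f (tens R X ?F x r) = (\<Oplus>\<^bsub>tensor R X ?F\<^esub>k\<in>{..<n}. tens R X ?F x (r k \<odot>\<^bsub>?F\<^esub> ?e k))"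
      by (rule T.finsum_cong')
        (use x r rk e in \<open>auto simp: coordinate_tens[OF X] tens_balanced[OF X F] tens_closed[OF X F]
          left_module.lsmult_closed[OF F]\<close>)
    also have "\<dots> = tens R X ?F x (\<Oplus>\<^bsub>?F\<^esub>k\<in>{..<n}. r k \<odot>\<^bsub>?F\<^esub> ?e k)"
      by (rule tens_finsum_right[OF X F x, symmetric]) (use rk e left_module.lsmult_closed[OF F] in auto)
    also have "\<dots> = tens R X ?F x r" by (simp add: free_left_expand[OF R r])
    finally show "?f (tens R X ?F x r) = tens R X ?F x r" .
  qed
qed

lemma tensor_free_eqI:
  assumes X: "right_module R X"
    and u: "u \<in> carrier (tensor R X (free_left R n))" and v: "v \<in> carrier (tensor R X (free_left R n))"
    and eq: "\<And>k. k < n \<Longrightarrow> coordinate X k u = coordinate X k v"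
  shows "u = v"
proof -
  interpret X: right_module R X by fact
  let ?F = "free_left R n"
  have R: "ring R" by unfold_locales
  have F: "left_module R ?F" by (rule free_left_module[OF R])
  interpret T: abelian_group "tensor R X ?F" by (rule tensor_abelian_group[OF X F])
  let ?s = "\<lambda>u. \<Oplus>\<^bsub>tensor R X ?F\<^esub>k\<in>{..<n}. tens R X ?F (coordinate X k u) (unit_vector R n k)"
  have "?s u = ?s v"
  proof (rule T.finsum_cong')
    show "(\<lambda>k. tens R X ?F (coordinate X k v) (unit_vector R n k)) \<in> {..<n} \<rightarrow> carrier (tensor R X ?F)"
      using add_hom_closed[OF coordinate_add_hom[OF X] v] unit_vector_closed[OF R]
      by (auto intro!: tens_closed[OF X F])
  qed (simp_all add: eq)
  then show ?thesis unfolding tensor_free_expand[OF X u] tensor_free_expand[OF X v] .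
qed

text \<open>
  By right exactness \<open>t\<close> is a sum of tensors \<open>x \<otimes> l\<close> with \<open>\<phi> l = 0\<close>; expanding \<open>l\<close> in the generators \<open>E\<close>
  and moving the coefficients across the tensor sign gives the normal form.
\<close>

lemma tensor_kernel_generators:
  assumes X: "right_module R X" and L: "left_module R L" and M: "left_module R M"
    and \<phi>: "left_linear R L M \<phi>" "\<phi> ` carrier L = carrier M"
    and E: "finite E" "E \<subseteq> carrier L" "{l \<in> carrier L. \<phi> l = \<zero>\<^bsub>M\<^esub>} \<subseteq> left_span R L E"
    and t: "t \<in> carrier (tensor R X L)"
    and zero: "tensor_map R X M (\<lambda>x. x) \<phi> t = \<zero>\<^bsub>tensor R X M\<^esub>"
  shows "\<exists>y. (\<forall>l\<in>E. y l \<in> carrier X) \<and> t = (\<Oplus>\<^bsub>tensor R X L\<^esub>l\<in>E. tens R X L (y l) l)"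
proof -
  interpret X: right_module R X by fact
  interpret L: left_module R L by fact
  let ?T = "tensor R X L"
  interpret T: abelian_group ?T by (rule tensor_abelian_group[OF X L])
  have EL: "\<And>l. l \<in> E \<Longrightarrow> l \<in> carrier L" using E(2) by auto
  have z: "(\<Oplus>\<^bsub>?T\<^esub>l\<in>E. tens R X L \<zero>\<^bsub>X\<^esub> l) = \<zero>\<^bsub>?T\<^esub>"
  proof -
    have "(\<Oplus>\<^bsub>?T\<^esub>l\<in>E. tens R X L \<zero>\<^bsub>X\<^esub> l) = (\<Oplus>\<^bsub>?T\<^esub>l\<in>E. \<zero>\<^bsub>?T\<^esub>)"
      by (rule T.finsum_cong') (auto simp: tens_zero_left[OF X L] EL)
    then show ?thesis by simp
  qed
  have "t \<in> add_span ?T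
    {tens R X L x l | x l. x \<in> carrier X \<and> l \<in> carrier L \<and> (x = \<zero>\<^bsub>X\<^esub> \<or> \<phi> l = \<zero>\<^bsub>M\<^esub>)}"
    by (rule tensor_right_exact[OF X X L M right_linear_id _ \<phi> t zero]) simp
  then show ?thesis
  proof induction
    case zero
    then show ?case using z by (intro exI[of _ "\<lambda>_. \<zero>\<^bsub>X\<^esub>"]) auto
  next
    case (base u)
    then obtain x l where u: "u = tens R X L x l" "x \<in> carrier X" "l \<in> carrier L"
      and or: "x = \<zero>\<^bsub>X\<^esub> \<or> \<phi> l = \<zero>\<^bsub>M\<^esub>" by blast
    show ?case
    proof (cases "x = \<zero>\<^bsub>X\<^esub>")
      case True
      then show ?thesis using z u tens_zero_left[OF X L u(3)] by (intro exI[of _ "\<lambda>_. \<zero>\<^bsub>X\<^esub>"]) auto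
    next
      case False
      then have "l \<in> left_span R L E" using or E(3) u(3) by auto
      then obtain r where r: "r \<in> E \<rightarrow> carrier R" "l = (\<Oplus>\<^bsub>L\<^esub>k\<in>E. r k \<odot>\<^bsub>L\<^esub> k)"
        using left_span_finsum[OF L E(1,2)] by blast
      have rk: "r k \<in> carrier R" if "k \<in> E" for k using r(1) that by auto
      have "u = (\<Oplus>\<^bsub>?T\<^esub>k\<in>E. tens R X L x (r k \<odot>\<^bsub>L\<^esub> k))"
        unfolding u(1) r(2)
        by (rule tens_finsum_right[OF X L u(2) E(1)]) (auto simp: rk EL L.lsmult_closed)
      also have "\<dots> = (\<Oplus>\<^bsub>?T\<^esub>k\<in>E. tens R X L (x \<triangleleft>\<^bsub>X\<^esub> r k) k)"
        by (rule T.finsum_cong')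
          (auto simp: rk EL u(2) tens_balanced[OF X L] tens_closed[OF X L] X.rsmult_closed L.lsmult_closed)
      finally show ?thesis
        using rk u(2) by (intro exI[of _ "\<lambda>k. x \<triangleleft>\<^bsub>X\<^esub> r k"]) (auto simp: X.rsmult_closed)
    qed
  next
    case (add u v)
    then obtain y w where y: "\<forall>l\<in>E. y l \<in> carrier X" "u = (\<Oplus>\<^bsub>?T\<^esub>l\<in>E. tens R X L (y l) l)"
      and w: "\<forall>l\<in>E. w l \<in> carrier X" "v = (\<Oplus>\<^bsub>?T\<^esub>l\<in>E. tens R X L (w l) l)" by blast
    have "(\<Oplus>\<^bsub>?T\<^esub>l\<in>E. tens R X L (y l \<oplus>\<^bsub>X\<^esub> w l) l)
        = (\<Oplus>\<^bsub>?T\<^esub>l\<in>E. tens R X L (y l) l \<oplus>\<^bsub>?T\<^esub> tens R X L (w l) l)"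
      by (rule T.finsum_cong') (use y w EL in \<open>auto simp: tens_add_left[OF X L] tens_closed[OF X L]\<close>)
    also have "\<dots> = u \<oplus>\<^bsub>?T\<^esub> v"
      unfolding y(2) w(2) by (rule T.finsum_addf) (use y w EL in \<open>auto simp: tens_closed[OF X L]\<close>)
    finally show ?case using y(1) w(1) by (intro exI[of _ "\<lambda>l. y l \<oplus>\<^bsub>X\<^esub> w l"]) auto
  qed
qed

lemma product_right_smult: "v \<triangleleft>\<^bsub>product_right I Q\<^esub> r = (\<lambda>i\<in>I. v i \<triangleleft>\<^bsub>Q i\<^esub> r)"
  by (simp add: product_right_def)

text \<open>
  The vanishing in each \<open>Q\<^sub>i \<otimes> M\<close> is witnessed by coefficients at the same finitely many relations of
  \<open>M\<close>. Coefficients at finitely many relations, chosen for all \<open>i\<close>, are the components of coefficients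
  in the product.
\<close>

lemma fin_presented_product_injective:
  assumes M: "left_module R M" and fp: "fin_presented R M"
    and Q: "\<And>i. i \<in> I \<Longrightarrow> right_module R (Q i)"
  shows "product_injective R M I Q"
  unfolding product_injective_def
proof (intro ballI impI)
  have R: "ring R" using M by (simp add: left_module_def)
  let ?P = "product_right I Q"
  have P: "right_module R ?P" by (rule product_right_module[OF R]) (rule Q)
  interpret P: right_module R ?P by fact
  obtain n \<phi> where \<phi>: "left_linear R (free_left R n) M \<phi>" "\<phi> ` carrier (free_left R n) = carrier M"
    and ker: "fin_gen R ((free_left R n)\<lparr>carrier := {x \<in> carrier (free_left R n). \<phi> x = \<zero>\<^bsub>M\<^esub>}\<rparr>)"
    using fp unfolding fin_presented_def by blast
  let ?F = "free_left R n"
  have F: "left_module R ?F" by (rule free_left_module[OF R])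
  obtain E where E: "finite E" "E \<subseteq> {x \<in> carrier ?F. \<phi> x = \<zero>\<^bsub>M\<^esub>}"
    "{x \<in> carrier ?F. \<phi> x = \<zero>\<^bsub>M\<^esub>} \<subseteq> left_span R ?F E"
    using ker unfolding fin_gen_iff[OF left_kernel[OF F M \<phi>(1)]] left_span_carrier_update by auto
  have EF: "E \<subseteq> carrier ?F" using E(2) by auto
  fix t assume t: "t \<in> carrier (tensor R ?P M)"
    and zero: "\<forall>i\<in>I. tensor_map R (Q i) M (\<lambda>v. v i) (\<lambda>m. m) t = \<zero>\<^bsub>tensor R (Q i) M\<^esub>"
  let ?T = "tensor R ?P ?F"
  interpret T: abelian_group ?T by (rule tensor_abelian_group[OF P F])
  have "t \<in> tensor_map R ?P M (\<lambda>x. x) \<phi> ` carrier ?T"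
    using tensor_map_surj[OF P P F M right_linear_id _ \<phi>] t by simp
  then obtain u where u: "u \<in> carrier ?T" "t = tensor_map R ?P M (\<lambda>x. x) \<phi> u" by blast
  let ?pi = "\<lambda>i. tensor_map R (Q i) ?F (\<lambda>v. v i) (\<lambda>m. m)"
  have pi: "add_hom ?T (tensor R (Q i) ?F) (?pi i)" if "i \<in> I" for i
    by (rule tensor_map_add_hom[OF P F Q[OF that] F product_right_proj[OF that] left_linear_id])
  have "\<forall>i\<in>I. \<exists>y. (\<forall>l\<in>E. y l \<in> carrier (Q i)) \<and> ?pi i u = (\<Oplus>\<^bsub>tensor R (Q i) ?F\<^esub>l\<in>E. tens R (Q i) ?F (y l) l)"
  proof
    fix i assume i: "i \<in> I"
    show "\<exists>y. (\<forall>l\<in>E. y l \<in> carrier (Q i)) \<and> ?pi i u = (\<Oplus>\<^bsub>tensor R (Q i) ?F\<^esub>l\<in>E. tens R (Q i) ?F (y l) l)"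
    proof (rule tensor_kernel_generators[OF Q[OF i] F M \<phi> E(1) EF E(3) add_hom_closed[OF pi[OF i] u(1)]])
      have "tensor_map R (Q i) M (\<lambda>x. x) \<phi> (?pi i u) = tensor_map R (Q i) M (\<lambda>v. v i) \<phi> u"
        by (rule tensor_map_compose[OF P F Q[OF i] F Q[OF i] M product_right_proj[OF i] left_linear_id
              right_linear_id \<phi>(1) refl refl u(1)])
      also have "\<dots> = tensor_map R (Q i) M (\<lambda>v. v i) (\<lambda>m. m) t"
        unfolding u(2) by (rule tensor_map_compose[OF P F P M Q[OF i] M right_linear_id \<phi>(1)
              product_right_proj[OF i] left_linear_id refl refl u(1), symmetric])
      finally show "tensor_map R (Q i) M (\<lambda>x. x) \<phi> (?pi i u) = \<zero>\<^bsub>tensor R (Q i) M\<^esub>"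
        using zero i by simp
    qed
  qed
  from bchoice[OF this] obtain y where y: "\<forall>i\<in>I. (\<forall>l\<in>E. y i l \<in> carrier (Q i)) \<and>
      ?pi i u = (\<Oplus>\<^bsub>tensor R (Q i) ?F\<^esub>l\<in>E. tens R (Q i) ?F (y i l) l)" ..
  let ?Y = "\<lambda>l. \<lambda>i\<in>I. y i l"
  have Y: "?Y l \<in> carrier ?P" if "l \<in> E" for l using y that by (auto simp: product_right_def)
  let ?v = "\<Oplus>\<^bsub>?T\<^esub>l\<in>E. tens R ?P ?F (?Y l) l"
  have vcl: "(\<lambda>l. tens R ?P ?F (?Y l) l) \<in> E \<rightarrow> carrier ?T"
    using Y EF by (auto intro!: tens_closed[OF P F])
  then have v: "?v \<in> carrier ?T" by (rule T.finsum_closed)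
  have piv: "?pi i ?v = ?pi i u" if i: "i \<in> I" for i
  proof -
    interpret Ti: abelian_group "tensor R (Q i) ?F" by (rule tensor_abelian_group[OF Q[OF i] F])
    have "?pi i ?v = (\<Oplus>\<^bsub>tensor R (Q i) ?F\<^esub>l\<in>E. ?pi i (tens R ?P ?F (?Y l) l))"
      by (rule add_hom_finsum[OF pi[OF i] T.abelian_group_axioms Ti.abelian_group_axioms E(1) vcl])
    also have "\<dots> = (\<Oplus>\<^bsub>tensor R (Q i) ?F\<^esub>l\<in>E. tens R (Q i) ?F (y i l) l)"
    proof (rule Ti.finsum_cong')
      show "(\<lambda>l. tens R (Q i) ?F (y i l) l) \<in> E \<rightarrow> carrier (tensor R (Q i) ?F)"
        using y i EF by (auto intro!: tens_closed[OF Q[OF i] F])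
      show "?pi i (tens R ?P ?F (?Y l) l) = tens R (Q i) ?F (y i l) l" if "l \<in> E" for l
        using tensor_map_tens[OF P F Q[OF i] F product_right_proj[OF i] left_linear_id Y[OF that]]
          EF that i by auto
    qed simp
    finally show ?thesis using y i by simp
  qed
  have "coordinate ?P k u = coordinate ?P k ?v" if k: "k < n" for k
  proof -
    have comp: "coordinate (Q i) k (?pi i w) = coordinate ?P k w i"
      if i: "i \<in> I" and w: "w \<in> carrier ?T" for i w
    proof (rule tensor_ext[OF P F _ _ _ w])
      show "add_hom ?T (Q i) (\<lambda>w. coordinate (Q i) k (?pi i w))"
        by (rule add_hom_compose[OF pi[OF i] coordinate_add_hom[OF Q[OF i] k]])
      show "add_hom ?T (Q i) (\<lambda>w. coordinate ?P k w i)"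
        by (rule add_hom_compose[OF coordinate_add_hom[OF P k]
              right_linear_add_hom[OF product_right_proj[OF i, of R Q]]])
      fix x r assume x: "x \<in> carrier ?P" and r: "r \<in> carrier ?F"
      then have "x i \<in> carrier (Q i)" using i by (auto simp: product_right_def)
      then show "coordinate (Q i) k (?pi i (tens R ?P ?F x r)) = coordinate ?P k (tens R ?P ?F x r) i"
        using x r i tensor_map_tens[OF P F Q[OF i] F product_right_proj[OF i] left_linear_id x r]
        by (simp add: coordinate_tens[OF Q[OF i] k] coordinate_tens[OF P k] product_right_smult)
    qed
    have "coordinate ?P k u \<in> carrier ?P" "coordinate ?P k ?v \<in> carrier ?P"
      using add_hom_closed[OF coordinate_add_hom[OF P k]] u(1) v by auto
    then show ?thesis
      using comp[OF _ u(1)] comp[OF _ v] piv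
      by (intro extensionalityI[of _ I]) (auto simp: product_right_def PiE_iff)
  qed
  then have "u = ?v" by (rule tensor_free_eqI[OF P u(1) v])
  then have "t = tensor_map R ?P M (\<lambda>x. x) \<phi> ?v" using u(2) by simp
  also have "\<dots> = (\<Oplus>\<^bsub>tensor R ?P M\<^esub>l\<in>E. tensor_map R ?P M (\<lambda>x. x) \<phi> (tens R ?P ?F (?Y l) l))"
    by (rule add_hom_finsum[OF tensor_map_add_hom[OF P F P M right_linear_id \<phi>(1)]
          T.abelian_group_axioms tensor_abelian_group[OF P M] E(1) vcl])
  also have "\<dots> = (\<Oplus>\<^bsub>tensor R ?P M\<^esub>l\<in>E. \<zero>\<^bsub>tensor R ?P M\<^esub>)"
  proof (rule abelian_monoid.finsum_cong')
    interpret TM: abelian_group "tensor R ?P M" by (rule tensor_abelian_group[OF P M])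
    show "abelian_monoid (tensor R ?P M)" by unfold_locales
    show "(\<lambda>l. \<zero>\<^bsub>tensor R ?P M\<^esub>) \<in> E \<rightarrow> carrier (tensor R ?P M)" by simp
    show "tensor_map R ?P M (\<lambda>x. x) \<phi> (tens R ?P ?F (?Y l) l) = \<zero>\<^bsub>tensor R ?P M\<^esub>" if "l \<in> E" for l
      using tensor_map_tens[OF P F P M right_linear_id \<phi>(1) Y[OF that]] E(2) that
        tens_zero_right[OF P M Y[OF that]] by auto
  qed simp
  also have "\<dots> = \<zero>\<^bsub>tensor R ?P M\<^esub>"
    using tensor_abelian_group[OF P M] by (simp add: abelian_group_def abelian_monoid.finsum_zero)
  finally show "t = \<zero>\<^bsub>tensor R ?P M\<^esub>" .
qed

lemma fin_gen_free_image:
  assumes M: "left_module R M" and fg: "fin_gen R M"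
  shows "\<exists>n \<phi>. left_linear R (free_left R n) M \<phi> \<and> \<phi> ` carrier (free_left R n) = carrier M"
proof -
  interpret M: left_module R M by fact
  have R: "ring R" by unfold_locales
  obtain X where X: "finite X" "X \<subseteq> carrier M" "carrier M \<subseteq> left_span R M X"
    using fg fin_gen_iff[OF M] by auto
  obtain g where g: "bij_betw g {..<card X} X"
    using ex_bij_betw_nat_finite[OF X(1)] by (metis atLeast0LessThan)
  let ?n = "card X" and ?F = "free_left R (card X)"
  interpret F: left_module R ?F by (rule free_left_module[OF R])
  have gM: "g k \<in> carrier M" if "k < ?n" for k using g X(2) that by (auto simp: bij_betw_def)
  have Fk: "r k \<in> carrier R" if "r \<in> carrier ?F" "k < ?n" for r k
    using that by (auto simp: free_left_def)
  let ?\<phi> = "\<lambda>r. \<Oplus>\<^bsub>M\<^esub>k\<in>{..<?n}. r k \<odot>\<^bsub>M\<^esub> g k"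
  have cl: "(\<lambda>k. r k \<odot>\<^bsub>M\<^esub> g k) \<in> {..<?n} \<rightarrow> carrier M" if "r \<in> carrier ?F" for r
    using Fk[OF that] gM by (auto intro: M.lsmult_closed)
  have lin: "left_linear R ?F M ?\<phi>"
    unfolding left_linear_iff
  proof (intro conjI add_homI ballI)
    fix r assume r: "r \<in> carrier ?F"
    show "?\<phi> r \<in> carrier M" by (rule M.M.finsum_closed[OF cl[OF r]])
    { fix q assume q: "q \<in> carrier ?F"
      have "?\<phi> (r \<oplus>\<^bsub>?F\<^esub> q) = (\<Oplus>\<^bsub>M\<^esub>k\<in>{..<?n}. r k \<odot>\<^bsub>M\<^esub> g k \<oplus>\<^bsub>M\<^esub> q k \<odot>\<^bsub>M\<^esub> g k)"
        by (rule M.M.finsum_cong') (use Fk[OF r] Fk[OF q] gM in \<open>auto simp: M.lsmult_closed free_left_def M.lsmult_l_distr\<close>)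
      also have "\<dots> = ?\<phi> r \<oplus>\<^bsub>M\<^esub> ?\<phi> q" by (rule M.M.finsum_addf[OF cl[OF r] cl[OF q]])
      finally show "?\<phi> (r \<oplus>\<^bsub>?F\<^esub> q) = ?\<phi> r \<oplus>\<^bsub>M\<^esub> ?\<phi> q" . }
    fix a assume a: "a \<in> carrier R"
    have "add_hom M M (\<lambda>x. a \<odot>\<^bsub>M\<^esub> x)"
      using a by (simp add: add_hom_def M.lsmult_closed M.lsmult_r_distr)
    then have "a \<odot>\<^bsub>M\<^esub> ?\<phi> r = (\<Oplus>\<^bsub>M\<^esub>k\<in>{..<?n}. a \<odot>\<^bsub>M\<^esub> (r k \<odot>\<^bsub>M\<^esub> g k))"
      by (rule add_hom_finsum[OF _ M.M.abelian_group_axioms M.M.abelian_group_axioms _ cl[OF r]]) simp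
    also have "\<dots> = ?\<phi> (a \<odot>\<^bsub>?F\<^esub> r)"
      by (rule M.M.finsum_cong') (use Fk[OF r] gM a in \<open>auto simp: M.lsmult_closed free_left_def M.lsmult_assoc\<close>)
    finally show "?\<phi> (a \<odot>\<^bsub>?F\<^esub> r) = a \<odot>\<^bsub>M\<^esub> ?\<phi> r" by simp
  qed
  define \<phi> where "\<phi> = ?\<phi>"
  note lin = lin[folded \<phi>_def]
  have "m \<in> \<phi> ` carrier ?F" if "m \<in> left_span R M X" for m
    using that
  proof induction
    case zero
    show ?case
      using add_hom_zero[OF left_linear_add_hom[OF lin] F.M.abelian_group_axioms M.M.abelian_group_axioms]
      by (intro image_eqI[of _ _ "\<zero>\<^bsub>?F\<^esub>"]) simp_all
  next
    case (base x)
    then have "x \<in> g ` {..<?n}" using bij_betw_imp_surj_on[OF g] by simp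
    then obtain i where i: "i < ?n" "g i = x" by blast
    have "\<phi> (unit_vector R ?n i) = (\<Oplus>\<^bsub>M\<^esub>k\<in>{..<?n}. if i = k then g k else \<zero>\<^bsub>M\<^esub>)"
      unfolding \<phi>_def
      by (rule M.M.finsum_cong') (use gM in \<open>auto simp: unit_vector_def M.lsmult_one left_module_zero_smult[OF M]\<close>)
    also have "\<dots> = x" using M.M.finsum_singleton[of i "{..<?n}" g] i gM by auto
    finally have "\<phi> (unit_vector R ?n i) = x" .
    then show ?case using unit_vector_closed[OF R] by blast
  next
    case (add x y)
    then obtain r q where "r \<in> carrier ?F" "q \<in> carrier ?F" "x = \<phi> r" "y = \<phi> q" by blast
    then show ?case
      using add_hom_add[OF left_linear_add_hom[OF lin], of r q]
      by (intro image_eqI[of _ _ "r \<oplus>\<^bsub>?F\<^esub> q"]) simp_all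
  next
    case (smult a x)
    then obtain r where r: "r \<in> carrier ?F" "x = \<phi> r" by blast
    then have "a \<odot>\<^bsub>M\<^esub> x = \<phi> (a \<odot>\<^bsub>?F\<^esub> r)" using lin smult.hyps(1) by (simp only: left_linear_iff)
    then show ?case
      using r(1) smult.hyps(1) F.lsmult_closed by (intro image_eqI[of _ _ "a \<odot>\<^bsub>?F\<^esub> r"]) simp_all
  qed
  moreover have "\<phi> ` carrier ?F \<subseteq> carrier M"
    using add_hom_closed[OF left_linear_add_hom[OF lin]] by blast
  ultimately have "\<phi> ` carrier ?F = carrier M" using X(3) by blast
  then show ?thesis using lin by blast
qed

text \<open>
  Let \<open>K\<close> be the set of all relations between finitely many generators of \<open>M\<close>. The tautological
  element of \<open>R\<^sup>K \<otimes> R\<^sup>n\<close> vanishes in every component of \<open>M\<^sup>K\<close>, so by assumption it vanishes in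
  \<open>R\<^sup>K \<otimes> M\<close>. Right exactness then writes it in terms of finitely many relations, and reading off its
  component at \<open>i \<in> K\<close> expresses the relation \<open>i\<close> through them.
\<close>

lemma fin_presentedI:
  assumes M: "left_module R M" and fg: "fin_gen R M"
    and inj: "\<And>I :: (nat \<Rightarrow> 'r) set. product_injective R M I (\<lambda>_. regular_right R)"
  shows "fin_presented (R :: ('r, 'x) ring_scheme) M"
proof -
  interpret M: left_module R M by fact
  have R: "ring R" by unfold_locales
  obtain n \<phi> where \<phi>: "left_linear R (free_left R n) M \<phi>" "\<phi> ` carrier (free_left R n) = carrier M"
    using fin_gen_free_image[OF M fg] by blast
  let ?F = "free_left R n" and ?K = "{x \<in> carrier (free_left R n). \<phi> x = \<zero>\<^bsub>M\<^esub>}"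
  let ?A = "regular_right R :: ('r, 'r) rmodule" and ?e = "unit_vector R n"
  let ?P = "product_right ?K (\<lambda>_. ?A)"
  have F: "left_module R ?F" by (rule free_left_module[OF R])
  interpret F: left_module R ?F by fact
  have A: "right_module R ?A" by (rule regular_right_module[OF R])
  have P: "right_module R ?P" by (rule product_right_module[OF R]) (rule A)
  interpret T: abelian_group "tensor R ?P ?F" by (rule tensor_abelian_group[OF P F])
  have Fk: "r k \<in> carrier R" if "r \<in> carrier ?F" "k < n" for r k
    using that by (auto simp: free_left_def)
  have proj: "right_linear R ?P ?A (\<lambda>v. v i)" if "i \<in> ?K" for i
    using product_right_proj[OF that, of R "\<lambda>_. ?A"] .
  \<comment> \<open>The element of \<open>R\<^sup>K \<otimes> R\<^sup>n\<close> whose component at a relation \<open>i \<in> K\<close> is \<open>i\<close> itself.\<close>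
  let ?c = "\<lambda>k. \<lambda>i\<in>?K. i k"
  let ?t = "\<Oplus>\<^bsub>tensor R ?P ?F\<^esub>k\<in>{..<n}. tens R ?P ?F (?c k) (?e k)"
  have c: "?c k \<in> carrier ?P" if "k < n" for k using Fk that by (auto simp: product_right_def)
  have tcl: "(\<lambda>k. tens R ?P ?F (?c k) (?e k)) \<in> {..<n} \<rightarrow> carrier (tensor R ?P ?F)"
    using c unit_vector_closed[OF R] by (auto intro!: tens_closed[OF P F])
  have t: "?t \<in> carrier (tensor R ?P ?F)" by (rule T.finsum_closed[OF tcl])
  let ?ev = "\<lambda>i. tensor_lift ?F (\<lambda>v r. v i \<odot>\<^bsub>?F\<^esub> r)"
  have bal: "balanced R ?P ?F ?F (\<lambda>v r. v i \<odot>\<^bsub>?F\<^esub> r)" if "i \<in> ?K" for i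
    by (rule scalar_balanced[OF F P proj[OF that]])
  have evh: "add_hom (tensor R ?P ?F) ?F (?ev i)" if "i \<in> ?K" for i
    by (rule tensor_lift_add_hom[OF P F F.M.abelian_group_axioms bal[OF that]])
  have evt: "?ev i (tens R ?P ?F v r) = v i \<odot>\<^bsub>?F\<^esub> r" if "i \<in> ?K" "v \<in> carrier ?P" "r \<in> carrier ?F" for i v r
    by (rule tensor_lift_tens[OF P F F.M.abelian_group_axioms bal[OF that(1)] that(2,3)])
  have ev: "?ev i ?t = i" if i: "i \<in> ?K" for i
  proof -
    have "?ev i ?t = (\<Oplus>\<^bsub>?F\<^esub>k\<in>{..<n}. ?ev i (tens R ?P ?F (?c k) (?e k)))"
      by (rule add_hom_finsum[OF evh[OF i] T.abelian_group_axioms F.M.abelian_group_axioms _ tcl]) simp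
    also have "\<dots> = (\<Oplus>\<^bsub>?F\<^esub>k\<in>{..<n}. i k \<odot>\<^bsub>?F\<^esub> ?e k)"
    proof (rule F.M.finsum_cong')
      show "(\<lambda>k. i k \<odot>\<^bsub>?F\<^esub> ?e k) \<in> {..<n} \<rightarrow> carrier ?F"
        using i Fk unit_vector_closed[OF R] F.lsmult_closed by auto
      show "?ev i (tens R ?P ?F (?c k) (?e k)) = i k \<odot>\<^bsub>?F\<^esub> ?e k" if "k \<in> {..<n}" for k
        using evt[OF i c[of k] unit_vector_closed[OF R]] that i by simp
    qed simp
    also have "\<dots> = i" by (rule free_left_expand[OF R]) (use i in simp)
    finally show ?thesis .
  qed
  let ?u = "tensor_map R ?P M (\<lambda>x. x) \<phi> ?t"
  have uh: "add_hom (tensor R ?P ?F) (tensor R ?P M) (tensor_map R ?P M (\<lambda>x. x) \<phi>)"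
    by (rule tensor_map_add_hom[OF P F P M right_linear_id \<phi>(1)])
  have "tensor_map R ?A M (\<lambda>v. v i) (\<lambda>m. m) ?u = \<zero>\<^bsub>tensor R ?A M\<^esub>" if i: "i \<in> ?K" for i
  proof -
    have "tensor_map R ?A M (\<lambda>v. v i) (\<lambda>m. m) (tensor_map R ?P M (\<lambda>x. x) \<phi> w) = tens R ?A M \<one>\<^bsub>R\<^esub> (\<phi> (?ev i w))"
      if w: "w \<in> carrier (tensor R ?P ?F)" for w
    proof (rule tensor_ext[OF P F _ _ _ w])
      show "add_hom (tensor R ?P ?F) (tensor R ?A M)
          (\<lambda>w. tensor_map R ?A M (\<lambda>v. v i) (\<lambda>m. m) (tensor_map R ?P M (\<lambda>x. x) \<phi> w))"
        by (rule add_hom_compose[OF uh tensor_map_add_hom[OF P M A M proj[OF i] left_linear_id]])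
      have "add_hom M (tensor R ?A M) (tens R ?A M \<one>\<^bsub>R\<^esub>)"
        by (rule add_homI) (simp_all add: tens_closed[OF A M] tens_add_right[OF A M])
      then show "add_hom (tensor R ?P ?F) (tensor R ?A M) (\<lambda>w. tens R ?A M \<one>\<^bsub>R\<^esub> (\<phi> (?ev i w)))"
        by (rule add_hom_compose[OF add_hom_compose[OF evh[OF i] left_linear_add_hom[OF \<phi>(1)]]])
      fix v r assume v: "v \<in> carrier ?P" and r: "r \<in> carrier ?F"
      have vi: "v i \<in> carrier R" using v i by (auto simp: product_right_def)
      have \<phi>r: "\<phi> r \<in> carrier M" using \<phi>(2) r by blast
      have "tensor_map R ?P M (\<lambda>x. x) \<phi> (tens R ?P ?F v r) = tens R ?P M v (\<phi> r)"
        by (rule tensor_map_tens[OF P F P M right_linear_id \<phi>(1) v r])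
      moreover have "tensor_map R ?A M (\<lambda>v. v i) (\<lambda>m. m) (tens R ?P M v (\<phi> r)) = tens R ?A M (v i) (\<phi> r)"
        by (rule tensor_map_tens[OF P M A M proj[OF i] left_linear_id v \<phi>r])
      moreover have "tens R ?A M (v i) (\<phi> r) = tens R ?A M \<one>\<^bsub>R\<^esub> (v i \<odot>\<^bsub>M\<^esub> \<phi> r)"
        using tens_balanced[OF A M, of "\<one>\<^bsub>R\<^esub>" "v i" "\<phi> r"] vi \<phi>r by simp
      moreover have "\<phi> (?ev i (tens R ?P ?F v r)) = v i \<odot>\<^bsub>M\<^esub> \<phi> r"
        using evt[OF i v r] \<phi>(1) vi r by (simp add: left_linear_iff)
      ultimately show "tensor_map R ?A M (\<lambda>v. v i) (\<lambda>m. m) (tensor_map R ?P M (\<lambda>x. x) \<phi> (tens R ?P ?F v r))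
          = tens R ?A M \<one>\<^bsub>R\<^esub> (\<phi> (?ev i (tens R ?P ?F v r)))" by simp
    qed
    from this[OF t] show ?thesis
      using ev[OF i] i tens_zero_right[OF A M, of "\<one>\<^bsub>R\<^esub>"] by simp
  qed
  then have "?u = \<zero>\<^bsub>tensor R ?P M\<^esub>"
    using inj[of ?K] add_hom_closed[OF uh t] unfolding product_injective_def by blast
  then have "?t \<in> add_span (tensor R ?P ?F)
      {tens R ?P ?F v r | v r. v \<in> carrier ?P \<and> r \<in> carrier ?F \<and> (v = \<zero>\<^bsub>?P\<^esub> \<or> \<phi> r = \<zero>\<^bsub>M\<^esub>)}"
    by (intro tensor_right_exact[OF P P F M right_linear_id _ \<phi> t]) simp_all
  then have "\<exists>E. finite E \<and> E \<subseteq> ?K \<and> (\<forall>i\<in>?K. ?ev i ?t \<in> left_span R ?F E)"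
  proof induction
    case zero
    have "?ev i \<zero>\<^bsub>tensor R ?P ?F\<^esub> = \<zero>\<^bsub>?F\<^esub>" if "i \<in> ?K" for i
      by (rule add_hom_zero[OF evh[OF that] T.abelian_group_axioms F.M.abelian_group_axioms])
    then show ?case by (intro exI[of _ "{}"]) (auto simp: left_span.zero)
  next
    case (base w)
    then obtain v r where w: "w = tens R ?P ?F v r" "v \<in> carrier ?P" "r \<in> carrier ?F"
      "v = \<zero>\<^bsub>?P\<^esub> \<or> \<phi> r = \<zero>\<^bsub>M\<^esub>" by blast
    show ?case
    proof (cases "\<phi> r = \<zero>\<^bsub>M\<^esub>")
      case True
      have "?ev i w \<in> left_span R ?F {r}" if i: "i \<in> ?K" for i
      proof -
        have "v i \<in> carrier R" using w(2) i by (auto simp: product_right_def)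
        then show ?thesis
          unfolding w(1) evt[OF i w(2,3)] by (rule left_span.smult) (rule left_span.base, simp)
      qed
      then show ?thesis using True w(3) by (intro exI[of _ "{r}"]) auto
    next
      case False
      have "?ev i w \<in> left_span R ?F {}" if i: "i \<in> ?K" for i
      proof -
        have "v i = \<zero>\<^bsub>R\<^esub>" using False w(4) i by (auto simp: product_right_def)
        then have "?ev i w = \<zero>\<^bsub>?F\<^esub>"
          unfolding w(1) evt[OF i w(2,3)] by (simp add: left_module_zero_smult[OF F w(3)])
        then show ?thesis by (simp add: left_span.zero)
      qed
      then show ?thesis by (intro exI[of _ "{}"]) auto
    qed
  next
    case (add w1 w2)
    obtain E1 where E1: "finite E1" "E1 \<subseteq> ?K" "\<forall>i\<in>?K. ?ev i w1 \<in> left_span R ?F E1"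
      using add.IH(1) by blast
    obtain E2 where E2: "finite E2" "E2 \<subseteq> ?K" "\<forall>i\<in>?K. ?ev i w2 \<in> left_span R ?F E2"
      using add.IH(2) by blast
    have span: "w \<in> carrier (tensor R ?P ?F)"
      if "w \<in> add_span (tensor R ?P ?F) {tens R ?P ?F v r | v r. v \<in> carrier ?P \<and> r \<in> carrier ?F \<and>
        (v = \<zero>\<^bsub>?P\<^esub> \<or> \<phi> r = \<zero>\<^bsub>M\<^esub>)}" for w
      using that by induction (auto simp: tens_closed[OF P F])
    have "?ev i (w1 \<oplus>\<^bsub>tensor R ?P ?F\<^esub> w2) \<in> left_span R ?F (E1 \<union> E2)" if i: "i \<in> ?K" for i
    proof -
      have "?ev i w1 \<in> left_span R ?F (E1 \<union> E2)" "?ev i w2 \<in> left_span R ?F (E1 \<union> E2)"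
        using E1(3) E2(3) i left_span_mono[of _ R ?F _ "E1 \<union> E2"]
        by (meson UnI1 UnI2 left_span.base subsetI)+
      then show ?thesis
        unfolding add_hom_add[OF evh[OF i] span[OF add.hyps(1)] span[OF add.hyps(2)]]
        by (rule left_span.add)
    qed
    then show ?case using E1(1,2) E2(1,2) by (intro exI[of _ "E1 \<union> E2"]) auto
  qed
  then obtain E where E: "finite E" "E \<subseteq> ?K" "\<forall>i\<in>?K. ?ev i ?t \<in> left_span R ?F E" by blast
  have "?K \<subseteq> left_span R ?F E" using E(3) ev by (metis (no_types, lifting) subsetI)
  then have "fin_gen R (?F\<lparr>carrier := ?K\<rparr>)"
    unfolding fin_gen_iff[OF left_kernel[OF F M \<phi>(1)]] left_span_carrier_update
    using E(1,2) by auto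
  then show ?thesis unfolding fin_presented_def using \<phi> by blast
qed

lemma fin_gen_of_fin_presented:
  assumes M: "left_module R M" and fp: "fin_presented R M" shows "fin_gen R M"
proof -
  obtain n \<phi> where \<phi>: "left_linear R (free_left R n) M \<phi>" "\<phi> ` carrier (free_left R n) = carrier M"
    using fp unfolding fin_presented_def by blast
  have R: "ring R" using M by (simp add: left_module_def)
  let ?F = "free_left R n" and ?X = "(\<lambda>k. \<phi> (unit_vector R n k)) ` {..<n}"
  interpret F: left_module R ?F by (rule free_left_module[OF R])
  interpret M: left_module R M by fact
  have e: "\<phi> (unit_vector R n k) \<in> carrier M" for k using \<phi>(2) unit_vector_closed[OF R] by blast
  have "m \<in> left_span R M ?X" if "m \<in> carrier M" for m
  proof -
    have "m \<in> \<phi> ` carrier ?F" using \<phi>(2) that by simp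
    then obtain r where r: "r \<in> carrier ?F" "m = \<phi> r" by blast
    have rk: "r k \<in> carrier R" if "k < n" for k using r(1) that by (auto simp: free_left_def)
    have "m = \<phi> (\<Oplus>\<^bsub>?F\<^esub>k\<in>{..<n}. r k \<odot>\<^bsub>?F\<^esub> unit_vector R n k)"
      by (simp add: free_left_expand[OF R r(1)] r(2))
    also have "\<dots> = (\<Oplus>\<^bsub>M\<^esub>k\<in>{..<n}. \<phi> (r k \<odot>\<^bsub>?F\<^esub> unit_vector R n k))"
      by (rule add_hom_finsum[OF left_linear_add_hom[OF \<phi>(1)] F.M.abelian_group_axioms
            M.M.abelian_group_axioms]) (use rk unit_vector_closed[OF R] F.lsmult_closed in auto)
    also have "\<dots> = (\<Oplus>\<^bsub>M\<^esub>k\<in>{..<n}. r k \<odot>\<^bsub>M\<^esub> \<phi> (unit_vector R n k))"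
      by (rule M.M.finsum_cong')
        (use rk unit_vector_closed[OF R] \<phi>(1) e M.lsmult_closed in \<open>auto simp: left_linear_iff\<close>)
    also have "\<dots> \<in> left_span R M ?X"
    proof -
      have "(\<Oplus>\<^bsub>M\<^esub>k\<in>J. r k \<odot>\<^bsub>M\<^esub> \<phi> (unit_vector R n k)) \<in> left_span R M ?X" if "finite J" "J \<subseteq> {..<n}" for J
        using that
      proof (induction J rule: finite_induct)
        case empty
        then show ?case by (simp add: left_span.zero)
      next
        case (insert j J)
        have "(\<lambda>k. r k \<odot>\<^bsub>M\<^esub> \<phi> (unit_vector R n k)) \<in> J \<rightarrow> carrier M"
          using insert.prems rk e M.lsmult_closed by auto
        moreover have "r j \<odot>\<^bsub>M\<^esub> \<phi> (unit_vector R n j) \<in> carrier M" "r j \<in> carrier R"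
          using insert.prems rk e M.lsmult_closed by auto
        ultimately show ?case
          using insert by (simp add: left_span.add left_span.smult left_span.base)
      qed
      then show ?thesis by simp
    qed
    finally show ?thesis .
  qed
  then show ?thesis unfolding fin_gen_iff[OF M] using e by (intro exI[of _ ?X]) auto
qed


section \<open>Linear and colinear maps\<close>

lemma tensor_right_simps [simp]:
  "carrier (tensor_right A M C) = carrier (tensor A M C)"
  "ring.zero (tensor_right A M C) = ring.zero (tensor A M C)"
  "ring.add (tensor_right A M C) = ring.add (tensor A M C)"
  "t \<triangleleft>\<^bsub>tensor_right A M C\<^esub> a = tensor_map A M C (\<lambda>m. m) (\<lambda>c. ract C c a) t"
  by (simp_all add: tensor_right_def ring.extend_def rmodule.fields_def)

lemma tensor_left_simps [simp]:
  "carrier (tensor_left A C N) = carrier (tensor A (right_part C) N)"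
  "ring.zero (tensor_left A C N) = ring.zero (tensor A (right_part C) N)"
  "ring.add (tensor_left A C N) = ring.add (tensor A (right_part C) N)"
  "a \<odot>\<^bsub>tensor_left A C N\<^esub> t = tensor_map A (right_part C) N (\<lambda>c. a \<odot>\<^bsub>C\<^esub> c) (\<lambda>n. n) t"
  by (simp_all add: tensor_left_def ring.extend_def module.fields_def)

lemma right_part_simps [simp]:
  "carrier (right_part C) = carrier C" "ring.zero (right_part C) = ring.zero C"
  "ring.add (right_part C) = ring.add C" "c \<triangleleft>\<^bsub>right_part C\<^esub> a = ract C c a"
  by (simp_all add: right_part_def)

lemma eval_module_simps [simp]:
  "carrier (eval_module P) = carrier P" "ring.zero (eval_module P) = ring.zero P"
  "ring.add (eval_module P) = ring.add P" "s \<odot>\<^bsub>eval_module P\<^esub> p = s p"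
  by (simp_all add: eval_module_def)

lemma Hom_module_simps [simp]:
  "carrier (Hom_module A P K) = Hom_A A P K"
  "ring.zero (Hom_module A P K) = (\<lambda>p\<in>carrier P. \<zero>\<^bsub>K\<^esub>)"
  "f \<oplus>\<^bsub>Hom_module A P K\<^esub> g = (\<lambda>p\<in>carrier P. f p \<oplus>\<^bsub>K\<^esub> g p)"
  "f \<triangleleft>\<^bsub>Hom_module A P K\<^esub> s = compose (carrier P) f s"
  by (simp_all add: Hom_module_def)

lemma End_C_simps [simp]:
  "carrier (End_C A C P) = Hom_C A C P P"
  "ring.zero (End_C A C P) = (\<lambda>p\<in>carrier P. \<zero>\<^bsub>P\<^esub>)"
  "f \<oplus>\<^bsub>End_C A C P\<^esub> g = (\<lambda>p\<in>carrier P. f p \<oplus>\<^bsub>P\<^esub> g p)"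
  "f \<otimes>\<^bsub>End_C A C P\<^esub> g = compose (carrier P) f g"
  "\<one>\<^bsub>End_C A C P\<^esub> = (\<lambda>p\<in>carrier P. p)"
  by (simp_all add: End_C_def endo_ring_def)

lemma Hom_A_linear: "f \<in> Hom_A A M N \<Longrightarrow> right_linear A M N f"
  and Hom_A_extensional: "f \<in> Hom_A A M N \<Longrightarrow> f \<in> extensional (carrier M)"
  by (simp_all add: Hom_A_def)

lemma Hom_A_restrict:
  assumes "right_module A M" "right_linear A M N f"
  shows "(\<lambda>m\<in>carrier M. f m) \<in> Hom_A A M N"
  using right_linear_cong[OF assms(2,1)] by (simp add: Hom_A_def)

lemma Hom_A_eqI:
  assumes "f \<in> Hom_A A M N" "g \<in> Hom_A A M N" "\<And>m. m \<in> carrier M \<Longrightarrow> f m = g m"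
  shows "f = g"
  using assms by (auto simp: Hom_A_def intro: extensionalityI)

lemma Hom_A_closed: "f \<in> Hom_A A M N \<Longrightarrow> m \<in> carrier M \<Longrightarrow> f m \<in> carrier N"
  by (auto simp: Hom_A_def right_linear_iff add_hom_def)

lemma Hom_A_compose:
  assumes "right_module A M" "f \<in> Hom_A A M N" "right_linear A N K g"
  shows "compose (carrier M) g f \<in> Hom_A A M K"
  unfolding compose_def
  by (rule Hom_A_restrict[OF assms(1)]) (rule right_linear_compose[OF Hom_A_linear[OF assms(2)] assms(3)])

lemma Hom_module_group:
  assumes M: "right_module A M" and N: "right_module A N"
  shows "abelian_group (Hom_module A M N)"
proof (rule abelian_groupI)
  interpret N: right_module A N by fact
  note H = Hom_A_restrict[OF M]
  note L = right_linear_add[OF N Hom_A_linear Hom_A_linear]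
  let ?H = "Hom_module A M N"
  show "f \<oplus>\<^bsub>?H\<^esub> g \<in> carrier ?H" if "f \<in> carrier ?H" "g \<in> carrier ?H" for f g
    using that H[OF L] by simp
  show "\<zero>\<^bsub>?H\<^esub> \<in> carrier ?H" using H[OF right_linear_zero[OF N]] by simp
  show "f \<oplus>\<^bsub>?H\<^esub> g \<oplus>\<^bsub>?H\<^esub> h = f \<oplus>\<^bsub>?H\<^esub> (g \<oplus>\<^bsub>?H\<^esub> h)"
    if "f \<in> carrier ?H" "g \<in> carrier ?H" "h \<in> carrier ?H" for f g h
    using that by (auto simp: fun_eq_iff restrict_def Hom_A_closed N.a_assoc)
  show "f \<oplus>\<^bsub>?H\<^esub> g = g \<oplus>\<^bsub>?H\<^esub> f" if "f \<in> carrier ?H" "g \<in> carrier ?H" for f g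
    using that by (auto simp: fun_eq_iff restrict_def Hom_A_closed N.a_comm)
  show "\<zero>\<^bsub>?H\<^esub> \<oplus>\<^bsub>?H\<^esub> f = f" if "f \<in> carrier ?H" for f
    using that Hom_A_extensional[of f A M N]
    by (auto simp: fun_eq_iff restrict_def Hom_A_closed extensional_def)
  show "\<exists>g\<in>carrier ?H. g \<oplus>\<^bsub>?H\<^esub> f = \<zero>\<^bsub>?H\<^esub>" if "f \<in> carrier ?H" for f
  proof (rule bexI)
    show "(\<lambda>m\<in>carrier M. \<ominus>\<^bsub>N\<^esub> f m) \<in> carrier ?H"
      using that H[OF right_linear_neg[OF N Hom_A_linear]] by simp
    show "(\<lambda>m\<in>carrier M. \<ominus>\<^bsub>N\<^esub> f m) \<oplus>\<^bsub>?H\<^esub> f = \<zero>\<^bsub>?H\<^esub>"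
      using that by (auto simp: fun_eq_iff restrict_def Hom_A_closed N.l_neg)
  qed
qed

locale comodule_setting = comodule A C P
  for A :: "('a, 'x) ring_scheme" and C :: "('a, 'c, 'y) coring_scheme"
    and P :: "('a, 'c, 'p, 'z) comodule_scheme"
begin

abbreviation "S \<equiv> End_C A C P"

abbreviation "PS \<equiv> (eval_module P :: ('p \<Rightarrow> 'p, 'p) module)"

abbreviation "HP \<equiv> Hom_module A P"

abbreviation "cmap K f \<equiv> tensor_map A K C f (\<lambda>c. c)"

lemma A_ring: "ring A" by unfold_locales

lemma C_left: "left_module A C" by unfold_locales

lemma C_right: "right_module A (right_part C)" by unfold_locales

lemma P_right: "right_module A P" by unfold_locales

lemma ract_left_linear: "a \<in> carrier A \<Longrightarrow> left_linear A C C (\<lambda>c. ract C c a)"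
  using right.rsmult_closed right.rsmult_l_distr by (simp add: left_linear_iff add_hom_def bimodule)

lemma lsmult_right_linear: "a \<in> carrier A \<Longrightarrow> right_linear A (right_part C) (right_part C) (\<lambda>c. a \<odot>\<^bsub>C\<^esub> c)"
  by (simp add: right_linear_iff add_hom_def bimodule lsmult_closed lsmult_r_distr)

lemma cmap_add_hom:
  "right_module A K \<Longrightarrow> right_module A K' \<Longrightarrow> right_linear A K K' f \<Longrightarrow>
    add_hom (tensor A K C) (tensor A K' C) (cmap K' f)"
  by (rule tensor_map_add_hom[OF _ C_left _ C_left _ left_linear_id])

lemma cmap_closed:
  "right_module A K \<Longrightarrow> right_module A K' \<Longrightarrow> right_linear A K K' f \<Longrightarrow> t \<in> carrier (tensor A K C) \<Longrightarrow>
    cmap K' f t \<in> carrier (tensor A K' C)"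
  using add_hom_closed[OF cmap_add_hom] by blast

lemma cmap_tens:
  "right_module A K \<Longrightarrow> right_module A K' \<Longrightarrow> right_linear A K K' f \<Longrightarrow> k \<in> carrier K \<Longrightarrow> c \<in> carrier C \<Longrightarrow>
    cmap K' f (tens A K C k c) = tens A K' C (f k) c"
  by (rule tensor_map_tens[OF _ C_left _ C_left _ left_linear_id])

lemma cmap_compose:
  assumes "right_module A K" "right_module A L" "right_module A N"
    and "right_linear A K L f" "right_linear A L N g"
    and "\<And>k. k \<in> carrier K \<Longrightarrow> g (f k) = h k" and "t \<in> carrier (tensor A K C)"
  shows "cmap N g (cmap L f t) = cmap N h t"
  by (rule tensor_map_compose[OF assms(1) C_left assms(2) C_left assms(3) C_left assms(4)
        left_linear_id assms(5) left_linear_id assms(6) refl assms(7)])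

lemma tensor_right_module:
  assumes K: "right_module A K" shows "right_module A (tensor_right A K C)"
proof (rule right_moduleI[OF A_ring])
  interpret K: right_module A K by fact
  let ?T = "tensor A K C"
  interpret T: abelian_group ?T by (rule tensor_abelian_group[OF K C_left])
  show "abelian_group (tensor_right A K C)"
    by (rule abelian_group_cong[OF T.abelian_group_axioms]) simp_all
  let ?r = "\<lambda>a. tensor_map A K C (\<lambda>k. k) (\<lambda>c. ract C c a)"
  have h: "add_hom ?T ?T (?r a)" if "a \<in> carrier A" for a
    by (rule tensor_map_add_hom[OF K C_left K C_left right_linear_id ract_left_linear[OF that]])
  have r: "?r a (tens A K C k c) = tens A K C k (ract C c a)"
    if "a \<in> carrier A" "k \<in> carrier K" "c \<in> carrier C" for a k c
    using tensor_map_tens[OF K C_left K C_left right_linear_id ract_left_linear[OF that(1)] that(2,3)] .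
  note rcl = right.rsmult_closed[simplified]
  show "t \<triangleleft>\<^bsub>tensor_right A K C\<^esub> a \<in> carrier (tensor_right A K C)"
    if "a \<in> carrier A" "t \<in> carrier (tensor_right A K C)" for a t
    using that add_hom_closed[OF h] by simp
  show "(t \<oplus>\<^bsub>tensor_right A K C\<^esub> t') \<triangleleft>\<^bsub>tensor_right A K C\<^esub> a =
      t \<triangleleft>\<^bsub>tensor_right A K C\<^esub> a \<oplus>\<^bsub>tensor_right A K C\<^esub> t' \<triangleleft>\<^bsub>tensor_right A K C\<^esub> a"
    if "a \<in> carrier A" "t \<in> carrier (tensor_right A K C)" "t' \<in> carrier (tensor_right A K C)" for a t t'
    using that add_hom_add[OF h] by simp
  show "t \<triangleleft>\<^bsub>tensor_right A K C\<^esub> (a \<oplus>\<^bsub>A\<^esub> b) =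
      t \<triangleleft>\<^bsub>tensor_right A K C\<^esub> a \<oplus>\<^bsub>tensor_right A K C\<^esub> t \<triangleleft>\<^bsub>tensor_right A K C\<^esub> b"
    if ab: "a \<in> carrier A" "b \<in> carrier A" and t: "t \<in> carrier (tensor_right A K C)" for a b t
  proof -
    have "?r (a \<oplus>\<^bsub>A\<^esub> b) t = ?r a t \<oplus>\<^bsub>?T\<^esub> ?r b t"
    proof (rule tensor_ext[OF K C_left h])
      show "add_hom ?T ?T (\<lambda>t. ?r a t \<oplus>\<^bsub>?T\<^esub> ?r b t)"
        by (rule add_homI) (use ab in \<open>simp_all add: add_hom_closed[OF h] add_hom_add[OF h] T.a_ac\<close>)
    qed (use ab t in \<open>simp_all add: r right.rsmult_r_distr[simplified] tens_add_right[OF K C_left] rcl\<close>)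
    then show ?thesis by simp
  qed
  show "t \<triangleleft>\<^bsub>tensor_right A K C\<^esub> (a \<otimes>\<^bsub>A\<^esub> b) =
      t \<triangleleft>\<^bsub>tensor_right A K C\<^esub> a \<triangleleft>\<^bsub>tensor_right A K C\<^esub> b"
    if ab: "a \<in> carrier A" "b \<in> carrier A" and t: "t \<in> carrier (tensor_right A K C)" for a b t
  proof -
    have "?r (a \<otimes>\<^bsub>A\<^esub> b) t = ?r b (?r a t)"
    proof (rule tensor_ext[OF K C_left h])
      show "add_hom ?T ?T (\<lambda>t. ?r b (?r a t))" by (rule add_hom_compose[OF h h]) (use ab in auto)
    qed (use ab t in \<open>simp_all add: r right.rsmult_assoc[simplified] rcl\<close>)
    then show ?thesis by simp
  qed
  show "t \<triangleleft>\<^bsub>tensor_right A K C\<^esub> \<one>\<^bsub>A\<^esub> = t" if "t \<in> carrier (tensor_right A K C)" for t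
  proof -
    have "?r \<one>\<^bsub>A\<^esub> t = t"
      by (rule tensor_map_ident[OF K C_left]) (use that right.rsmult_one[simplified] in simp_all)
    then show ?thesis by simp
  qed
qed

lemma cmap_right_linear:
  assumes K: "right_module A K" and K': "right_module A K'" and f: "right_linear A K K' f"
  shows "right_linear A (tensor_right A K C) (tensor_right A K' C) (cmap K' f)"
proof -
  have "cmap K' f (tensor_map A K C (\<lambda>k. k) (\<lambda>c. ract C c a) t) =
      tensor_map A K' C (\<lambda>k. k) (\<lambda>c. ract C c a) (cmap K' f t)"
    if a: "a \<in> carrier A" and t: "t \<in> carrier (tensor A K C)" for a t
  proof -
    note ra = ract_left_linear[OF a]
    have "cmap K' f (tensor_map A K C (\<lambda>k. k) (\<lambda>c. ract C c a) t) =
        tensor_map A K' C f (\<lambda>c. ract C c a) t"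
      by (rule tensor_map_compose[OF K C_left K C_left K' C_left right_linear_id ra f left_linear_id refl refl t])
    also have "\<dots> = tensor_map A K' C (\<lambda>k. k) (\<lambda>c. ract C c a) (cmap K' f t)"
      by (rule tensor_map_compose[OF K C_left K' C_left K' C_left f left_linear_id right_linear_id ra
            refl refl t, symmetric])
    finally show ?thesis .
  qed
  then show ?thesis
    using cmap_add_hom[OF K K' f] by (simp add: right_linear_iff add_hom_def)
qed

lemma coact_right_linear: "comodule A C M \<Longrightarrow> right_linear A M (tensor_right A M C) (coact M)"
  by (rule comodule.coact_linear)

lemma coact_closed:
  assumes "comodule A C M" "m \<in> carrier M" shows "coact M m \<in> carrier (tensor A M C)"
  using coact_right_linear[OF assms(1)] assms(2) by (auto simp: right_linear_iff add_hom_def)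

lemma P_comodule: "comodule A C P" by unfold_locales

lemma comodule_right_module: "comodule A C M \<Longrightarrow> right_module A M"
  by (simp add: comodule_def)

lemma Hom_C_Hom_A: "f \<in> Hom_C A C M N \<Longrightarrow> f \<in> Hom_A A M N"
  by (simp add: Hom_C_def)

lemmas Hom_C_linear = Hom_A_linear[OF Hom_C_Hom_A]

lemma Hom_C_coact:
  "f \<in> Hom_C A C M N \<Longrightarrow> m \<in> carrier M \<Longrightarrow> coact N (f m) = cmap N f (coact M m)"
  by (simp add: Hom_C_def)

lemma Hom_CI:
  assumes "f \<in> Hom_A A M N" "\<And>m. m \<in> carrier M \<Longrightarrow> coact N (f m) = cmap N f (coact M m)"
  shows "f \<in> Hom_C A C M N"
  using assms by (simp add: Hom_C_def)

lemma Hom_C_add: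
  assumes M: "comodule A C M" and f: "f \<in> Hom_C A C P M" and g: "g \<in> Hom_C A C P M"
  shows "(\<lambda>p\<in>carrier P. f p \<oplus>\<^bsub>M\<^esub> g p) \<in> Hom_C A C P M"
proof (rule Hom_CI)
  note MR = comodule_right_module[OF M]
  show h: "(\<lambda>p\<in>carrier P. f p \<oplus>\<^bsub>M\<^esub> g p) \<in> Hom_A A P M"
    by (rule Hom_A_restrict[OF P_right right_linear_add[OF MR Hom_C_linear[OF f] Hom_C_linear[OF g]]])
  fix p assume p: "p \<in> carrier P"
  have "coact M (f p \<oplus>\<^bsub>M\<^esub> g p) = cmap M f (coact P p) \<oplus>\<^bsub>tensor A M C\<^esub> cmap M g (coact P p)"
    using right_linear_add_hom[OF coact_right_linear[OF M]] p Hom_A_closed[OF Hom_C_Hom_A[OF f]]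
      Hom_A_closed[OF Hom_C_Hom_A[OF g]] by (simp add: add_hom_def Hom_C_coact[OF f] Hom_C_coact[OF g])
  also have "\<dots> = cmap M (\<lambda>p\<in>carrier P. f p \<oplus>\<^bsub>M\<^esub> g p) (coact P p)"
    by (rule tensor_map_add[OF P_right C_left MR Hom_C_linear[OF f] Hom_C_linear[OF g]
          Hom_A_linear[OF h] _ coact_closed[OF P_comodule p], symmetric]) simp
  finally show "coact M ((\<lambda>p\<in>carrier P. f p \<oplus>\<^bsub>M\<^esub> g p) p)
      = cmap M (\<lambda>p\<in>carrier P. f p \<oplus>\<^bsub>M\<^esub> g p) (coact P p)" using p by simp
qed

lemma Hom_C_zero:
  assumes M: "comodule A C M"
  shows "(\<lambda>p\<in>carrier P. \<zero>\<^bsub>M\<^esub>) \<in> Hom_C A C P M"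
proof (rule Hom_CI)
  note MR = comodule_right_module[OF M]
  show h: "(\<lambda>p\<in>carrier P. \<zero>\<^bsub>M\<^esub>) \<in> Hom_A A P M"
    by (rule Hom_A_restrict[OF P_right right_linear_zero[OF MR]])
  fix p assume p: "p \<in> carrier P"
  have "coact M \<zero>\<^bsub>M\<^esub> = \<zero>\<^bsub>tensor A M C\<^esub>"
    using add_hom_zero[OF right_linear_add_hom[OF coact_right_linear[OF M]] right_module_group[OF MR]
        right_module_group[OF tensor_right_module[OF MR]]] by simp
  also have "\<dots> = cmap M (\<lambda>p\<in>carrier P. \<zero>\<^bsub>M\<^esub>) (coact P p)"
    by (rule tensor_map_zero[OF P_right C_left MR Hom_A_linear[OF h] _ coact_closed[OF P_comodule p],
          symmetric]) simp
  finally show "coact M ((\<lambda>p\<in>carrier P. \<zero>\<^bsub>M\<^esub>) p) = cmap M (\<lambda>p\<in>carrier P. \<zero>\<^bsub>M\<^esub>) (coact P p)"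
    using p by simp
qed

lemma Hom_C_compose:
  assumes L: "right_module A L" and M: "right_module A M" and N: "right_module A N"
    and f: "f \<in> Hom_C A C L M" and g: "g \<in> Hom_C A C M N"
    and co: "\<And>l. l \<in> carrier L \<Longrightarrow> coact L l \<in> carrier (tensor A L C)"
  shows "compose (carrier L) g f \<in> Hom_C A C L N"
proof (rule Hom_CI)
  show h: "compose (carrier L) g f \<in> Hom_A A L N"
    by (rule Hom_A_compose[OF L Hom_C_Hom_A[OF f] Hom_C_linear[OF g]])
  fix l assume l: "l \<in> carrier L"
  have "coact N (g (f l)) = cmap N g (cmap M f (coact L l))"
    using Hom_C_coact[OF g] Hom_C_coact[OF f] l Hom_A_closed[OF Hom_C_Hom_A[OF f]] by simp
  also have "\<dots> = cmap N (compose (carrier L) g f) (coact L l)"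
    by (rule cmap_compose[OF L M N Hom_C_linear[OF f] Hom_C_linear[OF g] _ co[OF l]])
      (simp add: compose_def)
  finally show "coact N (compose (carrier L) g f l) = cmap N (compose (carrier L) g f) (coact L l)"
    using l by (simp add: compose_def)
qed

lemma Hom_C_id: "(\<lambda>p\<in>carrier P. p) \<in> Hom_C A C P P"
proof (rule Hom_CI)
  show "(\<lambda>p\<in>carrier P. p) \<in> Hom_A A P P"
    by (rule Hom_A_restrict[OF P_right right_linear_id])
  show "coact P ((\<lambda>p\<in>carrier P. p) p) = cmap P (\<lambda>p\<in>carrier P. p) (coact P p)" if p: "p \<in> carrier P" for p
    using tensor_map_ident[OF P_right C_left, of "\<lambda>p\<in>carrier P. p" "\<lambda>c. c" "coact P p"]
      coact_closed[OF P_comodule p] p by simp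
qed

lemma S_neg:
  assumes f: "f \<in> Hom_C A C P P"
  shows "(\<lambda>p\<in>carrier P. \<ominus>\<^bsub>P\<^esub> f p) \<in> Hom_C A C P P"
proof (rule Hom_CI)
  show h: "(\<lambda>p\<in>carrier P. \<ominus>\<^bsub>P\<^esub> f p) \<in> Hom_A A P P"
    by (rule Hom_A_restrict[OF P_right right_linear_neg[OF P_right Hom_C_linear[OF f]]])
  fix p assume p: "p \<in> carrier P"
  interpret T: abelian_group "tensor A P C" by (rule tensor_abelian_group[OF P_right C_left])
  let ?f = "\<lambda>p\<in>carrier P. \<ominus>\<^bsub>P\<^esub> f p"
  have fp: "f p \<in> carrier P" using Hom_A_closed[OF Hom_C_Hom_A[OF f] p] .
  note cl = coact_closed[OF P_comodule]
  have "cmap P ?f (coact P p) \<oplus>\<^bsub>tensor A P C\<^esub> cmap P f (coact P p)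
      = cmap P (\<lambda>p\<in>carrier P. \<zero>\<^bsub>P\<^esub>) (coact P p)"
    by (rule tensor_map_add[OF P_right C_left P_right Hom_A_linear[OF h] Hom_C_linear[OF f]
          Hom_C_linear[OF Hom_C_zero[OF P_comodule]] _ cl[OF p], symmetric])
      (simp add: comod.l_neg Hom_A_closed[OF Hom_C_Hom_A[OF f]])
  also have "\<dots> = coact P \<zero>\<^bsub>P\<^esub>"
    using Hom_C_coact[OF Hom_C_zero[OF P_comodule] p] p by simp
  also have "\<dots> = coact P (\<ominus>\<^bsub>P\<^esub> f p) \<oplus>\<^bsub>tensor A P C\<^esub> coact P (f p)"
    using add_hom_add[OF right_linear_add_hom[OF coact_linear], of "\<ominus>\<^bsub>P\<^esub> f p" "f p"] fp
    by (simp add: comod.l_neg)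
  finally have "cmap P ?f (coact P p) \<oplus>\<^bsub>tensor A P C\<^esub> coact P (f p)
      = coact P (\<ominus>\<^bsub>P\<^esub> f p) \<oplus>\<^bsub>tensor A P C\<^esub> coact P (f p)"
    using Hom_C_coact[OF f p] by simp
  then have "cmap P ?f (coact P p) = coact P (\<ominus>\<^bsub>P\<^esub> f p)"
    using cl fp p cmap_closed[OF P_right P_right Hom_A_linear[OF h] cl[OF p]] by simp
  then show "coact P (?f p) = cmap P ?f (coact P p)" using p by simp
qed

lemma S_group: "abelian_group S"
proof -
  interpret H: abelian_group "HP P" by (rule Hom_module_group[OF P_right P_right])
  have sub: "f \<in> Hom_C A C P P \<Longrightarrow> f \<in> carrier (HP P)" for f by (simp add: Hom_C_Hom_A)
  have eq: "ring.add S = ring.add (HP P)" "\<zero>\<^bsub>S\<^esub> = \<zero>\<^bsub>HP P\<^esub>" by (auto simp: fun_eq_iff)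
  show ?thesis
  proof (rule abelian_groupI; unfold eq)
    fix f assume f: "f \<in> carrier S"
    have "(\<lambda>p\<in>carrier P. \<ominus>\<^bsub>P\<^esub> f p) \<oplus>\<^bsub>HP P\<^esub> f = \<zero>\<^bsub>HP P\<^esub>"
      using f by (auto simp: fun_eq_iff restrict_def Hom_A_closed[OF Hom_C_Hom_A] comod.l_neg)
    then show "\<exists>g\<in>carrier S. g \<oplus>\<^bsub>HP P\<^esub> f = \<zero>\<^bsub>HP P\<^esub>" using S_neg f by fastforce
  next
    show "\<zero>\<^bsub>HP P\<^esub> \<in> carrier S" using Hom_C_zero[OF P_comodule] by simp
    fix f g assume f: "f \<in> carrier S" "g \<in> carrier S"
    then show "f \<oplus>\<^bsub>HP P\<^esub> g \<in> carrier S" using Hom_C_add[OF P_comodule] by simp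
    show "f \<oplus>\<^bsub>HP P\<^esub> g = g \<oplus>\<^bsub>HP P\<^esub> f" by (rule H.a_comm) (use sub f in auto)
    show "\<zero>\<^bsub>HP P\<^esub> \<oplus>\<^bsub>HP P\<^esub> f = f" using H.l_zero sub f by (simp del: Hom_module_simps(2,3))
    fix h assume "h \<in> carrier S"
    then show "f \<oplus>\<^bsub>HP P\<^esub> g \<oplus>\<^bsub>HP P\<^esub> h = f \<oplus>\<^bsub>HP P\<^esub> (g \<oplus>\<^bsub>HP P\<^esub> h)"
      using H.a_assoc[of f g h] sub f by (simp del: Hom_module_simps(3))
  qed
qed

lemma S_closed: "s \<in> carrier S \<Longrightarrow> p \<in> carrier P \<Longrightarrow> s p \<in> carrier P"
  using Hom_A_closed[OF Hom_C_Hom_A] by simp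

lemma S_add: "s \<in> carrier S \<Longrightarrow> p \<in> carrier P \<Longrightarrow> q \<in> carrier P \<Longrightarrow> s (p \<oplus>\<^bsub>P\<^esub> q) = s p \<oplus>\<^bsub>P\<^esub> s q"
  by (rule add_hom_add[OF right_linear_add_hom[OF Hom_C_linear]]) simp_all

lemma S_ring: "ring S"
proof (rule ringI[OF S_group])
  show "monoid S"
  proof (rule monoidI)
    fix f g assume fg: "f \<in> carrier S" "g \<in> carrier S"
    then show "f \<otimes>\<^bsub>S\<^esub> g \<in> carrier S"
      using Hom_C_compose[OF P_right P_right P_right] coact_closed[OF P_comodule] by simp
    fix h assume h: "h \<in> carrier S"
    show "f \<otimes>\<^bsub>S\<^esub> g \<otimes>\<^bsub>S\<^esub> h = f \<otimes>\<^bsub>S\<^esub> (g \<otimes>\<^bsub>S\<^esub> h)"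
      using S_closed[OF h] by (auto simp: compose_def fun_eq_iff restrict_def)
  next
    show "\<one>\<^bsub>S\<^esub> \<in> carrier S" using Hom_C_id by simp
    fix f assume f: "f \<in> carrier S"
    then have "f \<in> extensional (carrier P)" using Hom_A_extensional[OF Hom_C_Hom_A] by simp
    then show "\<one>\<^bsub>S\<^esub> \<otimes>\<^bsub>S\<^esub> f = f" "f \<otimes>\<^bsub>S\<^esub> \<one>\<^bsub>S\<^esub> = f"
      using S_closed[OF f] by (auto simp: compose_def fun_eq_iff restrict_def extensional_def)
  qed
  fix f g h assume fgh: "f \<in> carrier S" "g \<in> carrier S" "h \<in> carrier S"
  show "(f \<oplus>\<^bsub>S\<^esub> g) \<otimes>\<^bsub>S\<^esub> h = f \<otimes>\<^bsub>S\<^esub> h \<oplus>\<^bsub>S\<^esub> g \<otimes>\<^bsub>S\<^esub> h"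
    "h \<otimes>\<^bsub>S\<^esub> (f \<oplus>\<^bsub>S\<^esub> g) = h \<otimes>\<^bsub>S\<^esub> f \<oplus>\<^bsub>S\<^esub> h \<otimes>\<^bsub>S\<^esub> g"
    using S_closed[OF fgh(1)] S_closed[OF fgh(2)] S_closed[OF fgh(3)] S_add[OF fgh(3)]
    by (auto simp: compose_def fun_eq_iff restrict_def)
qed

lemma PS_left: "left_module S PS"
proof (rule left_moduleI[OF S_ring])
  show "abelian_group PS" by (rule abelian_group_cong[OF comod.abelian_group_axioms]) simp_all
qed (use S_closed S_add in \<open>auto simp: compose_def\<close>)

lemma HP_right:
  assumes K: "right_module A K" shows "right_module S (HP K)"
proof (rule right_moduleI[OF S_ring Hom_module_group[OF P_right K]])
  fix s f assume s: "s \<in> carrier S" and f: "f \<in> carrier (HP K)"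
  then show "f \<triangleleft>\<^bsub>HP K\<^esub> s \<in> carrier (HP K)"
    using Hom_A_compose[OF P_right Hom_C_Hom_A Hom_A_linear] by simp
  fix s' assume s': "s' \<in> carrier S"
  show "f \<triangleleft>\<^bsub>HP K\<^esub> (s \<oplus>\<^bsub>S\<^esub> s') = f \<triangleleft>\<^bsub>HP K\<^esub> s \<oplus>\<^bsub>HP K\<^esub> f \<triangleleft>\<^bsub>HP K\<^esub> s'"
    using right_linear_add_hom[OF Hom_A_linear[OF f[simplified]]] S_closed[OF s] S_closed[OF s']
    by (auto simp: compose_def fun_eq_iff restrict_def add_hom_def)
  show "f \<triangleleft>\<^bsub>HP K\<^esub> (s \<otimes>\<^bsub>S\<^esub> s') = f \<triangleleft>\<^bsub>HP K\<^esub> s \<triangleleft>\<^bsub>HP K\<^esub> s'"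
    using S_closed[OF s'] by (auto simp: compose_def fun_eq_iff restrict_def)
next
  fix s f g assume s: "s \<in> carrier S" "f \<in> carrier (HP K)" "g \<in> carrier (HP K)"
  show "(f \<oplus>\<^bsub>HP K\<^esub> g) \<triangleleft>\<^bsub>HP K\<^esub> s = f \<triangleleft>\<^bsub>HP K\<^esub> s \<oplus>\<^bsub>HP K\<^esub> g \<triangleleft>\<^bsub>HP K\<^esub> s"
    using S_closed[OF s(1)] by (auto simp: compose_def fun_eq_iff restrict_def)
next
  fix f assume f: "f \<in> carrier (HP K)"
  then have "f \<in> extensional (carrier P)" using Hom_A_extensional by simp
  then show "f \<triangleleft>\<^bsub>HP K\<^esub> \<one>\<^bsub>S\<^esub> = f"
    by (auto simp: compose_def fun_eq_iff restrict_def extensional_def)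
qed


section \<open>The Galois map\<close>

abbreviation "HPT K \<equiv> tensor S (HP K) PS"

abbreviation "gal K \<equiv> galois_map A C P K"

lemma gal_balanced:
  assumes K: "right_module A K"
  shows "balanced S (HP K) PS (tensor A K C) (\<lambda>g p. cmap K g (coact P p))"
proof (rule balancedI)
  fix g p assume g: "g \<in> carrier (HP K)" and p: "p \<in> carrier PS"
  have gl: "right_linear A P K g" using Hom_A_linear g by simp
  have cp: "coact P p \<in> carrier (tensor A P C)" using coact_closed[OF P_comodule] p by simp
  show "cmap K g (coact P p) \<in> carrier (tensor A K C)" by (rule cmap_closed[OF P_right K gl cp])
  fix g' assume g': "g' \<in> carrier (HP K)"
  then have gl': "right_linear A P K g'" using Hom_A_linear by simp
  show "cmap K (g \<oplus>\<^bsub>HP K\<^esub> g') (coact P p) =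
      cmap K g (coact P p) \<oplus>\<^bsub>tensor A K C\<^esub> cmap K g' (coact P p)"
  proof (rule tensor_map_add[OF P_right C_left K gl gl' _ _ cp])
    have "g \<oplus>\<^bsub>HP K\<^esub> g' \<in> carrier (HP K)"
      by (rule abelian_groupE(1)[OF right_module_group[OF HP_right[OF K]] g g'])
    then show "right_linear A P K (g \<oplus>\<^bsub>HP K\<^esub> g')" using Hom_A_linear by simp
  qed simp
next
  fix g p p' assume g: "g \<in> carrier (HP K)" and p: "p \<in> carrier PS" "p' \<in> carrier PS"
  have gl: "right_linear A P K g" using Hom_A_linear g by simp
  show "cmap K g (coact P (p \<oplus>\<^bsub>PS\<^esub> p')) =
      cmap K g (coact P p) \<oplus>\<^bsub>tensor A K C\<^esub> cmap K g (coact P p')"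
    using add_hom_add[OF cmap_add_hom[OF P_right K gl]] p coact_closed[OF P_comodule]
      add_hom_add[OF right_linear_add_hom[OF coact_linear], of p p'] by simp
next
  fix g s p assume g: "g \<in> carrier (HP K)" and s: "s \<in> carrier S" and p: "p \<in> carrier PS"
  have gl: "right_linear A P K g" and sl: "right_linear A P P s"
    using Hom_A_linear Hom_C_linear g s by auto
  have "cmap K g (cmap P s (coact P p)) = cmap K (compose (carrier P) g s) (coact P p)"
    by (rule cmap_compose[OF P_right P_right K sl gl]) (use p coact_closed[OF P_comodule] in \<open>simp_all add: compose_def\<close>)
  then show "cmap K (g \<triangleleft>\<^bsub>HP K\<^esub> s) (coact P p) = cmap K g (coact P (s \<odot>\<^bsub>PS\<^esub> p))"
    using Hom_C_coact[of s P P p] s p by simp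
qed

lemma gal_add_hom: "right_module A K \<Longrightarrow> add_hom (HPT K) (tensor A K C) (gal K)"
  unfolding galois_map_def
  by (rule tensor_lift_add_hom[OF HP_right PS_left tensor_abelian_group[OF _ C_left] gal_balanced])

lemma gal_tens:
  assumes "right_module A K" "g \<in> Hom_A A P K" "p \<in> carrier P"
  shows "gal K (tens S (HP K) PS g p) = cmap K g (coact P p)"
  unfolding galois_map_def
  by (rule tensor_lift_tens[OF HP_right PS_left tensor_abelian_group[OF _ C_left] gal_balanced])
    (use assms in simp_all)

lemma HPT_group: "right_module A K \<Longrightarrow> abelian_group (HPT K)"
  by (rule tensor_abelian_group[OF HP_right PS_left])

lemma TC_group: "right_module A K \<Longrightarrow> abelian_group (tensor A K C)"
  by (rule tensor_abelian_group[OF _ C_left])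

abbreviation "post f \<equiv> compose (carrier P) f"

lemma post_linear:
  assumes K: "right_module A K" and f: "right_linear A K K' f"
  shows "right_linear S (HP K) (HP K') (post f)"
proof -
  have "f (x \<oplus>\<^bsub>K\<^esub> y) = f x \<oplus>\<^bsub>K'\<^esub> f y" if "x \<in> carrier K" "y \<in> carrier K" for x y
    using f that by (simp add: right_linear_iff add_hom_def)
  then show ?thesis
    using S_closed Hom_A_compose[OF P_right _ f] Hom_A_closed[of _ A P K]
    by (auto simp: right_linear_iff add_hom_def compose_def fun_eq_iff restrict_def)
qed

abbreviation "hmap K f \<equiv> tensor_map S (HP K) PS (post f) (\<lambda>p. p)"

lemma hmap_add_hom:
  "right_module A K \<Longrightarrow> right_module A K' \<Longrightarrow> right_linear A K K' f \<Longrightarrow>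
    add_hom (HPT K) (HPT K') (hmap K' f)"
  by (rule tensor_map_add_hom[OF HP_right PS_left HP_right PS_left post_linear left_linear_id])

lemma hmap_tens:
  assumes "right_module A K" "right_module A K'" "right_linear A K K' f" "g \<in> Hom_A A P K" "p \<in> carrier P"
  shows "hmap K' f (tens S (HP K) PS g p) = tens S (HP K') PS (post f g) p"
  by (rule tensor_map_tens[OF HP_right PS_left HP_right PS_left post_linear left_linear_id])
    (use assms in simp_all)

lemma hmap_compose:
  assumes "right_module A K" "right_module A L" "right_module A N"
    and "right_linear A K L f" "right_linear A L N g"
    and "\<And>k. k \<in> carrier K \<Longrightarrow> g (f k) = h k" and "t \<in> carrier (HPT K)"
  shows "hmap N g (hmap L f t) = hmap N h t"
  by (rule tensor_map_compose[OF HP_right PS_left HP_right PS_left HP_right PS_left post_linear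
        left_linear_id post_linear left_linear_id _ refl assms(7)])
    (use assms Hom_A_closed[of _ A P K] in \<open>auto simp: compose_def fun_eq_iff restrict_def\<close>)

lemma gal_natural:
  assumes K: "right_module A K" and K': "right_module A K'" and f: "right_linear A K K' f"
    and z: "z \<in> carrier (HPT K)"
  shows "gal K' (hmap K' f z) = cmap K' f (gal K z)"
proof (rule tensor_ext[OF HP_right[OF K] PS_left _ _ _ z])
  show "add_hom (HPT K) (tensor A K' C) (\<lambda>z. gal K' (hmap K' f z))"
    by (rule add_hom_compose[OF hmap_add_hom[OF K K' f] gal_add_hom[OF K']])
  show "add_hom (HPT K) (tensor A K' C) (\<lambda>z. cmap K' f (gal K z))"
    by (rule add_hom_compose[OF gal_add_hom[OF K] cmap_add_hom[OF K K' f]])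
  fix g p assume g: "g \<in> carrier (HP K)" and p: "p \<in> carrier PS"
  then have g': "g \<in> Hom_A A P K" and p': "p \<in> carrier P" by simp_all
  show "gal K' (hmap K' f (tens S (HP K) PS g p)) = cmap K' f (gal K (tens S (HP K) PS g p))"
    using cmap_compose[OF P_right K K' Hom_A_linear[OF g'] f, of "post f g" "coact P p"]
      coact_closed[OF P_comodule p']
    unfolding hmap_tens[OF K K' f g' p'] gal_tens[OF K g' p']
        gal_tens[OF K' Hom_A_compose[OF P_right g' f] p'] by (simp add: compose_def)
qed


section \<open>Associativity of the tensor product\<close>

lemma tensor_left_module: "left_module A (tensor_left A C C)"
proof (rule left_moduleI[OF A_ring])
  let ?T = "tensor A (right_part C) C"
  interpret T: abelian_group ?T by (rule tensor_abelian_group[OF C_right C_left])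
  show "abelian_group (tensor_left A C C)"
    by (rule abelian_group_cong[OF T.abelian_group_axioms]) simp_all
  let ?l = "\<lambda>a. tensor_map A (right_part C) C (\<lambda>c. a \<odot>\<^bsub>C\<^esub> c) (\<lambda>d. d)"
  have h: "add_hom ?T ?T (?l a)" if "a \<in> carrier A" for a
    by (rule tensor_map_add_hom[OF C_right C_left C_right C_left lsmult_right_linear[OF that] left_linear_id])
  have l: "?l a (tens A (right_part C) C c d) = tens A (right_part C) C (a \<odot>\<^bsub>C\<^esub> c) d"
    if "a \<in> carrier A" "c \<in> carrier C" "d \<in> carrier C" for a c d
    using tensor_map_tens[OF C_right C_left C_right C_left lsmult_right_linear[OF that(1)] left_linear_id] that
    by simp
  fix a t assume a: "a \<in> carrier A" and "t \<in> carrier (tensor_left A C C)"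
  then have t: "t \<in> carrier ?T" by simp
  show "a \<odot>\<^bsub>tensor_left A C C\<^esub> t \<in> carrier (tensor_left A C C)"
    using add_hom_closed[OF h[OF a] t] by simp
  { fix u assume "u \<in> carrier (tensor_left A C C)"
    then show "a \<odot>\<^bsub>tensor_left A C C\<^esub> (t \<oplus>\<^bsub>tensor_left A C C\<^esub> u)
        = a \<odot>\<^bsub>tensor_left A C C\<^esub> t \<oplus>\<^bsub>tensor_left A C C\<^esub> a \<odot>\<^bsub>tensor_left A C C\<^esub> u"
      using add_hom_add[OF h[OF a] t] by simp }
  fix b assume b: "b \<in> carrier A"
  have "?l (a \<oplus>\<^bsub>A\<^esub> b) t = ?l a t \<oplus>\<^bsub>?T\<^esub> ?l b t"
    by (rule tensor_map_add[OF C_right C_left C_right lsmult_right_linear[OF a] lsmult_right_linear[OF b]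
          lsmult_right_linear _ t]) (use a b in \<open>simp_all add: lsmult_l_distr\<close>)
  then show "(a \<oplus>\<^bsub>A\<^esub> b) \<odot>\<^bsub>tensor_left A C C\<^esub> t
      = a \<odot>\<^bsub>tensor_left A C C\<^esub> t \<oplus>\<^bsub>tensor_left A C C\<^esub> b \<odot>\<^bsub>tensor_left A C C\<^esub> t" by simp
  have "?l a (?l b t) = ?l (a \<otimes>\<^bsub>A\<^esub> b) t"
    by (rule tensor_map_compose[OF C_right C_left C_right C_left C_right C_left lsmult_right_linear[OF b]
          left_linear_id lsmult_right_linear[OF a] left_linear_id _ refl t])
      (use a b in \<open>simp add: lsmult_assoc\<close>)
  then show "(a \<otimes>\<^bsub>A\<^esub> b) \<odot>\<^bsub>tensor_left A C C\<^esub> t = a \<odot>\<^bsub>tensor_left A C C\<^esub> (b \<odot>\<^bsub>tensor_left A C C\<^esub> t)"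
    by simp
next
  fix t assume "t \<in> carrier (tensor_left A C C)"
  then show "\<one>\<^bsub>A\<^esub> \<odot>\<^bsub>tensor_left A C C\<^esub> t = t"
    using tensor_map_ident[OF C_right C_left, of "\<lambda>c. \<one>\<^bsub>A\<^esub> \<odot>\<^bsub>C\<^esub> c" "\<lambda>d. d" t] by (simp add: lsmult_one)
qed

abbreviation "CC \<equiv> tensor_left A C C"

abbreviation "MC M \<equiv> tensor_right A M C"

abbreviation "ccten \<equiv> tens A (right_part C) C"

lemma ccten_closed: "c \<in> carrier C \<Longrightarrow> d \<in> carrier C \<Longrightarrow> ccten c d \<in> carrier CC"
  using tens_closed[OF C_right C_left, of c d] by simp

lemma ccten_add: "c \<in> carrier C \<Longrightarrow> c' \<in> carrier C \<Longrightarrow> d \<in> carrier C \<Longrightarrow> ccten (c \<oplus>\<^bsub>C\<^esub> c') d = ccten c d \<oplus>\<^bsub>CC\<^esub> ccten c' d"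
  and ccten_add': "c \<in> carrier C \<Longrightarrow> d \<in> carrier C \<Longrightarrow> d' \<in> carrier C \<Longrightarrow> ccten c (d \<oplus>\<^bsub>C\<^esub> d') = ccten c d \<oplus>\<^bsub>CC\<^esub> ccten c d'"
  and ccten_balanced: "c \<in> carrier C \<Longrightarrow> a \<in> carrier A \<Longrightarrow> d \<in> carrier C \<Longrightarrow> ccten (ract C c a) d = ccten c (a \<odot>\<^bsub>C\<^esub> d)"
  and ccten_smult: "c \<in> carrier C \<Longrightarrow> a \<in> carrier A \<Longrightarrow> d \<in> carrier C \<Longrightarrow> a \<odot>\<^bsub>CC\<^esub> ccten c d = ccten (a \<odot>\<^bsub>C\<^esub> c) d"
  using tens_add_left[OF C_right C_left, of c c' d] tens_add_right[OF C_right C_left, of c d d']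
    tens_balanced[OF C_right C_left, of c a d]
    tensor_map_tens[OF C_right C_left C_right C_left lsmult_right_linear left_linear_id, of a c d]
  by simp_all

lemma ract_closed: "c \<in> carrier C \<Longrightarrow> a \<in> carrier A \<Longrightarrow> ract C c a \<in> carrier C"
  using right.rsmult_closed[of a c] by simp

lemma tensor3_ext:
  assumes M: "right_module A M"
    and f: "add_hom (tensor A (MC M) C) G f" and g: "add_hom (tensor A (MC M) C) G g"
    and eq: "\<And>m c d. m \<in> carrier M \<Longrightarrow> c \<in> carrier C \<Longrightarrow> d \<in> carrier C \<Longrightarrow>
       f (tens A (MC M) C (tens A M C m c) d) = g (tens A (MC M) C (tens A M C m c) d)"
    and t: "t \<in> carrier (tensor A (MC M) C)"
  shows "f t = g t"
proof (rule tensor_ext[OF tensor_right_module[OF M] C_left f g _ t])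
  note MCr = tensor_right_module[OF M]
  fix s d assume s: "s \<in> carrier (MC M)" and d: "d \<in> carrier C"
  have h: "add_hom (tensor A M C) (tensor A (MC M) C) (\<lambda>s. tens A (MC M) C s d)"
    using tens_closed[OF MCr C_left _ d] tens_add_left[OF MCr C_left _ _ d] by (simp add: add_hom_def)
  show "f (tens A (MC M) C s d) = g (tens A (MC M) C s d)"
    by (rule tensor_ext[OF M C_left add_hom_compose[OF h f] add_hom_compose[OF h g]])
      (use s d eq in simp_all)
qed

lemma assoc_inner_balanced:
  assumes M: "right_module A M" and d: "d \<in> carrier C"
  shows "balanced A M C (tensor A M CC) (\<lambda>m c. tens A M CC m (ccten c d))"
  by (intro balancedI)
    (simp_all only: d tens_closed[OF M tensor_left_module] tens_add_left[OF M tensor_left_module]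
      tens_add_right[OF M tensor_left_module] tens_balanced[OF M tensor_left_module]
      ccten_closed ccten_add ccten_smult)

lemma assoc_outer_balanced:
  assumes M: "right_module A M"
  shows "balanced A (MC M) C (tensor A M CC)
    (\<lambda>t d. tensor_lift (tensor A M CC) (\<lambda>m c. tens A M CC m (ccten c d)) t)"
proof (rule balancedI)
  let ?G = "tensor A M CC"
  interpret G: abelian_group ?G by (rule tensor_abelian_group[OF M tensor_left_module])
  let ?i = "\<lambda>d. tensor_lift ?G (\<lambda>m c. tens A M CC m (ccten c d))"
  note h = tensor_lift_add_hom[OF M C_left G.abelian_group_axioms assoc_inner_balanced[OF M]]
  note v = tensor_lift_tens[OF M C_left G.abelian_group_axioms assoc_inner_balanced[OF M]]
  fix t d assume "t \<in> carrier (MC M)" and d: "d \<in> carrier C"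
  then have t: "t \<in> carrier (tensor A M C)" by simp
  show "?i d t \<in> carrier ?G" by (rule add_hom_closed[OF h[OF d] t])
  { fix u assume "u \<in> carrier (MC M)"
    then show "?i d (t \<oplus>\<^bsub>MC M\<^esub> u) = ?i d t \<oplus>\<^bsub>?G\<^esub> ?i d u" using add_hom_add[OF h[OF d] t] by simp }
  { fix e assume e: "e \<in> carrier C"
    then have de: "d \<oplus>\<^bsub>C\<^esub> e \<in> carrier C" using d by simp
    show "?i (d \<oplus>\<^bsub>C\<^esub> e) t = ?i d t \<oplus>\<^bsub>?G\<^esub> ?i e t"
    proof (rule tensor_ext[OF M C_left h[OF de] _ _ t])
      show "add_hom (tensor A M C) ?G (\<lambda>t. ?i d t \<oplus>\<^bsub>?G\<^esub> ?i e t)"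
        using h[OF d] h[OF e] by (auto simp: add_hom_def G.a_ac)
      show "?i (d \<oplus>\<^bsub>C\<^esub> e) (tens A M C m c) = ?i d (tens A M C m c) \<oplus>\<^bsub>?G\<^esub> ?i e (tens A M C m c)"
        if "m \<in> carrier M" "c \<in> carrier C" for m c
        unfolding v[OF de that] v[OF d that] v[OF e that] ccten_add'[OF that(2) d e]
        by (rule tens_add_right[OF M tensor_left_module that(1) ccten_closed[OF that(2) d] ccten_closed[OF that(2) e]])
    qed }
  fix a assume a: "a \<in> carrier A"
  note ra = ract_left_linear[OF a]
  have ad: "a \<odot>\<^bsub>C\<^esub> d \<in> carrier C" using a d by (rule lsmult_closed)
  have "?i d (tensor_map A M C (\<lambda>m. m) (\<lambda>c. ract C c a) t) = ?i (a \<odot>\<^bsub>C\<^esub> d) t"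
  proof (rule tensor_ext[OF M C_left
        add_hom_compose[OF tensor_map_add_hom[OF M C_left M C_left right_linear_id ra] h[OF d]] h[OF ad] _ t])
    fix m c assume mc: "m \<in> carrier M" "c \<in> carrier C"
    show "?i d (tensor_map A M C (\<lambda>m. m) (\<lambda>c. ract C c a) (tens A M C m c)) = ?i (a \<odot>\<^bsub>C\<^esub> d) (tens A M C m c)"
      unfolding tensor_map_tens[OF M C_left M C_left right_linear_id ra mc] v[OF ad mc]
        v[OF d mc(1) ract_closed[OF mc(2) a]] ccten_balanced[OF mc(2) a d] ..
  qed
  then show "?i d (t \<triangleleft>\<^bsub>MC M\<^esub> a) = ?i (a \<odot>\<^bsub>C\<^esub> d) t" by simp
qed

lemma assoc_add_hom:
  assumes M: "right_module A M"
  shows "add_hom (tensor A (MC M) C) (tensor A M CC) (tensor_assoc A M C)"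
  unfolding tensor_assoc_def Let_def
  by (rule tensor_lift_add_hom[OF tensor_right_module[OF M] C_left
        tensor_abelian_group[OF M tensor_left_module] assoc_outer_balanced[OF M]])

lemma assoc_tens:
  assumes M: "right_module A M" and "m \<in> carrier M" "c \<in> carrier C" "d \<in> carrier C"
  shows "tensor_assoc A M C (tens A (MC M) C (tens A M C m c) d) = tens A M CC m (ccten c d)"
proof -
  note G = tensor_abelian_group[OF M tensor_left_module]
  have "tens A M C m c \<in> carrier (MC M)" using assms by (simp add: tens_closed[OF M C_left])
  then have "tensor_assoc A M C (tens A (MC M) C (tens A M C m c) d)
      = tensor_lift (tensor A M CC) (\<lambda>m c. tens A M CC m (ccten c d)) (tens A M C m c)"
    unfolding tensor_assoc_def Let_def
    by (rule tensor_lift_tens[OF tensor_right_module[OF M] C_left G assoc_outer_balanced[OF M] _ assms(4)])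
  also have "\<dots> = tens A M CC m (ccten c d)"
    by (rule tensor_lift_tens[OF M C_left G assoc_inner_balanced[OF M assms(4)] assms(2,3)])
  finally show ?thesis .
qed

lemma assoc_natural:
  assumes M: "right_module A M" and N: "right_module A N" and f: "right_linear A M N f"
    and t: "t \<in> carrier (tensor A (MC M) C)"
  shows "tensor_assoc A N C (cmap (MC N) (cmap N f) t)
    = tensor_map A N CC f (\<lambda>u. u) (tensor_assoc A M C t)"
proof (rule tensor3_ext[OF M _ _ _ t])
  note MCr = tensor_right_module[OF M] and NCr = tensor_right_module[OF N]
  note fC = cmap_right_linear[OF M N f]
  show "add_hom (tensor A (MC M) C) (tensor A N CC) (\<lambda>t. tensor_assoc A N C (cmap (MC N) (cmap N f) t))"
    by (rule add_hom_compose[OF cmap_add_hom[OF MCr NCr fC] assoc_add_hom[OF N]])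
  show "add_hom (tensor A (MC M) C) (tensor A N CC) (\<lambda>t. tensor_map A N CC f (\<lambda>u. u) (tensor_assoc A M C t))"
    by (rule add_hom_compose[OF assoc_add_hom[OF M]
          tensor_map_add_hom[OF M tensor_left_module N tensor_left_module f left_linear_id]])
  fix m c d assume m: "m \<in> carrier M" and c: "c \<in> carrier C" and d: "d \<in> carrier C"
  have fm: "f m \<in> carrier N" using f m by (simp add: right_linear_iff add_hom_def)
  have mc: "tens A M C m c \<in> carrier (MC M)" using m c by (simp add: tens_closed[OF M C_left])
  show "tensor_assoc A N C (cmap (MC N) (cmap N f) (tens A (MC M) C (tens A M C m c) d))
      = tensor_map A N CC f (\<lambda>u. u) (tensor_assoc A M C (tens A (MC M) C (tens A M C m c) d))"
    unfolding cmap_tens[OF MCr NCr fC mc d] cmap_tens[OF M N f m c] assoc_tens[OF M m c d] assoc_tens[OF N fm c d]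
    by (rule tensor_map_tens[OF M tensor_left_module N tensor_left_module f left_linear_id m ccten_closed[OF c d],
          symmetric])
qed

text \<open>
  The inverse of \<open>tensor_assoc\<close>; it is needed because equations in \<open>(M \<otimes> C) \<otimes> C\<close> are derived from
  coassociativity, which lives in \<open>M \<otimes> (C \<otimes> C)\<close>.
\<close>

definition unassoc :: "('a, 'm, 'w) rmodule_scheme \<Rightarrow> ('m, ('c, 'c) tens) tens \<Rightarrow> (('m, 'c) tens, 'c) tens" where
  "unassoc M = tensor_lift (tensor A (MC M) C) (\<lambda>m u.
     tensor_lift (tensor A (MC M) C) (\<lambda>c d. tens A (MC M) C (tens A M C m c) d) u)"

lemma unassoc_assoc:
  assumes M: "right_module A M" and t: "t \<in> carrier (tensor A (MC M) C)"
  shows "unassoc M (tensor_assoc A M C t) = t"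
proof -
  let ?G = "tensor A (MC M) C"
  note MCr = tensor_right_module[OF M]
  interpret M: right_module A M by fact
  interpret G: abelian_group ?G by (rule tensor_abelian_group[OF MCr C_left])
  note mcl = tens_closed[OF M C_left]
  have mcl': "tens A M C m c \<in> carrier (MC M)" if "m \<in> carrier M" "c \<in> carrier C" for m c
    using mcl[OF that] by simp
  have smult: "tens A M C m c \<triangleleft>\<^bsub>MC M\<^esub> a = tens A M C m (ract C c a)"
    if "m \<in> carrier M" "c \<in> carrier C" "a \<in> carrier A" for m c a
    using tensor_map_tens[OF M C_left M C_left right_linear_id ract_left_linear[OF that(3)] that(1,2)] by simp
  have inner: "balanced A (right_part C) C ?G (\<lambda>c d. tens A (MC M) C (tens A M C m c) d)" if m: "m \<in> carrier M" for m
  proof (rule balancedI)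
    fix c d assume "c \<in> carrier (right_part C)" and d: "d \<in> carrier C"
    then have c: "c \<in> carrier C" by simp
    show "tens A (MC M) C (tens A M C m c) d \<in> carrier ?G" by (rule tens_closed[OF MCr C_left mcl'[OF m c] d])
    { fix c' assume "c' \<in> carrier (right_part C)"
      then have c': "c' \<in> carrier C" by simp
      show "tens A (MC M) C (tens A M C m (c \<oplus>\<^bsub>right_part C\<^esub> c')) d
          = tens A (MC M) C (tens A M C m c) d \<oplus>\<^bsub>?G\<^esub> tens A (MC M) C (tens A M C m c') d"
        using tens_add_left[OF MCr C_left mcl'[OF m c] mcl'[OF m c'] d] tens_add_right[OF M C_left m c c'] by simp }
    { fix d' assume d': "d' \<in> carrier C"
      show "tens A (MC M) C (tens A M C m c) (d \<oplus>\<^bsub>C\<^esub> d')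
          = tens A (MC M) C (tens A M C m c) d \<oplus>\<^bsub>?G\<^esub> tens A (MC M) C (tens A M C m c) d'"
        by (rule tens_add_right[OF MCr C_left mcl'[OF m c] d d']) }
    fix a assume a: "a \<in> carrier A"
    show "tens A (MC M) C (tens A M C m (c \<triangleleft>\<^bsub>right_part C\<^esub> a)) d = tens A (MC M) C (tens A M C m c) (a \<odot>\<^bsub>C\<^esub> d)"
      using tens_balanced[OF MCr C_left mcl'[OF m c] a d] unfolding smult[OF m c a] by simp
  qed
  let ?i = "\<lambda>m. tensor_lift ?G (\<lambda>c d. tens A (MC M) C (tens A M C m c) d)"
  have h: "add_hom (tensor A (right_part C) C) ?G (?i m)" if "m \<in> carrier M" for m
    by (rule tensor_lift_add_hom[OF C_right C_left G.abelian_group_axioms inner[OF that]])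
  have v: "?i m (ccten c d) = tens A (MC M) C (tens A M C m c) d"
    if "m \<in> carrier M" "c \<in> carrier C" "d \<in> carrier C" for m c d
    by (rule tensor_lift_tens[OF C_right C_left G.abelian_group_axioms inner]) (use that in simp_all)
  have outer: "balanced A M CC ?G ?i"
  proof (rule balancedI)
    fix m u assume m: "m \<in> carrier M" and "u \<in> carrier CC"
    then have u: "u \<in> carrier (tensor A (right_part C) C)" by simp
    show "?i m u \<in> carrier ?G" by (rule add_hom_closed[OF h[OF m] u])
    { fix u' assume "u' \<in> carrier CC"
      then show "?i m (u \<oplus>\<^bsub>CC\<^esub> u') = ?i m u \<oplus>\<^bsub>?G\<^esub> ?i m u'" using add_hom_add[OF h[OF m] u] by simp }
    { fix m' assume m': "m' \<in> carrier M"
      then have mm: "m \<oplus>\<^bsub>M\<^esub> m' \<in> carrier M" using m by simp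
      show "?i (m \<oplus>\<^bsub>M\<^esub> m') u = ?i m u \<oplus>\<^bsub>?G\<^esub> ?i m' u"
      proof (rule tensor_ext[OF C_right C_left h[OF mm] _ _ u])
        show "add_hom (tensor A (right_part C) C) ?G (\<lambda>u. ?i m u \<oplus>\<^bsub>?G\<^esub> ?i m' u)"
          using h[OF m] h[OF m'] by (auto simp: add_hom_def G.a_ac)
        fix c d assume "c \<in> carrier (right_part C)" and d: "d \<in> carrier C"
        then have c: "c \<in> carrier C" by simp
        show "?i (m \<oplus>\<^bsub>M\<^esub> m') (ccten c d) = ?i m (ccten c d) \<oplus>\<^bsub>?G\<^esub> ?i m' (ccten c d)"
          unfolding v[OF mm c d] v[OF m c d] v[OF m' c d] tens_add_left[OF M C_left m m' c]
          using tens_add_left[OF MCr C_left mcl'[OF m c] mcl'[OF m' c] d] by simp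
      qed }
    fix a assume a: "a \<in> carrier A"
    have ma: "m \<triangleleft>\<^bsub>M\<^esub> a \<in> carrier M" by (rule M.rsmult_closed[OF a m])
    have l: "add_hom (tensor A (right_part C) C) (tensor A (right_part C) C) (\<lambda>u. a \<odot>\<^bsub>CC\<^esub> u)"
      using tensor_map_add_hom[OF C_right C_left C_right C_left lsmult_right_linear[OF a] left_linear_id] by simp
    show "?i (m \<triangleleft>\<^bsub>M\<^esub> a) u = ?i m (a \<odot>\<^bsub>CC\<^esub> u)"
    proof (rule tensor_ext[OF C_right C_left h[OF ma] add_hom_compose[OF l h[OF m]] _ u])
      fix c d assume "c \<in> carrier (right_part C)" and d: "d \<in> carrier C"
      then have c: "c \<in> carrier C" by simp
      show "?i (m \<triangleleft>\<^bsub>M\<^esub> a) (ccten c d) = ?i m (a \<odot>\<^bsub>CC\<^esub> ccten c d)"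
        unfolding ccten_smult[OF c a d] v[OF ma c d] v[OF m lsmult_closed[OF a c] d]
          tens_balanced[OF M C_left m a c] ..
    qed
  qed
  have uh: "add_hom (tensor A M CC) ?G (unassoc M)"
    unfolding unassoc_def by (rule tensor_lift_add_hom[OF M tensor_left_module G.abelian_group_axioms outer])
  show ?thesis
  proof (rule tensor3_ext[OF M add_hom_compose[OF assoc_add_hom[OF M] uh] add_hom_id _ t])
    fix m c d assume m: "m \<in> carrier M" and c: "c \<in> carrier C" and d: "d \<in> carrier C"
    have "unassoc M (tens A M CC m (ccten c d)) = ?i m (ccten c d)"
      unfolding unassoc_def
      by (rule tensor_lift_tens[OF M tensor_left_module G.abelian_group_axioms outer m ccten_closed[OF c d]])
    then show "unassoc M (tensor_assoc A M C (tens A (MC M) C (tens A M C m c) d)) = tens A (MC M) C (tens A M C m c) d"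
      unfolding assoc_tens[OF M m c d] v[OF m c d] .
  qed
qed

end


section \<open>The Galois isomorphism for modules of every size\<close>

lemma Pow_lepoll_mono: "V \<lesssim> W \<Longrightarrow> Pow V \<lesssim> Pow W"
  unfolding lepoll_def by (meson image_Pow_mono inj_on_image_Pow)

locale galois_setting = comodule_setting A C P
  for A :: "('a, 'x) ring_scheme" and C :: "('a, 'c, 'y) coring_scheme"
    and P :: "('a, 'c, 'p, 'z) comodule_scheme" +
  fixes universe :: "'u itself"
  assumes large: "large_universe TYPE('u) A C P" and galois: "galois_comodule TYPE('u) A C P"
begin

text \<open>
  An endomorphism of \<open>P\<close> is determined by its graph, a subset of \<open>P \<times> P\<close>, and \<open>P \<times> P\<close> is not larger
  than the infinite set whose power set embeds into the universe.
\<close>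

lemma universe_sizes:
  shows "infinite (UNIV :: 'u set)" and "carrier A \<lesssim> (UNIV :: 'u set)"
    and "carrier P \<lesssim> (UNIV :: 'u set)" and "carrier S \<lesssim> (UNIV :: 'u set)"
proof -
  let ?W = "carrier A <+> carrier C <+> carrier P <+> (UNIV :: nat set)"
  have PW: "Pow ?W \<lesssim> (UNIV :: 'u set)"
    using large unfolding large_universe_def lepoll_def by auto
  have W: "?W \<lesssim> (UNIV :: 'u set)" by (rule lepoll_trans[OF lepoll_Pow_self PW])
  have infW: "infinite ?W" by simp
  show "infinite (UNIV :: 'u set)"
    using infW W by (meson infinite_le_lepoll lepoll_trans)
  have "carrier A \<lesssim> ?W" by (auto simp: lepoll_def intro!: exI[of _ Inl])
  then show "carrier A \<lesssim> (UNIV :: 'u set)" using W lepoll_trans by blast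
  have P: "carrier P \<lesssim> ?W"
    by (auto simp: lepoll_def inj_on_def intro!: exI[of _ "Inr \<circ> Inr \<circ> Inl"])
  then show "carrier P \<lesssim> (UNIV :: 'u set)" using W lepoll_trans by blast
  have "inj_on (\<lambda>s. (\<lambda>p. (p, s p)) ` carrier P) (carrier S)"
  proof (rule inj_onI)
    fix s s' assume s: "s \<in> carrier S" "s' \<in> carrier S"
      and eq: "(\<lambda>p. (p, s p)) ` carrier P = (\<lambda>p. (p, s' p)) ` carrier P"
    show "s = s'"
    proof (rule Hom_A_eqI[of _ A P P])
      show "s \<in> Hom_A A P P" "s' \<in> Hom_A A P P" using s by (simp_all add: Hom_C_Hom_A)
      show "s p = s' p" if "p \<in> carrier P" for p
        using eq that by (metis (no_types, lifting) Pair_inject imageE image_eqI)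
    qed
  qed
  moreover have "(\<lambda>p. (p, s p)) ` carrier P \<in> Pow (carrier P \<times> carrier P)" if "s \<in> carrier S" for s
    using S_closed[OF that] by auto
  ultimately have S: "carrier S \<lesssim> Pow (carrier P \<times> carrier P)"
    unfolding lepoll_def by blast
  have "Pow (carrier P \<times> carrier P) \<lesssim> Pow ?W"
    by (rule Pow_lepoll_mono[OF times_lepoll_infinite[OF infW P P]])
  then show "carrier S \<lesssim> (UNIV :: 'u set)" by (rule lepoll_trans[OF S lepoll_trans[OF _ PW]])
qed

lemma gal_bij:
  fixes K :: "('a, 'u) rmodule"
  shows "right_module A K \<Longrightarrow> bij_betw (gal K) (carrier (HPT K)) (carrier (tensor A K C))"
  using galois unfolding galois_comodule_def by blast

lemma gal_surj:
  assumes K: "right_module A K" and y: "y \<in> carrier (tensor A K C)"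
  shows "\<exists>z\<in>carrier (HPT K). gal K z = y"
proof -
  obtain K1 :: "('a, 'u) rmodule" and e y1 where K1: "right_module A K1" and e: "right_linear A K1 K e"
    and y1: "y1 \<in> carrier (tensor A K1 C)" "cmap K e y1 = y"
    using tensor_small_submodule[OF K C_left universe_sizes(1,2) y] by metis
  have "y1 \<in> gal K1 ` carrier (HPT K1)"
    unfolding bij_betw_imp_surj_on[OF gal_bij[OF K1]] by (rule y1(1))
  then obtain z1 where z1: "z1 \<in> carrier (HPT K1)" "gal K1 z1 = y1" by (rule imageE) simp
  then show ?thesis
    using gal_natural[OF K1 K e z1(1)] y1(2) add_hom_closed[OF hmap_add_hom[OF K1 K e] z1(1)] by auto
qed

text \<open>
  A map \<open>P \<rightarrow> K\<close> factors through every submodule that contains its image, and the images of finitely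
  many such maps together are still small, because \<open>P\<close> is.
\<close>

lemma Hom_tensor_small_submodule:
  assumes K: "right_module A K" and z: "z \<in> carrier (HPT K)"
  obtains K1 :: "('a, 'u) rmodule" and e z1 where "right_module A K1" "right_linear A K1 K e"
    "z1 \<in> carrier (HPT K1)" "hmap K e z1 = z"
proof -
  have "\<exists>G \<subseteq> carrier K. G \<lesssim> (UNIV :: 'u set) \<and>
    (\<forall>(K1 :: ('a, 'u) rmodule) e. right_module A K1 \<longrightarrow> right_linear A K1 K e \<longrightarrow>
       inj_on e (carrier K1) \<longrightarrow> G \<subseteq> e ` carrier K1 \<longrightarrow> (\<exists>z1\<in>carrier (HPT K1). hmap K e z1 = z))"
    using HP_right[OF K] PS_left z
  proof (induction rule: tensor_induct)
    case (tens g p)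
    then have g: "g \<in> Hom_A A P K" and p: "p \<in> carrier P" by simp_all
    show ?case
    proof (intro exI[of _ "g ` carrier P"] conjI allI impI)
      show "g ` carrier P \<subseteq> carrier K" using Hom_A_closed[OF g] by auto
      show "g ` carrier P \<lesssim> (UNIV :: 'u set)" by (rule lepoll_trans[OF image_lepoll universe_sizes(3)])
      fix K1 :: "('a, 'u) rmodule" and e
      assume K1: "right_module A K1" and e: "right_linear A K1 K e" and inj: "inj_on e (carrier K1)"
        and G: "g ` carrier P \<subseteq> e ` carrier K1"
      interpret K1: right_module A K1 by fact
      let ?i = "inv_into (carrier K1) e"
      let ?g = "\<lambda>p\<in>carrier P. ?i (g p)"
      have ei: "e (?i (g q)) = g q" "?i (g q) \<in> carrier K1" if "q \<in> carrier P" for q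
      proof -
        have "g q \<in> e ` carrier K1" using that G by blast
        then show "e (?i (g q)) = g q" "?i (g q) \<in> carrier K1"
          by (rule f_inv_into_f, rule inv_into_into)
      qed
      have ie: "?i (e k) = k" if "k \<in> carrier K1" for k using that inj by simp
      have "right_linear A P K1 (\<lambda>p. ?i (g p))"
        unfolding right_linear_iff
      proof (intro conjI add_homI ballI)
        fix q q' assume q: "q \<in> carrier P" "q' \<in> carrier P"
        have "g (q \<oplus>\<^bsub>P\<^esub> q') = e (?i (g q) \<oplus>\<^bsub>K1\<^esub> ?i (g q'))"
          using add_hom_add[OF right_linear_add_hom[OF Hom_A_linear[OF g]] q]
            add_hom_add[OF right_linear_add_hom[OF e]] ei q by simp
        then show "?i (g (q \<oplus>\<^bsub>P\<^esub> q')) = ?i (g q) \<oplus>\<^bsub>K1\<^esub> ?i (g q')" using ie ei q by simp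
      next
        fix r q assume q: "r \<in> carrier A" "q \<in> carrier P"
        have "g (q \<triangleleft>\<^bsub>P\<^esub> r) = e (?i (g q) \<triangleleft>\<^bsub>K1\<^esub> r)"
          using Hom_A_linear[OF g] e ei q by (simp add: right_linear_iff)
        then show "?i (g (q \<triangleleft>\<^bsub>P\<^esub> r)) = ?i (g q) \<triangleleft>\<^bsub>K1\<^esub> r" using ie ei q K1.rsmult_closed by simp
      qed (rule ei(2))
      then have g': "?g \<in> Hom_A A P K1" by (rule Hom_A_restrict[OF P_right])
      have "post e ?g = g"
        by (rule Hom_A_eqI[OF Hom_A_compose[OF P_right g' e] g]) (simp add: compose_def ei)
      then show "\<exists>z1\<in>carrier (HPT K1). hmap K e z1 = tens S (HP K) PS g p"
        using hmap_tens[OF K1 K e g' p] tens_closed[OF HP_right[OF K1] PS_left, of ?g p] g' p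
        by (intro bexI[of _ "tens S (HP K1) PS ?g p"]) simp_all
    qed
  next
    case (add z1 z2)
    obtain G1 where G1: "G1 \<subseteq> carrier K" "G1 \<lesssim> (UNIV :: 'u set)"
      "\<And>(K1 :: ('a, 'u) rmodule) e. right_module A K1 \<Longrightarrow> right_linear A K1 K e \<Longrightarrow>
       inj_on e (carrier K1) \<Longrightarrow> G1 \<subseteq> e ` carrier K1 \<Longrightarrow> \<exists>z\<in>carrier (HPT K1). hmap K e z = z1"
      using add.IH(1) by blast
    obtain G2 where G2: "G2 \<subseteq> carrier K" "G2 \<lesssim> (UNIV :: 'u set)"
      "\<And>(K1 :: ('a, 'u) rmodule) e. right_module A K1 \<Longrightarrow> right_linear A K1 K e \<Longrightarrow>
       inj_on e (carrier K1) \<Longrightarrow> G2 \<subseteq> e ` carrier K1 \<Longrightarrow> \<exists>z\<in>carrier (HPT K1). hmap K e z = z2"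
      using add.IH(2) by blast
    show ?case
    proof (intro exI[of _ "G1 \<union> G2"] conjI allI impI)
      show "G1 \<union> G2 \<lesssim> (UNIV :: 'u set)"
        by (rule Un_lepoll_infinite[OF universe_sizes(1) G1(2) G2(2)])
      fix K1 :: "('a, 'u) rmodule" and e
      assume K1: "right_module A K1" and e: "right_linear A K1 K e" and inj: "inj_on e (carrier K1)"
        and G: "G1 \<union> G2 \<subseteq> e ` carrier K1"
      obtain y1 where y1: "y1 \<in> carrier (HPT K1)" "hmap K e y1 = z1"
        using G1(3)[OF K1 e inj] G by auto
      obtain y2 where y2: "y2 \<in> carrier (HPT K1)" "hmap K e y2 = z2"
        using G2(3)[OF K1 e inj] G by auto
      show "\<exists>z\<in>carrier (HPT K1). hmap K e z = z1 \<oplus>\<^bsub>HPT K\<^esub> z2"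
      proof (rule bexI)
        show "y1 \<oplus>\<^bsub>HPT K1\<^esub> y2 \<in> carrier (HPT K1)"
          by (rule abelian_groupE(1)[OF HPT_group[OF K1] y1(1) y2(1)])
        show "hmap K e (y1 \<oplus>\<^bsub>HPT K1\<^esub> y2) = z1 \<oplus>\<^bsub>HPT K\<^esub> z2"
          using add_hom_add[OF hmap_add_hom[OF K1 K e] y1(1) y2(1)] unfolding y1(2) y2(2) .
      qed
    qed (use G1(1) G2(1) in auto)
  qed
  then obtain G where G: "G \<subseteq> carrier K" "G \<lesssim> (UNIV :: 'u set)"
      "\<And>(K1 :: ('a, 'u) rmodule) e. right_module A K1 \<Longrightarrow> right_linear A K1 K e \<Longrightarrow>
       inj_on e (carrier K1) \<Longrightarrow> G \<subseteq> e ` carrier K1 \<Longrightarrow> \<exists>z1\<in>carrier (HPT K1). hmap K e z1 = z"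
    by blast
  obtain K1 :: "('a, 'u) rmodule" and e where K1: "right_module A K1" "right_linear A K1 K e"
    "inj_on e (carrier K1)" "G \<subseteq> e ` carrier K1"
    using small_submodule[OF K universe_sizes(1,2) G(1,2)] by metis
  then show ?thesis using G(3)[OF K1] that by blast
qed

text \<open>
  The element \<open>z\<close> is carried by a small \<open>K1\<close>, and its value under the Galois map vanishes after
  passing to some small \<open>K2\<close>, to which the hypothesis applies.
\<close>

lemma gal_inj:
  assumes K: "right_module A K" and z: "z \<in> carrier (HPT K)" and zero: "gal K z = \<zero>\<^bsub>tensor A K C\<^esub>"
  shows "z = \<zero>\<^bsub>HPT K\<^esub>"
proof -
  obtain K1 :: "('a, 'u) rmodule" and e z1 where K1: "right_module A K1" and e: "right_linear A K1 K e"
    and z1: "z1 \<in> carrier (HPT K1)" "hmap K e z1 = z"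
    using Hom_tensor_small_submodule[OF K z] by metis
  have g1: "gal K1 z1 \<in> carrier (tensor A K1 C)" by (rule add_hom_closed[OF gal_add_hom[OF K1] z1(1)])
  have "cmap K e (gal K1 z1) = \<zero>\<^bsub>tensor A K C\<^esub>"
    using gal_natural[OF K1 K e z1(1)] z1(2) zero by simp
  then obtain K2 :: "('a, 'u) rmodule" and f e2 where K2: "right_module A K2"
    and f: "right_linear A K1 K2 f" and e2: "right_linear A K2 K e2"
    and ef: "\<And>k. k \<in> carrier K1 \<Longrightarrow> e2 (f k) = e k"
    and f0: "cmap K2 f (gal K1 z1) = \<zero>\<^bsub>tensor A K2 C\<^esub>"
    using tensor_zero_small_submodule[OF K1 K C_left universe_sizes(1,2) lepoll_UNIV e g1] by metis
  have hc: "hmap K2 f z1 \<in> carrier (HPT K2)"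
    by (rule add_hom_closed[OF hmap_add_hom[OF K1 K2 f] z1(1)])
  have "gal K2 (hmap K2 f z1) = \<zero>\<^bsub>tensor A K2 C\<^esub>"
    using gal_natural[OF K1 K2 f z1(1)] f0 by simp
  moreover have "inj_on (gal K2) (carrier (HPT K2))"
    using gal_bij[OF K2] by (simp add: bij_betw_def)
  ultimately have "hmap K2 f z1 = \<zero>\<^bsub>HPT K2\<^esub>"
    using add_hom_inj_iff[OF gal_add_hom[OF K2] HPT_group[OF K2] TC_group[OF K2]] hc by blast
  then have "hmap K e2 (hmap K2 f z1) = \<zero>\<^bsub>HPT K\<^esub>"
    using add_hom_zero[OF hmap_add_hom[OF K2 K e2] HPT_group[OF K2] HPT_group[OF K]] by simp
  then show ?thesis using hmap_compose[OF K1 K2 K f e2 ef z1(1)] z1(2) by simp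
qed


section \<open>The coring as a tensor product over the endomorphism ring\<close>

abbreviation "Ar \<equiv> (regular_right A :: ('a, 'a) rmodule)"

lemma Ar_right: "right_module A Ar"
  by (rule regular_right_module[OF A_ring])

text \<open>
  The map \<open>k \<otimes> L : P \<otimes> L \<rightarrow> A \<otimes> L = L\<close>.
\<close>

definition ev :: "('a, 'l, 'w) module_scheme \<Rightarrow> ('p \<Rightarrow> 'a) \<Rightarrow> ('p, 'l) tens \<Rightarrow> 'l" where
  "ev L k = tensor_lift L (\<lambda>p l. k p \<odot>\<^bsub>L\<^esub> l)"

lemma ev_add_hom:
  "left_module A L \<Longrightarrow> k \<in> Hom_A A P Ar \<Longrightarrow> add_hom (tensor A P L) L (ev L k)"
  unfolding ev_def
  by (rule tensor_lift_add_hom[OF P_right _ left_module_group scalar_balanced[OF _ P_right Hom_A_linear]])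

lemma ev_tens:
  "left_module A L \<Longrightarrow> k \<in> Hom_A A P Ar \<Longrightarrow> p \<in> carrier P \<Longrightarrow> l \<in> carrier L \<Longrightarrow>
    ev L k (tens A P L p l) = k p \<odot>\<^bsub>L\<^esub> l"
  unfolding ev_def
  by (rule tensor_lift_tens[OF P_right _ left_module_group scalar_balanced[OF _ P_right Hom_A_linear]])

text \<open>
  The canonical isomorphism \<open>A \<otimes> C \<rightarrow> C\<close>.
\<close>

definition scal :: "('a, 'c) tens \<Rightarrow> 'c" where
  "scal = tensor_lift C (\<lambda>a c. a \<odot>\<^bsub>C\<^esub> c)"

lemma scal_add_hom: "add_hom (tensor A Ar C) C scal"
  unfolding scal_def
  by (rule tensor_lift_add_hom[OF Ar_right C_left left_module_group[OF C_left]
        scalar_balanced[OF C_left Ar_right right_linear_id]])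

lemma scal_tens: "a \<in> carrier A \<Longrightarrow> c \<in> carrier C \<Longrightarrow> scal (tens A Ar C a c) = a \<odot>\<^bsub>C\<^esub> c"
  unfolding scal_def
  by (rule tensor_lift_tens[OF Ar_right C_left left_module_group[OF C_left]
        scalar_balanced[OF C_left Ar_right right_linear_id]]) simp_all

lemma scal_inverse:
  assumes t: "t \<in> carrier (tensor A Ar C)"
  shows "tens A Ar C \<one>\<^bsub>A\<^esub> (scal t) = t"
proof (rule tensor_ext[OF Ar_right C_left _ add_hom_id _ t])
  show "add_hom (tensor A Ar C) (tensor A Ar C) (\<lambda>t. tens A Ar C \<one>\<^bsub>A\<^esub> (scal t))"
    by (rule add_hom_compose[OF scal_add_hom])
      (rule add_homI; simp add: tens_closed[OF Ar_right C_left] tens_add_right[OF Ar_right C_left])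
  show "tens A Ar C \<one>\<^bsub>A\<^esub> (scal (tens A Ar C a c)) = tens A Ar C a c"
    if "a \<in> carrier Ar" "c \<in> carrier C" for a c
    using that tens_balanced[OF Ar_right C_left, of "\<one>\<^bsub>A\<^esub>" a c]
    by (simp add: scal_tens lsmult_closed lsmult_one)
qed

lemma scal_cmap:
  assumes K: "right_module A K" and k: "right_linear A K Ar k" and t: "t \<in> carrier (tensor A K C)"
  shows "scal (cmap Ar k t) = tensor_lift C (\<lambda>x c. k x \<odot>\<^bsub>C\<^esub> c) t"
proof (rule tensor_ext[OF K C_left _ _ _ t])
  note b = scalar_balanced[OF C_left K k]
  show "add_hom (tensor A K C) C (\<lambda>t. scal (cmap Ar k t))"
    by (rule add_hom_compose[OF cmap_add_hom[OF K Ar_right k] scal_add_hom])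
  show "add_hom (tensor A K C) C (tensor_lift C (\<lambda>x c. k x \<odot>\<^bsub>C\<^esub> c))"
    by (rule tensor_lift_add_hom[OF K C_left left_module_group[OF C_left] b])
  fix x c assume x: "x \<in> carrier K" "c \<in> carrier C"
  then have "k x \<in> carrier A" using k by (auto simp: right_linear_iff add_hom_def)
  then show "scal (cmap Ar k (tens A K C x c)) = tensor_lift C (\<lambda>x c. k x \<odot>\<^bsub>C\<^esub> c) (tens A K C x c)"
    using x by (simp add: cmap_tens[OF K Ar_right k] scal_tens
        tensor_lift_tens[OF K C_left left_module_group[OF C_left] b])
qed

definition theta :: "('p \<Rightarrow> 'a, 'p) tens \<Rightarrow> 'c" where
  "theta z = scal (gal Ar z)"

lemma theta_add_hom: "add_hom (HPT Ar) C theta"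
  unfolding theta_def by (rule add_hom_compose[OF gal_add_hom[OF Ar_right] scal_add_hom])

lemma theta_tens:
  assumes "k \<in> Hom_A A P Ar" "p \<in> carrier P"
  shows "theta (tens S (HP Ar) PS k p) = ev C k (coact P p)"
  unfolding theta_def gal_tens[OF Ar_right assms] ev_def
  by (rule scal_cmap[OF P_right Hom_A_linear[OF assms(1)] coact_closed[OF P_comodule assms(2)]])

lemma theta_surj:
  assumes "c \<in> carrier C" shows "\<exists>z\<in>carrier (HPT Ar). theta z = c"
proof -
  have "tens A Ar C \<one>\<^bsub>A\<^esub> c \<in> carrier (tensor A Ar C)"
    using assms by (simp add: tens_closed[OF Ar_right C_left])
  then obtain z where z: "z \<in> carrier (HPT Ar)" "gal Ar z = tens A Ar C \<one>\<^bsub>A\<^esub> c"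
    using gal_surj[OF Ar_right] by blast
  have "theta z = c" unfolding theta_def z(2) using assms by (simp add: scal_tens lsmult_one)
  then show ?thesis using z(1) by blast
qed

lemma theta_inj:
  assumes z: "z \<in> carrier (HPT Ar)" and zero: "theta z = \<zero>\<^bsub>C\<^esub>"
  shows "z = \<zero>\<^bsub>HPT Ar\<^esub>"
proof (rule gal_inj[OF Ar_right z])
  have "gal Ar z = tens A Ar C \<one>\<^bsub>A\<^esub> \<zero>\<^bsub>C\<^esub>"
    using scal_inverse[OF add_hom_closed[OF gal_add_hom[OF Ar_right] z]] zero by (simp add: theta_def)
  then show "gal Ar z = \<zero>\<^bsub>tensor A Ar C\<^esub>" by (simp add: tens_zero_right[OF Ar_right C_left])
qed


section \<open>Finite generation\<close>

text \<open>
  The set \<open>E\<close> consists of the right factors of \<open>t\<close>, so it works for all \<open>k\<close> at once.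
\<close>

lemma ev_left_span:
  assumes t: "t \<in> carrier (tensor A P C)"
  shows "\<exists>E. finite E \<and> E \<subseteq> carrier C \<and> (\<forall>k\<in>Hom_A A P Ar. ev C k t \<in> left_span A C E)"
  using P_right C_left t
proof (induction rule: tensor_induct)
  case (tens p c)
  have "ev C k (tens A P C p c) \<in> left_span A C {c}" if "k \<in> Hom_A A P Ar" for k
    using that tens Hom_A_closed[OF that, of p]
    by (simp add: ev_tens[OF C_left] left_span.smult left_span.base)
  then show ?case using tens by (intro exI[of _ "{c}"]) auto
next
  case (add t u)
  then obtain E F where E: "finite E" "E \<subseteq> carrier C" "\<forall>k\<in>Hom_A A P Ar. ev C k t \<in> left_span A C E"
    and F: "finite F" "F \<subseteq> carrier C" "\<forall>k\<in>Hom_A A P Ar. ev C k u \<in> left_span A C F" by blast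
  have "ev C k (t \<oplus>\<^bsub>tensor A P C\<^esub> u) \<in> left_span A C (E \<union> F)" if k: "k \<in> Hom_A A P Ar" for k
    unfolding add_hom_add[OF ev_add_hom[OF C_left k] add.hyps(1,2)]
    using E(3) F(3) k by (auto intro!: left_span.add intro: left_span_mono left_span.base)
  then show ?case using E(1,2) F(1,2) by (intro exI[of _ "E \<union> F"]) auto
qed

text \<open>
  For fixed \<open>E\<close>, the elements \<open>p\<close> such that \<open>theta (k \<otimes> p)\<close> lies in the span of \<open>E\<close> for every \<open>k\<close> form
  an \<open>S\<close>-submodule of \<open>P\<close>, since \<open>theta (k \<otimes> s p) = theta (k s \<otimes> p)\<close>.
\<close>

lemma fin_gen_coring:
  assumes fg: "fin_gen S PS" shows "fin_gen A C"
proof -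
  obtain X where X: "finite X" "X \<subseteq> carrier P" "carrier P \<subseteq> left_span S PS X"
    using fg fin_gen_iff[OF PS_left] by auto
  have "\<forall>x\<in>X. \<exists>E. finite E \<and> E \<subseteq> carrier C \<and>
      (\<forall>k\<in>Hom_A A P Ar. ev C k (coact P x) \<in> left_span A C E)"
    using X(2) by (intro ballI ev_left_span coact_closed[OF P_comodule]) auto
  from bchoice[OF this] obtain E where "\<forall>x\<in>X. finite (E x) \<and> E x \<subseteq> carrier C \<and>
      (\<forall>k\<in>Hom_A A P Ar. ev C k (coact P x) \<in> left_span A C (E x))" ..
  then obtain E where E: "\<And>x. x \<in> X \<Longrightarrow> finite (E x)" "\<And>x. x \<in> X \<Longrightarrow> E x \<subseteq> carrier C"
    "\<And>x k. x \<in> X \<Longrightarrow> k \<in> Hom_A A P Ar \<Longrightarrow> ev C k (coact P x) \<in> left_span A C (E x)"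
    by blast
  let ?E = "\<Union>x\<in>X. E x"
  have gen: "\<forall>k\<in>Hom_A A P Ar. theta (tens S (HP Ar) PS k p) \<in> left_span A C ?E"
    if "p \<in> left_span S PS X" for p
    using that
  proof induction
    case zero
    have "theta \<zero>\<^bsub>HPT Ar\<^esub> = \<zero>\<^bsub>C\<^esub>"
      by (rule add_hom_zero[OF theta_add_hom HPT_group[OF Ar_right] left_module_group[OF C_left]])
    then show ?case
      using tens_zero_right[OF HP_right[OF Ar_right] PS_left] by (simp add: left_span.zero)
  next
    case (base x)
    show ?case
    proof
      fix k assume k: "k \<in> Hom_A A P Ar"
      have "E x \<subseteq> left_span A C ?E" using base by (auto intro: left_span.base)
      then have "ev C k (coact P x) \<in> left_span A C ?E" by (rule left_span_mono[OF E(3)[OF base k]])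
      then show "theta (tens S (HP Ar) PS k x) \<in> left_span A C ?E"
        using base X(2) k by (simp add: theta_tens subset_iff)
    qed
  next
    case (add p q)
    have "p \<in> carrier PS" "q \<in> carrier PS"
      using add.hyps left_span_closed[OF PS_left, of X] X(2) by auto
    note pq = this
    show ?case
    proof
      fix k assume k: "k \<in> Hom_A A P Ar"
      then have kH: "k \<in> carrier (HP Ar)" by simp
      have "theta (tens S (HP Ar) PS k (p \<oplus>\<^bsub>PS\<^esub> q))
          = theta (tens S (HP Ar) PS k p) \<oplus>\<^bsub>C\<^esub> theta (tens S (HP Ar) PS k q)"
        unfolding tens_add_right[OF HP_right[OF Ar_right] PS_left kH pq]
        by (rule add_hom_add[OF theta_add_hom]; rule tens_closed[OF HP_right[OF Ar_right] PS_left kH]; fact pq)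
      then show "theta (tens S (HP Ar) PS k (p \<oplus>\<^bsub>PS\<^esub> q)) \<in> left_span A C ?E"
        using add.IH k left_span.add by metis
    qed
  next
    case (smult s p)
    have p: "p \<in> carrier PS" using smult.hyps left_span_closed[OF PS_left, of X] X(2) by auto
    have "tens S (HP Ar) PS k (s \<odot>\<^bsub>PS\<^esub> p) = tens S (HP Ar) PS (post k s) p"
      "post k s \<in> Hom_A A P Ar" if "k \<in> Hom_A A P Ar" for k
      using tens_balanced[OF HP_right[OF Ar_right] PS_left, of k s p] that smult.hyps(1) p
        right_module.rsmult_closed[OF HP_right[OF Ar_right] smult.hyps(1), of k] by simp_all
    then show ?case using smult.IH by auto
  qed
  have "theta z \<in> left_span A C ?E" if "z \<in> carrier (HPT Ar)" for z
    using HP_right[OF Ar_right] PS_left that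
  proof (induction rule: tensor_induct)
    case (tens k p)
    then show ?case using gen X(3) by auto
  next
    case (add x y)
    then show ?case by (simp add: add_hom_add[OF theta_add_hom] left_span.add)
  qed
  then have "carrier C \<subseteq> left_span A C ?E" using theta_surj by blast
  then show ?thesis
    unfolding fin_gen_iff[OF C_left] using X(1) E(1,2) by (intro exI[of _ ?E]) auto
qed


section \<open>The Mittag-Leffler property and finite presentation\<close>

text \<open>
  The Galois maps turn the question about \<open>\<Prod>Q\<^sub>i\<close> over \<open>A\<close> into the one about
  \<open>Hom\<^sub>A(P, \<Prod>Q\<^sub>i) = \<Prod>Hom\<^sub>A(P, Q\<^sub>i)\<close> over \<open>S\<close>.
\<close>

lemma product_injective_coring:
  assumes Q: "\<And>i. i \<in> I \<Longrightarrow> right_module A (Q i)"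
    and pi: "product_injective S PS I (\<lambda>i. HP (Q i))"
  shows "product_injective A C I Q"
  unfolding product_injective_def
proof (intro ballI impI)
  let ?K = "product_right I Q" and ?H = "product_right I (\<lambda>i. HP (Q i))"
  have K: "right_module A ?K" by (rule product_right_module[OF A_ring]) (rule Q)
  have H: "right_module S ?H" by (rule product_right_module[OF S_ring]) (rule HP_right[OF Q])
  fix t assume t: "t \<in> carrier (tensor A ?K C)"
    and zero: "\<forall>i\<in>I. cmap (Q i) (\<lambda>v. v i) t = \<zero>\<^bsub>tensor A (Q i) C\<^esub>"
  obtain z where z: "z \<in> carrier (HPT ?K)" "gal ?K z = t" using gal_surj[OF K t] by blast
  have zi: "hmap (Q i) (\<lambda>v. v i) z = \<zero>\<^bsub>HPT (Q i)\<^esub>" if i: "i \<in> I" for i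
  proof -
    have l: "right_linear A ?K (Q i) (\<lambda>v. v i)" by (rule product_right_proj[OF i])
    show ?thesis
      using gal_inj[OF Q[OF i] add_hom_closed[OF hmap_add_hom[OF K Q[OF i] l] z(1)]]
        gal_natural[OF K Q[OF i] l z(1)] z(2) zero i by simp
  qed
  let ?J = "\<lambda>g. \<lambda>i\<in>I. post (\<lambda>v. v i) g"
  have J: "right_linear S (HP ?K) ?H ?J"
    by (rule product_right_map) (rule post_linear[OF K product_right_proj])
  let ?w = "tensor_map S ?H PS ?J (\<lambda>p. p) z"
  have w: "?w \<in> carrier (tensor S ?H PS)"
    by (rule add_hom_closed[OF tensor_map_add_hom[OF HP_right[OF K] PS_left H PS_left J left_linear_id] z(1)])
  have "tensor_map S (HP (Q i)) PS (\<lambda>v. v i) (\<lambda>p. p) ?w = \<zero>\<^bsub>HPT (Q i)\<^esub>" if i: "i \<in> I" for i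
  proof -
    have "tensor_map S (HP (Q i)) PS (\<lambda>v. v i) (\<lambda>p. p) ?w = hmap (Q i) (\<lambda>v. v i) z"
    proof (rule tensor_map_compose[OF HP_right[OF K] PS_left H PS_left HP_right[OF Q[OF i]] PS_left J
            left_linear_id _ left_linear_id _ refl z(1)])
      show "right_linear S ?H (HP (Q i)) (\<lambda>v. v i)"
        using product_right_proj[OF i, of S "\<lambda>i. HP (Q i)"] .
    qed (use i in simp)
    then show ?thesis using zi[OF i] by simp
  qed
  then have w0: "?w = \<zero>\<^bsub>tensor S ?H PS\<^esub>"
    using pi w unfolding product_injective_def by blast
  let ?B = "\<lambda>v. \<lambda>p\<in>carrier P. \<lambda>i\<in>I. v i p"
  have B: "right_linear S ?H (HP ?K) ?B"
    unfolding right_linear_iff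
  proof (intro conjI add_homI ballI)
    fix v assume v: "v \<in> carrier ?H"
    have vi: "right_linear A P (Q i) (v i)" if "i \<in> I" for i
    proof (rule Hom_A_linear)
      show "v i \<in> Hom_A A P (Q i)" using v that by (simp add: product_right_def PiE_iff)
    qed
    have "right_linear A P ?K (\<lambda>p. \<lambda>i\<in>I. v i p)" by (rule product_right_map[OF vi])
    then show "?B v \<in> carrier (HP ?K)" using Hom_A_restrict[OF P_right] by simp
    fix s assume "s \<in> carrier S"
    then show "?B (v \<triangleleft>\<^bsub>?H\<^esub> s) = ?B v \<triangleleft>\<^bsub>HP ?K\<^esub> s"
      using S_closed by (auto simp: product_right_def compose_def fun_eq_iff restrict_def)
  next
    fix v w assume "v \<in> carrier ?H" "w \<in> carrier ?H"
    show "?B (v \<oplus>\<^bsub>?H\<^esub> w) = ?B v \<oplus>\<^bsub>HP ?K\<^esub> ?B w"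
      by (auto simp: product_right_def fun_eq_iff restrict_def)
  qed
  have "tensor_map S (HP ?K) PS ?B (\<lambda>p. p) ?w = tensor_map S (HP ?K) PS (\<lambda>g. g) (\<lambda>p. p) z"
  proof (rule tensor_map_compose[OF HP_right[OF K] PS_left H PS_left HP_right[OF K] PS_left J
          left_linear_id B left_linear_id _ refl z(1)])
    fix g assume "g \<in> carrier (HP ?K)"
    then have g: "g \<in> Hom_A A P ?K" by simp
    have "g p \<in> extensional I" if "p \<in> carrier P" for p
      using Hom_A_closed[OF g that] by (simp add: product_right_def PiE_iff)
    then show "?B (?J g) = g"
      using Hom_A_extensional[OF g] by (auto simp: compose_def fun_eq_iff restrict_def extensional_def)
  qed
  also have "\<dots> = z" by (rule tensor_map_ident[OF HP_right[OF K] PS_left refl refl z(1)])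
  finally have "z = \<zero>\<^bsub>HPT ?K\<^esub>"
    using w0 add_hom_zero[OF tensor_map_add_hom[OF H PS_left HP_right[OF K] PS_left B left_linear_id]
        tensor_abelian_group[OF H PS_left] HPT_group[OF K]] by simp
  then show "t = \<zero>\<^bsub>tensor A ?K C\<^esub>"
    using z(2) add_hom_zero[OF gal_add_hom[OF K] HPT_group[OF K] TC_group[OF K]] by simp
qed

lemma mittag_leffler_product_injective:
  fixes I :: "'u set"
  assumes ml: "mittag_leffler TYPE('u) S PS" and Q: "\<And>i. i \<in> I \<Longrightarrow> right_module A (Q i)"
  shows "product_injective A C I Q"
  by (rule product_injective_coring[OF Q])
    (auto intro!: mittag_leffler_any[OF ml PS_left universe_sizes(1,4)] HP_right Q)

lemma mittag_leffler_coring: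
  assumes ml: "mittag_leffler TYPE('u) S PS"
  shows "mittag_leffler TYPE('u) A C"
  unfolding mittag_leffler_def
proof (intro allI impI)
  fix I :: "'u set" and Q :: "'u \<Rightarrow> ('a, 'u) rmodule"
  assume "\<forall>i\<in>I. right_module A (Q i)"
  then show "inj_on (\<lambda>t. \<lambda>i\<in>I. cmap (Q i) (\<lambda>v. v i) t) (carrier (tensor A (product_right I Q) C))"
    using product_injective_iff[OF A_ring C_left, of I Q] mittag_leffler_product_injective[OF ml, of I Q]
    by simp
qed

lemma power_mittag_leffler_coring:
  assumes ml: "mittag_leffler TYPE('u) S PS"
  shows "power_mittag_leffler TYPE('u) A C"
  unfolding power_mittag_leffler_def
proof (intro allI inj_onI)
  fix I :: "'u set" and s t
  let ?K = "product_right I (\<lambda>_. Ar)"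
  have K: "right_module A ?K" by (rule product_right_module[OF A_ring]) (rule Ar_right)
  assume s: "s \<in> carrier (tensor A ?K C)" and t: "t \<in> carrier (tensor A ?K C)"
    and eq: "(\<lambda>i\<in>I. tensor_lift C (\<lambda>v m. v i \<odot>\<^bsub>C\<^esub> m) s) = (\<lambda>i\<in>I. tensor_lift C (\<lambda>v m. v i \<odot>\<^bsub>C\<^esub> m) t)"
  have "cmap Ar (\<lambda>v. v i) s = cmap Ar (\<lambda>v. v i) t" if i: "i \<in> I" for i
  proof -
    have l: "right_linear A ?K Ar (\<lambda>v. v i)" using product_right_proj[OF i, of A "\<lambda>_. Ar"] .
    have "scal (cmap Ar (\<lambda>v. v i) s) = scal (cmap Ar (\<lambda>v. v i) t)"
      using fun_cong[OF eq, of i] i by (simp add: scal_cmap[OF K l s] scal_cmap[OF K l t])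
    then show ?thesis
      using scal_inverse[OF cmap_closed[OF K Ar_right l s]] scal_inverse[OF cmap_closed[OF K Ar_right l t]]
      by metis
  qed
  moreover have "inj_on (\<lambda>t. \<lambda>i\<in>I. cmap Ar (\<lambda>v. v i) t) (carrier (tensor A ?K C))"
    using product_injective_iff[OF A_ring C_left, of I "\<lambda>_. Ar"]
      mittag_leffler_product_injective[OF ml, of I "\<lambda>_. Ar"] Ar_right by simp
  moreover have "(\<lambda>i\<in>I. cmap Ar (\<lambda>v. v i) s) = (\<lambda>i\<in>I. cmap Ar (\<lambda>v. v i) t)"
    using calculation(1) by (rule restrict_ext)
  ultimately show "s = t" using inj_onD[OF _ _ s t] by blast
qed

lemma fin_presented_coring:
  assumes fp: "fin_presented S PS" shows "fin_presented A C"
proof (rule fin_presentedI[OF C_left fin_gen_coring[OF fin_gen_of_fin_presented[OF PS_left fp]]])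
  fix I :: "(nat \<Rightarrow> 'a) set"
  show "product_injective A C I (\<lambda>_. Ar)"
    by (rule product_injective_coring[OF Ar_right
          fin_presented_product_injective[OF PS_left fp HP_right[OF Ar_right]]])
qed


section \<open>Projectivity and local projectivity\<close>

text \<open>
  \<open>P \<otimes>\<^sub>A L\<close> as a left \<open>S\<close>-module through the first factor.
\<close>

definition tensor_end :: "('a, 'l, 'w) module_scheme \<Rightarrow> ('p \<Rightarrow> 'p, ('p, 'l) tens) module" where
  "tensor_end L = \<lparr>carrier = carrier (tensor A P L), monoid.mult = undefined, monoid.one = undefined,
     ring.zero = ring.zero (tensor A P L), ring.add = ring.add (tensor A P L),
     smult = (\<lambda>s. tensor_map A P L s (\<lambda>l. l))\<rparr>"

lemma tensor_end_simps [simp]: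
  "carrier (tensor_end L) = carrier (tensor A P L)" "ring.zero (tensor_end L) = ring.zero (tensor A P L)"
  "ring.add (tensor_end L) = ring.add (tensor A P L)"
  "s \<odot>\<^bsub>tensor_end L\<^esub> t = tensor_map A P L s (\<lambda>l. l) t"
  by (simp_all add: tensor_end_def)

lemma S_right_linear: "s \<in> carrier S \<Longrightarrow> right_linear A P P s"
  by (simp add: Hom_C_linear)

lemma tensor_end_left:
  assumes L: "left_module A L" shows "left_module S (tensor_end L)"
proof (rule left_moduleI[OF S_ring])
  show "abelian_group (tensor_end L)"
    by (rule abelian_group_cong[OF tensor_abelian_group[OF P_right L]]) simp_all
  have h: "add_hom (tensor A P L) (tensor A P L) (tensor_map A P L s (\<lambda>l. l))" if "s \<in> carrier S" for s
    by (rule tensor_map_add_hom[OF P_right L P_right L S_right_linear[OF that] left_linear_id])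
  fix s t assume s: "s \<in> carrier S" and t: "t \<in> carrier (tensor_end L)"
  then have t': "t \<in> carrier (tensor A P L)" by simp
  show "s \<odot>\<^bsub>tensor_end L\<^esub> t \<in> carrier (tensor_end L)" using add_hom_closed[OF h[OF s]] t by simp
  { fix u assume "u \<in> carrier (tensor_end L)"
    then show "s \<odot>\<^bsub>tensor_end L\<^esub> (t \<oplus>\<^bsub>tensor_end L\<^esub> u) = s \<odot>\<^bsub>tensor_end L\<^esub> t \<oplus>\<^bsub>tensor_end L\<^esub> s \<odot>\<^bsub>tensor_end L\<^esub> u"
      using add_hom_add[OF h[OF s]] t by simp }
  fix s' assume s': "s' \<in> carrier S"
  have "s \<oplus>\<^bsub>S\<^esub> s' \<in> carrier S" by (rule abelian_groupE(1)[OF S_group s s'])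
  then show "(s \<oplus>\<^bsub>S\<^esub> s') \<odot>\<^bsub>tensor_end L\<^esub> t = s \<odot>\<^bsub>tensor_end L\<^esub> t \<oplus>\<^bsub>tensor_end L\<^esub> s' \<odot>\<^bsub>tensor_end L\<^esub> t"
    using tensor_map_add[OF P_right L P_right S_right_linear[OF s] S_right_linear[OF s'] S_right_linear _ t',
        of "s \<oplus>\<^bsub>S\<^esub> s'"] by simp
  have "tensor_map A P L s (\<lambda>l. l) (tensor_map A P L s' (\<lambda>l. l) t) = tensor_map A P L (compose (carrier P) s s') (\<lambda>l. l) t"
    by (rule tensor_map_compose[OF P_right L P_right L P_right L S_right_linear[OF s'] left_linear_id
          S_right_linear[OF s] left_linear_id _ refl t']) (simp add: compose_def)
  then show "(s \<otimes>\<^bsub>S\<^esub> s') \<odot>\<^bsub>tensor_end L\<^esub> t = s \<odot>\<^bsub>tensor_end L\<^esub> (s' \<odot>\<^bsub>tensor_end L\<^esub> t)" by simp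
next
  fix t assume "t \<in> carrier (tensor_end L)"
  then show "\<one>\<^bsub>S\<^esub> \<odot>\<^bsub>tensor_end L\<^esub> t = t"
    using tensor_map_ident[OF P_right L, of "\<lambda>p\<in>carrier P. p" "\<lambda>l. l" t] by simp
qed

lemma tensor_end_map:
  assumes L: "left_module A L" and N: "left_module A N" and f: "left_linear A L N f"
  shows "left_linear S (tensor_end L) (tensor_end N) (tensor_map A P N (\<lambda>p. p) f)"
  unfolding left_linear_iff
proof (intro conjI ballI)
  show "add_hom (tensor_end L) (tensor_end N) (tensor_map A P N (\<lambda>p. p) f)"
    using tensor_map_add_hom[OF P_right L P_right N right_linear_id f] by (simp add: add_hom_def)
  fix s t assume s: "s \<in> carrier S" and "t \<in> carrier (tensor_end L)"
  then have t: "t \<in> carrier (tensor A P L)" by simp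
  note sl = S_right_linear[OF s]
  have "tensor_map A P N (\<lambda>p. p) f (tensor_map A P L s (\<lambda>l. l) t) = tensor_map A P N s f t"
    by (rule tensor_map_compose[OF P_right L P_right L P_right N sl left_linear_id right_linear_id f refl refl t])
  also have "\<dots> = tensor_map A P N s (\<lambda>l. l) (tensor_map A P N (\<lambda>p. p) f t)"
    by (rule tensor_map_compose[OF P_right L P_right N P_right N right_linear_id f sl left_linear_id refl refl t, symmetric])
  finally show "tensor_map A P N (\<lambda>p. p) f (s \<odot>\<^bsub>tensor_end L\<^esub> t) = s \<odot>\<^bsub>tensor_end N\<^esub> tensor_map A P N (\<lambda>p. p) f t"
    by simp
qed

text \<open>
  Commuting with the endomorphisms in \<open>S\<close> is exactly their colinearity.
\<close>

lemma coact_tensor_end: "left_linear S PS (tensor_end C) (coact P)"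
  using right_linear_add_hom[OF coact_linear] Hom_C_coact[of _ P P]
  by (simp add: left_linear_iff add_hom_def)

lemma ev_map:
  assumes L: "left_module A L" and N: "left_module A N" and f: "left_linear A L N f"
    and k: "k \<in> Hom_A A P Ar" and t: "t \<in> carrier (tensor A P L)"
  shows "ev N k (tensor_map A P N (\<lambda>p. p) f t) = f (ev L k t)"
proof (rule tensor_ext[OF P_right L _ _ _ t])
  show "add_hom (tensor A P L) N (\<lambda>t. ev N k (tensor_map A P N (\<lambda>p. p) f t))"
    by (rule add_hom_compose[OF tensor_map_add_hom[OF P_right L P_right N right_linear_id f] ev_add_hom[OF N k]])
  show "add_hom (tensor A P L) N (\<lambda>t. f (ev L k t))"
    by (rule add_hom_compose[OF ev_add_hom[OF L k] left_linear_add_hom[OF f]])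
  fix p l assume pl: "p \<in> carrier P" "l \<in> carrier L"
  then have "f l \<in> carrier N" using f by (simp add: left_linear_iff add_hom_def)
  then show "ev N k (tensor_map A P N (\<lambda>p. p) f (tens A P L p l)) = f (ev L k (tens A P L p l))"
    using pl f Hom_A_closed[OF k pl(1)]
    by (simp add: tensor_map_tens[OF P_right L P_right N right_linear_id f] ev_tens[OF L k] ev_tens[OF N k]
        left_linear_iff)
qed

lemma ev_compose:
  assumes L: "left_module A L" and k: "k \<in> Hom_A A P Ar" and s: "s \<in> carrier S"
    and t: "t \<in> carrier (tensor A P L)"
  shows "ev L (post k s) t = ev L k (tensor_map A P L s (\<lambda>l. l) t)"
proof (rule tensor_ext[OF P_right L _ _ _ t])
  note sl = S_right_linear[OF s]
  have ks: "post k s \<in> Hom_A A P Ar"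
    using Hom_A_compose[OF P_right Hom_C_Hom_A Hom_A_linear[OF k]] s by simp
  show "add_hom (tensor A P L) L (ev L (post k s))" by (rule ev_add_hom[OF L ks])
  show "add_hom (tensor A P L) L (\<lambda>t. ev L k (tensor_map A P L s (\<lambda>l. l) t))"
    by (rule add_hom_compose[OF tensor_map_add_hom[OF P_right L P_right L sl left_linear_id] ev_add_hom[OF L k]])
  show "ev L (post k s) (tens A P L p l) = ev L k (tensor_map A P L s (\<lambda>l. l) (tens A P L p l))"
    if "p \<in> carrier P" "l \<in> carrier L" for p l
    using that S_closed[OF s]
    by (simp add: tensor_map_tens[OF P_right L P_right L sl left_linear_id] ev_tens[OF L k] ev_tens[OF L ks]
        compose_eq)
qed

lemma ev_add:
  assumes L: "left_module A L" and k: "k \<in> Hom_A A P Ar" and k': "k' \<in> Hom_A A P Ar"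
    and kk: "k'' \<in> Hom_A A P Ar" and eq: "\<And>p. p \<in> carrier P \<Longrightarrow> k'' p = k p \<oplus>\<^bsub>A\<^esub> k' p"
    and t: "t \<in> carrier (tensor A P L)"
  shows "ev L k'' t = ev L k t \<oplus>\<^bsub>L\<^esub> ev L k' t"
proof (rule tensor_ext[OF P_right L ev_add_hom[OF L kk] _ _ t])
  interpret L: left_module A L by fact
  show "add_hom (tensor A P L) L (\<lambda>t. ev L k t \<oplus>\<^bsub>L\<^esub> ev L k' t)"
    using ev_add_hom[OF L k] ev_add_hom[OF L k'] by (auto simp: add_hom_def L.M.a_ac)
  show "ev L k'' (tens A P L p l) = ev L k (tens A P L p l) \<oplus>\<^bsub>L\<^esub> ev L k' (tens A P L p l)"
    if "p \<in> carrier P" "l \<in> carrier L" for p l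
    using that Hom_A_closed[OF k that(1)] Hom_A_closed[OF k' that(1)]
    by (simp add: ev_tens[OF L k] ev_tens[OF L k'] ev_tens[OF L kk] eq L.lsmult_l_distr)
qed

text \<open>
  The left action of \<open>A\<close> on \<open>Hom\<^sub>A(P,A)\<close>, which makes \<open>theta\<close> left \<open>A\<close>-linear.
\<close>

definition lmul :: "'a \<Rightarrow> ('p \<Rightarrow> 'a) \<Rightarrow> 'p \<Rightarrow> 'a" where
  "lmul a k = (\<lambda>p\<in>carrier P. a \<otimes>\<^bsub>A\<^esub> k p)"

lemma lmul_apply: "p \<in> carrier P \<Longrightarrow> lmul a k p = a \<otimes>\<^bsub>A\<^esub> k p"
  by (simp add: lmul_def)

lemma lmul_Hom:
  assumes a: "a \<in> carrier A" and k: "k \<in> Hom_A A P Ar" shows "lmul a k \<in> Hom_A A P Ar"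
  unfolding lmul_def
proof (rule Hom_A_restrict[OF P_right])
  show "right_linear A P Ar (\<lambda>p. a \<otimes>\<^bsub>A\<^esub> k p)"
    using a Hom_A_linear[OF k] by (auto simp: right_linear_iff add_hom_def r_distr m_assoc)
qed

lemma lmul_linear:
  assumes a: "a \<in> carrier A" shows "right_linear S (HP Ar) (HP Ar) (lmul a)"
proof -
  show ?thesis
    unfolding right_linear_iff
    using lmul_Hom[OF a] S_closed a Hom_A_closed[of _ A P Ar]
    by (auto simp: add_hom_def lmul_def compose_def fun_eq_iff restrict_def r_distr)
qed

lemma ev_lmul:
  assumes L: "left_module A L" and a: "a \<in> carrier A" and k: "k \<in> Hom_A A P Ar"
    and t: "t \<in> carrier (tensor A P L)"
  shows "ev L (lmul a k) t = a \<odot>\<^bsub>L\<^esub> ev L k t"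
proof (rule tensor_ext[OF P_right L ev_add_hom[OF L lmul_Hom[OF a k]] _ _ t])
  interpret L: left_module A L by fact
  show "add_hom (tensor A P L) L (\<lambda>t. a \<odot>\<^bsub>L\<^esub> ev L k t)"
    using ev_add_hom[OF L k] a by (auto simp: add_hom_def L.lsmult_closed L.lsmult_r_distr)
  show "ev L (lmul a k) (tens A P L p l) = a \<odot>\<^bsub>L\<^esub> ev L k (tens A P L p l)"
    if "p \<in> carrier P" "l \<in> carrier L" for p l
    using that Hom_A_closed[OF k that(1)] a
    by (simp add: ev_tens[OF L k] ev_tens[OF L lmul_Hom[OF a k]] lmul_apply L.lsmult_assoc)
qed

text \<open>
  The assignment \<open>k \<otimes> p \<mapsto> (k \<otimes> L)(h' p)\<close> is balanced because \<open>h'\<close> is \<open>S\<close>-linear; composing it with the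
  inverse of \<open>theta\<close> gives \<open>h\<close>.
\<close>

lemma left_linear_from_tensor:
  assumes L: "left_module A L" and h': "left_linear S PS (tensor_end L) h'"
  shows "\<exists>h. left_linear A C L h \<and>
    (\<forall>k\<in>Hom_A A P Ar. \<forall>p\<in>carrier P. h (theta (tens S (HP Ar) PS k p)) = ev L k (h' p))"
proof -
  interpret L: left_module A L by fact
  note HA = HP_right[OF Ar_right]
  have h'cl: "h' p \<in> carrier (tensor A P L)" if "p \<in> carrier P" for p
    using h' that by (simp add: left_linear_iff add_hom_def)
  define H where "H = tensor_lift L (\<lambda>k p. ev L k (h' p))"
  have bal: "balanced S (HP Ar) PS L (\<lambda>k p. ev L k (h' p))"
  proof (rule balancedI)
    fix k p assume k: "k \<in> carrier (HP Ar)" and p: "p \<in> carrier PS"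
    then have k': "k \<in> Hom_A A P Ar" and p': "p \<in> carrier P" by simp_all
    show "ev L k (h' p) \<in> carrier L" by (rule add_hom_closed[OF ev_add_hom[OF L k'] h'cl[OF p']])
    { fix l assume l: "l \<in> carrier (HP Ar)"
      have kl: "k \<oplus>\<^bsub>HP Ar\<^esub> l \<in> Hom_A A P Ar"
        using abelian_groupE(1)[OF right_module_group[OF HA] k l] by (simp del: Hom_module_simps(3))
      show "ev L (k \<oplus>\<^bsub>HP Ar\<^esub> l) (h' p) = ev L k (h' p) \<oplus>\<^bsub>L\<^esub> ev L l (h' p)"
        by (rule ev_add[OF L k' _ kl _ h'cl[OF p']]) (use l in simp_all) }
    { fix q assume "q \<in> carrier PS"
      then show "ev L k (h' (p \<oplus>\<^bsub>PS\<^esub> q)) = ev L k (h' p) \<oplus>\<^bsub>L\<^esub> ev L k (h' q)"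
        using h' p h'cl add_hom_add[OF ev_add_hom[OF L k']] by (simp add: left_linear_iff add_hom_def) }
    fix s assume s: "s \<in> carrier S"
    have "h' (s p) = tensor_map A P L s (\<lambda>l. l) (h' p)" using h' s p by (simp add: left_linear_iff)
    then show "ev L (k \<triangleleft>\<^bsub>HP Ar\<^esub> s) (h' p) = ev L k (h' (s \<odot>\<^bsub>PS\<^esub> p))"
      using ev_compose[OF L k' s h'cl[OF p']] by simp
  qed
  have Hh: "add_hom (HPT Ar) L H"
    unfolding H_def by (rule tensor_lift_add_hom[OF HA PS_left L.M.abelian_group_axioms bal])
  have Ht: "H (tens S (HP Ar) PS k p) = ev L k (h' p)" if "k \<in> Hom_A A P Ar" "p \<in> carrier P" for k p
    unfolding H_def
    by (rule tensor_lift_tens[OF HA PS_left L.M.abelian_group_axioms bal]) (use that in simp_all)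
  have inj: "z = w" if "z \<in> carrier (HPT Ar)" "w \<in> carrier (HPT Ar)" "theta z = theta w" for z w
  proof -
    have "inj_on theta (carrier (HPT Ar))"
      using add_hom_inj_iff[OF theta_add_hom HPT_group[OF Ar_right] left_module_group[OF C_left]] theta_inj
      by blast
    then show ?thesis using that by (auto dest: inj_onD)
  qed
  define tinv where "tinv c = (SOME z. z \<in> carrier (HPT Ar) \<and> theta z = c)" for c
  have tinv: "tinv c \<in> carrier (HPT Ar)" "theta (tinv c) = c" if "c \<in> carrier C" for c
  proof -
    have "tinv c \<in> carrier (HPT Ar) \<and> theta (tinv c) = c"
      unfolding tinv_def by (rule someI_ex) (use theta_surj[OF that] in blast)
    then show "tinv c \<in> carrier (HPT Ar)" "theta (tinv c) = c" by auto
  qed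
  have tinv_theta: "tinv (theta z) = z" if "z \<in> carrier (HPT Ar)" for z
    using tinv[OF add_hom_closed[OF theta_add_hom that]] inj that by blast
  let ?l = "\<lambda>a. tensor_map S (HP Ar) PS (lmul a) (\<lambda>p. p)"
  have lh: "add_hom (HPT Ar) (HPT Ar) (?l a)" if "a \<in> carrier A" for a
    by (rule tensor_map_add_hom[OF HA PS_left HA PS_left lmul_linear[OF that] left_linear_id])
  have lt: "?l a (tens S (HP Ar) PS k p) = tens S (HP Ar) PS (lmul a k) p"
    if "a \<in> carrier A" "k \<in> Hom_A A P Ar" "p \<in> carrier P" for a k p
    by (rule tensor_map_tens[OF HA PS_left HA PS_left lmul_linear left_linear_id]) (use that in simp_all)
  have smultC: "add_hom C C (\<lambda>c. a \<odot>\<^bsub>C\<^esub> c)" if "a \<in> carrier A" for a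
    using that by (simp add: add_hom_def lsmult_closed lsmult_r_distr)
  have smultL: "add_hom L L (\<lambda>c. a \<odot>\<^bsub>L\<^esub> c)" if "a \<in> carrier A" for a
    using that by (simp add: add_hom_def L.lsmult_closed L.lsmult_r_distr)
  have theta_l: "theta (?l a z) = a \<odot>\<^bsub>C\<^esub> theta z" if a: "a \<in> carrier A" and z: "z \<in> carrier (HPT Ar)" for a z
    by (rule tensor_ext[OF HA PS_left add_hom_compose[OF lh[OF a] theta_add_hom]
          add_hom_compose[OF theta_add_hom smultC[OF a]] _ z])
      (simp add: lt[OF a] theta_tens lmul_Hom[OF a] ev_lmul[OF C_left a] coact_closed[OF P_comodule])
  have H_l: "H (?l a z) = a \<odot>\<^bsub>L\<^esub> H z" if a: "a \<in> carrier A" and z: "z \<in> carrier (HPT Ar)" for a z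
    by (rule tensor_ext[OF HA PS_left add_hom_compose[OF lh[OF a] Hh] add_hom_compose[OF Hh smultL[OF a]] _ z])
      (simp add: lt[OF a] Ht lmul_Hom[OF a] ev_lmul[OF L a] h'cl)
  have "left_linear A C L (\<lambda>c. H (tinv c))"
    unfolding left_linear_iff
  proof (intro conjI add_homI ballI)
    fix c assume c: "c \<in> carrier C"
    show "H (tinv c) \<in> carrier L" by (rule add_hom_closed[OF Hh tinv(1)[OF c]])
    { fix d assume d: "d \<in> carrier C"
      have "tinv (c \<oplus>\<^bsub>C\<^esub> d) = tinv c \<oplus>\<^bsub>HPT Ar\<^esub> tinv d"
      proof (rule inj)
        show "tinv (c \<oplus>\<^bsub>C\<^esub> d) \<in> carrier (HPT Ar)" using tinv c d by simp
        show "tinv c \<oplus>\<^bsub>HPT Ar\<^esub> tinv d \<in> carrier (HPT Ar)"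
          by (rule abelian_groupE(1)[OF HPT_group[OF Ar_right] tinv(1)[OF c] tinv(1)[OF d]])
        show "theta (tinv (c \<oplus>\<^bsub>C\<^esub> d)) = theta (tinv c \<oplus>\<^bsub>HPT Ar\<^esub> tinv d)"
          using add_hom_add[OF theta_add_hom tinv(1)[OF c] tinv(1)[OF d]] tinv(2) c d by simp
      qed
      then show "H (tinv (c \<oplus>\<^bsub>C\<^esub> d)) = H (tinv c) \<oplus>\<^bsub>L\<^esub> H (tinv d)"
        using add_hom_add[OF Hh tinv(1)[OF c] tinv(1)[OF d]] by simp }
    fix a assume a: "a \<in> carrier A"
    have "tinv (a \<odot>\<^bsub>C\<^esub> c) = ?l a (tinv c)"
    proof (rule inj)
      show "tinv (a \<odot>\<^bsub>C\<^esub> c) \<in> carrier (HPT Ar)" using tinv a c lsmult_closed by simp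
      show "?l a (tinv c) \<in> carrier (HPT Ar)" by (rule add_hom_closed[OF lh[OF a] tinv(1)[OF c]])
      show "theta (tinv (a \<odot>\<^bsub>C\<^esub> c)) = theta (?l a (tinv c))"
        using theta_l[OF a tinv(1)[OF c]] tinv(2) a c lsmult_closed by simp
    qed
    then show "H (tinv (a \<odot>\<^bsub>C\<^esub> c)) = a \<odot>\<^bsub>L\<^esub> H (tinv c)" using H_l[OF a tinv(1)[OF c]] by simp
  qed
  moreover have "H (tinv (theta (tens S (HP Ar) PS k p))) = ev L k (h' p)"
    if "k \<in> Hom_A A P Ar" "p \<in> carrier P" for k p
    using Ht[OF that] tinv_theta[OF tens_closed[OF HA PS_left, of k p]] that by simp
  ultimately show ?thesis by blast
qed

text \<open>
  The common core of projectivity, where \<open>F\<close> is all of \<open>P\<close>, and of local projectivity, where \<open>F\<close> is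
  finitely generated.
\<close>

definition lifts_on :: "'p set \<Rightarrow> bool" where
  "lifts_on F \<longleftrightarrow> (\<forall>(L :: ('p \<Rightarrow> 'p, 'u) module) (N :: ('p \<Rightarrow> 'p, 'u) module) f g.
      left_module S L \<longrightarrow> left_module S N \<longrightarrow> left_linear S L N f \<longrightarrow> f ` carrier L = carrier N \<longrightarrow>
      left_linear S PS N g \<longrightarrow> (\<exists>h. left_linear S PS L h \<and> (\<forall>p\<in>F. f (h p) = g p)))"

text \<open>
  Lifting is needed for \<open>P \<otimes>\<^sub>A L\<close> and \<open>P \<otimes>\<^sub>A N\<close>, which live in another type but are
  small enough to have copies in the universe.
\<close>

lemma left_universe_lift:
  fixes L :: "('p \<Rightarrow> 'p, 'l, 'v) module_scheme" and N :: "('p \<Rightarrow> 'p, 'n, 'w) module_scheme"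
  assumes lift: "lifts_on F"
    and F: "F \<subseteq> carrier P"
    and L: "left_module S L" "carrier L \<lesssim> (UNIV :: 'u set)"
    and N: "left_module S N" "carrier N \<lesssim> (UNIV :: 'u set)"
    and f: "left_linear S L N f" "f ` carrier L = carrier N" and g: "left_linear S PS N g"
  shows "\<exists>h. left_linear S PS L h \<and> (\<forall>p\<in>F. f (h p) = g p)"
proof -
  obtain i :: "'l \<Rightarrow> 'u" where i: "inj_on i (carrier L)" using L(2) by (auto simp: lepoll_def)
  obtain j :: "'n \<Rightarrow> 'u" where j: "inj_on j (carrier N)" using N(2) by (auto simp: lepoll_def)
  note tL = left_transport[OF L(1) i] and tN = left_transport[OF N(1) j]
  let ?i' = "inv_into (carrier L) i" and ?j' = "inv_into (carrier N) j"
  have gN: "g p \<in> carrier N" if "p \<in> carrier P" for p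
    using g that by (simp add: left_linear_iff add_hom_def)
  have "\<exists>h. left_linear S PS (left_transport i L) h \<and> (\<forall>p\<in>F. j (f (?i' (h p))) = j (g p))"
  proof (rule lift[unfolded lifts_on_def, rule_format, OF tL(1) tN(1)])
    show "left_linear S (left_transport i L) (left_transport j N) (\<lambda>x. j (f (?i' x)))"
      by (rule left_linear_compose[OF left_linear_compose[OF tL(3) f(1)] tN(2)])
    show "left_linear S PS (left_transport j N) (\<lambda>p. j (g p))"
      by (rule left_linear_compose[OF g tN(2)])
    have "(\<lambda>x. j (f (?i' x))) ` i ` carrier L = j ` f ` carrier L"
      using i by (simp add: image_image)
    then show "(\<lambda>x. j (f (?i' x))) ` carrier (left_transport i L) = carrier (left_transport j N)"
      using f(2) by (simp add: left_transport_def)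
  qed
  then obtain h where h: "left_linear S PS (left_transport i L) h" "\<forall>p\<in>F. j (f (?i' (h p))) = j (g p)"
    by blast
  have ih: "left_linear S PS L (\<lambda>p. ?i' (h p))" by (rule left_linear_compose[OF h(1) tL(3)])
  have "f (?i' (h p)) = g p" if p: "p \<in> F" for p
  proof (rule inj_onD[OF j])
    show "j (f (?i' (h p))) = j (g p)" using h(2) p by blast
    have "?i' (h p) \<in> carrier L" using ih p F by (auto simp: left_linear_iff add_hom_def)
    then show "f (?i' (h p)) \<in> carrier N" using f(2) by blast
    show "g p \<in> carrier N" using gN p F by blast
  qed
  then show ?thesis using ih by blast
qed

text \<open>
  The \<open>S\<close>-linear map \<open>(P \<otimes> g) \<circ> \<rho>\<close> is lifted along \<open>P \<otimes> f\<close>. Evaluation by \<open>k\<close> is natural, so it carries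
  the equation on \<open>F\<close> to the required equation on \<open>C\<close>.
\<close>

lemma lift_to_coring:
  fixes L :: "('a, 'u) module" and N :: "('a, 'u) module"
  assumes lift: "lifts_on F"
    and F: "F \<subseteq> carrier P"
    and L: "left_module A L" and N: "left_module A N"
    and f: "left_linear A L N f" "f ` carrier L = carrier N" and g: "left_linear A C N g"
  shows "\<exists>h. left_linear A C L h \<and> (\<forall>k\<in>Hom_A A P Ar. \<forall>p\<in>F.
    f (h (theta (tens S (HP Ar) PS k p))) = g (theta (tens S (HP Ar) PS k p)))"
proof -
  have small: "carrier (tensor_end L) \<lesssim> (UNIV :: 'u set)" "carrier (tensor_end N) \<lesssim> (UNIV :: 'u set)"
    using tensor_lepoll[OF P_right L universe_sizes(1,3) lepoll_UNIV]
      tensor_lepoll[OF P_right N universe_sizes(1,3) lepoll_UNIV] by simp_all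
  have "tensor_map A P N (\<lambda>p. p) f ` carrier (tensor_end L) = carrier (tensor_end N)"
    using tensor_map_surj[OF P_right P_right L N right_linear_id _ f] by simp
  then obtain h' where h': "left_linear S PS (tensor_end L) h'"
    "\<forall>p\<in>F. tensor_map A P N (\<lambda>p. p) f (h' p) = tensor_map A P N (\<lambda>p. p) g (coact P p)"
    using left_universe_lift[OF lift F tensor_end_left[OF L] small(1) tensor_end_left[OF N] small(2)
        tensor_end_map[OF L N f(1)] _ left_linear_compose[OF coact_tensor_end tensor_end_map[OF C_left N g]]]
    by blast
  obtain h where h: "left_linear A C L h"
    "\<forall>k\<in>Hom_A A P Ar. \<forall>p\<in>carrier P. h (theta (tens S (HP Ar) PS k p)) = ev L k (h' p)"
    using left_linear_from_tensor[OF L h'(1)] by blast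
  have "f (h (theta (tens S (HP Ar) PS k p))) = g (theta (tens S (HP Ar) PS k p))"
    if k: "k \<in> Hom_A A P Ar" and p: "p \<in> F" for k p
  proof -
    have pP: "p \<in> carrier P" using p F by blast
    have h'p: "h' p \<in> carrier (tensor A P L)" using h'(1) pP by (simp add: left_linear_iff add_hom_def)
    have "f (h (theta (tens S (HP Ar) PS k p))) = f (ev L k (h' p))" using h(2) k pP by simp
    also have "\<dots> = ev N k (tensor_map A P N (\<lambda>p. p) f (h' p))"
      by (rule ev_map[OF L N f(1) k h'p, symmetric])
    also have "\<dots> = ev N k (tensor_map A P N (\<lambda>p. p) g (coact P p))" using h'(2) p by simp
    also have "\<dots> = g (ev C k (coact P p))"
      by (rule ev_map[OF C_left N g k coact_closed[OF P_comodule pP]])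
    finally show ?thesis by (simp add: theta_tens[OF k pP])
  qed
  then show ?thesis using h(1) by blast
qed

lemma projective_coring:
  assumes proj: "projective_left TYPE('u) S PS" shows "projective_left TYPE('u) A C"
  unfolding projective_left_def
proof (intro allI impI)
  fix L N :: "('a, 'u) module" and f g
  assume L: "left_module A L" and N: "left_module A N" and f: "left_linear A L N f" "f ` carrier L = carrier N"
    and g: "left_linear A C N g"
  have "lifts_on (carrier P)"
    using proj unfolding projective_left_def lifts_on_def by simp
  from lift_to_coring[OF this order_refl L N f g] obtain h where h: "left_linear A C L h"
    "\<forall>k\<in>Hom_A A P Ar. \<forall>p\<in>carrier P. f (h (theta (tens S (HP Ar) PS k p))) = g (theta (tens S (HP Ar) PS k p))"
    by blast
  have "f (h (theta z)) = g (theta z)" if z: "z \<in> carrier (HPT Ar)" for z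
    by (rule tensor_ext[OF HP_right[OF Ar_right] PS_left
          add_hom_compose[OF add_hom_compose[OF theta_add_hom left_linear_add_hom[OF h(1)]] left_linear_add_hom[OF f(1)]]
          add_hom_compose[OF theta_add_hom left_linear_add_hom[OF g]] _ z]) (use h(2) in simp)
  then show "\<exists>h. left_linear A C L h \<and> (\<forall>m\<in>carrier C. f (h m) = g m)" using h(1) theta_surj by metis
qed

text \<open>
  A sum of values \<open>theta (k \<otimes> p)\<close> with \<open>p\<close> from a finite set \<open>Y\<close>, expressed through sets \<open>D\<close> closed under
  addition so that no summation over tensors has to be written down.
\<close>

lemma theta_finite_support:
  assumes z: "z \<in> carrier (HPT Ar)"
  shows "\<exists>Y. finite Y \<and> Y \<subseteq> carrier P \<and> (\<forall>D. (\<forall>k\<in>Hom_A A P Ar. \<forall>p\<in>Y. theta (tens S (HP Ar) PS k p) \<in> D) \<longrightarrow>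
     (\<forall>c\<in>D. \<forall>d\<in>D. c \<oplus>\<^bsub>C\<^esub> d \<in> D) \<longrightarrow> theta z \<in> D)"
  using HP_right[OF Ar_right] PS_left z
proof (induction rule: tensor_induct)
  case (tens k p)
  then show ?case by (intro exI[of _ "{p}"]) auto
next
  case (add x y)
  obtain X where X: "finite X" "X \<subseteq> carrier P" "\<And>D. (\<forall>k\<in>Hom_A A P Ar. \<forall>p\<in>X. theta (tens S (HP Ar) PS k p) \<in> D) \<Longrightarrow>
     (\<forall>c\<in>D. \<forall>d\<in>D. c \<oplus>\<^bsub>C\<^esub> d \<in> D) \<Longrightarrow> theta x \<in> D" using add.IH(1) by blast
  obtain Y where Y: "finite Y" "Y \<subseteq> carrier P" "\<And>D. (\<forall>k\<in>Hom_A A P Ar. \<forall>p\<in>Y. theta (tens S (HP Ar) PS k p) \<in> D) \<Longrightarrow>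
     (\<forall>c\<in>D. \<forall>d\<in>D. c \<oplus>\<^bsub>C\<^esub> d \<in> D) \<Longrightarrow> theta y \<in> D" using add.IH(2) by blast
  have "theta (x \<oplus>\<^bsub>HPT Ar\<^esub> y) \<in> D"
    if "\<forall>k\<in>Hom_A A P Ar. \<forall>p\<in>X \<union> Y. theta (tens S (HP Ar) PS k p) \<in> D" "\<forall>c\<in>D. \<forall>d\<in>D. c \<oplus>\<^bsub>C\<^esub> d \<in> D" for D
    unfolding add_hom_add[OF theta_add_hom add.hyps] using X(3)[of D] Y(3)[of D] that by blast
  then show ?case using X(1,2) Y(1,2) by (intro exI[of _ "X \<union> Y"]) auto
qed

text \<open>
  Finitely many elements of \<open>C\<close> involve only finitely many elements of \<open>P\<close> under \<open>theta\<close>. A lift that is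
  correct on the \<open>S\<close>-submodule generated by the latter is correct on the former, hence on their span.
\<close>

lemma locally_projective_coring:
  assumes lp: "locally_projective TYPE('u) S PS" shows "locally_projective TYPE('u) A C"
  unfolding locally_projective_def
proof (intro allI impI)
  fix F0 and L N :: "('a, 'u) module" and f g
  assume F0: "submodule F0 A C" "fin_gen A (C\<lparr>carrier := F0\<rparr>)"
    and L: "left_module A L" and N: "left_module A N" and f: "left_linear A L N f" "f ` carrier L = carrier N"
    and g: "left_linear A C N g"
  interpret L: left_module A L by fact
  interpret N: left_module A N by fact
  have F0C: "F0 \<subseteq> carrier C" using F0(1) by (auto simp: submodule_def subgroup_def)
  obtain X where X: "finite X" "X \<subseteq> F0" "F0 \<subseteq> left_span A C X"
    using F0(2) unfolding fin_gen_iff[OF submodule_left_module[OF C_left F0(1)]] left_span_carrier_update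
    by auto
  have "\<forall>x\<in>X. \<exists>Y. finite Y \<and> Y \<subseteq> carrier P \<and>
    (\<forall>D. (\<forall>k\<in>Hom_A A P Ar. \<forall>p\<in>Y. theta (tens S (HP Ar) PS k p) \<in> D) \<longrightarrow>
     (\<forall>c\<in>D. \<forall>d\<in>D. c \<oplus>\<^bsub>C\<^esub> d \<in> D) \<longrightarrow> x \<in> D)"
  proof
    fix x assume "x \<in> X"
    then have "x \<in> carrier C" using X(2) F0C by blast
    then obtain z where z: "z \<in> carrier (HPT Ar)" "theta z = x" using theta_surj by blast
    show "\<exists>Y. finite Y \<and> Y \<subseteq> carrier P \<and>
      (\<forall>D. (\<forall>k\<in>Hom_A A P Ar. \<forall>p\<in>Y. theta (tens S (HP Ar) PS k p) \<in> D) \<longrightarrow>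
       (\<forall>c\<in>D. \<forall>d\<in>D. c \<oplus>\<^bsub>C\<^esub> d \<in> D) \<longrightarrow> x \<in> D)"
      using theta_finite_support[OF z(1)] unfolding z(2) .
  qed
  from bchoice[OF this] obtain Y where Y: "\<forall>x\<in>X. finite (Y x) \<and> Y x \<subseteq> carrier P \<and>
    (\<forall>D. (\<forall>k\<in>Hom_A A P Ar. \<forall>p\<in>Y x. theta (tens S (HP Ar) PS k p) \<in> D) \<longrightarrow>
     (\<forall>c\<in>D. \<forall>d\<in>D. c \<oplus>\<^bsub>C\<^esub> d \<in> D) \<longrightarrow> x \<in> D)" ..
  let ?Y = "\<Union>x\<in>X. Y x" and ?F = "left_span S PS (\<Union>x\<in>X. Y x)"
  have YP: "?Y \<subseteq> carrier PS" using Y by auto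
  have sub: "submodule ?F S PS" by (rule left_span_submodule(2)[OF PS_left YP])
  have FP: "?F \<subseteq> carrier P" using left_span_closed[OF PS_left YP] by auto
  have "finite ?Y" using X(1) Y by blast
  then have "fin_gen S (PS\<lparr>carrier := ?F\<rparr>)"
    unfolding fin_gen_iff[OF left_span_submodule(1)[OF PS_left YP]] left_span_carrier_update
    by (intro exI[of _ ?Y]) (auto intro: left_span.base)
  then have "lifts_on ?F"
    using lp sub unfolding locally_projective_def lifts_on_def by blast
  from lift_to_coring[OF this FP L N f g] obtain h where h: "left_linear A C L h"
    "\<forall>k\<in>Hom_A A P Ar. \<forall>p\<in>?F. f (h (theta (tens S (HP Ar) PS k p))) = g (theta (tens S (HP Ar) PS k p))"
    by blast
  note fh = left_linear_compose[OF h(1) f(1)]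
  let ?D = "{c \<in> carrier C. f (h c) = g c}"
  have Dadd: "c \<oplus>\<^bsub>C\<^esub> d \<in> ?D" if "c \<in> ?D" "d \<in> ?D" for c d
    using that fh g by (simp add: left_linear_iff add_hom_def)
  have XD: "x \<in> ?D" if x: "x \<in> X" for x
  proof -
    have "theta (tens S (HP Ar) PS k p) \<in> ?D" if "k \<in> Hom_A A P Ar" "p \<in> Y x" for k p
    proof -
      have "p \<in> ?F" using that(2) x by (intro left_span.base) blast
      moreover then have "theta (tens S (HP Ar) PS k p) \<in> carrier C"
        using add_hom_closed[OF theta_add_hom tens_closed[OF HP_right[OF Ar_right] PS_left, of k p]]
          that(1) FP by auto
      ultimately show ?thesis using h(2) that(1) by simp
    qed
    then have *: "\<forall>k\<in>Hom_A A P Ar. \<forall>p\<in>Y x. theta (tens S (HP Ar) PS k p) \<in> ?D" by blast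
    show ?thesis
    proof (rule mp[OF mp[OF spec[OF conjunct2[OF conjunct2[OF bspec[OF Y x]]], of ?D]]])
      show "\<forall>c\<in>?D. \<forall>d\<in>?D. c \<oplus>\<^bsub>C\<^esub> d \<in> ?D" using Dadd by blast
    qed (rule *)
  qed
  have "c \<in> ?D" if "c \<in> left_span A C X" for c
    using that
  proof induction
    case zero
    show ?case
      using add_hom_zero[OF left_linear_add_hom[OF fh] left_module_group[OF C_left] N.M.abelian_group_axioms]
        add_hom_zero[OF left_linear_add_hom[OF g] left_module_group[OF C_left] N.M.abelian_group_axioms]
        abelian_groupE(2)[OF left_module_group[OF C_left]] by simp
  next
    case (base x)
    then show ?case by (rule XD)
  next
    case (add c d)
    then show ?case using Dadd by blast
  next
    case (smult a c)
    then show ?case using fh g lsmult_closed by (simp add: left_linear_iff)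
  qed
  then show "\<exists>h. left_linear A C L h \<and> (\<forall>m\<in>F0. f (h m) = g m)" using h(1) X(3) by blast
qed


section \<open>Flatness\<close>

text \<open>
  \<open>Hom\<^sub>A(P,-)\<close> preserves injectivity, and the Galois map is natural.
\<close>

lemma flat_coring:
  assumes flat: "flat_left TYPE('u) S PS"
  shows "flat_left TYPE('u) A C"
  unfolding flat_left_def
proof (intro allI impI)
  fix X Y :: "('a, 'u) rmodule" and f
  assume X: "right_module A X" and Y: "right_module A Y" and f: "right_linear A X Y f"
    and inj: "inj_on f (carrier X)"
  have inj': "inj_on (post f) (carrier (HP X))"
  proof (rule inj_onI)
    fix g h assume gh: "g \<in> carrier (HP X)" "h \<in> carrier (HP X)" "post f g = post f h"
    show "g = h"
    proof (rule Hom_A_eqI[of _ A P X])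
      fix p assume p: "p \<in> carrier P"
      have "f (g p) = f (h p)" using fun_cong[OF gh(3), of p] p by (simp add: compose_eq)
      then show "g p = h p" using inj_onD[OF inj] gh(1,2) p Hom_A_closed[of _ A P X] by simp
    qed (use gh in simp_all)
  qed
  show "inj_on (cmap Y f) (carrier (tensor A X C))"
    unfolding tensor_inj_iff[OF X Y C_left f]
  proof (intro ballI impI)
    fix t assume t: "t \<in> carrier (tensor A X C)" "cmap Y f t = \<zero>\<^bsub>tensor A Y C\<^esub>"
    obtain z where z: "z \<in> carrier (HPT X)" "gal X z = t" using gal_surj[OF X t(1)] by blast
    have "hmap Y f z = \<zero>\<^bsub>HPT Y\<^esub>"
      using gal_inj[OF Y add_hom_closed[OF hmap_add_hom[OF X Y f] z(1)]] gal_natural[OF X Y f z(1)]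
        z(2) t(2) by simp
    then have "z = \<zero>\<^bsub>HPT X\<^esub>"
      by (rule flat_left_any[OF flat PS_left universe_sizes(1,4) HP_right[OF X] HP_right[OF Y]
            post_linear[OF X f] inj' z(1)])
    then show "t = \<zero>\<^bsub>tensor A X C\<^esub>"
      using z(2) add_hom_zero[OF gal_add_hom[OF X] HPT_group[OF X] TC_group[OF X]] by simp
  qed
qed


section \<open>Generators and projective objects of the category of comodules\<close>

text \<open>
  The defect of colinearity: its kernel is \<open>Hom\<^sup>C(P,M)\<close> (\<open>coact_diff_zero_iff\<close>).
\<close>

definition coact_diff :: "('a, 'c, 'm, 'w) comodule_scheme \<Rightarrow> ('p \<Rightarrow> 'm) \<Rightarrow> 'p \<Rightarrow> ('m, 'c) tens" where
  "coact_diff M g = (post (coact M) g) \<ominus>\<^bsub>HP (MC M)\<^esub> (\<lambda>p\<in>carrier P. cmap M g (coact P p))"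

lemma coact_after_linear:
  assumes M: "right_module A M"
  shows "right_linear S (HP M) (HP (MC M)) (\<lambda>g. \<lambda>p\<in>carrier P. cmap M g (coact P p))"
  unfolding right_linear_iff
proof (intro conjI add_homI ballI)
  note bal = gal_balanced[OF M, unfolded balanced_def]
  fix g assume g: "g \<in> carrier (HP M)"
  then have gl: "right_linear A P M g" using Hom_A_linear by simp
  show "(\<lambda>p\<in>carrier P. cmap M g (coact P p)) \<in> carrier (HP (MC M))"
    using Hom_A_restrict[OF P_right right_linear_compose[OF coact_linear cmap_right_linear[OF P_right M gl]]]
    by simp
  { fix h assume h: "h \<in> carrier (HP M)"
    have "cmap M (g \<oplus>\<^bsub>HP M\<^esub> h) (coact P p) = cmap M g (coact P p) \<oplus>\<^bsub>tensor A M C\<^esub> cmap M h (coact P p)"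
      if "p \<in> carrier P" for p
      using bal g h that by (simp only: eval_module_simps)
    then show "(\<lambda>p\<in>carrier P. cmap M (g \<oplus>\<^bsub>HP M\<^esub> h) (coact P p))
        = (\<lambda>p\<in>carrier P. cmap M g (coact P p)) \<oplus>\<^bsub>HP (MC M)\<^esub> (\<lambda>p\<in>carrier P. cmap M h (coact P p))"
      by (auto simp del: Hom_module_simps(3) simp: Hom_module_simps(3)[of A P "MC M"] fun_eq_iff restrict_def) }
  fix s assume s: "s \<in> carrier S"
  have "cmap M (g \<triangleleft>\<^bsub>HP M\<^esub> s) (coact P p) = cmap M g (coact P (s p))" if "p \<in> carrier P" for p
    using bal g s that by (simp only: eval_module_simps)
  then show "(\<lambda>p\<in>carrier P. cmap M (g \<triangleleft>\<^bsub>HP M\<^esub> s) (coact P p))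
      = (\<lambda>p\<in>carrier P. cmap M g (coact P p)) \<triangleleft>\<^bsub>HP (MC M)\<^esub> s"
    using S_closed[OF s] by (auto simp: compose_def fun_eq_iff restrict_def)
qed

lemma coact_diff_linear:
  assumes M: "comodule A C M" shows "right_linear S (HP M) (HP (MC M)) (coact_diff M)"
proof -
  note MR = comodule_right_module[OF M]
  note H = HP_right[OF tensor_right_module[OF MR]]
  show ?thesis
    unfolding coact_diff_def[abs_def] a_minus_def
    by (rule right_linear_add[OF H post_linear[OF MR coact_right_linear[OF M]]
          right_linear_neg[OF H coact_after_linear[OF MR]]])
qed

lemma coact_diff_zero_iff:
  assumes M: "comodule A C M" and g: "g \<in> Hom_A A P M"
  shows "coact_diff M g = \<zero>\<^bsub>HP (MC M)\<^esub> \<longleftrightarrow> g \<in> Hom_C A C P M"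
proof -
  note MR = comodule_right_module[OF M]
  interpret H: abelian_group "HP (MC M)" by (rule right_module_group[OF HP_right[OF tensor_right_module[OF MR]]])
  have gH: "g \<in> carrier (HP M)" using g by simp
  have 1: "post (coact M) g \<in> carrier (HP (MC M))"
    by (rule add_hom_closed[OF right_linear_add_hom[OF post_linear[OF MR coact_right_linear[OF M]]] gH])
  have 2: "(\<lambda>p\<in>carrier P. cmap M g (coact P p)) \<in> carrier (HP (MC M))"
    by (rule add_hom_closed[OF right_linear_add_hom[OF coact_after_linear[OF MR]] gH])
  have "coact_diff M g = \<zero>\<^bsub>HP (MC M)\<^esub> \<longleftrightarrow> post (coact M) g = (\<lambda>p\<in>carrier P. cmap M g (coact P p))"
    unfolding coact_diff_def by (rule H.diff_zero_iff[OF 1 2])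
  also have "\<dots> \<longleftrightarrow> g \<in> Hom_C A C P M"
    using g by (auto simp: Hom_C_def compose_def fun_eq_iff restrict_def)
  finally show ?thesis .
qed

text \<open>
  The two parts of the defect agree on \<open>z\<close>. Under the Galois map for \<open>M \<otimes> C\<close> and reassociation, the part
  \<open>g \<mapsto> \<rho>\<^sub>M \<circ> g\<close> yields \<open>(M \<otimes> \<Delta>)(\<rho>\<^sub>M m)\<close> by coassociativity of \<open>M\<close>, and the part \<open>g \<mapsto> (g \<otimes> C) \<circ> \<rho>\<close>
  yields the same by coassociativity of \<open>P\<close>; both reassociation and the Galois map are injective.
\<close>

lemma coact_diff_coact:
  assumes M: "comodule A C M" and m: "m \<in> carrier M"
    and z: "z \<in> carrier (HPT M)" "gal M z = coact M m"
  shows "tensor_map S (HP (MC M)) PS (coact_diff M) (\<lambda>p. p) z = \<zero>\<^bsub>HPT (MC M)\<^esub>"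
proof -
  note MR = comodule_right_module[OF M]
  note MCr = tensor_right_module[OF MR] and PCr = tensor_right_module[OF P_right]
  note co = coact_right_linear[OF M]
  let ?\<beta> = "\<lambda>g. \<lambda>p\<in>carrier P. cmap M g (coact P p)"
  let ?a = "hmap (MC M) (coact M)" and ?b = "tensor_map S (HP (MC M)) PS ?\<beta> (\<lambda>p. p)"
    and ?d = "tensor_map S (HP (MC M)) PS (coact_diff M) (\<lambda>p. p)"
  note \<beta> = coact_after_linear[OF MR]
  note bh = tensor_map_add_hom[OF HP_right[OF MR] PS_left HP_right[OF MCr] PS_left \<beta> left_linear_id]
  note ah = hmap_add_hom[OF MR MCr co]
  note dh = tensor_map_add_hom[OF HP_right[OF MR] PS_left HP_right[OF MCr] PS_left coact_diff_linear[OF M] left_linear_id]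
  interpret T: abelian_group "HPT (MC M)" by (rule HPT_group[OF MCr])
  interpret H: abelian_group "HP (MC M)" by (rule right_module_group[OF HP_right[OF MCr]])
  let ?\<Delta> = "tensor_map A M CC (\<lambda>n. n) (comult C)"
  note \<Delta>h = tensor_map_add_hom[OF MR C_left MR tensor_left_module right_linear_id comult_left_linear]
  have A: "tensor_assoc A M C (gal (MC M) (?a z)) = ?\<Delta> (coact M m)"
    unfolding gal_natural[OF MR MCr co z(1)] z(2) by (rule comodule.coact_coassoc[OF M m])
  have B: "tensor_assoc A M C (gal (MC M) (?b z)) = ?\<Delta> (gal M z)"
  proof (rule tensor_ext[OF HP_right[OF MR] PS_left
        add_hom_compose[OF add_hom_compose[OF bh gal_add_hom[OF MCr]] assoc_add_hom[OF MR]]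
        add_hom_compose[OF gal_add_hom[OF MR] \<Delta>h] _ z(1)])
    fix g p assume g: "g \<in> carrier (HP M)" and "p \<in> carrier PS"
    then have g': "g \<in> Hom_A A P M" and p: "p \<in> carrier P" and pS: "p \<in> carrier PS" by simp_all
    note gl = Hom_A_linear[OF g']
    note cp = coact_closed[OF P_comodule p]
    note gC = cmap_right_linear[OF P_right MR gl]
    have \<beta>g: "?\<beta> g \<in> Hom_A A P (MC M)"
      using add_hom_closed[OF right_linear_add_hom[OF \<beta>] g] by simp
    have "gal (MC M) (?b (tens S (HP M) PS g p)) = cmap (MC M) (?\<beta> g) (coact P p)"
      unfolding tensor_map_tens[OF HP_right[OF MR] PS_left HP_right[OF MCr] PS_left \<beta> left_linear_id g pS]
      by (rule gal_tens[OF MCr \<beta>g p])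
    also have "\<dots> = cmap (MC M) (cmap M g) (cmap (MC P) (coact P) (coact P p))"
      by (rule cmap_compose[OF P_right PCr MCr coact_linear gC _ cp, symmetric]) simp
    finally have "tensor_assoc A M C (gal (MC M) (?b (tens S (HP M) PS g p)))
        = tensor_map A M CC g (\<lambda>u. u) (tensor_assoc A P C (cmap (MC P) (coact P) (coact P p)))"
      using assoc_natural[OF P_right MR gl cmap_closed[OF P_right PCr coact_linear cp]] by simp
    also have "\<dots> = tensor_map A M CC g (\<lambda>u. u) (tensor_map A P CC (\<lambda>n. n) (comult C) (coact P p))"
      by (simp only: coact_coassoc[OF p])
    also have "\<dots> = tensor_map A M CC g (comult C) (coact P p)"
      by (rule tensor_map_compose[OF P_right C_left P_right tensor_left_module MR tensor_left_module
            right_linear_id comult_left_linear gl left_linear_id refl refl cp])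
    also have "\<dots> = ?\<Delta> (cmap M g (coact P p))"
      by (rule tensor_map_compose[OF P_right C_left MR C_left MR tensor_left_module
            gl left_linear_id right_linear_id comult_left_linear refl refl cp, symmetric])
    finally show "tensor_assoc A M C (gal (MC M) (?b (tens S (HP M) PS g p))) = ?\<Delta> (gal M (tens S (HP M) PS g p))"
      by (simp only: gal_tens[OF MR g' p])
  qed
  have acl: "?a z \<in> carrier (HPT (MC M))" and bcl: "?b z \<in> carrier (HPT (MC M))"
    and dcl: "?d z \<in> carrier (HPT (MC M))"
    using add_hom_closed[OF ah z(1)] add_hom_closed[OF bh z(1)] add_hom_closed[OF dh z(1)] by auto
  have galcl: "gal (MC M) (?a z) \<in> carrier (tensor A (MC M) C)" "gal (MC M) (?b z) \<in> carrier (tensor A (MC M) C)"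
    using add_hom_closed[OF gal_add_hom[OF MCr]] acl bcl by auto
  have "gal (MC M) (?a z) = gal (MC M) (?b z)"
    using unassoc_assoc[OF MR galcl(1)] unassoc_assoc[OF MR galcl(2)] A B z(2) by simp
  moreover have "inj_on (gal (MC M)) (carrier (HPT (MC M)))"
    using add_hom_inj_iff[OF gal_add_hom[OF MCr] HPT_group[OF MCr] TC_group[OF MCr]] gal_inj[OF MCr] by blast
  ultimately have ab: "?a z = ?b z" using acl bcl by (auto dest: inj_onD)
  have "?a z = ?d z \<oplus>\<^bsub>HPT (MC M)\<^esub> ?b z"
  proof (rule tensor_map_add[OF HP_right[OF MR] PS_left HP_right[OF MCr] coact_diff_linear[OF M] \<beta>
        post_linear[OF MR co] _ z(1)])
    fix g assume g: "g \<in> carrier (HP M)"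
    have 1: "post (coact M) g \<in> carrier (HP (MC M))"
      by (rule add_hom_closed[OF right_linear_add_hom[OF post_linear[OF MR co]] g])
    have 2: "?\<beta> g \<in> carrier (HP (MC M))" by (rule add_hom_closed[OF right_linear_add_hom[OF \<beta>] g])
    have 3: "coact_diff M g \<in> carrier (HP (MC M))" unfolding coact_diff_def by (rule H.minus_closed[OF 1 2])
    have "post (coact M) g = ?\<beta> g \<oplus>\<^bsub>HP (MC M)\<^esub> coact_diff M g"
      using H.diff_eq_iff[OF 1 2 3] unfolding coact_diff_def by blast
    also have "\<dots> = coact_diff M g \<oplus>\<^bsub>HP (MC M)\<^esub> ?\<beta> g" by (rule H.a_comm[OF 2 3])
    finally show "post (coact M) g = coact_diff M g \<oplus>\<^bsub>HP (MC M)\<^esub> ?\<beta> g" .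
  qed
  then have "?b z = ?b z \<oplus>\<^bsub>HPT (MC M)\<^esub> ?d z"
    unfolding ab T.a_comm[OF bcl dcl] .
  then have "?b z \<ominus>\<^bsub>HPT (MC M)\<^esub> ?b z = ?d z" by (rule iffD2[OF T.diff_eq_iff[OF bcl bcl dcl]])
  then show ?thesis using iffD2[OF T.diff_zero_iff[OF bcl bcl] refl] by (rule trans[OF sym])
qed

abbreviation "HC M \<equiv> (HP M)\<lparr>carrier := Hom_C A C P M\<rparr>"

abbreviation "HCT M \<equiv> tensor S (HC M) PS"

lemma Hom_C_submodule:
  assumes M: "comodule A C M" shows "right_submodule S (HP M) (Hom_C A C P M)"
  unfolding right_submodule_def
proof (intro conjI ballI)
  note MR = comodule_right_module[OF M]
  show "Hom_C A C P M \<subseteq> carrier (HP M)" using Hom_C_Hom_A by auto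
  show "\<zero>\<^bsub>HP M\<^esub> \<in> Hom_C A C P M" using Hom_C_zero[OF M] by simp
  show "f \<oplus>\<^bsub>HP M\<^esub> g \<in> Hom_C A C P M" if "f \<in> Hom_C A C P M" "g \<in> Hom_C A C P M" for f g
    using Hom_C_add[OF M that] by simp
  show "f \<triangleleft>\<^bsub>HP M\<^esub> s \<in> Hom_C A C P M" if "f \<in> Hom_C A C P M" "s \<in> carrier S" for f s
    using Hom_C_compose[OF P_right P_right MR _ that(1) coact_closed[OF P_comodule]] that(2) by simp
qed

lemma HC_right: "comodule A C M \<Longrightarrow> right_module S (HC M)"
  by (rule right_submodule_right_module[OF HP_right[OF comodule_right_module] Hom_C_submodule])

text \<open>
  The evaluation map \<open>Hom\<^sup>C(P,M) \<otimes>\<^sub>S P \<rightarrow> M\<close>.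
\<close>

definition evaluate :: "('a, 'c, 'm, 'w) comodule_scheme \<Rightarrow> ('p \<Rightarrow> 'm, 'p) tens \<Rightarrow> 'm" where
  "evaluate M = tensor_lift M (\<lambda>h p. h p)"

lemma evaluate_balanced:
  assumes M: "comodule A C M" shows "balanced S (HC M) PS M (\<lambda>h p. h p)"
proof (rule balancedI)
  fix h p assume h: "h \<in> carrier (HC M)" and p: "p \<in> carrier PS"
  then have hA: "h \<in> Hom_A A P M" and p': "p \<in> carrier P" by (simp_all add: Hom_C_Hom_A)
  show "h p \<in> carrier M" by (rule Hom_A_closed[OF hA p'])
  show "(h \<oplus>\<^bsub>HC M\<^esub> g) p = h p \<oplus>\<^bsub>M\<^esub> g p" for g using p' by (simp add: Hom_module_def)
  show "h (p \<oplus>\<^bsub>PS\<^esub> q) = h p \<oplus>\<^bsub>M\<^esub> h q" if "q \<in> carrier PS" for q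
    using add_hom_add[OF right_linear_add_hom[OF Hom_A_linear[OF hA]] p'] that by simp
  show "(h \<triangleleft>\<^bsub>HC M\<^esub> s) p = h (s \<odot>\<^bsub>PS\<^esub> p)" for s using p' by (simp add: Hom_module_def compose_eq)
qed

lemma evaluate_add_hom: "comodule A C M \<Longrightarrow> add_hom (HCT M) M (evaluate M)"
  unfolding evaluate_def
  by (rule tensor_lift_add_hom[OF HC_right PS_left right_module_group[OF comodule_right_module] evaluate_balanced])

lemma evaluate_tens:
  assumes "comodule A C M" "h \<in> Hom_C A C P M" "p \<in> carrier P"
  shows "evaluate M (tens S (HC M) PS h p) = h p"
  unfolding evaluate_def
  by (rule tensor_lift_tens[OF HC_right PS_left right_module_group[OF comodule_right_module] evaluate_balanced])
    (use assms in simp_all)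

abbreviation "hinc M \<equiv> tensor_map S (HP M) PS (\<lambda>h. h) (\<lambda>p. p)"

lemma hinc_add_hom: "comodule A C M \<Longrightarrow> add_hom (HCT M) (HPT M) (hinc M)"
  by (rule tensor_map_add_hom[OF HC_right PS_left HP_right[OF comodule_right_module] PS_left
        right_submodule_inclusion[OF Hom_C_submodule] left_linear_id])

lemma hinc_tens:
  assumes "comodule A C M" "h \<in> Hom_C A C P M" "p \<in> carrier P"
  shows "hinc M (tens S (HC M) PS h p) = tens S (HP M) PS h p"
  by (rule tensor_map_tens[OF HC_right PS_left HP_right[OF comodule_right_module] PS_left
        right_submodule_inclusion[OF Hom_C_submodule] left_linear_id]) (use assms in simp_all)

text \<open>
  Colinearity, read as a commuting square: evaluation followed by the coaction is the Galois map.
\<close>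

lemma gal_hinc:
  assumes M: "comodule A C M" and w: "w \<in> carrier (HCT M)"
  shows "gal M (hinc M w) = coact M (evaluate M w)"
proof (rule tensor_ext[OF HC_right[OF M] PS_left _ _ _ w])
  note MR = comodule_right_module[OF M]
  show "add_hom (HCT M) (tensor A M C) (\<lambda>w. gal M (hinc M w))"
    by (rule add_hom_compose[OF hinc_add_hom[OF M] gal_add_hom[OF MR]])
  have "add_hom M (tensor A M C) (coact M)"
    using right_linear_add_hom[OF coact_right_linear[OF M]] by (simp add: add_hom_def)
  then show "add_hom (HCT M) (tensor A M C) (\<lambda>w. coact M (evaluate M w))"
    by (rule add_hom_compose[OF evaluate_add_hom[OF M]])
  fix h p assume "h \<in> carrier (HC M)" "p \<in> carrier PS"
  then have h: "h \<in> Hom_C A C P M" and p: "p \<in> carrier P" by simp_all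
  show "gal M (hinc M (tens S (HC M) PS h p)) = coact M (evaluate M (tens S (HC M) PS h p))"
    unfolding hinc_tens[OF M h p] gal_tens[OF MR Hom_C_Hom_A[OF h] p] evaluate_tens[OF M h p]
    by (rule Hom_C_coact[OF h p, symmetric])
qed

text \<open>
  The preimage \<open>z\<close> of the coaction at \<open>m\<close> under the Galois map is killed by the colinearity defect; by
  flatness it comes from \<open>Hom\<^sup>C(P,M) \<otimes>\<^sub>S P\<close>. The counit makes the coaction injective.
\<close>

lemma evaluate_surj:
  assumes flat: "flat_left TYPE('u) S PS" and M: "comodule A C M" and m: "m \<in> carrier M"
  shows "\<exists>w\<in>carrier (HCT M). evaluate M w = m"
proof -
  note MR = comodule_right_module[OF M]
  note MCr = tensor_right_module[OF MR]
  obtain z where z: "z \<in> carrier (HPT M)" "gal M z = coact M m"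
    using gal_surj[OF MR coact_closed[OF M m]] by blast
  have K: "Hom_C A C P M = {g \<in> carrier (HP M). coact_diff M g = \<zero>\<^bsub>HP (MC M)\<^esub>}"
  proof (intro equalityI subsetI)
    fix g assume "g \<in> Hom_C A C P M"
    then show "g \<in> {g \<in> carrier (HP M). coact_diff M g = \<zero>\<^bsub>HP (MC M)\<^esub>}"
      using coact_diff_zero_iff[OF M Hom_C_Hom_A] Hom_C_Hom_A[of g] by simp
  next
    fix g assume "g \<in> {g \<in> carrier (HP M). coact_diff M g = \<zero>\<^bsub>HP (MC M)\<^esub>}"
    then have "g \<in> Hom_A A P M" "coact_diff M g = \<zero>\<^bsub>HP (MC M)\<^esub>" by simp_all
    then show "g \<in> Hom_C A C P M" using coact_diff_zero_iff[OF M] by blast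
  qed
  obtain w where w: "w \<in> carrier (HCT M)" "hinc M w = z"
    using flat_kernel(2)[OF flat PS_left universe_sizes(1,4) HP_right[OF MR] HP_right[OF MCr]
        coact_diff_linear[OF M] z(1) coact_diff_coact[OF M m z] K] by blast
  have "coact M (evaluate M w) = coact M m" using gal_hinc[OF M w(1)] w(2) z(2) by simp
  moreover have "evaluate M w \<in> carrier M" by (rule add_hom_closed[OF evaluate_add_hom[OF M] w(1)])
  ultimately have "evaluate M w = m"
    using comodule.coact_counit[OF M m] comodule.coact_counit[OF M, of "evaluate M w"] by simp
  then show ?thesis using w(1) by blast
qed

text \<open>
  Followed by the coaction, evaluation is the composite of the inclusion \<open>Hom\<^sup>C(P,M) \<otimes> P \<rightarrow> Hom\<^sub>A(P,M) \<otimes> P\<close>,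
  injective by flatness, and the injective Galois map.
\<close>

lemma evaluate_inj:
  assumes flat: "flat_left TYPE('u) S PS" and M: "comodule A C M"
  shows "inj_on (evaluate M) (carrier (HCT M))"
proof -
  note MR = comodule_right_module[OF M]
  have "w = \<zero>\<^bsub>HCT M\<^esub>" if w: "w \<in> carrier (HCT M)" and zero: "evaluate M w = \<zero>\<^bsub>M\<^esub>" for w
  proof -
    have "coact M \<zero>\<^bsub>M\<^esub> = \<zero>\<^bsub>tensor A M C\<^esub>"
      using add_hom_zero[OF right_linear_add_hom[OF coact_right_linear[OF M]] right_module_group[OF MR]
          right_module_group[OF tensor_right_module[OF MR]]] by simp
    then have "gal M (hinc M w) = \<zero>\<^bsub>tensor A M C\<^esub>" using gal_hinc[OF M w] zero by simp
    then have "hinc M w = \<zero>\<^bsub>HPT M\<^esub>"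
      by (rule gal_inj[OF MR add_hom_closed[OF hinc_add_hom[OF M] w]])
    then show ?thesis
      by (intro flat_left_any[OF flat PS_left universe_sizes(1,4) HC_right[OF M] HP_right[OF MR]
            right_submodule_inclusion[OF Hom_C_submodule[OF M]] _ w]) simp_all
  qed
  then show ?thesis
    using add_hom_inj_iff[OF evaluate_add_hom[OF M] tensor_abelian_group[OF HC_right[OF M] PS_left]
        right_module_group[OF MR]] by blast
qed

text \<open>
  Two colinear maps that agree after composition with all \<open>P \<rightarrow> M\<close> agree on all values of evaluation,
  that is, everywhere.
\<close>

lemma generator_of_flat:
  assumes flat: "flat_left TYPE('u) S PS"
  shows "comodule_generator TYPE('u) A C P"
  unfolding comodule_generator_def
proof (intro allI impI ballI)
  fix M N :: "('a, 'c, 'u) comodule" and f g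
  assume M: "comodule A C M" and N: "comodule A C N" and f: "f \<in> Hom_C A C M N" and g: "g \<in> Hom_C A C M N"
    and eq: "\<forall>h\<in>Hom_C A C P M. post f h = post g h"
  show "f = g"
  proof (rule Hom_A_eqI[OF Hom_C_Hom_A[OF f] Hom_C_Hom_A[OF g]])
    fix m assume "m \<in> carrier M"
    then obtain w where w: "w \<in> carrier (HCT M)" "evaluate M w = m" using evaluate_surj[OF flat M] by blast
    have "f (evaluate M w) = g (evaluate M w)"
    proof (rule tensor_ext[OF HC_right[OF M] PS_left
          add_hom_compose[OF evaluate_add_hom[OF M] right_linear_add_hom[OF Hom_C_linear[OF f]]]
          add_hom_compose[OF evaluate_add_hom[OF M] right_linear_add_hom[OF Hom_C_linear[OF g]]] _ w(1)])
      fix h p assume "h \<in> carrier (HC M)" "p \<in> carrier PS"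
      then have h: "h \<in> Hom_C A C P M" and p: "p \<in> carrier P" by simp_all
      have "post f h p = post g h p" using eq h by simp
      then show "f (evaluate M (tens S (HC M) PS h p)) = g (evaluate M (tens S (HC M) PS h p))"
        using p by (simp add: evaluate_tens[OF M h p] compose_eq)
    qed
    then show "f m = g m" using w(2) by simp
  qed
qed

text \<open>
  Let \<open>V\<close> be the image of \<open>Hom\<^sup>C(P,M)\<close> in \<open>Hom\<^sup>C(P,N)\<close>. For \<open>h \<otimes> p\<close> in \<open>Hom\<^sup>C(P,N) \<otimes> P\<close>, the value \<open>h p\<close> is the
  image of some \<open>m\<close>, which is an evaluation; since evaluation at \<open>N\<close> is injective, \<open>h \<otimes> p\<close> comes from
  \<open>V \<otimes> P\<close>. Faithful flatness then gives \<open>V = Hom\<^sup>C(P,N)\<close>.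
\<close>

lemma projective_of_faithfully_flat:
  assumes ff: "faithfully_flat_left TYPE('u) S PS"
  shows "comodule_projective TYPE('u) A C P"
  unfolding comodule_projective_def
proof (intro allI impI ballI)
  have flat: "flat_left TYPE('u) S PS" using ff by (simp add: faithfully_flat_left_def)
  fix M N :: "('a, 'c, 'u) comodule" and f g
  assume M: "comodule A C M" and N: "comodule A C N" and f: "f \<in> Hom_C A C M N"
    and surj: "f ` carrier M = carrier N" and g: "g \<in> Hom_C A C P N"
  note MR = comodule_right_module[OF M] and NR = comodule_right_module[OF N]
  note fl = Hom_C_linear[OF f]
  have pf: "post f h \<in> Hom_C A C P N" if "h \<in> Hom_C A C P M" for h
    by (rule Hom_C_compose[OF P_right MR NR that f coact_closed[OF P_comodule]])
  note pl = post_linear[OF MR fl, unfolded right_linear_iff]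
  let ?V = "post f ` Hom_C A C P M"
  note subM = Hom_C_submodule[OF M, unfolded right_submodule_def]
  have plz: "post f \<zero>\<^bsub>HP M\<^esub> = \<zero>\<^bsub>HP N\<^esub>"
    by (rule add_hom_zero[OF right_linear_add_hom[OF post_linear[OF MR fl]]
          right_module_group[OF HP_right[OF MR]] right_module_group[OF HP_right[OF NR]]])
  have V: "right_submodule S (HC N) ?V"
    unfolding right_submodule_def
  proof (intro conjI ballI)
    show "?V \<subseteq> carrier (HC N)" using pf by auto
    have "\<zero>\<^bsub>HP N\<^esub> \<in> ?V" unfolding plz[symmetric] using subM by (intro imageI) blast
    then show "\<zero>\<^bsub>HC N\<^esub> \<in> ?V" by simp
    fix a assume "a \<in> ?V"
    then obtain h where h: "h \<in> Hom_C A C P M" "a = post f h" by blast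
    have hH: "h \<in> carrier (HP M)" using h Hom_C_Hom_A by simp
    { fix b assume "b \<in> ?V"
      then obtain k where k: "k \<in> Hom_C A C P M" "b = post f k" by blast
      have kH: "k \<in> carrier (HP M)" using k Hom_C_Hom_A by simp
      have "post f (h \<oplus>\<^bsub>HP M\<^esub> k) = a \<oplus>\<^bsub>HP N\<^esub> b"
        unfolding h(2) k(2) using pl hH kH by (simp only: add_hom_def)
      moreover have "h \<oplus>\<^bsub>HP M\<^esub> k \<in> Hom_C A C P M" using subM h(1) k(1) by blast
      ultimately have "a \<oplus>\<^bsub>HP N\<^esub> b \<in> ?V" by (metis imageI)
      then show "a \<oplus>\<^bsub>HC N\<^esub> b \<in> ?V" by simp }
    fix s assume s: "s \<in> carrier S"
    have "post f (h \<triangleleft>\<^bsub>HP M\<^esub> s) = a \<triangleleft>\<^bsub>HP N\<^esub> s"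
      unfolding h(2) using pl hH s by (simp only:)
    moreover have "h \<triangleleft>\<^bsub>HP M\<^esub> s \<in> Hom_C A C P M" using subM h(1) s by blast
    ultimately have "a \<triangleleft>\<^bsub>HP N\<^esub> s \<in> ?V" by (metis imageI)
    then show "a \<triangleleft>\<^bsub>HC N\<^esub> s \<in> ?V" by simp
  qed
  let ?HV = "(HC N)\<lparr>carrier := ?V\<rparr>"
  note VR = right_submodule_right_module[OF HC_right[OF N] V] and incV = right_submodule_inclusion[OF V]
  have pV: "right_linear S (HC M) ?HV (post f)"
    using right_linear_compose[OF right_submodule_inclusion[OF Hom_C_submodule[OF M]] post_linear[OF MR fl]]
    by (auto simp: right_linear_iff add_hom_def simp del: Hom_module_simps)
  have "g \<in> ?V"
  proof (rule faithfully_flat_submodule[OF ff PS_left universe_sizes(1,4) HC_right[OF N] V])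
    show "g \<in> carrier (HC N)" using g by simp
    fix h p assume h: "h \<in> carrier (HC N)" and p: "p \<in> carrier PS"
    then have h': "h \<in> Hom_C A C P N" and p': "p \<in> carrier P" by simp_all
    have "h p \<in> f ` carrier M" unfolding surj by (rule Hom_A_closed[OF Hom_C_Hom_A[OF h'] p'])
    then obtain m where m: "m \<in> carrier M" "f m = h p" by auto
    obtain w where w: "w \<in> carrier (HCT M)" "evaluate M w = m" using evaluate_surj[OF flat M m(1)] by blast
    let ?w = "tensor_map S ?HV PS (post f) (\<lambda>p. p) w" and ?i = "tensor_map S (HC N) PS (\<lambda>h. h) (\<lambda>p. p)"
    note wh = tensor_map_add_hom[OF HC_right[OF M] PS_left VR PS_left pV left_linear_id]
    note ih = tensor_map_add_hom[OF VR PS_left HC_right[OF N] PS_left incV left_linear_id]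
    have "evaluate N (?i ?w) = f (evaluate M w)"
    proof (rule tensor_ext[OF HC_right[OF M] PS_left
          add_hom_compose[OF add_hom_compose[OF wh ih] evaluate_add_hom[OF N]]
          add_hom_compose[OF evaluate_add_hom[OF M] right_linear_add_hom[OF fl]] _ w(1)])
      fix k q assume k: "k \<in> carrier (HC M)" and q: "q \<in> carrier PS"
      then have k': "k \<in> Hom_C A C P M" and q': "q \<in> carrier P" by simp_all
      have fk: "post f k \<in> carrier ?HV" using k' by simp
      show "evaluate N (?i (tensor_map S ?HV PS (post f) (\<lambda>p. p) (tens S (HC M) PS k q)))
          = f (evaluate M (tens S (HC M) PS k q))"
        unfolding tensor_map_tens[OF HC_right[OF M] PS_left VR PS_left pV left_linear_id k q]
          tensor_map_tens[OF VR PS_left HC_right[OF N] PS_left incV left_linear_id fk q]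
          evaluate_tens[OF N pf[OF k'] q'] evaluate_tens[OF M k' q'] by (rule compose_eq[OF q'])
    qed
    then have "evaluate N (?i ?w) = evaluate N (tens S (HC N) PS h p)"
      using w(2) m(2) evaluate_tens[OF N h' p'] by simp
    then have "?i ?w = tens S (HC N) PS h p"
      by (rule inj_onD[OF evaluate_inj[OF flat N] _ add_hom_closed[OF ih add_hom_closed[OF wh w(1)]]
            tens_closed[OF HC_right[OF N] PS_left h p]])
    then show "\<exists>w\<in>carrier (tensor S ?HV PS). ?i w = tens S (HC N) PS h p"
      using add_hom_closed[OF wh w(1)] by blast
  qed
  then show "\<exists>h\<in>Hom_C A C P M. post f h = g" by blast
qed

end


section \<open>The transfer theorem\<close>

theorem mainTheorem2:
  fixes A :: "('a, 'x) ring_scheme"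
    and C :: "('a, 'c, 'y) coring_scheme"
    and P :: "('a, 'c, 'p, 'z) comodule_scheme"
  assumes "ring A" and "coring A C" and "comodule A C P"
    and "large_universe TYPE('u) A C P"
    and "galois_comodule TYPE('u) A C P"
  shows
    "(fin_gen (End_C A C P) (eval_module P) \<longrightarrow> fin_gen A C) \<and>
     (mittag_leffler TYPE('u) (End_C A C P) (eval_module P) \<longrightarrow>
        mittag_leffler TYPE('u) A C \<and> power_mittag_leffler TYPE('u) A C) \<and>
     (fin_presented (End_C A C P) (eval_module P) \<longrightarrow> fin_presented A C) \<and>
     (projective_left TYPE('u) (End_C A C P) (eval_module P) \<longrightarrow>
        projective_left TYPE('u) A C) \<and>
     (fin_gen (End_A A P) (eval_module P) \<and>
        locally_projective TYPE('u) (End_C A C P) (eval_module P) \<longrightarrow>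
        locally_projective TYPE('u) A C) \<and>
     (flat_left TYPE('u) (End_C A C P) (eval_module P) \<longrightarrow>
        flat_left TYPE('u) A C \<and> comodule_generator TYPE('u) A C P) \<and>
     (faithfully_flat_left TYPE('u) (End_C A C P) (eval_module P) \<longrightarrow>
        flat_left TYPE('u) A C \<and>
        comodule_projective TYPE('u) A C P \<and> comodule_generator TYPE('u) A C P)"
proof -
  interpret galois_setting A C P "TYPE('u)"
    using assms by (simp add: galois_setting_def galois_setting_axioms_def comodule_setting_def)
  have flat: "flat_left TYPE('u) S PS" if "faithfully_flat_left TYPE('u) S PS"
    using that by (simp add: faithfully_flat_left_def)
  show ?thesis
    using fin_gen_coring mittag_leffler_coring power_mittag_leffler_coring fin_presented_coring
      projective_coring locally_projective_coring flat_coring generator_of_flat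
      projective_of_faithfully_flat flat
    by blast
qed


end
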